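(* Let $n\geq 1$ be an integer, let $\alpha\in(0,2)$, and let $(L^{(i)},\ 1\leq i\leq n)$ be independent and identically distributed symmetric $\alpha$-stable Lévy processes on $\mathbb{R}$ started from $0$. There exist two constants $0<\kappa_1\leq\kappa_2<+\infty$ such that the following estimates hold. (1) (Large deviations) For all sufficiently large $x$, $$\kappa_1\,\frac{(\ln(x))^{n-1}}{x^\alpha}\leq \mathbb{P}\left(\sup_{0\leq u\leq 1}\prod_{i=1}^n L_u^{(i)}\geq x\right)\leq \kappa_2\,\frac{(\ln(x))^{n-1}}{x^\alpha}.$$ (2) (Persistence probability) For all sufficiently small $\varepsilon>0$, $$\kappa_1\,\varepsilon^{\alpha/2}\leq \mathbb{P}\left(\sup_{0\leq u\leq 1}\prod_{i=1}^n L_u^{(i)}\leq \varepsilon\right)\leq \kappa_2\,\varepsilon^{\alpha/2}\,|\ln(\varepsilon)|.$$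
   Context: A symmetric $\alpha$-stable Lévy process $L$ is a càdlàg Lévy process with $\mathbb{E}[e^{i\lambda L_t}]=e^{-b\,t|\lambda|^\alpha}$ for all $\lambda\in\mathbb{R}$, $t\geq 0$, for some constant $b>0$ (the same for all the processes considered). The constants $\kappa_1,\kappa_2$ may depend on $n$, $\alpha$ and $b$ but not on $x$ or $\varepsilon$. "Sufficiently large $x$" and "sufficiently small $\varepsilon$" mean that there exist $x_0>1$ and $\varepsilon_0\in(0,1)$ (depending on $n,\alpha,b$) such that (1) holds for all $x\geq x_0$ and (2) holds for all $\varepsilon\in(0,\varepsilon_0)$. *)

theory Defs
  imports "HOL-Probability.Probability"
begin

definition cadlag :: "(real \<Rightarrow> real) \<Rightarrow> bool" where
  "cadlag f \<longleftrightarrow>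
     (\<forall>t\<ge>0. (f \<longlongrightarrow> f t) (at_right t)) \<and>
     (\<forall>t>0. \<exists>l. (f \<longlongrightarrow> l) (at_left t))"

text \<open>
  Only the times \<open>t \<ge> 0\<close> matter. All paths, not just almost all, are cadlag, so that suprema
  over time intervals are measurable without completing the probability space. Continuity in
  probability follows from right-continuity and stationarity of the increments.
\<close>

definition levy_process :: "'a measure \<Rightarrow> (real \<Rightarrow> 'a \<Rightarrow> real) \<Rightarrow> bool" where
  "levy_process M X \<longleftrightarrow>
     (\<forall>t\<ge>0. X t \<in> borel_measurable M) \<and>
     (\<forall>\<omega>\<in>space M. cadlag (\<lambda>t. X t \<omega>)) \<and>
     (AE \<omega> in M. X 0 \<omega> = 0) \<and>
     (\<forall>(k::nat) t. 0 \<le> t 0 \<and> mono_on {..k} t \<longrightarrow>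
        prob_space.indep_vars M (\<lambda>_. borel) (\<lambda>j \<omega>. X (t (Suc j)) \<omega> - X (t j) \<omega>) {..<k}) \<and>
     (\<forall>s\<ge>0. \<forall>h\<ge>0. distr M borel (\<lambda>\<omega>. X (s + h) \<omega> - X s \<omega>) = distr M borel (X h))"

definition symmetric_stable_levy ::
    "'a measure \<Rightarrow> real \<Rightarrow> real \<Rightarrow> (real \<Rightarrow> 'a \<Rightarrow> real) \<Rightarrow> bool" where
  "symmetric_stable_levy M \<alpha> b X \<longleftrightarrow>
     levy_process M X \<and>
     (\<forall>t\<ge>0. \<forall>\<theta>. char (distr M borel (X t)) \<theta> = complex_of_real (exp (- (b * t * \<bar>\<theta>\<bar> powr \<alpha>))))"

text \<open>
  Independence is that of the whole paths, as random elements of the product space over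
  \<open>t \<ge> 0\<close>. Equality in law is expressed by the common parameters \<open>\<alpha>\<close> and \<open>b\<close>, which determine
  the finite-dimensional distributions of a symmetric stable Levy process.
\<close>

definition iid_symmetric_stable_levy ::
    "'a measure \<Rightarrow> real \<Rightarrow> real \<Rightarrow> nat \<Rightarrow> (nat \<Rightarrow> real \<Rightarrow> 'a \<Rightarrow> real) \<Rightarrow> bool" where
  "iid_symmetric_stable_levy M \<alpha> b n L \<longleftrightarrow>
     (\<forall>i\<in>{1..n}. symmetric_stable_levy M \<alpha> b (L i)) \<and>
     prob_space.indep_vars M (\<lambda>_. Pi\<^sub>M {0..} (\<lambda>_. borel)) (\<lambda>i \<omega>. \<lambda>t\<in>{0..}. L i t \<omega>) {1..n}"

text \<open>
  On cadlag paths the product is bounded on \<open>{0..1}\<close>, so the real-valued supremum is the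
  genuine one.
\<close>

definition sup_prod :: "nat \<Rightarrow> (nat \<Rightarrow> real \<Rightarrow> 'a \<Rightarrow> real) \<Rightarrow> 'a \<Rightarrow> real" where
  "sup_prod n L \<omega> = (SUP u\<in>{0..1}. \<Prod>i=1..n. L i u \<omega>)"

end

theory Submission
  imports Defs
begin

text \<open>
  Sparre Andersen's convolution identity \<open>(\<Sum>k\<le>N. u k * u (N - k)) = 1\<close> for symmetric walks with
  continuous increments shows that the probability that one stable process stays below \<open>y\<close> up to
  time \<open>1\<close> is comparable to \<open>y powr (\<alpha> / 2)\<close> for small \<open>y\<close>. Hence, for \<open>\<beta> < \<alpha> / 2\<close>, the integral of
  that probability at \<open>y * s\<close> against \<open>s powr (- \<beta> - 1)\<close> is finite; it is a multiple of \<open>y powr \<beta>\<close>, and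
  by the Markov property it is superharmonic for the process killed on leaving a half-line.
  Letting \<open>\<beta>\<close> tend to \<open>\<alpha> / 2\<close>, the same holds for \<open>y powr (\<alpha> / 2)\<close>.

  The function \<open>\<epsilon> - (\<Prod>i. x i)\<close> is affine in each coordinate, so its positive part to the power
  \<open>\<alpha> / 2\<close> is a supermartingale along staircases that move one coordinate at a time. Independent
  Levy processes have no common jumps; refining the staircases therefore bounds the expectation of
  \<open>(2 * \<epsilon> - (\<Prod>i. L i T)) powr (\<alpha> / 2)\<close> on the event that the product stays below \<open>\<epsilon>\<close> by
  \<open>(2 * \<epsilon>) powr (\<alpha> / 2)\<close>. On that event either the product is large and negative at time \<open>T\<close>, which
  this bound controls, or some coordinate is small at time \<open>T\<close>, which is unlikely given the past up
  to \<open>T / 2\<close>; iterating over \<open>T / 2, T / 4, \<dots>\<close> gives an upper bound of order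
  \<open>\<epsilon> powr (\<alpha> / 2)\<close>, without the logarithm. For the lower bound, each coordinate stays in a small
  interval for a short while and then keeps a sign of its own, the signs having product \<open>-1\<close>.

  For large deviations, the event is covered by about \<open>ln x ^ (n - 1)\<close> products of one-dimensional
  tail events at dyadic levels, and it contains disjoint products of the same kind in as large a
  number; each has probability of order \<open>x powr - \<alpha>\<close>.
\<close>

text \<open>Survival below \<open>y\<close> up to \<open>t + T\<close> is survival up to
  \<open>t\<close> followed by survival of a fresh copy below \<open>y - X t\<close> up to
  \<open>T\<close>. As survival decreases in the horizon, \<open>surv\<close> with any fixed horizon
  is superharmonic for the killed process. By self-similarity a factor in the level is a change of
  horizon, so integrating over horizons against a power weight leaves a pure power of
  \<open>y\<close>. Since survival is comparable to s^(\<alpha>/2) near 0, the weight s^(-\<beta> -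
  1) is integrable there only for \<beta> < \<alpha>/2, whence the detour through smaller exponents.

  The product itself, with all factors moving at once, is not an affine function of a Levy process;
  hence the clocks run one after the other. If two factors jumped together, a staircase could meet
  the product of a new value and an old one, which the true path never takes; this is where the
  absence of common jumps enters.

  Each halving of the horizon costs a factor 2^(n/2) in the supermartingale bound. This is harmless
  because the chance that a coordinate is small can be made as small as desired beforehand.\<close>

abbreviation paths :: "(real \<Rightarrow> real) measure" where
  "paths \<equiv> \<Pi>\<^sub>M t\<in>{0..}. borel"

section \<open>Levy processes as random elements of path space\<close>

definition traj :: "(real \<Rightarrow> 'a \<Rightarrow> real) \<Rightarrow> 'a \<Rightarrow> real \<Rightarrow> real" where
  "traj X \<omega> = (\<lambda>t\<in>{0..}. X t \<omega>)"

text \<open>Puts finitely many times into the weakly increasing, indexed form in which independence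
  of increments is available; starting at 0 makes values of the process partial sums of
  increments.\<close>

lemma finite_grid:
  fixes T :: "real set"
  assumes "finite T" "0 \<in> T" "T \<subseteq> {0..}"
  obtains t :: "nat \<Rightarrow> real" and k :: nat where "mono_on {..k} t" "t 0 = 0" "t ` {..k} = T"
proof -
  define xs where "xs = sorted_list_of_set T"
  have xs: "sorted xs" "set xs = T" "xs \<noteq> []" using assms by (auto simp: xs_def)
  have 1: "mono_on {..length xs - 1} (\<lambda>j. xs ! j)"
    using xs(3) by (auto simp: mono_on_def intro!: sorted_nth_mono xs) (metis One_nat_def Suc_pred length_greater_0_conv less_Suc_eq_le)
  have 2: "(\<lambda>j. xs ! j) ` {..length xs - 1} = T"
  proof -
    have "{..length xs - 1} = {..<length xs}" using xs(3) by (cases xs) auto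
    then show ?thesis using xs(2) by (auto simp: set_conv_nth)
  qed
  then obtain j where j: "j \<le> length xs - 1" "xs ! j = 0" using assms by (metis atMost_iff imageE)
  have "xs ! 0 \<le> xs ! j" using j xs by (intro sorted_nth_mono) (auto simp: Suc_leI le_less_trans)
  moreover have "xs ! 0 \<in> T" using xs by auto
  ultimately have "xs ! 0 = 0" using j assms by fastforce
  then show thesis using that[OF 1 _ 2] by blast
qed

lemma measurable_Collect_in:
  "f \<in> N \<rightarrow>\<^sub>M K \<Longrightarrow> A \<in> sets K \<Longrightarrow> {w\<in>space N. f w \<in> A} \<in> sets N"
  using measurable_sets[of f N K A] by (auto simp: vimage_def Int_def conj_commute)

text \<open>A Levy process starts at \<open>0\<close> only almost surely; subtracting the initial value makes it start
  there everywhere.\<close>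

locale levy = prob_space M for M :: "'a measure" and X :: "real \<Rightarrow> 'a \<Rightarrow> real" +
  assumes levy: "levy_process M X"
    and start: "\<And>\<omega>. \<omega> \<in> space M \<Longrightarrow> X 0 \<omega> = 0"
begin

lemma meas [measurable]: "0 \<le> t \<Longrightarrow> X t \<in> borel_measurable M"
  using levy by (auto simp: levy_process_def)

lemma cadlag: "\<omega> \<in> space M \<Longrightarrow> cadlag (\<lambda>t. X t \<omega>)"
  using levy by (auto simp: levy_process_def)

lemma increments_indep:
  "0 \<le> t 0 \<Longrightarrow> mono_on {..k} t \<Longrightarrow>
    indep_vars (\<lambda>_. borel) (\<lambda>j \<omega>. X (t (Suc j)) \<omega> - X (t j) \<omega>) {..<k}"
  using levy unfolding levy_process_def by blast

lemma increment_law: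
  "0 \<le> s \<Longrightarrow> s \<le> t \<Longrightarrow> distr M borel (\<lambda>\<omega>. X t \<omega> - X s \<omega>) = distr M borel (X (t - s))"
proof -
  assume "0 \<le> s" "s \<le> t"
  moreover have "\<forall>s\<ge>0. \<forall>h\<ge>0. distr M borel (\<lambda>\<omega>. X (s + h) \<omega> - X s \<omega>) = distr M borel (X h)"
    using levy by (simp add: levy_process_def)
  ultimately have "distr M borel (\<lambda>\<omega>. X (s + (t - s)) \<omega> - X s \<omega>) = distr M borel (X (t - s))"
    by (metis diff_ge_0_iff_ge)
  then show ?thesis by simp
qed

lemma traj_measurable [measurable]: "traj X \<in> M \<rightarrow>\<^sub>M paths"
  unfolding traj_def by (intro measurable_restrict) auto

lemma shift_levy:
  assumes "0 \<le> s"
  shows "levy M (\<lambda>r \<omega>. X (s + r) \<omega> - X s \<omega>)"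
proof
  have cad: "Defs.cadlag (\<lambda>t. X (s + t) \<omega> - X s \<omega>)" if \<omega>: "\<omega> \<in> space M" for \<omega>
    unfolding cadlag_def
  proof (safe)
    fix t :: real assume "0 \<le> t"
    then have "((\<lambda>t. X t \<omega>) \<longlongrightarrow> X (s + t) \<omega>) (at_right (s + t))"
      using cadlag[OF \<omega>] assms unfolding cadlag_def by auto
    then show "((\<lambda>t. X (s + t) \<omega> - X s \<omega>) \<longlongrightarrow> X (s + t) \<omega> - X s \<omega>) (at_right t)"
      by (auto simp: filterlim_at_right_to_0[of _ _ "s + t"] filterlim_at_right_to_0[of _ _ t] add_ac intro!: tendsto_intros)
  next
    fix t :: real assume "0 < t"
    then obtain l where "((\<lambda>t. X t \<omega>) \<longlongrightarrow> l) (at_left (s + t))"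
      using cadlag[OF \<omega>] assms unfolding cadlag_def by (metis add_nonneg_pos)
    \<comment> \<open>Reflecting time turns left limits into right limits, which can be moved to 0
      and compared there.\<close>
    then show "\<exists>l. ((\<lambda>t. X (s + t) \<omega> - X s \<omega>) \<longlongrightarrow> l) (at_left t)"
      by (intro exI[of _ "l - X s \<omega>"])
        (auto simp: at_left_minus[of "s+t"] at_left_minus[of t] filterlim_filtermap filterlim_at_right_to_0[of _ _ "-s - t"] filterlim_at_right_to_0[of _ _ "-t"] algebra_simps intro!: tendsto_intros)
  qed
  have ind: "indep_vars (\<lambda>_. borel) (\<lambda>j \<omega>. X (s + t (Suc j)) \<omega> - X s \<omega> - (X (s + t j) \<omega> - X s \<omega>)) {..<k}"
    if "0 \<le> t 0" "mono_on {..k} t" for k and t :: "nat \<Rightarrow> real"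
    using increments_indep[of "\<lambda>j. s + t j" k] that assms by (auto simp: mono_on_def)
  have law: "distr M borel (\<lambda>\<omega>. X (s + (u + h)) \<omega> - X s \<omega> - (X (s + u) \<omega> - X s \<omega>)) =
      distr M borel (\<lambda>\<omega>. X (s + h) \<omega> - X s \<omega>)" if "0 \<le> u" "0 \<le> h" for u h
    using increment_law[of "s + u" "s + (u + h)"] increment_law[of s "s + h"] that assms by simp
  show "levy_process M (\<lambda>r \<omega>. X (s + r) \<omega> - X s \<omega>)"
    unfolding levy_process_def using assms cad ind law by auto
qed simp

text \<open>Two finite-dimensional cylinders, one of the past and one of the future, depend on
  disjoint blocks of increments over one common grid. Cylinders form an intersection-stable
  generator, so independence extends to the whole paths.\<close>

lemma past_future_indep:
  assumes s: "0 \<le> s"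
  shows "indep_var (\<Pi>\<^sub>M t\<in>{0..s}. borel) (\<lambda>\<omega>. \<lambda>t\<in>{0..s}. X t \<omega>)
    paths (traj (\<lambda>r \<omega>. X (s + r) \<omega> - X s \<omega>))"
proof -
  interpret S: levy M "\<lambda>r \<omega>. X (s + r) \<omega> - X s \<omega>" by (rule shift_levy[OF s])
  let ?past = "\<lambda>\<omega>. \<lambda>t\<in>{0..s}. X t \<omega>" and ?fut = "traj (\<lambda>r \<omega>. X (s + r) \<omega> - X s \<omega>)"
  let ?P = "\<Pi>\<^sub>M t\<in>{0..s}. (borel :: real measure)"
  let ?GA = "{?past -` A \<inter> space M | A. A \<in> prod_algebra {0..s} (\<lambda>_. borel)}"
  let ?GB = "{?fut -` A \<inter> space M | A. A \<in> prod_algebra {0..} (\<lambda>_. borel)}"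
  have rv1: "?past \<in> M \<rightarrow>\<^sub>M ?P" by (intro measurable_restrict) auto
  have rv2: "?fut \<in> M \<rightarrow>\<^sub>M paths" by simp
  have key: "prob (A \<inter> B) = prob A * prob B" if "A \<in> ?GA" "B \<in> ?GB" for A B
  proof -
    from that obtain A0 B0 where A0: "A = ?past -` A0 \<inter> space M" "A0 \<in> prod_algebra {0..s} (\<lambda>_. borel)"
      and B0: "B = ?fut -` B0 \<inter> space M" "B0 \<in> prod_algebra {0..} (\<lambda>_. borel)" by auto
    from A0(2) obtain J E where J: "A0 = prod_emb {0..s} (\<lambda>_. borel) J (\<Pi>\<^sub>E j\<in>J. E j)"
      "finite J" "J \<subseteq> {0..s}" "\<And>i. i \<in> J \<Longrightarrow> E i \<in> sets borel" by (elim prod_algebraE) auto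
    from B0(2) obtain K F where K: "B0 = prod_emb {0..} (\<lambda>_. borel) K (\<Pi>\<^sub>E j\<in>K. F j)"
      "finite K" "K \<subseteq> {0..}" "\<And>i. i \<in> K \<Longrightarrow> F i \<in> sets borel" by (elim prod_algebraE) auto
    have A: "A = {\<omega>\<in>space M. \<forall>j\<in>J. X j \<omega> \<in> E j}"
      using J(3) unfolding A0 J(1) by (auto simp: prod_emb_def PiE_iff subset_eq)
    have B: "B = {\<omega>\<in>space M. \<forall>j\<in>K. X (s + j) \<omega> - X s \<omega> \<in> F j}"
      using K(3) unfolding B0 K(1) by (auto simp: prod_emb_def PiE_iff subset_eq traj_def)
    \<comment> \<open>The time \<open>s\<close> belongs to the grid so that it separates past
      increments from future ones; 0 belongs to it so that \<open>X j\<close> is a sum of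
      increments.\<close>
    define T where "T = insert 0 (insert s (J \<union> (+) s ` K))"
    have "finite T" "0 \<in> T" "T \<subseteq> {0..}" using J K s by (auto simp: T_def subset_eq)
    then obtain t :: "nat \<Rightarrow> real" and k :: nat where t: "mono_on {..k} t" "t 0 = 0" "t ` {..k} = T" by (rule finite_grid)
    have "s \<in> t ` {..k}" unfolding t(3) by (auto simp: T_def)
    then obtain q where q: "q \<le> k" "t q = s" by auto
    have "\<exists>i\<le>q. t i = j" if "j \<in> J" for j
    proof -
      have "j \<in> t ` {..k}" unfolding t(3) using that by (auto simp: T_def)
      then obtain i where "i \<le> k" "t i = j" by blast
      show ?thesis
      proof (cases "i \<le> q")
        case False
        then have "t q \<le> t i" using q \<open>i \<le> k\<close> t(1) by (auto simp: mono_on_def)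
        moreover have "j \<le> s" using J(3) that by auto
        ultimately have "t q = j" using q \<open>t i = j\<close> by simp
        then show ?thesis by blast
      qed (use \<open>t i = j\<close> in blast)
    qed
    then obtain a where a: "\<And>j. j \<in> J \<Longrightarrow> a j \<le> q \<and> t (a j) = j" by metis
    have "\<exists>i. q \<le> i \<and> i \<le> k \<and> t i = s + j" if "j \<in> K" for j
    proof -
      have "s + j \<in> t ` {..k}" unfolding t(3) using that by (auto simp: T_def)
      then obtain i where i: "i \<le> k" "t i = s + j" by auto
      show ?thesis
      proof (cases "q \<le> i")
        case False
        then have "t i \<le> t q" using q t(1) by (auto simp: mono_on_def)
        then have "j = 0" using i q K(3) that by (auto simp: subset_eq)
        then show ?thesis using q by auto
      qed (use i in auto)
    qed
    then obtain b where b: "\<And>j. j \<in> K \<Longrightarrow> q \<le> b j \<and> b j \<le> k \<and> t (b j) = s + j" by metis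
    define inc where "inc = (\<lambda>j \<omega>. X (t (Suc j)) \<omega> - X (t j) \<omega>)"
    have tel: "X (t j) \<omega> - X (t i) \<omega> = (\<Sum>p\<in>{i..<j}. inc p \<omega>)" if "i \<le> j" for i j \<omega>
      using sum_Suc_diff'[OF that, of "\<lambda>p. X (t p) \<omega>"] by (simp add: inc_def)
    have ind: "indep_var (PiM {0..<q} (\<lambda>_. borel)) (\<lambda>\<omega>. restrict (\<lambda>i. inc i \<omega>) {0..<q})
       (PiM {q..<k} (\<lambda>_. borel)) (\<lambda>\<omega>. restrict (\<lambda>i. inc i \<omega>) {q..<k})"
      using q increments_indep[OF _ t(1)] t(2) unfolding inc_def by (intro indep_var_restrict) auto
    define A' where "A' = {w\<in>space (PiM {0..<q} (\<lambda>_. borel)). \<forall>j\<in>J. (\<Sum>p\<in>{0..<a j}. w p) \<in> E j}"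
    define B' where "B' = {w\<in>space (PiM {q..<k} (\<lambda>_. borel)). \<forall>j\<in>K. (\<Sum>p\<in>{q..<b j}. w p) \<in> F j}"
    have A'm: "A' \<in> sets (PiM {0..<q} (\<lambda>_. borel))" unfolding A'_def
      using J a by (intro sets.sets_Collect_finite_All measurable_Collect_in[where K = borel] borel_measurable_sum
          measurable_component_singleton) (auto dest: less_le_trans)
    have B'm: "B' \<in> sets (PiM {q..<k} (\<lambda>_. borel))" unfolding B'_def
      using K b by (intro sets.sets_Collect_finite_All measurable_Collect_in[where K = borel] borel_measurable_sum
          measurable_component_singleton) (auto dest: less_le_trans)
    have tA: "(\<Sum>p\<in>{0..<a j}. (\<lambda>i\<in>{0..<q}. inc i \<omega>) p) = X j \<omega>" if "j \<in> J" "\<omega> \<in> space M" for j \<omega>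
    proof -
      have "(\<Sum>p\<in>{0..<a j}. (\<lambda>i\<in>{0..<q}. inc i \<omega>) p) = (\<Sum>p\<in>{0..<a j}. inc p \<omega>)"
        using a[OF that(1)] by (intro sum.cong) auto
      then show ?thesis using tel[of 0 "a j" \<omega>] a[OF that(1)] t(2) start[OF that(2)] by simp
    qed
    have tB: "(\<Sum>p\<in>{q..<b j}. (\<lambda>i\<in>{q..<k}. inc i \<omega>) p) = X (s + j) \<omega> - X s \<omega>" if "j \<in> K" for j \<omega>
    proof -
      have "(\<Sum>p\<in>{q..<b j}. (\<lambda>i\<in>{q..<k}. inc i \<omega>) p) = (\<Sum>p\<in>{q..<b j}. inc p \<omega>)"
        using b[OF that] by (intro sum.cong) auto
      then show ?thesis using tel[of q "b j" \<omega>] b[OF that(1)] q by simp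
    qed
    have A2: "A = (\<lambda>\<omega>. \<lambda>i\<in>{0..<q}. inc i \<omega>) -` A' \<inter> space M"
      unfolding A A'_def vimage_def by (auto simp only: mem_Collect_eq Int_iff tA space_PiM) (auto simp: PiE_iff)
    have B2: "B = (\<lambda>\<omega>. \<lambda>i\<in>{q..<k}. inc i \<omega>) -` B' \<inter> space M"
      unfolding B B'_def vimage_def by (auto simp only: mem_Collect_eq Int_iff tB space_PiM) (auto simp: PiE_iff)
    have "A \<inter> B = (\<lambda>\<omega>. (\<lambda>i\<in>{0..<q}. inc i \<omega>, \<lambda>i\<in>{q..<k}. inc i \<omega>)) -` (A' \<times> B') \<inter> space M"
      unfolding A2 B2 by blast
    then show ?thesis
      using indep_varD[OF ind A'm B'm] unfolding A2[symmetric] B2[symmetric] by simp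
  qed
  have gen: "Int_stable {f -` A \<inter> space M | A. A \<in> prod_algebra I (\<lambda>_. borel :: real measure)}"
    for f :: "'a \<Rightarrow> real \<Rightarrow> real" and I :: "real set"
    unfolding Int_stable_def
  proof safe
    fix A B assume "A \<in> prod_algebra I (\<lambda>_. borel :: real measure)" "B \<in> prod_algebra I (\<lambda>_. borel :: real measure)"
    then have "A \<inter> B \<in> prod_algebra I (\<lambda>_. borel)" using Int_stable_prod_algebra by (auto simp: Int_stable_def)
    then show "\<exists>C. f -` A \<inter> space M \<inter> (f -` B \<inter> space M) = f -` C \<inter> space M \<and> C \<in> prod_algebra I (\<lambda>_. borel)"
      by (intro exI[of _ "A \<inter> B"] conjI) blast+
  qed
  have sub: "prod_algebra I (\<lambda>_. borel :: real measure) \<subseteq> sets (PiM I (\<lambda>_. borel))" for I :: "real set"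
    unfolding sets_PiM by (rule sigma_sets_superset_generator)
  have "?GA \<subseteq> events"
  proof safe
    fix A assume "A \<in> prod_algebra {0..s} (\<lambda>_. borel :: real measure)"
    then have "A \<in> sets ?P" using sub[of "{0..s}"] by (rule rev_subsetD)
    then show "?past -` A \<inter> space M \<in> events" by (rule measurable_sets[OF rv1])
  qed
  moreover have "?GB \<subseteq> events"
  proof safe
    fix A assume "A \<in> prod_algebra {0::real..} (\<lambda>_. borel :: real measure)"
    then have "A \<in> sets paths" using sub[of "{0::real..}"] by (rule rev_subsetD)
    then show "?fut -` A \<inter> space M \<in> events" by (rule measurable_sets[OF rv2])
  qed
  ultimately have ind: "indep_set ?GA ?GB"
    by (rule indep_setI) (rule key)
  \<comment> \<open>Replaces the generator of all measurable sets by that of cylinders, for which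
    the product rule was checked.\<close>
  have sig: "sigma_sets (space M) {f -` A \<inter> space M | A. A \<in> sets (PiM I (\<lambda>_. borel :: real measure))} =
      sigma_sets (space M) {f -` A \<inter> space M | A. A \<in> prod_algebra I (\<lambda>_. borel :: real measure)}"
    if f: "f \<in> M \<rightarrow>\<^sub>M PiM I (\<lambda>_. borel :: real measure)" for f and I :: "real set"
  proof -
    have "f \<in> space M \<rightarrow> (\<Pi>\<^sub>E i\<in>I. space (borel :: real measure))"
      using measurable_space[OF f] by (auto simp: space_PiM)
    from sigma_sets_vimage_commute[OF this, of "prod_algebra I (\<lambda>_. borel)"]
    have "{f -` A \<inter> space M | A. A \<in> sets (PiM I (\<lambda>_. borel :: real measure))} =
        sigma_sets (space M) {f -` A \<inter> space M | A. A \<in> prod_algebra I (\<lambda>_. borel :: real measure)}"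
      unfolding sets_PiM .
    then show ?thesis by (simp only:) (rule sigma_sets_sigma_sets_eq, blast)
  qed
  show ?thesis
    unfolding indep_var_eq sig[OF rv1] sig[OF rv2]
    using rv1 rv2 indep_set_sigma_sets[OF ind gen gen] by (intro conjI)
qed

end

text \<open>A cylinder event is an event about finitely many independent increments, each
  distributed as the process at the time difference. One-dimensional marginals thus determine the
  law of the path.\<close>

lemma traj_law_cong:
  assumes "levy M X" "levy M' X'"
    and marg: "\<And>t. 0 \<le> t \<Longrightarrow> distr M borel (X t) = distr M' borel (X' t)"
  shows "distr M paths (traj X) = distr M' paths (traj X')"
proof -
  interpret A: levy M X by fact
  interpret B: levy M' X' by fact
  show ?thesis
  proof (rule measure_eqI_PiM_infinite)
    show "finite_measure (distr M paths (traj X))"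
      using A.prob_space_distr[OF A.traj_measurable] by (simp add: prob_space_def)
    fix E :: "real \<Rightarrow> real set" and J
    assume J: "finite J" "J \<subseteq> {0..}" "\<And>i. i \<in> J \<Longrightarrow> E i \<in> sets (borel :: real measure)"
    \<comment> \<open>The extra time 1 guarantees at least one increment, since the product form of
      the joint law is used for a nonempty index set.\<close>
    define T where "T = insert 0 (insert 1 J)"
    have "finite T" "0 \<in> T" "T \<subseteq> {0..}" using J by (auto simp: T_def)
    then obtain t :: "nat \<Rightarrow> real" and k :: nat where t: "mono_on {..k} t" "t 0 = 0" "t ` {..k} = T" by (rule finite_grid)
    have t0: "0 \<le> t i" if "i \<le> k" for i using that t(1,2) by (force simp: mono_on_def)
    have "k \<noteq> 0"
    proof
      assume "k = 0"
      then have "T = {0}" using t by simp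
      then show False by (auto simp: T_def)
    qed
    then have ne: "{..<k} \<noteq> {}" by auto
    have "\<exists>i\<le>k. t i = j" if "j \<in> J" for j
    proof -
      have "j \<in> t ` {..k}" unfolding t(3) using that by (auto simp: T_def)
      then show ?thesis by auto
    qed
    then obtain a where a: "\<And>j. j \<in> J \<Longrightarrow> a j \<le> k \<and> t (a j) = j" by metis
    define C where "C = {w\<in>space (PiM {..<k} (\<lambda>_. borel)). \<forall>j\<in>J. (\<Sum>p<a j. w p) \<in> E j}"
    have Cm: "C \<in> sets (PiM {..<k} (\<lambda>_. borel))" unfolding C_def
      using J a by (intro sets.sets_Collect_finite_All measurable_Collect_in[where K = borel] borel_measurable_sum
          measurable_component_singleton) (auto dest: less_le_trans)
    have *: "emeasure (distr Q paths (traj Y)) (prod_emb {0..} (\<lambda>_. borel) J (Pi\<^sub>E J E)) =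
        emeasure (\<Pi>\<^sub>M p\<in>{..<k}. distr Q borel (Y (t (Suc p) - t p))) C" if "levy Q Y" for Q :: "'q measure" and Y
    proof -
      interpret levy Q Y by fact
      define inc where "inc = (\<lambda>j \<omega>. Y (t (Suc j)) \<omega> - Y (t j) \<omega>)"
      have im: "inc p \<in> borel_measurable Q" if "p < k" for p
        unfolding inc_def using t0 that by (intro borel_measurable_diff meas) auto
      have tel: "Y j \<omega> = (\<Sum>p<a j. inc p \<omega>)" if "j \<in> J" "\<omega> \<in> space Q" for j \<omega>
        using sum_lessThan_telescope[of "\<lambda>p. Y (t p) \<omega>" "a j"] a[OF that(1)] t(2) start[OF that(2)]
        by (simp add: inc_def)
      have telr: "(\<Sum>p<a j. (\<lambda>p\<in>{..<k}. inc p \<omega>) p) = Y j \<omega>" if "j \<in> J" "\<omega> \<in> space Q" for j \<omega>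
        unfolding tel[OF that] using a[OF that(1)] by (intro sum.cong) auto
      have "emeasure (distr Q paths (traj Y)) (prod_emb {0..} (\<lambda>_. borel) J (Pi\<^sub>E J E)) =
          emeasure Q {\<omega>\<in>space Q. \<forall>j\<in>J. Y j \<omega> \<in> E j}"
      proof -
        have "prod_emb {0..} (\<lambda>_. borel) J (Pi\<^sub>E J E) \<in> sets paths" using J by (intro sets_PiM_I) auto
        moreover have "traj Y -` prod_emb {0..} (\<lambda>_. borel) J (Pi\<^sub>E J E) \<inter> space Q = {\<omega>\<in>space Q. \<forall>j\<in>J. Y j \<omega> \<in> E j}"
          using J(2) by (auto simp: prod_emb_def PiE_iff subset_eq traj_def)
        ultimately show ?thesis using traj_measurable by (simp add: emeasure_distr)
      qed
      also have "{\<omega>\<in>space Q. \<forall>j\<in>J. Y j \<omega> \<in> E j} = (\<lambda>\<omega>. \<lambda>p\<in>{..<k}. inc p \<omega>) -` C \<inter> space Q"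
        unfolding C_def vimage_def
        by (auto simp only: mem_Collect_eq Int_iff telr space_PiM) (auto simp: PiE_iff split: if_splits)
      also have "emeasure Q \<dots> = emeasure (distr Q (PiM {..<k} (\<lambda>_. borel)) (\<lambda>\<omega>. \<lambda>p\<in>{..<k}. inc p \<omega>)) C"
        using Cm im by (subst emeasure_distr) (auto intro!: measurable_restrict)
      also have "distr Q (PiM {..<k} (\<lambda>_. borel)) (\<lambda>\<omega>. \<lambda>p\<in>{..<k}. inc p \<omega>) =
          (\<Pi>\<^sub>M p\<in>{..<k}. distr Q borel (inc p))"
        using increments_indep[OF _ t(1)] t(2) im
        by (subst indep_vars_iff_distr_eq_PiM'[OF ne, symmetric]) (auto simp: inc_def)
      also have "\<dots> = (\<Pi>\<^sub>M p\<in>{..<k}. distr Q borel (Y (t (Suc p) - t p)))"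
        unfolding inc_def using t0 t(1) by (intro PiM_cong increment_law) (auto simp: mono_on_def)
      finally show ?thesis .
    qed
    have "(\<Pi>\<^sub>M p\<in>{..<k}. distr M borel (X (t (Suc p) - t p))) = (\<Pi>\<^sub>M p\<in>{..<k}. distr M' borel (X' (t (Suc p) - t p)))"
      using t(1) by (intro PiM_cong marg) (auto simp: mono_on_def)
    then show "emeasure (distr M paths (traj X)) (prod_emb {0..} (\<lambda>_. borel) J (Pi\<^sub>E J E)) =
        emeasure (distr M' paths (traj X')) (prod_emb {0..} (\<lambda>_. borel) J (Pi\<^sub>E J E))"
      unfolding *[OF assms(1)] *[OF assms(2)] by simp
  qed simp_all
qed

section \<open>Independent pairs and integration over an independent variable\<close>

context prob_space
begin

text \<open>The two variables may take values in different types, such as a point of the sample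
  space and a path.\<close>

definition indep_pair :: "'s measure \<Rightarrow> ('a \<Rightarrow> 's) \<Rightarrow> 't measure \<Rightarrow> ('a \<Rightarrow> 't) \<Rightarrow> bool" where
  "indep_pair S X T Y \<longleftrightarrow> X \<in> M \<rightarrow>\<^sub>M S \<and> Y \<in> M \<rightarrow>\<^sub>M T \<and>
     (\<forall>A\<in>sets S. \<forall>B\<in>sets T. prob ((X -` A \<inter> space M) \<inter> (Y -` B \<inter> space M)) =
        prob (X -` A \<inter> space M) * prob (Y -` B \<inter> space M))"

lemma indep_var_imp_indep_pair:
  assumes "indep_var S X T Y"
  shows "indep_pair S X T Y"
  unfolding indep_pair_def
proof (intro conjI ballI)
  fix A B assume "A \<in> sets S" "B \<in> sets T"
  from indep_varD[OF assms this]
  show "prob ((X -` A \<inter> space M) \<inter> (Y -` B \<inter> space M)) =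
        prob (X -` A \<inter> space M) * prob (Y -` B \<inter> space M)"
    by (simp add: vimage_def Int_def conj_ac)
qed (use indep_var_rv1[OF assms] indep_var_rv2[OF assms] in auto)

lemma indep_pair_compose:
  assumes ind: "indep_pair S X T Y" and f: "f \<in> S \<rightarrow>\<^sub>M S'" and g: "g \<in> T \<rightarrow>\<^sub>M T'"
  shows "indep_pair S' (\<lambda>\<omega>. f (X \<omega>)) T' (\<lambda>\<omega>. g (Y \<omega>))"
proof -
  have X: "X \<in> M \<rightarrow>\<^sub>M S" and Y: "Y \<in> M \<rightarrow>\<^sub>M T" using ind by (auto simp: indep_pair_def)
  show ?thesis
    unfolding indep_pair_def
  proof (intro conjI ballI)
    show "(\<lambda>\<omega>. f (X \<omega>)) \<in> M \<rightarrow>\<^sub>M S'" "(\<lambda>\<omega>. g (Y \<omega>)) \<in> M \<rightarrow>\<^sub>M T'"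
      using measurable_compose[OF X f] measurable_compose[OF Y g] by auto
    fix A B assume AB: "A \<in> sets S'" "B \<in> sets T'"
    have "(\<lambda>\<omega>. f (X \<omega>)) -` A \<inter> space M = X -` (f -` A \<inter> space S) \<inter> space M"
      using measurable_space[OF X] by auto
    moreover have "(\<lambda>\<omega>. g (Y \<omega>)) -` B \<inter> space M = Y -` (g -` B \<inter> space T) \<inter> space M"
      using measurable_space[OF Y] by auto
    ultimately show "prob (((\<lambda>\<omega>. f (X \<omega>)) -` A \<inter> space M) \<inter> ((\<lambda>\<omega>. g (Y \<omega>)) -` B \<inter> space M)) =
        prob ((\<lambda>\<omega>. f (X \<omega>)) -` A \<inter> space M) * prob ((\<lambda>\<omega>. g (Y \<omega>)) -` B \<inter> space M)"
      using ind[unfolded indep_pair_def, THEN conjunct2, THEN conjunct2, rule_format,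
          OF measurable_sets[OF f AB(1)] measurable_sets[OF g AB(2)]] by (simp only:)
  qed
qed

text \<open>On rectangles the three-fold product rule can be regrouped; rectangles generate the
  product sigma-algebra. With \<open>Y\<close> the past and \<open>Z\<close> the future of a
  process, it adjoins independent side information \<open>V\<close> to the past.\<close>

lemma indep_pair_assoc:
  fixes V :: "'a \<Rightarrow> 's" and Y :: "'a \<Rightarrow> 't" and Z :: "'a \<Rightarrow> 'u"
  assumes OYZ: "indep_pair S V (T \<Otimes>\<^sub>M U) (\<lambda>\<omega>. (Y \<omega>, Z \<omega>))" and YZ: "indep_pair T Y U Z"
  shows "indep_pair (S \<Otimes>\<^sub>M T) (\<lambda>\<omega>. (V \<omega>, Y \<omega>)) U Z"
proof -
  have Om: "V \<in> M \<rightarrow>\<^sub>M S" and Ym: "Y \<in> M \<rightarrow>\<^sub>M T" and Zm: "Z \<in> M \<rightarrow>\<^sub>M U"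
    using OYZ YZ by (auto simp: indep_pair_def)
  have OYm: "(\<lambda>\<omega>. (V \<omega>, Y \<omega>)) \<in> M \<rightarrow>\<^sub>M S \<Otimes>\<^sub>M T" using Om Ym by simp
  define R where "R = {a \<times> b | a b. a \<in> sets S \<and> b \<in> sets T}"
  let ?GA = "{(\<lambda>\<omega>. (V \<omega>, Y \<omega>)) -` A \<inter> space M | A. A \<in> R}"
  let ?GB = "{Z -` A \<inter> space M | A. A \<in> sets U}"
  have key: "prob (A \<inter> B) = prob A * prob B" if "A \<in> ?GA" "B \<in> ?GB" for A B
  proof -
    from that obtain a b c where
      A: "A = (\<lambda>\<omega>. (V \<omega>, Y \<omega>)) -` (a \<times> b) \<inter> space M" "a \<in> sets S" "b \<in> sets T"
      and B: "B = Z -` c \<inter> space M" "c \<in> sets U" unfolding R_def by blast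
    have *: "prob (V -` a \<inter> space M \<inter> ((\<lambda>\<omega>. (Y \<omega>, Z \<omega>)) -` (b \<times> d) \<inter> space M)) =
        prob (V -` a \<inter> space M) * (prob (Y -` b \<inter> space M) * prob (Z -` d \<inter> space M))" if "d \<in> sets U" for d
    proof -
      have "(\<lambda>\<omega>. (Y \<omega>, Z \<omega>)) -` (b \<times> d) \<inter> space M = (Y -` b \<inter> space M) \<inter> (Z -` d \<inter> space M)" by auto
      moreover have "prob (V -` a \<inter> space M \<inter> ((\<lambda>\<omega>. (Y \<omega>, Z \<omega>)) -` (b \<times> d) \<inter> space M)) =
          prob (V -` a \<inter> space M) * prob ((\<lambda>\<omega>. (Y \<omega>, Z \<omega>)) -` (b \<times> d) \<inter> space M)"
        using OYZ A(2,3) that unfolding indep_pair_def by blast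
      ultimately show ?thesis using YZ A(3) that unfolding indep_pair_def by simp
    qed
    have "A \<inter> B = V -` a \<inter> space M \<inter> ((\<lambda>\<omega>. (Y \<omega>, Z \<omega>)) -` (b \<times> c) \<inter> space M)"
      unfolding A B by auto
    moreover have "A = V -` a \<inter> space M \<inter> ((\<lambda>\<omega>. (Y \<omega>, Z \<omega>)) -` (b \<times> space U) \<inter> space M)"
      unfolding A using measurable_space[OF Zm] by auto
    moreover have "Z -` space U \<inter> space M = space M" using measurable_space[OF Zm] by auto
    ultimately show ?thesis using *[OF B(2)] *[OF sets.top] B(1) prob_space by simp
  qed
  have "?GA \<subseteq> events" using measurable_sets[OF OYm] unfolding R_def by blast
  moreover have "?GB \<subseteq> events" using measurable_sets[OF Zm] by blast
  ultimately have ind: "indep_set ?GA ?GB" by (rule indep_setI) (rule key)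
  have iA: "Int_stable ?GA"
    unfolding Int_stable_def R_def
  proof safe
    fix a b c d assume "a \<in> sets S" "b \<in> sets T" "c \<in> sets S" "d \<in> sets T"
    then show "\<exists>A. (\<lambda>\<omega>. (V \<omega>, Y \<omega>)) -` (a \<times> b) \<inter> space M \<inter> ((\<lambda>\<omega>. (V \<omega>, Y \<omega>)) -` (c \<times> d) \<inter> space M) =
        (\<lambda>\<omega>. (V \<omega>, Y \<omega>)) -` A \<inter> space M \<and> A \<in> {a \<times> b |a b. a \<in> sets S \<and> b \<in> sets T}"
      by (intro exI[of _ "(a \<inter> c) \<times> (b \<inter> d)"]) auto
  qed
  have iB: "Int_stable ?GB"
    unfolding Int_stable_def
  proof safe
    fix a b assume "a \<in> sets U" "b \<in> sets U"
    then show "\<exists>A. Z -` a \<inter> space M \<inter> (Z -` b \<inter> space M) = Z -` A \<inter> space M \<and> A \<in> sets U"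
      by (intro exI[of _ "a \<inter> b"]) auto
  qed
  have "(\<lambda>\<omega>. (V \<omega>, Y \<omega>)) \<in> space M \<rightarrow> space S \<times> space T"
    using measurable_space[OF OYm] by (auto simp: space_pair_measure)
  from sigma_sets_vimage_commute[OF this, of R]
  have sA: "sigma_sets (space M) ?GA = {(\<lambda>\<omega>. (V \<omega>, Y \<omega>)) -` A \<inter> space M | A. A \<in> sets (S \<Otimes>\<^sub>M T)}"
    by (simp add: sets_pair_measure R_def)
  show ?thesis
    unfolding indep_pair_def
  proof (intro conjI ballI OYm Zm)
    fix A B assume "A \<in> sets (S \<Otimes>\<^sub>M T)" "B \<in> sets U"
    then have "(\<lambda>\<omega>. (V \<omega>, Y \<omega>)) -` A \<inter> space M \<in> sigma_sets (space M) ?GA"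
      "Z -` B \<inter> space M \<in> sigma_sets (space M) ?GB"
      unfolding sA by (blast, intro sigma_sets.Basic, blast)
    with indep_setD[OF indep_set_sigma_sets[OF ind iA iB]]
    show "prob ((\<lambda>\<omega>. (V \<omega>, Y \<omega>)) -` A \<inter> space M \<inter> (Z -` B \<inter> space M)) =
       prob ((\<lambda>\<omega>. (V \<omega>, Y \<omega>)) -` A \<inter> space M) * prob (Z -` B \<inter> space M)" by blast
  qed
qed

text \<open>Encodes "independent of the sigma-algebra generated by \<open>W\<close>" through the
  identity map into that sigma-algebra. Integrands may then depend on the sample point measurably
  without being written as functions of \<open>W\<close>.\<close>

lemma indep_pair_vimage_algebra:
  assumes "indep_pair K W U Z"
  shows "indep_pair (vimage_algebra (space M) W K) (\<lambda>\<omega>. \<omega>) U Z"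
proof -
  have W: "W \<in> M \<rightarrow>\<^sub>M K" using assms by (auto simp: indep_pair_def)
  then have W': "W \<in> space M \<rightarrow> space K" by (auto dest: measurable_space)
  have s: "sets (vimage_algebra (space M) W K) = {W -` A \<inter> space M | A. A \<in> sets K}"
    by (rule sets_vimage_algebra2[OF W'])
  show ?thesis
    unfolding indep_pair_def
  proof (intro conjI ballI)
    show "(\<lambda>\<omega>. \<omega>) \<in> M \<rightarrow>\<^sub>M vimage_algebra (space M) W K"
    proof (rule measurableI)
      fix A assume "A \<in> sets (vimage_algebra (space M) W K)"
      then obtain B where B: "A = W -` B \<inter> space M" "B \<in> sets K" using s by auto
      have "(\<lambda>\<omega>. \<omega>) -` A \<inter> space M = W -` B \<inter> space M" using B by auto
      then show "(\<lambda>\<omega>. \<omega>) -` A \<inter> space M \<in> events" using measurable_sets[OF W B(2)] by simp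
    qed simp
    show "Z \<in> M \<rightarrow>\<^sub>M U" using assms by (auto simp: indep_pair_def)
    fix A B assume "A \<in> sets (vimage_algebra (space M) W K)" "B \<in> sets U"
    then obtain A' where A': "A = W -` A' \<inter> space M" "A' \<in> sets K" using s by auto
    have "(\<lambda>\<omega>. \<omega>) -` A \<inter> space M = W -` A' \<inter> space M" using A' by auto
    then show "prob ((\<lambda>\<omega>. \<omega>) -` A \<inter> space M \<inter> (Z -` B \<inter> space M)) =
        prob ((\<lambda>\<omega>. \<omega>) -` A \<inter> space M) * prob (Z -` B \<inter> space M)"
      using assms[unfolded indep_pair_def, THEN conjunct2, THEN conjunct2, rule_format, OF A'(2) \<open>B \<in> sets U\<close>] by simp
  qed
qed

text \<open>The joint law of an independent pair is the product law, so this is Tonelli; it plays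
  the part of conditional expectation given \<open>N\<close>.\<close>

lemma nn_integral_freeze:
  assumes ind: "indep_pair N (\<lambda>\<omega>. \<omega>) S Y" and F: "case_prod F \<in> borel_measurable (N \<Otimes>\<^sub>M S)"
  shows "(\<integral>\<^sup>+\<omega>. F \<omega> (Y \<omega>) \<partial>M) = (\<integral>\<^sup>+\<omega>. (\<integral>\<^sup>+y. F \<omega> y \<partial>distr M S Y) \<partial>M)"
proof -
  have N: "(\<lambda>\<omega>. \<omega>) \<in> M \<rightarrow>\<^sub>M N" and Y: "Y \<in> M \<rightarrow>\<^sub>M S"
    using ind by (auto simp: indep_pair_def)
  interpret Y: prob_space "distr M S Y" by (rule prob_space_distr) fact
  interpret N: prob_space "distr M N (\<lambda>\<omega>. \<omega>)" by (rule prob_space_distr) fact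
  have F': "case_prod F \<in> borel_measurable (distr M N (\<lambda>\<omega>. \<omega>) \<Otimes>\<^sub>M distr M S Y)"
    using F by (simp cong: measurable_cong_sets sets_pair_measure_cong)
  have "distr M N (\<lambda>\<omega>. \<omega>) \<Otimes>\<^sub>M distr M S Y = distr M (N \<Otimes>\<^sub>M S) (\<lambda>\<omega>. (\<omega>, Y \<omega>))"
  proof (rule pair_measure_eqI)
    show "sigma_finite_measure (distr M N (\<lambda>\<omega>. \<omega>))" "sigma_finite_measure (distr M S Y)" ..
    show "sets (distr M N (\<lambda>\<omega>. \<omega>) \<Otimes>\<^sub>M distr M S Y) = sets (distr M (N \<Otimes>\<^sub>M S) (\<lambda>\<omega>. (\<omega>, Y \<omega>)))"
      by (simp cong: sets_pair_measure_cong)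
    fix A B assume "A \<in> sets (distr M N (\<lambda>\<omega>. \<omega>))" "B \<in> sets (distr M S Y)"
    then have AB: "A \<in> sets N" "B \<in> sets S" by auto
    have "(\<lambda>\<omega>. (\<omega>, Y \<omega>)) -` (A \<times> B) \<inter> space M = ((\<lambda>\<omega>. \<omega>) -` A \<inter> space M) \<inter> (Y -` B \<inter> space M)" by auto
    then have "prob ((\<lambda>\<omega>. (\<omega>, Y \<omega>)) -` (A \<times> B) \<inter> space M) = prob ((\<lambda>\<omega>. \<omega>) -` A \<inter> space M) * prob (Y -` B \<inter> space M)"
      using ind[unfolded indep_pair_def, THEN conjunct2, THEN conjunct2, rule_format, OF AB] by simp
    then show "emeasure (distr M N (\<lambda>\<omega>. \<omega>)) A * emeasure (distr M S Y) B =
        emeasure (distr M (N \<Otimes>\<^sub>M S) (\<lambda>\<omega>. (\<omega>, Y \<omega>))) (A \<times> B)"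
      using AB N Y by (simp add: emeasure_distr emeasure_eq_measure ennreal_mult)
  qed
  moreover have "(\<integral>\<^sup>+\<omega>. F \<omega> (Y \<omega>) \<partial>M) = (\<integral>\<^sup>+z. case_prod F z \<partial>distr M (N \<Otimes>\<^sub>M S) (\<lambda>\<omega>. (\<omega>, Y \<omega>)))"
    using F N Y by (subst nn_integral_distr) auto
  ultimately have "(\<integral>\<^sup>+\<omega>. F \<omega> (Y \<omega>) \<partial>M) = (\<integral>\<^sup>+z. case_prod F z \<partial>(distr M N (\<lambda>\<omega>. \<omega>) \<Otimes>\<^sub>M distr M S Y))"
    by simp
  also have "\<dots> = (\<integral>\<^sup>+\<omega>. (\<integral>\<^sup>+y. F \<omega> y \<partial>distr M S Y) \<partial>distr M N (\<lambda>\<omega>. \<omega>))"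
    using Y.nn_integral_fst[OF F', symmetric] by simp
  also have "\<dots> = (\<integral>\<^sup>+\<omega>. (\<integral>\<^sup>+y. F \<omega> y \<partial>distr M S Y) \<partial>M)"
    using Y.borel_measurable_nn_integral_fst[OF F'] N by (subst nn_integral_distr) auto
  finally show ?thesis .
qed

end

section \<open>Symmetric random walks\<close>

text \<open>Reindexing an infinite product of equal factors along an injection. Shifted blocks and
  reversed blocks of steps are both of this form.\<close>

lemma (in prob_space) iid_block_law:
  fixes \<zeta> :: "nat \<Rightarrow> 'a \<Rightarrow> real"
    and f :: "nat \<Rightarrow> nat" and k :: nat
  assumes ind: "indep_vars (\<lambda>_. borel) \<zeta> UNIV" and law: "\<And>p. distr M borel (\<zeta> p) = \<mu>"
    and f: "inj_on f {..<k}"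
  shows "distr M (PiM {..<k} (\<lambda>_. borel)) (\<lambda>\<omega>. \<lambda>p\<in>{..<k}. \<zeta> (f p) \<omega>) = PiM {..<k} (\<lambda>_. \<mu>)"
proof -
  have rv: "\<zeta> p \<in> borel_measurable M" for p using ind by (auto simp: indep_vars_def)
  have \<mu>: "prob_space \<mu>" unfolding law[of 0, symmetric] by (rule prob_space_distr) (rule rv)
  have s: "sets \<mu> = sets borel" unfolding law[of 0, symmetric] by simp
  have all: "(\<lambda>\<omega>. \<lambda>i\<in>UNIV. \<zeta> i \<omega>) \<in> M \<rightarrow>\<^sub>M PiM UNIV (\<lambda>_. borel)"
    using rv by (intro measurable_restrict)
  have "distr M (PiM UNIV (\<lambda>_. borel)) (\<lambda>\<omega>. \<lambda>i\<in>UNIV. \<zeta> i \<omega>) = (\<Pi>\<^sub>M i\<in>UNIV. distr M borel (\<zeta> i))"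
    using ind rv by (subst (asm) indep_vars_iff_distr_eq_PiM) auto
  also have "\<dots> = PiM UNIV (\<lambda>_. \<mu>)" unfolding law ..
  finally have D: "distr M (PiM UNIV (\<lambda>_. borel)) (\<lambda>\<omega>. \<lambda>i\<in>UNIV. \<zeta> i \<omega>) = PiM UNIV (\<lambda>_. \<mu>)" .
  have "PiM {..<k} (\<lambda>_. \<mu>) = distr (PiM UNIV (\<lambda>_. \<mu>)) (PiM {..<k} (\<lambda>_. \<mu>)) (\<lambda>\<omega>. \<lambda>n\<in>{..<k}. \<omega> (f n))"
    using distr_PiM_reindex[of UNIV "\<lambda>_. \<mu>" f "{..<k}"] \<mu> f by simp
  also have "\<dots> = distr (PiM UNIV (\<lambda>_. \<mu>)) (PiM {..<k} (\<lambda>_. borel)) (\<lambda>\<omega>. \<lambda>n\<in>{..<k}. \<omega> (f n))"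
    by (intro distr_cong sets_PiM_cong refl) (auto simp: s)
  also have "\<dots> = distr M (PiM {..<k} (\<lambda>_. borel)) (\<lambda>\<omega>. \<lambda>p\<in>{..<k}. \<zeta> (f p) \<omega>)"
    unfolding D[symmetric] using all
    by (subst distr_distr) (auto simp: comp_def intro!: measurable_restrict measurable_component_singleton)
  finally show ?thesis by simp
qed

abbreviation seqs :: "(nat \<Rightarrow> real) measure" where
  "seqs \<equiv> \<Pi>\<^sub>M j\<in>UNIV. borel"

text \<open>Capping the index at \<open>k\<close> lets a block of \<open>k\<close> steps determine a
  full sequence, so one notion of predicate on sequences serves blocks of every length.\<close>

lemma partial_sums_measurable:
  "(\<lambda>w j. \<Sum>p<min j k. w p) \<in> PiM {..<k} (\<lambda>_. borel) \<rightarrow>\<^sub>M seqs" for k :: nat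
proof -
  have "(\<lambda>w. \<lambda>j\<in>UNIV. \<Sum>p<min j k. w p) \<in> PiM {..<k} (\<lambda>_. borel) \<rightarrow>\<^sub>M seqs"
    by (intro measurable_restrict borel_measurable_sum measurable_component_singleton) auto
  then show ?thesis by (simp add: restrict_UNIV)
qed

text \<open>Continuity of the steps enters only through \<open>no_tie\<close>: it makes the place of
  the maximum almost surely unique.\<close>

locale sym_walk = prob_space M for M :: "'a measure" +
  fixes \<xi> :: "nat \<Rightarrow> 'a \<Rightarrow> real" and S :: "nat \<Rightarrow> 'a \<Rightarrow> real"
  defines S_def: "S \<equiv> \<lambda>k \<omega>. \<Sum>p<k. \<xi> p \<omega>"
  assumes indep: "indep_vars (\<lambda>_. borel) \<xi> UNIV"
    and law: "\<And>p. distr M borel (\<xi> p) = distr M borel (\<xi> 0)"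
    and sym: "distr M borel (\<lambda>\<omega>. - \<xi> 0 \<omega>) = distr M borel (\<xi> 0)"
    and no_tie: "\<And>k. 0 < k \<Longrightarrow> AE \<omega> in M. S k \<omega> \<noteq> 0"
begin

lemma xi_meas [measurable]: "\<xi> p \<in> borel_measurable M"
  using indep by (auto simp: indep_vars_def)

lemma S_meas [measurable]: "S k \<in> borel_measurable M"
  unfolding S_def by simp

lemma block_prob:
  fixes \<zeta> :: "nat \<Rightarrow> 'a \<Rightarrow> real" and f :: "nat \<Rightarrow> nat" and k :: nat
  assumes P: "Measurable.pred seqs P" and ind: "indep_vars (\<lambda>_. borel) \<zeta> UNIV"
    and law': "\<And>p. distr M borel (\<zeta> p) = distr M borel (\<xi> 0)" and f: "inj_on f {..<k}"
  shows "\<P>(\<omega> in M. P (\<lambda>j. \<Sum>p<min j k. \<zeta> (f p) \<omega>)) = \<P>(\<omega> in M. P (\<lambda>j. S (min j k) \<omega>))"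
proof -
  have rv: "\<zeta> p \<in> borel_measurable M" for p using ind by (auto simp: indep_vars_def)
  have *: "\<P>(\<omega> in M. P (\<lambda>j. \<Sum>p<min j k. \<eta> p \<omega>)) =
      measure (distr M (PiM {..<k} (\<lambda>_. borel)) (\<lambda>\<omega>. \<lambda>p\<in>{..<k}. \<eta> p \<omega>))
        {w\<in>space (PiM {..<k} (\<lambda>_. borel)). P (\<lambda>j. \<Sum>p<min j k. w p)}"
    if e: "\<And>p. \<eta> p \<in> borel_measurable M" for \<eta> :: "nat \<Rightarrow> 'a \<Rightarrow> real"
  proof -
    have 1: "(\<lambda>\<omega>. \<lambda>p\<in>{..<k}. \<eta> p \<omega>) \<in> M \<rightarrow>\<^sub>M PiM {..<k} (\<lambda>_. borel)"
      using e by (intro measurable_restrict)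
    have 2: "{w\<in>space (PiM {..<k} (\<lambda>_. borel)). P (\<lambda>j. \<Sum>p<min j k. w p)} \<in> sets (PiM {..<k} (\<lambda>_. borel))"
      using measurable_compose[OF partial_sums_measurable P] by (simp add: pred_def)
    have 3: "(\<Sum>p<min j k. (\<lambda>p\<in>{..<k}. \<eta> p \<omega>) p) = (\<Sum>p<min j k. \<eta> p \<omega>)" for j \<omega>
      by (intro sum.cong) auto
    have 4: "(\<lambda>p\<in>{..<k}. \<eta> p \<omega>) \<in> space (PiM {..<k} (\<lambda>_. borel))" for \<omega>
      by (auto simp: space_PiM)
    show ?thesis
      unfolding measure_distr[OF 1 2] by (intro arg_cong[where f = prob]) (use 3 4 in auto)
  qed
  have "(\<lambda>\<omega>. \<lambda>p\<in>{..<k}. \<xi> p \<omega>) = (\<lambda>\<omega>. \<lambda>p\<in>{..<k}. \<xi> (id p) \<omega>)" by simp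
  then show ?thesis
    unfolding S_def using *[of "\<lambda>p. \<zeta> (f p)"] *[of \<xi>] rv
      iid_block_law[where \<zeta> = \<zeta> and f = f and k = k, OF ind law' f] iid_block_law[where \<zeta> = \<xi> and f = id and k = k, OF indep law inj_on_id] by simp
qed

text \<open>Markov property at the fixed index \<open>k\<close>: the steps after \<open>k\<close>
  are independent of those before it and again form a block of the same walk.\<close>

lemma block_indep:
  assumes P: "Measurable.pred seqs P" and Q: "Measurable.pred seqs Q"
  shows "\<P>(\<omega> in M. P (\<lambda>j. S (min j k) \<omega>) \<and> Q (\<lambda>j. S (k + min j m) \<omega> - S k \<omega>)) =
    \<P>(\<omega> in M. P (\<lambda>j. S (min j k) \<omega>)) * \<P>(\<omega> in M. Q (\<lambda>j. S (min j m) \<omega>))"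
proof -
  let ?R1 = "\<lambda>\<omega>. \<lambda>p\<in>{..<k}. \<xi> p \<omega>" and ?R2 = "\<lambda>\<omega>. \<lambda>p\<in>{k..<k+m}. \<xi> p \<omega>"
  define A where "A = {w\<in>space (PiM {..<k} (\<lambda>_. borel)). P (\<lambda>j. \<Sum>p<min j k. w p)}"
  define B where "B = {w\<in>space (PiM {k..<k+m} (\<lambda>_. borel)). Q (\<lambda>j. \<Sum>p<min j m. w (k + p))}"
  have A: "A \<in> sets (PiM {..<k} (\<lambda>_. borel))"
    unfolding A_def using measurable_compose[OF partial_sums_measurable P] by (simp add: pred_def)
  have "(\<lambda>w. \<lambda>j\<in>UNIV. \<Sum>p<min j m. w (k + p)) \<in> PiM {k..<k+m} (\<lambda>_. borel) \<rightarrow>\<^sub>M seqs"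
    by (intro measurable_restrict borel_measurable_sum measurable_component_singleton) auto
  then have B: "B \<in> sets (PiM {k..<k+m} (\<lambda>_. borel))"
    unfolding B_def using measurable_compose[OF _ Q] by (simp add: pred_def restrict_UNIV)
  have ind: "indep_var (PiM {..<k} (\<lambda>_. borel)) ?R1 (PiM {k..<k+m} (\<lambda>_. borel)) ?R2"
    by (rule indep_var_restrict[OF indep]) auto
  have s1: "(\<Sum>p<min j k. ?R1 \<omega> p) = S (min j k) \<omega>" for j \<omega>
    unfolding S_def by (intro sum.cong) auto
  have s2: "(\<Sum>p<min j m. ?R2 \<omega> (k + p)) = S (k + min j m) \<omega> - S k \<omega>" for j \<omega>
  proof -
    have "(\<Sum>p<min j m. ?R2 \<omega> (k + p)) = (\<Sum>p<min j m. \<xi> (k + p) \<omega>)"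
      by (intro sum.cong) auto
    also have "S (k + i) \<omega> = S k \<omega> + (\<Sum>p<i. \<xi> (k + p) \<omega>)" for i
      unfolding S_def by (induction i) auto
    then have "(\<Sum>p<min j m. \<xi> (k + p) \<omega>) = S (k + min j m) \<omega> - S k \<omega>" by simp
    finally show ?thesis .
  qed
  have r1: "?R1 -` A \<inter> space M = {\<omega>\<in>space M. P (\<lambda>j. S (min j k) \<omega>)}"
    unfolding A_def vimage_def by (auto simp only: mem_Collect_eq Int_iff s1) (auto simp: space_PiM)
  have r2: "?R2 -` B \<inter> space M = {\<omega>\<in>space M. Q (\<lambda>j. S (k + min j m) \<omega> - S k \<omega>)}"
    unfolding B_def vimage_def by (auto simp only: mem_Collect_eq Int_iff s2) (auto simp: space_PiM)
  have inj: "inj_on (\<lambda>p. k + p) {..<m}" by (auto simp: inj_on_def)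
  have sk: "(\<Sum>p<i. \<xi> (k + p) \<omega>) = S (k + i) \<omega> - S k \<omega>" for i \<omega>
    unfolding S_def by (induction i) auto
  have "prob (?R2 -` B \<inter> space M) = \<P>(\<omega> in M. Q (\<lambda>j. S (min j m) \<omega>))"
    unfolding r2 using block_prob[OF Q indep law inj] unfolding sk .
  moreover have "(\<lambda>\<omega>. (?R1 \<omega>, ?R2 \<omega>)) -` (A \<times> B) \<inter> space M = (?R1 -` A \<inter> space M) \<inter> (?R2 -` B \<inter> space M)" by auto
  ultimately show ?thesis
    using indep_varD[OF ind A B] unfolding r1 r2 by (simp add: Int_def conj_ac)
qed

text \<open>\<open>u\<close> is the persistence sequence. Summed over \<open>k\<close>,
  \<open>r k\<close> is the renewal measure of the strictly ascending ladder heights, with index 0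
  counted as a record.\<close>

definition u where "u k = \<P>(\<omega> in M. \<forall>j\<in>{1..k}. S j \<omega> < 0)"
definition r where "r k C = \<P>(\<omega> in M. (\<forall>j<k. S j \<omega> < S k \<omega>) \<and> S k \<omega> \<in> C)"
definition G where "G N x = \<P>(\<omega> in M. \<forall>j\<le>N. S j \<omega> \<le> x)"

lemma xi_sym: "distr M borel (\<lambda>\<omega>. - \<xi> p \<omega>) = distr M borel (\<xi> 0)"
proof -
  have "distr M borel (\<lambda>\<omega>. - \<xi> p \<omega>) = distr (distr M borel (\<xi> p)) borel uminus"
    by (simp add: distr_distr comp_def)
  also have "\<dots> = distr (distr M borel (\<xi> 0)) borel uminus" by (simp only: law[of p])
  also have "\<dots> = distr M borel (\<xi> 0)" using sym by (simp add: distr_distr comp_def)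
  finally show ?thesis .
qed

lemma indep_minus: "indep_vars (\<lambda>_. borel) (\<lambda>p \<omega>. - \<xi> p \<omega>) UNIV"
  by (rule indep_vars_compose2[OF indep]) auto

lemma S_law_sym: "Measurable.pred seqs P \<Longrightarrow>
    \<P>(\<omega> in M. P (\<lambda>j. - S (min j k) \<omega>)) = \<P>(\<omega> in M. P (\<lambda>j. S (min j k) \<omega>))"
  using block_prob[OF _ indep_minus xi_sym, of P id k] by (simp add: sum_negf S_def)

text \<open>Time reversal combined with symmetry: reversing the first \<open>k\<close> steps and
  changing their signs preserves their law, and turns a strict record at \<open>k\<close> into
  staying negative.\<close>

lemma record_prob:
  assumes C[measurable]: "C \<in> sets borel"
  shows "\<P>(\<omega> in M. (\<forall>j<k. S j \<omega> < S k \<omega>) \<and> S k \<omega> \<in> C) = \<P>(\<omega> in M. (\<forall>j\<in>{1..k}. S j \<omega> < 0) \<and> - S k \<omega> \<in> C)"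
proof -
  let ?P = "\<lambda>s :: nat \<Rightarrow> real. (\<forall>j\<in>{1..k}. s j < 0) \<and> - s k \<in> C"
  have m: "Measurable.pred seqs ?P" by measurable
  have inj: "inj_on (\<lambda>p. k - 1 - p) {..<k}" by (auto simp: inj_on_def)
  have s: "(\<Sum>p<i. - \<xi> (k - 1 - p) \<omega>) = S (k - i) \<omega> - S k \<omega>" if "i \<le> k" for i \<omega>
    using that
  proof (induction i)
    case (Suc i)
    then have "k - i = Suc (k - Suc i)" by simp
    then have "S (k - i) \<omega> = S (k - Suc i) \<omega> + \<xi> (k - Suc i) \<omega>" unfolding S_def by simp
    then show ?case using Suc by simp
  qed (simp add: S_def)
  have "\<P>(\<omega> in M. ?P (\<lambda>j. S (min j k) \<omega>)) = \<P>(\<omega> in M. ?P (\<lambda>j. S (k - min j k) \<omega> - S k \<omega>))"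
    using block_prob[OF m indep_minus xi_sym inj] by (simp only: s min.cobounded2)
  also have "\<dots> = \<P>(\<omega> in M. (\<forall>j<k. S j \<omega> < S k \<omega>) \<and> S k \<omega> \<in> C)"
  proof -
    have "(\<forall>j\<in>{1..k}. S (k - min j k) \<omega> - S k \<omega> < 0) \<longleftrightarrow> (\<forall>j<k. S j \<omega> < S k \<omega>)" for \<omega>
    proof (intro iffI allI ballI impI)
      fix j assume "\<forall>j\<in>{1..k}. S (k - min j k) \<omega> - S k \<omega> < 0" "j < k"
      from bspec[OF this(1), of "k - j"] this(2) show "S j \<omega> < S k \<omega>" by simp
    next
      fix j assume "\<forall>j<k. S j \<omega> < S k \<omega>" "j \<in> {1..k}"
      then show "S (k - min j k) \<omega> - S k \<omega> < 0" by auto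
    qed
    moreover have "S 0 \<omega> = 0" for \<omega> by (simp add: S_def)
    ultimately show ?thesis by simp
  qed
  also have "(\<lambda>\<omega>. ?P (\<lambda>j. S (min j k) \<omega>)) = (\<lambda>\<omega>. (\<forall>j\<in>{1..k}. S j \<omega> < 0) \<and> - S k \<omega> \<in> C)"
    by (auto simp: fun_eq_iff)
  finally show ?thesis by simp
qed

lemma record_u: "\<P>(\<omega> in M. \<forall>j<k. S j \<omega> < S k \<omega>) = u k"
  using record_prob[of UNIV k] by (simp add: u_def)

text \<open>The walk up to \<open>k\<close> has a record there; the walk restarted at
  \<open>k\<close> then stays negative for \<open>N - k\<close> steps, independently.\<close>

lemma argmax_prob:
  assumes "k \<le> N" and C[measurable]: "C \<in> sets borel"
  shows "\<P>(\<omega> in M. (\<forall>j<k. S j \<omega> < S k \<omega>) \<and> S k \<omega> \<in> C \<and> (\<forall>j\<in>{k<..N}. S j \<omega> < S k \<omega>)) = r k C * u (N - k)"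
proof -
  let ?P = "\<lambda>s :: nat \<Rightarrow> real. (\<forall>j<k. s j < s k) \<and> s k \<in> C"
  let ?Q = "\<lambda>s :: nat \<Rightarrow> real. \<forall>j\<in>{1..N-k}. s j < 0"
  have "Measurable.pred seqs ?P" "Measurable.pred seqs ?Q" by measurable
  from block_indep[OF this, of k "N - k"]
  have "\<P>(\<omega> in M. ?P (\<lambda>j. S (min j k) \<omega>) \<and> ?Q (\<lambda>j. S (k + min j (N - k)) \<omega> - S k \<omega>)) =
     \<P>(\<omega> in M. ?P (\<lambda>j. S (min j k) \<omega>)) * \<P>(\<omega> in M. ?Q (\<lambda>j. S (min j (N - k)) \<omega>))" .
  moreover have "?Q (\<lambda>j. S (k + min j (N - k)) \<omega> - S k \<omega>) \<longleftrightarrow> (\<forall>j\<in>{k<..N}. S j \<omega> < S k \<omega>)" for \<omega>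
  proof (intro iffI ballI)
    fix j assume "?Q (\<lambda>j. S (k + min j (N - k)) \<omega> - S k \<omega>)" "j \<in> {k<..N}"
    moreover from this(2) have "j - k \<in> {1..N - k}" by auto
    ultimately show "S j \<omega> < S k \<omega>" by (force dest: bspec[of _ _ "j - k"])
  next
    fix j assume "\<forall>j\<in>{k<..N}. S j \<omega> < S k \<omega>" "j \<in> {1..N - k}"
    then show "S (k + min j (N - k)) \<omega> - S k \<omega> < 0" by auto
  qed
  moreover have "?P (\<lambda>j. S (min j k) \<omega>) \<longleftrightarrow> (\<forall>j<k. S j \<omega> < S k \<omega>) \<and> S k \<omega> \<in> C" for \<omega> by simp
  moreover have "?Q (\<lambda>j. S (min j (N - k)) \<omega>) \<longleftrightarrow> (\<forall>j\<in>{1..N-k}. S j \<omega> < 0)" for \<omega> by simp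
  ultimately show ?thesis by (simp only: r_def u_def conj_assoc)
qed

lemma S_distinct: "i \<noteq> j \<Longrightarrow> AE \<omega> in M. S i \<omega> \<noteq> S j \<omega>"
proof (induction i j rule: linorder_wlog)
  case (le i j)
  let ?Q = "\<lambda>s :: nat \<Rightarrow> real. s (j - i) = 0"
  have Q: "Measurable.pred seqs ?Q" by measurable
  have inj: "inj_on (\<lambda>p. i + p) {..<j - i}" by (auto simp: inj_on_def)
  have sk: "(\<Sum>p<m. \<xi> (i + p) \<omega>) = S (i + m) \<omega> - S i \<omega>" for m \<omega>
    unfolding S_def by (induction m) auto
  have "\<P>(\<omega> in M. S j \<omega> - S i \<omega> = 0) = \<P>(\<omega> in M. S (j - i) \<omega> = 0)"
    using block_prob[OF Q indep law inj] le unfolding sk by simp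
  also have "\<dots> = 0"
    using no_tie[of "j - i"] le by (subst prob_Collect_eq_0) auto
  finally have "AE \<omega> in M. \<not> (S j \<omega> - S i \<omega> = 0)" by (subst (asm) prob_Collect_eq_0) auto
  then show ?case by eventually_elim auto
next
  case (sym i j)
  then show ?case by (auto simp: eq_commute)
qed

text \<open>Partition by the place of the maximum, which is unique off a null set because distinct
  partial sums almost surely differ.\<close>

lemma max_decomp:
  assumes C[measurable]: "C \<in> sets borel"
  shows "\<P>(\<omega> in M. \<exists>k\<le>N. (\<forall>j\<le>N. S j \<omega> \<le> S k \<omega>) \<and> S k \<omega> \<in> C) = (\<Sum>k\<le>N. r k C * u (N - k))"
proof -
  define D where "D = (\<lambda>k. {\<omega>\<in>space M. (\<forall>j<k. S j \<omega> < S k \<omega>) \<and> S k \<omega> \<in> C \<and> (\<forall>j\<in>{k<..N}. S j \<omega> < S k \<omega>)})"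
  have D: "D k \<in> events" for k unfolding D_def by measurable
  have Dlt: "S j \<omega> < S k \<omega>" if "\<omega> \<in> D k" "j \<le> N" "j \<noteq> k" for j k \<omega>
  proof (cases "j < k")
    case False
    then have "j \<in> {k<..N}" using that by auto
    then show ?thesis using that(1) unfolding D_def by blast
  qed (use that in \<open>auto simp: D_def\<close>)
  have disj: "disjoint_family_on D {..N}"
    unfolding disjoint_family_on_def
  proof (intro ballI impI)
    fix i j assume ij: "i \<in> {..N}" "j \<in> {..N}" "i \<noteq> j"
    show "D i \<inter> D j = {}"
    proof (rule ccontr)
      assume "D i \<inter> D j \<noteq> {}"
      then obtain \<omega> where "\<omega> \<in> D i" "\<omega> \<in> D j" by auto
      then have "S j \<omega> < S i \<omega>" "S i \<omega> < S j \<omega>" using ij Dlt by auto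
      then show False by simp
    qed
  qed
  have "AE \<omega> in M. \<forall>i\<in>{..N}. \<forall>j\<in>{..N}. i \<noteq> j \<longrightarrow> S i \<omega> \<noteq> S j \<omega>"
    using S_distinct by (intro AE_finite_allI) auto
  then have "AE \<omega> in M. \<omega> \<in> {\<omega>\<in>space M. \<exists>k\<le>N. (\<forall>j\<le>N. S j \<omega> \<le> S k \<omega>) \<and> S k \<omega> \<in> C} \<longleftrightarrow> \<omega> \<in> (\<Union>k\<in>{..N}. D k)"
  proof (eventually_elim, intro iffI)
    fix \<omega> assume dist: "\<forall>i\<in>{..N}. \<forall>j\<in>{..N}. i \<noteq> j \<longrightarrow> S i \<omega> \<noteq> S j \<omega>"
    {
      assume *: "\<omega> \<in> {\<omega>\<in>space M. \<exists>k\<le>N. (\<forall>j\<le>N. S j \<omega> \<le> S k \<omega>) \<and> S k \<omega> \<in> C}"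
      then obtain k where k: "k \<le> N" "\<And>j. j \<le> N \<Longrightarrow> S j \<omega> \<le> S k \<omega>" "S k \<omega> \<in> C" using * by auto
      then have "S j \<omega> < S k \<omega>" if "j \<le> N" "j \<noteq> k" for j using that dist k by (force simp: less_le)
      then have "\<omega> \<in> D k" using * k unfolding D_def by auto
      then show "\<omega> \<in> (\<Union>k\<in>{..N}. D k)" using k by auto
    }
    assume "\<omega> \<in> (\<Union>k\<in>{..N}. D k)"
    then obtain k where k: "k \<le> N" "\<omega> \<in> D k" by auto
    have "S j \<omega> \<le> S k \<omega>" if "j \<le> N" for j
      using Dlt[OF k(2) that] by (cases "j = k") auto
    then show "\<omega> \<in> {\<omega>\<in>space M. \<exists>k\<le>N. (\<forall>j\<le>N. S j \<omega> \<le> S k \<omega>) \<and> S k \<omega> \<in> C}" using k unfolding D_def by auto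
  qed
  then have "\<P>(\<omega> in M. \<exists>k\<le>N. (\<forall>j\<le>N. S j \<omega> \<le> S k \<omega>) \<and> S k \<omega> \<in> C) = prob (\<Union>k\<in>{..N}. D k)"
    using D by (intro measure_eq_AE) auto
  also have "\<dots> = (\<Sum>k\<le>N. prob (D k))"
    using D disj by (intro finite_measure_finite_Union) auto
  also have "\<dots> = (\<Sum>k\<le>N. r k C * u (N - k))"
    unfolding D_def using argmax_prob assms by (intro sum.cong) auto
  finally show ?thesis .
qed

lemma max_exists: "\<exists>k\<le>N. \<forall>j\<le>N. S j \<omega> \<le> S k \<omega>"
proof -
  define mx where "mx = Max ((\<lambda>j. S j \<omega>) ` {..N})"
  have "mx \<in> (\<lambda>j. S j \<omega>) ` {..N}" unfolding mx_def by (rule Max_in) auto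
  then obtain k where k: "k \<le> N" "S k \<omega> = mx" by auto
  have "S j \<omega> \<le> S k \<omega>" if "j \<le> N" for j
    unfolding k(2) mx_def using that by (intro Max_ge) auto
  then show ?thesis using k by blast
qed

lemma G_decomp: "G N x = (\<Sum>k\<le>N. r k {..x} * u (N - k))"
proof -
  have "(\<exists>k\<le>N. (\<forall>j\<le>N. S j \<omega> \<le> S k \<omega>) \<and> S k \<omega> \<in> {..x}) \<longleftrightarrow> (\<forall>j\<le>N. S j \<omega> \<le> x)" for \<omega>
    using max_exists[of N \<omega>] by (auto intro: order_trans)
  then show ?thesis using max_decomp[of "{..x}" N] by (simp add: G_def)
qed

lemma G_compl: "1 - G N x = (\<Sum>k\<le>N. r k {x<..} * u (N - k))"
proof -
  have "(\<exists>k\<le>N. (\<forall>j\<le>N. S j \<omega> \<le> S k \<omega>) \<and> S k \<omega> \<in> {x<..}) \<longleftrightarrow> \<not> (\<forall>j\<le>N. S j \<omega> \<le> x)" for \<omega>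
    using max_exists[of N \<omega>] by (auto simp: not_le) (meson less_le_trans)
  moreover have "\<P>(\<omega> in M. \<not> (\<forall>j\<le>N. S j \<omega> \<le> x)) = 1 - G N x"
    unfolding G_def by (subst prob_neg) auto
  ultimately show ?thesis using max_decomp[of "{x<..}" N] by simp
qed

lemma r_UNIV: "r k UNIV = u k"
  unfolding r_def using record_u by simp

text \<open>Without a restriction on the height of the maximum the decomposition exhausts the space.
  This is Sparre Andersen's identity; the bounds below use only it and monotonicity of
  \<open>u\<close>.\<close>

lemma u_convolution: "(\<Sum>k\<le>N. u k * u (N - k)) = 1"
  using max_decomp[of UNIV N] max_exists[of N] prob_space by (simp add: r_UNIV)

lemma u_nonneg: "0 \<le> u k" and r_nonneg: "0 \<le> r k C"
  unfolding u_def r_def by auto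

lemma u_antimono: "i \<le> j \<Longrightarrow> u j \<le> u i"
  unfolding u_def by (intro finite_measure_mono) auto

lemma r_split: "r k {..x} + r k {x<..} = u k"
proof -
  have "u k = prob ({\<omega>\<in>space M. (\<forall>j<k. S j \<omega> < S k \<omega>) \<and> S k \<omega> \<in> {..x}} \<union> {\<omega>\<in>space M. (\<forall>j<k. S j \<omega> < S k \<omega>) \<and> S k \<omega> \<in> {x<..}})"
    unfolding record_u[symmetric] by (intro arg_cong[where f = prob]) auto
  also have "\<dots> = r k {..x} + r k {x<..}"
    unfolding r_def by (intro finite_measure_Union) auto
  finally show ?thesis by simp
qed

text \<open>By monotonicity each of the \<open>N + 1\<close> terms of the convolution is at least
  \<open>u N\<close> squared.\<close>

lemma u_upper: "u N \<le> 1 / sqrt (real N + 1)"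
proof -
  have "(\<Sum>k\<le>N. u N * u N) \<le> (\<Sum>k\<le>N. u k * u (N - k))"
    by (intro sum_mono mult_mono u_antimono u_nonneg) auto
  then have "(u N)\<^sup>2 \<le> 1 / (real N + 1)"
    unfolding u_convolution by (simp add: power2_eq_square field_simps)
  then have "u N \<le> sqrt (1 / (real N + 1))" by (rule real_le_rsqrt)
  then show ?thesis by (simp add: real_sqrt_divide)
qed

lemma sum_u: "(\<Sum>k\<le>N. u k) \<le> 2 * sqrt (real N + 1)"
proof -
  have "(\<Sum>k\<le>N. 1 / sqrt (real k + 1)) \<le> 2 * sqrt (real N + 1)"
  proof (induction N)
    case (Suc N)
    define a where "a = sqrt (real N + 1)"
    define b where "b = sqrt (real N + 2)"
    have ab: "0 < a" "a \<le> b" "b\<^sup>2 = a\<^sup>2 + 1" unfolding a_def b_def by auto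
    then have "(b - a) * (b + a) = 1" by (simp add: algebra_simps power2_eq_square)
    moreover have "(b - a) * (b + a) \<le> (b - a) * (2 * b)" using ab by (intro mult_left_mono) auto
    ultimately have "1 / b \<le> 2 * (b - a)" using ab by (simp add: field_simps)
    then have "2 * a + 1 / b \<le> 2 * b" by simp
    then show ?case using Suc by (simp add: a_def b_def add_ac)
  qed simp
  moreover have "(\<Sum>k\<le>N. u k) \<le> (\<Sum>k\<le>N. 1 / sqrt (real k + 1))"
    by (intro sum_mono u_upper)
  ultimately show ?thesis by linarith
qed

text \<open>The convolution of length \<open>2 * N\<close> is symmetric about \<open>N\<close>, so
  its first half carries at least half of the total 1.\<close>

lemma half_convolution: "1 / 2 \<le> (\<Sum>k\<le>N. u k * u (2 * N - k))"
proof -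
  have "1 = (\<Sum>k\<le>2 * N. u k * u (2 * N - k))" by (rule u_convolution[symmetric])
  also have "\<dots> \<le> (\<Sum>k\<in>{..N} \<union> {N..2*N}. u k * u (2 * N - k))"
    by (intro sum_mono2) (auto intro: mult_nonneg_nonneg u_nonneg)
  also have "\<dots> \<le> (\<Sum>k\<le>N. u k * u (2 * N - k)) + (\<Sum>k\<in>{N..2*N}. u k * u (2 * N - k))"
    by (subst sum_Un) (auto intro!: sum_nonneg mult_nonneg_nonneg u_nonneg)
  also have "(\<Sum>k\<in>{N..2*N}. u k * u (2 * N - k)) = (\<Sum>k\<le>N. u k * u (2 * N - k))"
    by (rule sum.reindex_bij_witness[of _ "\<lambda>k. 2 * N - k" "\<lambda>k. 2 * N - k"]) (auto simp: mult.commute)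
  finally show ?thesis by simp
qed

text \<open>In the first half of the convolution the second factor is at most \<open>u N\<close>,
  while the first factors sum to at most \<open>2 * sqrt (N + 1)\<close>.\<close>

lemma u_lower: "1 / (4 * sqrt (real N + 1)) \<le> u N"
proof -
  have "(\<Sum>k\<le>N. u k * u (2 * N - k)) \<le> (\<Sum>k\<le>N. u k * u N)"
    by (intro sum_mono mult_left_mono u_antimono u_nonneg) auto
  also have "\<dots> = u N * (\<Sum>k\<le>N. u k)" by (simp add: sum_distrib_left mult.commute)
  also have "\<dots> \<le> u N * (2 * sqrt (real N + 1))" by (intro mult_left_mono sum_u u_nonneg)
  finally have "1 / 2 \<le> u N * (2 * sqrt (real N + 1))" using half_convolution[of N] by linarith
  then show ?thesis by (simp add: field_simps)
qed

text \<open>Records above \<open>x\<close> contribute at most 1/4 to the half convolution, because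
  the maximum rarely exceeds \<open>x\<close> up to \<open>2 * N'\<close>. Records below
  \<open>x\<close> before \<open>N'\<close> therefore have renewal mass of order
  \<open>sqrt (N' + 1)\<close>. Each can be followed by staying below the record until
  \<open>N\<close>, at a cost of order \<open>1 / sqrt (N + 1)\<close>.\<close>

lemma G_lower:
  assumes N: "N' \<le> N" and G: "3 / 4 \<le> G (2 * N') x"
  shows "sqrt ((real N' + 1) / (real N + 1)) / 16 \<le> G N x"
proof -
  define R where "R = (\<Sum>k\<le>N'. r k {..x})"
  have R: "0 \<le> R" unfolding R_def by (intro sum_nonneg r_nonneg)
  have "(\<Sum>k\<le>N'. r k {x<..} * u (2 * N' - k)) \<le> (\<Sum>k\<le>2 * N'. r k {x<..} * u (2 * N' - k))"
    by (intro sum_mono2) (auto intro!: mult_nonneg_nonneg r_nonneg u_nonneg)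
  also have "\<dots> \<le> 1 / 4" using G_compl[of "2 * N'" x] G by simp
  finally have 1: "(\<Sum>k\<le>N'. r k {x<..} * u (2 * N' - k)) \<le> 1 / 4" .
  have "(\<Sum>k\<le>N'. u k * u (2 * N' - k)) =
      (\<Sum>k\<le>N'. r k {..x} * u (2 * N' - k)) + (\<Sum>k\<le>N'. r k {x<..} * u (2 * N' - k))"
    unfolding sum.distrib[symmetric] by (simp add: r_split[symmetric, of _ x] algebra_simps)
  then have "1 / 4 \<le> (\<Sum>k\<le>N'. r k {..x} * u (2 * N' - k))"
    using 1 half_convolution[of N'] by linarith
  also have "\<dots> \<le> (\<Sum>k\<le>N'. r k {..x} * u N')"
    by (intro sum_mono mult_left_mono u_antimono r_nonneg) auto
  also have "\<dots> = u N' * R" unfolding R_def by (simp add: sum_distrib_left mult.commute)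
  also have "\<dots> \<le> 1 / sqrt (real N' + 1) * R" by (intro mult_right_mono u_upper R)
  finally have "sqrt (real N' + 1) / 4 \<le> R" by (simp add: field_simps)
  then have "1 / (4 * sqrt (real N + 1)) * (sqrt (real N' + 1) / 4) \<le> u N * R"
    by (intro mult_mono u_lower) (auto intro: u_nonneg)
  also have "u N * R = (\<Sum>k\<le>N'. r k {..x} * u N)" unfolding R_def by (simp add: sum_distrib_left mult.commute)
  also have "\<dots> \<le> (\<Sum>k\<le>N'. r k {..x} * u (N - k))"
    by (intro sum_mono mult_left_mono u_antimono r_nonneg) auto
  also have "\<dots> \<le> (\<Sum>k\<le>N. r k {..x} * u (N - k))"
    using N by (intro sum_mono2) (auto intro!: mult_nonneg_nonneg r_nonneg u_nonneg)
  also have "\<dots> = G N x" by (rule G_decomp[symmetric])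
  finally show ?thesis by (simp add: real_sqrt_divide)
qed

text \<open>By reversal, \<open>r k {x<..}\<close> is the probability of staying negative for
  \<open>k\<close> steps and ending below \<open>- x\<close>; a further \<open>N\<close> steps that
  never climb more than \<open>x\<close> leave the walk negative.\<close>

lemma u_block_lower: "r k {x<..} * G N x \<le> u (N + k)"
proof -
  let ?P = "\<lambda>s :: nat \<Rightarrow> real. (\<forall>j\<in>{1..k}. s j < 0) \<and> - s k \<in> {x<..}"
  let ?Q = "\<lambda>s :: nat \<Rightarrow> real. \<forall>j\<le>N. s j \<le> x"
  have m: "Measurable.pred seqs ?P" "Measurable.pred seqs ?Q" by measurable
  have "r k {x<..} * G N x = \<P>(\<omega> in M. ?P (\<lambda>j. S (min j k) \<omega>)) * \<P>(\<omega> in M. ?Q (\<lambda>j. S (min j N) \<omega>))"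
  proof -
    have "?P (\<lambda>j. S (min j k) \<omega>) \<longleftrightarrow> (\<forall>j\<in>{1..k}. S j \<omega> < 0) \<and> - S k \<omega> \<in> {x<..}" for \<omega> by auto
    moreover have "?Q (\<lambda>j. S (min j N) \<omega>) \<longleftrightarrow> (\<forall>j\<le>N. S j \<omega> \<le> x)" for \<omega> by auto
    moreover have "r k {x<..} = \<P>(\<omega> in M. (\<forall>j\<in>{1..k}. S j \<omega> < 0) \<and> - S k \<omega> \<in> {x<..})"
      unfolding r_def by (rule record_prob) simp
    ultimately show ?thesis unfolding G_def by (simp only:)
  qed
  also have "\<dots> = \<P>(\<omega> in M. ?P (\<lambda>j. S (min j k) \<omega>) \<and> ?Q (\<lambda>j. S (k + min j N) \<omega> - S k \<omega>))"
    by (rule block_indep[OF m, symmetric])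
  also have "\<dots> \<le> u (N + k)"
    unfolding u_def
  proof (intro finite_measure_mono subsetI CollectI conjI ballI)
    fix \<omega> j assume \<omega>: "\<omega> \<in> {\<omega>\<in>space M. ?P (\<lambda>j. S (min j k) \<omega>) \<and> ?Q (\<lambda>j. S (k + min j N) \<omega> - S k \<omega>)}"
      and j: "j \<in> {1..N + k}"
    show "S j \<omega> < 0"
    proof (cases "j \<le> k")
      case True
      then show ?thesis using \<omega> j by auto
    next
      case False
      then have "j - k \<le> N" "k + (j - k) = j" using j by auto
      moreover have "S (k + min (j - k) N) \<omega> - S k \<omega> \<le> x" using \<omega> \<open>j - k \<le> N\<close> by blast
      ultimately have "S j \<omega> \<le> S k \<omega> + x" by simp
      moreover have "S k \<omega> < - x" using \<omega> by simp
      ultimately show ?thesis by simp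
    qed
  qed auto
  finally show ?thesis .
qed

text \<open>Expand the complementary probability by the place of the maximum and bound each product
  of a record term with \<open>G N x\<close> by \<open>u N\<close>; what remains is a sum of
  \<open>u\<close>.\<close>

lemma G_upper: "G N x * (1 - G N' x) \<le> 2 * sqrt (real N' + 1) / sqrt (real N + 1)"
proof -
  have "G N x * (1 - G N' x) = (\<Sum>k\<le>N'. (r k {x<..} * G N x) * u (N' - k))"
    unfolding G_compl by (simp add: sum_distrib_left mult_ac)
  also have "\<dots> \<le> (\<Sum>k\<le>N'. u N * u (N' - k))"
    by (intro sum_mono mult_right_mono u_nonneg order_trans[OF u_block_lower] u_antimono) auto
  also have "\<dots> = u N * (\<Sum>k\<le>N'. u (N' - k))" by (simp add: sum_distrib_left)
  also have "(\<Sum>k\<le>N'. u (N' - k)) = (\<Sum>k\<le>N'. u k)"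
    by (rule sum.reindex_bij_witness[of _ "\<lambda>k. N' - k" "\<lambda>k. N' - k"]) auto
  also have "u N * \<dots> \<le> 1 / sqrt (real N + 1) * (2 * sqrt (real N' + 1))"
    by (intro mult_mono u_upper sum_u sum_nonneg u_nonneg) auto
  finally show ?thesis by simp
qed

lemma half_le_prob_nonneg: "1 / 2 \<le> \<P>(\<omega> in M. 0 \<le> S m \<omega>)"
proof -
  have m: "Measurable.pred seqs (\<lambda>s. 0 \<le> s m)" by measurable
  have "1 = prob ({\<omega>\<in>space M. 0 \<le> S m \<omega>} \<union> {\<omega>\<in>space M. 0 \<le> - S m \<omega>})"
    using prob_space by (subst prob_space[symmetric]) (intro arg_cong[where f = prob], auto)
  also have "\<dots> \<le> \<P>(\<omega> in M. 0 \<le> S m \<omega>) + \<P>(\<omega> in M. 0 \<le> - S m \<omega>)"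
    by (intro measure_Un_le) auto
  also have "\<P>(\<omega> in M. 0 \<le> - S m \<omega>) = \<P>(\<omega> in M. 0 \<le> S m \<omega>)"
    using S_law_sym[OF m, of m] by simp
  finally show ?thesis by simp
qed

text \<open>Levy's inequality: after first exceeding \<open>x\<close>, the symmetric walk ends at
  least as high with probability at least 1/2.\<close>

lemma max_inequality: "1 - G N x \<le> 2 * \<P>(\<omega> in M. x < S N \<omega>)"
proof -
  define D where "D = (\<lambda>k. {\<omega>\<in>space M. (\<forall>j<k. S j \<omega> \<le> x) \<and> x < S k \<omega>})"
  define E where "E = (\<lambda>k. {\<omega>\<in>space M. ((\<forall>j<k. S j \<omega> \<le> x) \<and> x < S k \<omega>) \<and> 0 \<le> S N \<omega> - S k \<omega>})"
  have D: "D k \<in> events" and E: "E k \<in> events" for k unfolding D_def E_def by measurable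
  have "disjoint_family_on D {..N}"
    unfolding disjoint_family_on_def D_def
  proof (intro ballI impI)
    fix i j assume "i \<noteq> (j :: nat)"
    then consider "i < j" | "j < i" by linarith
    then show "{\<omega>\<in>space M. (\<forall>j<i. S j \<omega> \<le> x) \<and> x < S i \<omega>} \<inter> {\<omega>\<in>space M. (\<forall>i<j. S i \<omega> \<le> x) \<and> x < S j \<omega>} = {}"
      by cases (auto simp: not_le[symmetric])
  qed
  moreover have ED: "E k \<subseteq> D k" for k unfolding D_def E_def by auto
  ultimately have disj: "disjoint_family_on E {..N}"
    unfolding disjoint_family_on_def by blast
  have half: "prob (D k) \<le> 2 * prob (E k)" if "k \<le> N" for k
  proof -
    let ?P = "\<lambda>s :: nat \<Rightarrow> real. (\<forall>j<k. s j \<le> x) \<and> x < s k"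
    let ?Q = "\<lambda>s :: nat \<Rightarrow> real. 0 \<le> s (N - k)"
    have m: "Measurable.pred seqs ?P" "Measurable.pred seqs ?Q" by measurable
    have P: "?P (\<lambda>j. S (min j k) \<omega>) \<longleftrightarrow> (\<forall>j<k. S j \<omega> \<le> x) \<and> x < S k \<omega>" for \<omega> by auto
    have "prob (E k) = prob (D k) * \<P>(\<omega> in M. 0 \<le> S (N - k) \<omega>)"
      using block_indep[OF m, of k "N - k"] that unfolding P D_def E_def by simp
    moreover have "prob (D k) * (1 / 2) \<le> prob (D k) * \<P>(\<omega> in M. 0 \<le> S (N - k) \<omega>)"
      by (intro mult_left_mono half_le_prob_nonneg) auto
    ultimately show ?thesis by simp
  qed
  have "1 - G N x = \<P>(\<omega> in M. \<not> (\<forall>j\<le>N. S j \<omega> \<le> x))"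
    unfolding G_def by (subst prob_neg) auto
  also have "\<dots> \<le> prob (\<Union>k\<in>{..N}. D k)"
  proof (intro finite_measure_mono subsetI)
    fix \<omega> assume \<omega>: "\<omega> \<in> {\<omega>\<in>space M. \<not> (\<forall>j\<le>N. S j \<omega> \<le> x)}"
    then obtain j where j: "j \<le> N" "x < S j \<omega>" by (auto simp: not_le)
    define k where "k = (LEAST j. x < S j \<omega>)"
    have "x < S k \<omega>" unfolding k_def using j(2) by (rule LeastI)
    moreover have "k \<le> j" unfolding k_def using j(2) by (rule Least_le)
    moreover have "S i \<omega> \<le> x" if "i < k" for i
      using not_less_Least[of i "\<lambda>j. x < S j \<omega>"] that unfolding k_def by simp
    ultimately have "k \<in> {..N}" "\<omega> \<in> D k" using \<omega> j unfolding D_def by auto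
    then show "\<omega> \<in> (\<Union>k\<in>{..N}. D k)" by (rule UN_I)
  qed (use D in auto)
  also have "\<dots> \<le> (\<Sum>k\<in>{..N}. prob (D k))"
    using D by (intro finite_measure_subadditive_finite) auto
  also have "\<dots> \<le> (\<Sum>k\<in>{..N}. 2 * prob (E k))"
    using half by (intro sum_mono) auto
  also have "\<dots> = 2 * prob (\<Union>k\<in>{..N}. E k)"
    using E disj by (subst finite_measure_finite_Union) (auto simp: sum_distrib_left)
  also have "\<dots> \<le> 2 * \<P>(\<omega> in M. x < S N \<omega>)"
    unfolding E_def by (intro mult_left_mono finite_measure_mono) auto
  finally show ?thesis .
qed

end

section \<open>Stable laws\<close>

text \<open>Parseval's relation with a Gaussian: the Gaussian is, up to scaling, its own
  characteristic function, and Fubini exchanges the two laws.\<close>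

lemma gauss_smoothing:
  assumes "real_distribution \<nu>"
  shows "(CLINT x|\<nu>. complex_of_real (exp (- ((\<sigma> * (x - a))\<^sup>2) / 2))) =
    (CLINT \<theta>|std_normal_distribution. iexp (- (\<sigma> * a * \<theta>)) * char \<nu> (\<sigma> * \<theta>))"
proof -
  interpret \<nu>: real_distribution \<nu> by fact
  interpret N: real_distribution std_normal_distribution by (rule real_dist_normal_dist)
  interpret P: pair_prob_space \<nu> std_normal_distribution ..
  have m: "(\<lambda>(x, \<theta>). iexp (\<sigma> * (x - a) * \<theta>)) \<in> borel_measurable (\<nu> \<Otimes>\<^sub>M std_normal_distribution)"
    by measurable
  have int: "integrable (\<nu> \<Otimes>\<^sub>M std_normal_distribution) (\<lambda>(x, \<theta>). iexp (\<sigma> * (x - a) * \<theta>))"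
    by (rule P.P.integrable_const_bound[where B = 1]) (use m in \<open>auto simp: norm_exp_i_times\<close>)
  have "(CLINT x|\<nu>. complex_of_real (exp (- ((\<sigma> * (x - a))\<^sup>2) / 2))) =
      (CLINT x|\<nu>. CLINT \<theta>|std_normal_distribution. iexp (\<sigma> * (x - a) * \<theta>))"
  proof (rule Bochner_Integration.integral_cong[OF refl])
    fix x
    have "complex_of_real (exp (- ((\<sigma> * (x - a))\<^sup>2) / 2)) = char std_normal_distribution (\<sigma> * (x - a))"
      unfolding char_std_normal_distribution by simp
    then show "complex_of_real (exp (- ((\<sigma> * (x - a))\<^sup>2) / 2)) =
        (CLINT \<theta>|std_normal_distribution. iexp (\<sigma> * (x - a) * \<theta>))"
      by (simp only: char_def)
  qed
  also have "\<dots> = (CLINT \<theta>|std_normal_distribution. CLINT x|\<nu>. iexp (\<sigma> * (x - a) * \<theta>))"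
    by (rule P.Fubini_integral[OF int, symmetric])
  also have "\<dots> = (CLINT \<theta>|std_normal_distribution. CLINT x|\<nu>. iexp (- (\<sigma> * a * \<theta>)) * iexp (\<sigma> * \<theta> * x))"
    by (simp add: exp_add[symmetric] algebra_simps)
  also have "\<dots> = (CLINT \<theta>|std_normal_distribution. iexp (- (\<sigma> * a * \<theta>)) * char \<nu> (\<sigma> * \<theta>))"
    by (simp add: char_def)
  finally show ?thesis .
qed

text \<open>For a process with parameter \<open>b\<close>, the scale parameter \<open>c\<close> at
  time \<open>t\<close> is \<open>b * t\<close>.\<close>

definition stable_law :: "real \<Rightarrow> real \<Rightarrow> real measure \<Rightarrow> bool" where
  "stable_law \<alpha> c \<nu> \<longleftrightarrow> real_distribution \<nu> \<and>
    (\<forall>\<theta>. char \<nu> \<theta> = complex_of_real (exp (- (c * \<bar>\<theta>\<bar> powr \<alpha>))))"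

text \<open>At the centre 0 the relation is an equality of real integrals; any other centre only
  inserts a factor of modulus 1, hence the bound uniform in \<open>a\<close>.\<close>

lemma stable_law_smoothing:
  assumes st: "stable_law \<alpha> c \<nu>" and "0 < \<sigma>" "0 < \<alpha>" "0 \<le> c"
  shows "(LINT x|\<nu>. exp (- ((\<sigma> * x)\<^sup>2) / 2)) =
      (LINT \<theta>|std_normal_distribution. exp (- (c * \<sigma> powr \<alpha> * \<bar>\<theta>\<bar> powr \<alpha>)))" (is ?A)
    and "(LINT x|\<nu>. exp (- ((\<sigma> * (x - a))\<^sup>2) / 2)) \<le>
      (LINT \<theta>|std_normal_distribution. exp (- (c * \<sigma> powr \<alpha> * \<bar>\<theta>\<bar> powr \<alpha>)))" (is ?B)
proof -
  have \<nu>: "real_distribution \<nu>" using st by (simp add: stable_law_def)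
  interpret N: real_distribution std_normal_distribution by (rule real_dist_normal_dist)
  have ch: "char \<nu> (\<sigma> * \<theta>) = complex_of_real (exp (- (c * \<sigma> powr \<alpha> * \<bar>\<theta>\<bar> powr \<alpha>)))" for \<theta>
    using st \<open>0 < \<sigma>\<close> by (simp add: stable_law_def abs_mult powr_mult mult.assoc)
  have "complex_of_real (LINT x|\<nu>. exp (- ((\<sigma> * x)\<^sup>2) / 2)) =
      complex_of_real (LINT \<theta>|std_normal_distribution. exp (- (c * \<sigma> powr \<alpha> * \<bar>\<theta>\<bar> powr \<alpha>)))"
    using gauss_smoothing[OF \<nu>, of \<sigma> 0] unfolding ch integral_complex_of_real[symmetric] by simp
  then show ?A by (simp only: of_real_eq_iff)
  have "complex_of_real (LINT x|\<nu>. exp (- ((\<sigma> * (x - a))\<^sup>2) / 2)) =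
      (CLINT \<theta>|std_normal_distribution. iexp (- (\<sigma> * a * \<theta>)) * complex_of_real (exp (- (c * \<sigma> powr \<alpha> * \<bar>\<theta>\<bar> powr \<alpha>))))"
    using gauss_smoothing[OF \<nu>, of \<sigma> a] unfolding ch integral_complex_of_real[symmetric] by simp
  note eq = this
  have "(LINT x|\<nu>. exp (- ((\<sigma> * (x - a))\<^sup>2) / 2)) \<le> norm (complex_of_real (LINT x|\<nu>. exp (- ((\<sigma> * (x - a))\<^sup>2) / 2)))"
    unfolding norm_of_real by (rule abs_ge_self)
  also have "\<dots> = norm (CLINT \<theta>|std_normal_distribution. iexp (- (\<sigma> * a * \<theta>)) * complex_of_real (exp (- (c * \<sigma> powr \<alpha> * \<bar>\<theta>\<bar> powr \<alpha>))))"
    unfolding eq ..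
  also have "\<dots> \<le> (LINT \<theta>|std_normal_distribution. norm (iexp (- (\<sigma> * a * \<theta>)) * complex_of_real (exp (- (c * \<sigma> powr \<alpha> * \<bar>\<theta>\<bar> powr \<alpha>)))))"
    by (rule integral_norm_bound)
  also have "\<dots> = (LINT \<theta>|std_normal_distribution. exp (- (c * \<sigma> powr \<alpha> * \<bar>\<theta>\<bar> powr \<alpha>)))"
    by (simp add: norm_mult norm_exp_i_times)
  finally show ?B .
qed

lemma abs_powr_le: "0 < \<alpha> \<Longrightarrow> \<alpha> < 2 \<Longrightarrow> \<bar>x::real\<bar> powr \<alpha> \<le> 1 + x\<^sup>2"
proof (cases "\<bar>x\<bar> \<le> 1")
  case True
  assume "0 < \<alpha>"
  then have "\<bar>x\<bar> powr \<alpha> \<le> 1 powr \<alpha>" using True by (intro powr_mono2) auto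
  then show ?thesis by (simp add: add_increasing2)
next
  case False
  assume "\<alpha> < 2"
  then have "\<bar>x\<bar> powr \<alpha> \<le> \<bar>x\<bar> powr 2" using False by (intro powr_mono) auto
  also have "\<dots> = x\<^sup>2" using False by (simp add: powr_numeral)
  finally show ?thesis by simp
qed

text \<open>On the Fourier side use 1 - e^(-u) \<le> u and |\<theta>|^\<alpha> \<le> 1 + \<theta>^2.
  The factor 2 is 1 plus the variance of the standard Gaussian.\<close>

lemma stable_law_gauss_deficit:
  assumes st: "stable_law \<alpha> c \<nu>" and \<sigma>: "0 < \<sigma>" and \<alpha>: "0 < \<alpha>" "\<alpha> < 2" and c: "0 \<le> c"
  shows "(LINT x|\<nu>. 1 - exp (- ((\<sigma> * x)\<^sup>2) / 2)) \<le> 2 * c * \<sigma> powr \<alpha>"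
proof -
  interpret N: real_distribution std_normal_distribution by (rule real_dist_normal_dist)
  interpret \<nu>: real_distribution \<nu> using st by (simp add: stable_law_def)
  have i1: "integrable \<nu> (\<lambda>x. exp (- ((\<sigma> * x)\<^sup>2) / 2))"
    by (rule \<nu>.integrable_const_bound[where B = 1]) auto
  have i2: "integrable std_normal_distribution (\<lambda>\<theta>. exp (- (c * \<sigma> powr \<alpha> * \<bar>\<theta>\<bar> powr \<alpha>)))"
    by (rule N.integrable_const_bound[where B = 1]) (use c in auto)
  have i3: "integrable std_normal_distribution (\<lambda>\<theta>. \<theta>\<^sup>2)"
    by (rule integrable_std_normal_distribution_moment)
  have "(LINT x|\<nu>. 1 - exp (- ((\<sigma> * x)\<^sup>2) / 2)) = 1 - (LINT x|\<nu>. exp (- ((\<sigma> * x)\<^sup>2) / 2))"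
    using i1 \<nu>.prob_space by (subst Bochner_Integration.integral_diff) auto
  also have "\<dots> = (LINT \<theta>|std_normal_distribution. 1 - exp (- (c * \<sigma> powr \<alpha> * \<bar>\<theta>\<bar> powr \<alpha>)))"
    unfolding stable_law_smoothing(1)[OF st \<sigma> \<alpha>(1) c]
    using i2 N.prob_space by (subst Bochner_Integration.integral_diff) auto
  also have "\<dots> \<le> (LINT \<theta>|std_normal_distribution. c * \<sigma> powr \<alpha> * (1 + \<theta>\<^sup>2))"
  proof (rule integral_mono)
    fix \<theta> :: real
    have "1 - exp (- (c * \<sigma> powr \<alpha> * \<bar>\<theta>\<bar> powr \<alpha>)) \<le> c * \<sigma> powr \<alpha> * \<bar>\<theta>\<bar> powr \<alpha>"
      using exp_ge_add_one_self[of "- (c * \<sigma> powr \<alpha> * \<bar>\<theta>\<bar> powr \<alpha>)"] by simp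
    also have "\<dots> \<le> c * \<sigma> powr \<alpha> * (1 + \<theta>\<^sup>2)"
      using abs_powr_le[OF \<alpha>] c by (intro mult_left_mono) auto
    finally show "1 - exp (- (c * \<sigma> powr \<alpha> * \<bar>\<theta>\<bar> powr \<alpha>)) \<le> c * \<sigma> powr \<alpha> * (1 + \<theta>\<^sup>2)" .
  qed (use i2 i3 in auto)
  also have "\<dots> = c * \<sigma> powr \<alpha> * (1 + (LINT \<theta>|std_normal_distribution. \<theta>\<^sup>2))"
    using i3 N.prob_space by simp
  also have "(LINT \<theta>|std_normal_distribution. \<theta>\<^sup>2) = 1"
    using std_normal_distribution_even_moments[of 1] by simp
  finally show ?thesis by (simp add: algebra_simps)
qed

text \<open>At scale 1/x the Gaussian deficit is at least 1/4 wherever |y| exceeds x, which turns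
  the constant 2 of the deficit bound into 8.\<close>

lemma stable_law_tail_upper:
  assumes st: "stable_law \<alpha> c \<nu>" and x: "0 < x" and \<alpha>: "0 < \<alpha>" "\<alpha> < 2" and c: "0 \<le> c"
  shows "measure \<nu> {y. x < \<bar>y\<bar>} \<le> 8 * c * x powr - \<alpha>"
proof -
  interpret \<nu>: real_distribution \<nu> using st by (simp add: stable_law_def)
  let ?f = "\<lambda>y. 1 - exp (- ((1 / x * y)\<^sup>2) / 2)"
  have i1: "integrable \<nu> ?f"
    by (rule \<nu>.integrable_const_bound[where B = 1]) auto
  have e: "exp (- 1 / 2 :: real) \<le> 3 / 4"
  proof -
    have "(4 / 3 :: real) \<le> exp (1 / 2)" using exp_ge_add_one_self[of "1 / 2 :: real"] by simp
    then show ?thesis by (simp add: exp_minus field_simps)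
  qed
  have "measure \<nu> {y. x < \<bar>y\<bar>} / 4 = (LINT y|\<nu>. indicator {y. x < \<bar>y\<bar>} y / 4)"
    by simp
  also have "\<dots> \<le> (LINT y|\<nu>. ?f y)"
  proof (rule integral_mono)
    fix y :: real
    show "indicator {y. x < \<bar>y\<bar>} y / 4 \<le> ?f y"
    proof (cases "x < \<bar>y\<bar>")
      case True
      then have "1 \<le> \<bar>1 / x * y\<bar>" using x by (simp add: abs_mult field_simps)
      from one_le_power[OF this, of 2] have "1 \<le> (1 / x * y)\<^sup>2" by (simp only: power2_abs)
      then have "exp (- ((1 / x * y)\<^sup>2) / 2) \<le> exp (- 1 / 2)" by simp
      then have "1 / 4 \<le> ?f y" using e by linarith
      then show ?thesis using True by simp
    qed simp
  qed (use i1 in \<open>auto intro!: integrable_real_indicator simp: \<nu>.emeasure_eq_measure\<close>)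
  also have "\<dots> \<le> 2 * c * (1 / x) powr \<alpha>"
    using x by (intro stable_law_gauss_deficit[OF st _ \<alpha> c]) auto
  also have "(1 / x) powr \<alpha> = x powr - \<alpha>" using x by (simp add: powr_minus powr_divide inverse_eq_divide)
  finally show ?thesis by simp
qed

text \<open>Otherwise 1 - x^2 would be almost surely positive, yet its mean is 0 because the
  variance is 1.\<close>

lemma std_normal_outside_pos: "0 < measure std_normal_distribution {x. 1 \<le> \<bar>x\<bar>}"
proof (rule ccontr)
  interpret N: real_distribution std_normal_distribution by (rule real_dist_normal_dist)
  assume "\<not> ?thesis"
  then have "measure std_normal_distribution {x. 1 \<le> \<bar>x\<bar>} = 0" by (simp add: less_le)
  then have "AE x in std_normal_distribution. x \<notin> {x. 1 \<le> \<bar>x\<bar>}"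
    by (intro AE_not_in) (auto simp: null_sets_def N.emeasure_eq_measure)
  then have ae: "AE x in std_normal_distribution. \<bar>x\<bar> < 1" by (simp add: not_le)
  have i3: "integrable std_normal_distribution (\<lambda>\<theta>. \<theta>\<^sup>2)"
    by (rule integrable_std_normal_distribution_moment)
  have "(LINT x|std_normal_distribution. 1 - x\<^sup>2) = 0"
    using std_normal_distribution_even_moments[of 1] i3 N.prob_space by simp
  moreover have "AE x in std_normal_distribution. 0 \<le> 1 - x\<^sup>2"
    using ae by eventually_elim (simp add: abs_square_le_1)
  ultimately have "AE x in std_normal_distribution. 1 - x\<^sup>2 = 0"
    using i3 by (subst (asm) integral_nonneg_eq_0_iff_AE) auto
  then have "AE x in std_normal_distribution. False"
    using ae
  proof eventually_elim
    fix x :: real assume "1 - x\<^sup>2 = 0" "\<bar>x\<bar> < 1"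
    then show False using abs_square_less_1[of x] by linarith
  qed
  then show False using N.AE_False by simp
qed

text \<open>Compare the deficits at scales \<eta>/x and 1/x. Where |y| \<le> x both behave
  quadratically, so the first is at most 2 \<eta>^2 times the second. The first has total size of
  order (\<eta>/x)^\<alpha>, the second at most of order x^(-\<alpha>). Since \<alpha> < 2, a small
  \<eta> leaves a surplus that only the tail can supply.\<close>

lemma stable_law_tail_lower:
  assumes \<alpha>: "0 < \<alpha>" "\<alpha> < 2" and c: "0 < c"
  obtains k x1 where "0 < k" "0 < x1"
    "\<And>\<nu> x. stable_law \<alpha> c \<nu> \<Longrightarrow> x1 \<le> x \<Longrightarrow> k * x powr - \<alpha> \<le> measure \<nu> {y. x < \<bar>y\<bar>}"
proof -
  interpret N: real_distribution std_normal_distribution by (rule real_dist_normal_dist)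
  define p where "p = measure std_normal_distribution {x. 1 \<le> \<bar>x\<bar>}"
  have p: "0 < p" unfolding p_def by (rule std_normal_outside_pos)
  \<comment> \<open>Makes the quadratic part at most \<open>z * p / 8\<close>, against a total
    deficit of at least \<open>z * p / 2\<close>.\<close>
  define \<eta> where "\<eta> = min 1 ((p / 32) powr (1 / (2 - \<alpha>)))"
  have \<eta>: "0 < \<eta>" "\<eta> \<le> 1" unfolding \<eta>_def using p by auto
  have "\<eta> powr (2 - \<alpha>) \<le> ((p / 32) powr (1 / (2 - \<alpha>))) powr (2 - \<alpha>)"
    unfolding \<eta>_def using \<alpha> p by (intro powr_mono2) auto
  also have "\<dots> = p / 32" using \<alpha> p by (simp add: powr_powr)
  finally have \<eta>p: "\<eta> powr (2 - \<alpha>) \<le> p / 32" .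
  \<comment> \<open>From this level on, c \<sigma>^\<alpha> \<le> 1, the range in which 1 - e^(-z)
    \<ge> z/2 is applied.\<close>
  define x1 where "x1 = \<eta> * c powr (1 / \<alpha>)"
  define k where "k = c * \<eta> powr \<alpha> * p / 4"
  have x1: "0 < x1" and k: "0 < k" unfolding x1_def k_def using \<eta> c p by auto
  show thesis
  proof (rule that[OF k x1])
    fix \<nu> x assume st: "stable_law \<alpha> c \<nu>" and x: "x1 \<le> x"
    interpret \<nu>: real_distribution \<nu> using st by (simp add: stable_law_def)
    have x0: "0 < x" using x x1 by simp
    define \<sigma> where "\<sigma> = \<eta> / x"
    have \<sigma>: "0 < \<sigma>" unfolding \<sigma>_def using \<eta> x0 by simp
    have "\<sigma> \<le> 1 / c powr (1 / \<alpha>)"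
      unfolding \<sigma>_def using x x0 c \<eta> by (simp add: x1_def field_simps)
    then have "\<sigma> powr \<alpha> \<le> (1 / c powr (1 / \<alpha>)) powr \<alpha>" using \<sigma> \<alpha> by (intro powr_mono2) auto
    also have "\<dots> = 1 / c" using \<alpha> c by (simp add: powr_divide powr_powr)
    finally have cs: "c * \<sigma> powr \<alpha> \<le> 1" using c by (simp add: field_simps)
    define z where "z = c * \<sigma> powr \<alpha>"
    have z: "0 < z" "z \<le> 1" unfolding z_def using cs c \<sigma> by auto
    have half: "y / 2 \<le> 1 - exp (- y)" if "0 \<le> y" "y \<le> 1" for y :: real
    proof -
      have "1 + y \<le> exp y" by simp
      then have "exp (- y) \<le> 1 / (1 + y)" using that by (simp add: exp_minus field_simps)
      also have "\<dots> \<le> 1 - y / 2"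
      proof -
        have "y * y \<le> y" using that by (simp add: mult_left_le)
        then have "1 \<le> (1 - y / 2) * (1 + y)" by (simp add: algebra_simps)
        then show ?thesis using that by (simp add: divide_le_eq)
      qed
      finally show ?thesis by simp
    qed
    let ?f = "\<lambda>\<sigma> y :: real. 1 - exp (- ((\<sigma> * y)\<^sup>2) / 2)"
    have if': "integrable \<nu> (?f \<tau>)" for \<tau>
      by (rule \<nu>.integrable_const_bound[where B = 1]) auto
    have i1: "integrable \<nu> (\<lambda>x. exp (- ((\<sigma> * x)\<^sup>2) / 2))"
      by (rule \<nu>.integrable_const_bound[where B = 1]) auto
    have i2: "integrable std_normal_distribution (\<lambda>\<theta>. exp (- (c * \<sigma> powr \<alpha> * \<bar>\<theta>\<bar> powr \<alpha>)))"
      by (rule N.integrable_const_bound[where B = 1]) (use c in auto)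
    have "z / 2 * p = (LINT \<theta>|std_normal_distribution. z / 2 * indicator {x. 1 \<le> \<bar>x\<bar>} \<theta>)"
      unfolding p_def by simp
    also have "\<dots> \<le> (LINT \<theta>|std_normal_distribution. 1 - exp (- (c * \<sigma> powr \<alpha> * \<bar>\<theta>\<bar> powr \<alpha>)))"
    proof (rule integral_mono)
      fix \<theta> :: real
      show "z / 2 * indicator {x. 1 \<le> \<bar>x\<bar>} \<theta> \<le> 1 - exp (- (c * \<sigma> powr \<alpha> * \<bar>\<theta>\<bar> powr \<alpha>))"
      proof (cases "1 \<le> \<bar>\<theta>\<bar>")
        case True
        then have "1 \<le> \<bar>\<theta>\<bar> powr \<alpha>" using \<alpha> by (intro ge_one_powr_ge_zero) auto
        then have "z * 1 \<le> z * \<bar>\<theta>\<bar> powr \<alpha>" using z by (intro mult_left_mono) auto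
        then have "exp (- (z * \<bar>\<theta>\<bar> powr \<alpha>)) \<le> exp (- z)" by simp
        moreover have "z / 2 \<le> 1 - exp (- z)" using half[of z] z by simp
        ultimately have "z / 2 \<le> 1 - exp (- (z * \<bar>\<theta>\<bar> powr \<alpha>))" by linarith
        then show ?thesis using True by (simp only: z_def[symmetric] indicator_simps mem_Collect_eq mult_1_right)
      qed (use c in auto)
    qed (use i2 in \<open>auto intro!: integrable_mult_right integrable_real_indicator simp: N.emeasure_eq_measure\<close>)
    also have "\<dots> = (LINT y|\<nu>. ?f \<sigma> y)"
      using i1 i2 \<nu>.prob_space N.prob_space stable_law_smoothing(1)[OF st \<sigma> \<alpha>(1)] c by simp
    also have "\<dots> \<le> (LINT y|\<nu>. indicator {y. x < \<bar>y\<bar>} y + 2 * \<eta>\<^sup>2 * ?f (1 / x) y)"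
    proof (rule integral_mono)
      fix y :: real
      show "?f \<sigma> y \<le> indicator {y. x < \<bar>y\<bar>} y + 2 * \<eta>\<^sup>2 * ?f (1 / x) y"
      proof (cases "x < \<bar>y\<bar>")
        case True
        then show ?thesis by (simp add: add_increasing2)
      next
        case False
        define q where "q = (1 / x * y)\<^sup>2 / 2"
        have "\<bar>1 / x * y\<bar> \<le> 1" using False x0 by (simp add: abs_mult field_simps)
        then have q: "0 \<le> q" "q \<le> 1" unfolding q_def using abs_square_le_1[of "1 / x * y"] by auto
        have "?f \<sigma> y \<le> (\<sigma> * y)\<^sup>2 / 2" using exp_ge_add_one_self[of "- ((\<sigma> * y)\<^sup>2) / 2"] by simp
        also have "\<dots> = \<eta>\<^sup>2 * q" unfolding q_def \<sigma>_def by (simp add: power_mult_distrib power_divide)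
        also have "\<dots> \<le> \<eta>\<^sup>2 * (2 * (1 - exp (- q)))" using half[OF q] by (intro mult_left_mono) auto
        finally show ?thesis using False by (simp add: q_def algebra_simps)
      qed
    next
      show "integrable \<nu> (?f \<sigma>)" by (rule if')
      show "integrable \<nu> (\<lambda>y. indicator {y. x < \<bar>y\<bar>} y + 2 * \<eta>\<^sup>2 * ?f (1 / x) y)"
        by (intro Bochner_Integration.integrable_add integrable_mult_right if' integrable_real_indicator) (auto simp: \<nu>.emeasure_eq_measure)
    qed
    also have "\<dots> = measure \<nu> {y. x < \<bar>y\<bar>} + 2 * \<eta>\<^sup>2 * (LINT y|\<nu>. ?f (1 / x) y)"
      using if'[of "1 / x"] by (subst Bochner_Integration.integral_add)
       (auto intro!: integrable_real_indicator simp: \<nu>.emeasure_eq_measure)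
    also have "(LINT y|\<nu>. ?f (1 / x) y) \<le> 2 * c * (1 / x) powr \<alpha>"
      using x0 c by (intro stable_law_gauss_deficit[OF st _ \<alpha>]) auto
    finally have "z / 2 * p \<le> measure \<nu> {y. x < \<bar>y\<bar>} + 2 * \<eta>\<^sup>2 * (2 * c * (1 / x) powr \<alpha>)"
      by (simp add: mult_left_mono)
    also have "2 * \<eta>\<^sup>2 * (2 * c * (1 / x) powr \<alpha>) = 4 * z * \<eta> powr (2 - \<alpha>)"
    proof -
      have "\<sigma> powr \<alpha> = \<eta> powr \<alpha> * (1 / x) powr \<alpha>" unfolding \<sigma>_def using \<eta> x0 by (simp add: powr_divide)
      moreover have "\<eta>\<^sup>2 = \<eta> powr \<alpha> * \<eta> powr (2 - \<alpha>)" using \<eta> by (simp add: powr_add[symmetric] powr_numeral)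
      ultimately show ?thesis unfolding z_def by simp
    qed
    also have "\<dots> \<le> 4 * z * (p / 32)" using \<eta>p z by (intro mult_left_mono) auto
    finally have "z * p / 4 \<le> measure \<nu> {y. x < \<bar>y\<bar>}" using mult_pos_pos[OF p z(1)] by (simp add: field_simps)
    moreover have "z * p / 4 = k * x powr - \<alpha>"
      unfolding z_def k_def \<sigma>_def using \<eta> x0 by (simp add: powr_divide powr_minus field_simps)
    ultimately show "k * x powr - \<alpha> \<le> measure \<nu> {y. x < \<bar>y\<bar>}" by simp
  qed
qed

lemma std_normal_interval: "0 \<le> \<eta> \<Longrightarrow> measure std_normal_distribution {x. \<bar>x\<bar> \<le> \<eta>} \<le> 2 * \<eta>"
proof -
  assume \<eta>: "0 \<le> \<eta>"
  interpret N: real_distribution std_normal_distribution by (rule real_dist_normal_dist)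
  have "emeasure std_normal_distribution {x. \<bar>x\<bar> \<le> \<eta>} =
      (\<integral>\<^sup>+x. ennreal (std_normal_density x) * indicator {x. \<bar>x\<bar> \<le> \<eta>} x \<partial>lborel)"
    by (subst emeasure_density) auto
  also have "\<dots> \<le> (\<integral>\<^sup>+x. indicator {- \<eta>..\<eta>} x \<partial>lborel)"
  proof (rule nn_integral_mono)
    fix x :: real
    have "1 \<le> sqrt (2 * pi)" using pi_ge_two by simp
    then have "std_normal_density x \<le> 1"
      unfolding std_normal_density_def by (intro mult_le_one) (auto simp: field_simps)
    then show "ennreal (std_normal_density x) * indicator {x. \<bar>x\<bar> \<le> \<eta>} x \<le> indicator {- \<eta>..\<eta>} x"
      by (auto split: split_indicator simp: ennreal_le_1)
  qed
  also have "\<dots> = ennreal (2 * \<eta>)" using \<eta> by simp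
  finally show ?thesis using \<eta> by (simp add: N.emeasure_eq_measure)
qed

text \<open>An interval of radius \<open>R\<close> is dominated by twice a Gaussian of width
  \<open>R\<close>, whose integral is bounded on the Fourier side uniformly in the centre. With
  \<open>R\<close> proportional to t^(1/\<alpha>) the bound does not depend on
  \<open>t\<close>.\<close>

lemma stable_law_concentration:
  assumes \<alpha>: "0 < \<alpha>" and b: "0 < b" and e: "0 < e"
  obtains \<rho> where "0 < \<rho>"
    "\<And>\<nu> t a. 0 < t \<Longrightarrow> stable_law \<alpha> (b * t) \<nu> \<Longrightarrow> measure \<nu> {y. \<bar>y - a\<bar> \<le> \<rho> * t powr (1 / \<alpha>)} \<le> e"
proof -
  \<comment> \<open>The Gaussian mass of frequencies within \<eta> of 0 is at most 2 \<eta> = e/4;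
    the other frequencies contribute at most e^(-K) \<le> e/4. Domination by the Gaussian costs the
    last factor 2.\<close>
  define \<eta> where "\<eta> = e / 8"
  have \<eta>: "0 < \<eta>" unfolding \<eta>_def using e by simp
  define K where "K = max 1 (ln (4 / e))"
  have K: "0 < K" and Ke: "exp (- K) \<le> e / 4"
  proof -
    have "ln (4 / e) \<le> K" unfolding K_def by simp
    then have "exp (ln (4 / e)) \<le> exp K" by simp
    then have "4 / e \<le> exp K" using e by simp
    then show "exp (- K) \<le> e / 4" using e by (simp add: exp_minus field_simps)
  qed (simp add: K_def)
  \<comment> \<open>Solves \<open>z * \<eta> powr \<alpha> = K\<close>.\<close>
  define \<rho> where "\<rho> = \<eta> * (b / K) powr (1 / \<alpha>)"
  have \<rho>: "0 < \<rho>" unfolding \<rho>_def using \<eta> b K by simp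
  show thesis
  proof (rule that[OF \<rho>])
    fix \<nu> and t a :: real assume t: "0 < t" and st: "stable_law \<alpha> (b * t) \<nu>"
    interpret \<nu>: real_distribution \<nu> using st by (simp add: stable_law_def)
    interpret N: real_distribution std_normal_distribution by (rule real_dist_normal_dist)
    define R where "R = \<rho> * t powr (1 / \<alpha>)"
    have R: "0 < R" unfolding R_def using \<rho> t by simp
    define z where "z = b * t * (1 / R) powr \<alpha>"
    have z0: "0 \<le> z" unfolding z_def using b t by simp
    have "R powr \<alpha> = \<rho> powr \<alpha> * t" unfolding R_def using \<alpha> t \<rho> by (simp add: powr_mult powr_powr)
    moreover have "\<rho> powr \<alpha> = \<eta> powr \<alpha> * (b / K)" unfolding \<rho>_def using \<alpha> b K \<eta> by (simp add: powr_mult powr_powr)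
    ultimately have zK: "z * \<eta> powr \<alpha> = K"
      unfolding z_def using R t b K \<eta> by (simp add: powr_divide field_simps)
    have e2: "1 / 2 \<le> exp (- 1 / 2 :: real)"
      using exp_ge_add_one_self[of "- 1 / 2 :: real"] by simp
    have "measure \<nu> {y. \<bar>y - a\<bar> \<le> R} / 2 = (LINT y|\<nu>. indicator {y. \<bar>y - a\<bar> \<le> R} y / 2)" by simp
    also have "\<dots> \<le> (LINT y|\<nu>. exp (- ((1 / R * (y - a))\<^sup>2) / 2))"
    proof (rule integral_mono)
      fix y :: real
      show "indicator {y. \<bar>y - a\<bar> \<le> R} y / 2 \<le> exp (- ((1 / R * (y - a))\<^sup>2) / 2)"
      proof (cases "\<bar>y - a\<bar> \<le> R")
        case True
        then have "\<bar>1 / R * (y - a)\<bar> \<le> 1" using R by (simp add: abs_mult field_simps)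
        then have "(1 / R * (y - a))\<^sup>2 \<le> 1" by (simp only: abs_square_le_1)
        then have "exp (- 1 / 2) \<le> exp (- ((1 / R * (y - a))\<^sup>2) / 2)" by simp
        with e2 have "1 / 2 \<le> exp (- ((1 / R * (y - a))\<^sup>2) / 2)" by (rule order_trans)
        then show ?thesis using True by simp
      qed simp
    next
      show "integrable \<nu> (\<lambda>y. exp (- ((1 / R * (y - a))\<^sup>2) / 2))"
        by (rule \<nu>.integrable_const_bound[where B = 1]) auto
    qed (auto intro!: integrable_real_indicator simp: \<nu>.emeasure_eq_measure)
    also have "\<dots> \<le> (LINT \<theta>|std_normal_distribution. exp (- (b * t * (1 / R) powr \<alpha> * \<bar>\<theta>\<bar> powr \<alpha>)))"
      using R b t by (intro stable_law_smoothing(2)[OF st _ \<alpha>]) auto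
    also have "\<dots> \<le> (LINT \<theta>|std_normal_distribution. indicator {x. \<bar>x\<bar> \<le> \<eta>} \<theta> + e / 4)"
    proof (rule integral_mono)
      fix \<theta> :: real
      show "exp (- (b * t * (1 / R) powr \<alpha> * \<bar>\<theta>\<bar> powr \<alpha>)) \<le> indicator {x. \<bar>x\<bar> \<le> \<eta>} \<theta> + e / 4"
      proof (cases "\<bar>\<theta>\<bar> \<le> \<eta>")
        case True
        then show ?thesis using z0 e by (simp add: z_def[symmetric] add_increasing2)
      next
        case False
        then have "\<eta> powr \<alpha> \<le> \<bar>\<theta>\<bar> powr \<alpha>" using \<eta> \<alpha> by (intro powr_mono2) auto
        then have "K \<le> z * \<bar>\<theta>\<bar> powr \<alpha>" unfolding zK[symmetric] using z0 by (intro mult_left_mono) auto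
        then have "exp (- (z * \<bar>\<theta>\<bar> powr \<alpha>)) \<le> exp (- K)" by simp
        then have "exp (- (z * \<bar>\<theta>\<bar> powr \<alpha>)) \<le> e / 4" using Ke by linarith
        then show ?thesis using False by (simp only: z_def[symmetric]) simp
      qed
    next
      show "integrable std_normal_distribution (\<lambda>\<theta>. exp (- (b * t * (1 / R) powr \<alpha> * \<bar>\<theta>\<bar> powr \<alpha>)))"
        by (rule N.integrable_const_bound[where B = 1]) (use z0 in \<open>auto simp: z_def[symmetric]\<close>)
    qed (auto intro!: integrable_real_indicator integrable_add simp: N.emeasure_eq_measure)
    also have "\<dots> = measure std_normal_distribution {x. \<bar>x\<bar> \<le> \<eta>} + e / 4"
      using N.prob_space by (subst Bochner_Integration.integral_add) (auto intro!: integrable_real_indicator simp: N.emeasure_eq_measure)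
    also have "\<dots> \<le> e / 2" using std_normal_interval[of \<eta>] \<eta> by (simp add: \<eta>_def)
    finally show "measure \<nu> {y. \<bar>y - a\<bar> \<le> \<rho> * t powr (1 / \<alpha>)} \<le> e" by (simp add: R_def)
  qed
qed

section \<open>Cadlag paths\<close>

lemma cadlag_right: "cadlag f \<Longrightarrow> 0 \<le> t \<Longrightarrow> (f \<longlongrightarrow> f t) (at_right t)"
  and cadlag_left: "cadlag f \<Longrightarrow> 0 < t \<Longrightarrow> \<exists>l. (f \<longlongrightarrow> l) (at_left t)"
  by (auto simp: cadlag_def)

text \<open>One-sided limits bound the path near every time, and bisection of the interval makes
  this global.\<close>

lemma cadlag_bounded:
  assumes f: "cadlag f" and T: "0 \<le> T"
  shows "\<exists>B. \<forall>t\<in>{0..T}. \<bar>f t\<bar> \<le> B"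
proof -
  define P where "P = (\<lambda>a b :: real. 0 \<le> a \<longrightarrow> (\<exists>B. \<forall>t\<in>{a..b}. \<bar>f t\<bar> \<le> B))"
  have "P 0 T"
    using T
  proof (induction rule: Bolzano)
    case (trans a b c)
    show ?case
      unfolding P_def
    proof
      assume a: "0 \<le> a"
      with trans obtain B C where "\<forall>t\<in>{a..b}. \<bar>f t\<bar> \<le> B" "\<forall>t\<in>{b..c}. \<bar>f t\<bar> \<le> C" unfolding P_def by force
      then have "\<forall>t\<in>{a..c}. \<bar>f t\<bar> \<le> max B C" by (force simp: le_max_iff_disj)
      then show "\<exists>B. \<forall>t\<in>{a..c}. \<bar>f t\<bar> \<le> B" ..
    qed
  next
    case (local x)
    have "eventually (\<lambda>t. dist (f t) (f x) < 1) (at_right x)"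
      using cadlag_right[OF f local(1)] by (rule tendstoD) simp
    then obtain b1 where "x < b1" "\<And>t. x < t \<Longrightarrow> t < b1 \<Longrightarrow> dist (f t) (f x) < 1"
      unfolding eventually_at_right_field by auto
    then obtain d1 where d1: "0 < d1" "\<And>t. x < t \<Longrightarrow> t < x + d1 \<Longrightarrow> dist (f t) (f x) < 1"
      by (intro that[of "b1 - x"]) auto
    have "\<exists>d2>0. \<exists>l. \<forall>t. 0 \<le> t \<longrightarrow> x - d2 < t \<longrightarrow> t < x \<longrightarrow> dist (f t) l < 1"
    proof (cases "x = 0")
      case False
      then obtain l where "(f \<longlongrightarrow> l) (at_left x)" using cadlag_left[OF f] local by force
      then have "eventually (\<lambda>t. dist (f t) l < 1) (at_left x)" by (rule tendstoD) simp
      then obtain b where "b < x" "\<And>t. b < t \<Longrightarrow> t < x \<Longrightarrow> dist (f t) l < 1"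
        unfolding eventually_at_left_field by auto
      then show ?thesis by (intro exI[of _ "x - b"]) auto
    qed (auto intro!: exI[of _ 1])
    then obtain d2 l where d2: "0 < d2" "\<And>t. 0 \<le> t \<Longrightarrow> x - d2 < t \<Longrightarrow> t < x \<Longrightarrow> dist (f t) l < 1" by auto
    show ?case
      unfolding P_def
    proof (rule exI[of _ "min d1 d2"], intro conjI allI impI)
      fix a b assume ab: "a \<le> x \<and> x \<le> b \<and> b - a < min d1 d2" "0 \<le> a"
      show "\<exists>B. \<forall>t\<in>{a..b}. \<bar>f t\<bar> \<le> B"
      proof (intro exI ballI)
        fix t assume t: "t \<in> {a..b}"
        then have "t = x \<or> dist (f t) (f x) < 1 \<or> dist (f t) l < 1"
          using d1(2)[of t] d2(2)[of t] ab by (cases t x rule: linorder_cases) auto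
        then show "\<bar>f t\<bar> \<le> \<bar>f x\<bar> + \<bar>l\<bar> + 1" by (auto simp: dist_real_def)
      qed
    qed (use d1 d2 in auto)
  qed
  then show ?thesis by (simp add: P_def)
qed

lemma dyadic_point_le:
  assumes "k \<le> 2 ^ l" "0 \<le> (t :: real)"
  shows "real k * (t / 2 ^ l) \<le> t"
proof -
  have "real k \<le> 2 ^ l" using assms(1) by (metis of_nat_le_iff of_nat_numeral of_nat_power)
  then have "real k * (t / 2 ^ l) \<le> 2 ^ l * (t / 2 ^ l)" using assms(2) by (intro mult_right_mono) auto
  then show ?thesis by simp
qed

text \<open>Reduces a condition over an interval to countably many times, by right continuity.
  Nothing is assumed at \<open>b\<close>, which is itself a grid point of every level.\<close>

lemma dyadic_le_iff:
  fixes f :: "real \<Rightarrow> real"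
  assumes f: "\<And>t. a \<le> t \<Longrightarrow> t < b \<Longrightarrow> (f \<longlongrightarrow> f t) (at_right t)" and ab: "a \<le> b"
  shows "(\<forall>t\<in>{a..b}. f t \<le> c) \<longleftrightarrow> (\<forall>l. \<forall>k\<le>2 ^ l. f (a + real k * ((b - a) / 2 ^ l)) \<le> c)"
proof (intro iffI allI impI ballI)
  fix l k :: nat assume *: "\<forall>t\<in>{a..b}. f t \<le> c" "k \<le> 2 ^ l"
  have "real k * ((b - a) / 2 ^ l) \<le> b - a" using *(2) ab by (intro dyadic_point_le) auto
  then have "a + real k * ((b - a) / 2 ^ l) \<in> {a..b}" using ab by auto
  then show "f (a + real k * ((b - a) / 2 ^ l)) \<le> c" using * by blast
next
  fix t assume *: "\<forall>l. \<forall>k\<le>2 ^ l. f (a + real k * ((b - a) / 2 ^ l)) \<le> c" and t: "t \<in> {a..b}"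
  show "f t \<le> c"
  proof (cases "t = b")
    case True
    then show ?thesis using *[rule_format, of 1 0] by simp
  next
    case False
    then have t: "a \<le> t" "t < b" using t by auto
    show ?thesis
    proof (rule ccontr)
      assume "\<not> f t \<le> c"
      then have "eventually (\<lambda>s. c < f s) (at_right t)"
        using f[OF t] by (intro order_tendstoD) auto
      then obtain d where d: "t < d" "\<And>s. t < s \<Longrightarrow> s < d \<Longrightarrow> c < f s"
        unfolding eventually_at_right_field by auto
      obtain l where "(b - a) / (d - t) < 2 ^ l" using real_arch_pow[of 2 "(b - a) / (d - t)"] by auto
      then have l: "(b - a) / 2 ^ l < d - t" using d(1) by (simp add: field_simps)
      define w where "w = (b - a) / 2 ^ l"
      have w: "0 < w" "w < d - t" unfolding w_def using t l by auto
      \<comment> \<open>The first grid point strictly to the right of \<open>t\<close>.\<close>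
      define k where "k = nat \<lfloor>(t - a) / w\<rfloor> + 1"
      have "(t - a) / w < 2 ^ l" unfolding w_def using t by (simp add: field_simps)
      then have "\<lfloor>(t - a) / w\<rfloor> < 2 ^ l" by (simp add: floor_less_iff)
      moreover have fl: "0 \<le> \<lfloor>(t - a) / w\<rfloor>" using t w by simp
      ultimately have k: "k \<le> 2 ^ l" unfolding k_def by (simp add: nat_less_iff Suc_le_eq)
      have rk: "real k = of_int \<lfloor>(t - a) / w\<rfloor> + 1" unfolding k_def using fl by simp
      have "(t - a) / w < real k" "real k \<le> (t - a) / w + 1" unfolding rk by linarith+
      then have "t < a + real k * w" "a + real k * w \<le> t + w" using w by (simp_all add: field_simps)
      then have "c < f (a + real k * w)" using w by (intro d) auto
      then show False using * k unfolding w_def by (simp add: not_le[symmetric])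
    qed
  qed
qed

lemma tendsto_right_seq:
  fixes f :: "real \<Rightarrow> real"
  assumes "(f \<longlongrightarrow> f t) (at_right t)" "s \<longlonglongrightarrow> t" "\<And>r :: nat. t \<le> s r"
  shows "(\<lambda>r. f (s r)) \<longlonglongrightarrow> f t"
proof (rule continuous_within_tendsto_compose'[of t "{t..}" f])
  show "continuous (at t within {t..}) f"
    unfolding continuous_within at_within_Ici_at_right by fact
qed (use assms in auto)

lemma tendsto_left_seq:
  fixes f :: "real \<Rightarrow> real"
  assumes "(f \<longlongrightarrow> l) (at_left t)" "s \<longlonglongrightarrow> t" "\<And>r :: nat. s r < t"
  shows "(\<lambda>r. f (s r)) \<longlonglongrightarrow> l"
  using assms unfolding tendsto_at_iff_sequentially by (auto simp: comp_def)

lemma tendsto_two_sided_seq: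
  fixes f :: "real \<Rightarrow> real"
  assumes "(f \<longlongrightarrow> f t) (at_right t)" "t = 0 \<or> (f \<longlongrightarrow> f t) (at_left t)" "s \<longlonglongrightarrow> t" "\<And>r :: nat. 0 \<le> s r" "0 \<le> t"
  shows "(\<lambda>r. f (s r)) \<longlonglongrightarrow> f t"
proof (cases "t = 0")
  case True
  then show ?thesis using tendsto_right_seq[OF assms(1,3)] assms(4) by simp
next
  case False
  then have "continuous (at t within UNIV) f"
    using assms unfolding continuous_within by (simp add: filterlim_split_at)
  then show ?thesis by (rule continuous_within_tendsto_compose') (use assms in auto)
qed

text \<open>In the grid cell that contains \<open>t\<close>, the left end tends to \<open>t\<close>
  strictly from the left and the right end tends to it from \<open>t\<close> or above, so the
  increments over the cell tend to the jumps of both paths.\<close>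

lemma common_jump_detected:
  assumes f: "cadlag f" and g: "cadlag g" and t: "0 < t" "t \<le> T"
    and jf: "\<not> (f \<longlongrightarrow> f t) (at_left t)" and jg: "\<not> (g \<longlongrightarrow> g t) (at_left t)"
  shows "\<exists>r::nat. eventually (\<lambda>m. \<exists>k<m. 1 / real (Suc r) < \<bar>f (real (Suc k) * (T / real m)) - f (real k * (T / real m))\<bar> \<and>
    1 / real (Suc r) < \<bar>g (real (Suc k) * (T / real m)) - g (real k * (T / real m))\<bar>) sequentially"
proof -
  obtain lf lg where lf: "(f \<longlongrightarrow> lf) (at_left t)" and lg: "(g \<longlongrightarrow> lg) (at_left t)"
    using cadlag_left[OF f t(1)] cadlag_left[OF g t(1)] by auto
  define \<eta> where "\<eta> = min \<bar>f t - lf\<bar> \<bar>g t - lg\<bar>"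
  have "0 < \<eta>" unfolding \<eta>_def using jf jg lf lg by auto
  then obtain r where r: "1 / real (Suc r) < \<eta>"
    using reals_Archimedean[of \<eta>] by (auto simp: inverse_eq_divide)
  \<comment> \<open>Ceiling minus 1 instead of floor: the left end of the cell lies strictly before
    \<open>t\<close> even when \<open>t\<close> is a grid point.\<close>
  define k where "k = (\<lambda>m. nat (\<lceil>t * real (Suc m) / T\<rceil> - 1))"
  define a b where "a = (\<lambda>m. real (k m) * (T / real (Suc m)))" and "b = (\<lambda>m. real (Suc (k m)) * (T / real (Suc m)))"
  have T: "0 < T" using t by simp
  have rk: "real (k m) = of_int \<lceil>t * real (Suc m) / T\<rceil> - 1" for m
  proof -
    have "0 < t * real (Suc m) / T" using t T by simp
    then have "1 \<le> \<lceil>t * real (Suc m) / T\<rceil>" by linarith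
    then show ?thesis unfolding k_def by simp
  qed
  have km: "real (k m) < t * real (Suc m) / T" "t * real (Suc m) / T \<le> real (k m) + 1" for m
    unfolding rk by linarith+
  have at: "a m < t" for m unfolding a_def using km(1)[of m] T by (simp add: field_simps)
  have bt: "t \<le> b m" for m unfolding b_def using km(2)[of m] T by (simp add: field_simps)
  have ba: "b m = a m + T / real (Suc m)" for m unfolding a_def b_def of_nat_Suc[of "k m"] by (simp only: distrib_right add.commute mult_1_left)
  have kl: "k m < Suc m" for m
  proof -
    have "t * real (Suc m) \<le> T * real (Suc m)" using t by (intro mult_right_mono) auto
    then have "t * real (Suc m) / T \<le> real (Suc m)" using T by (simp add: divide_le_eq mult.commute)
    then have "real (k m) < real (Suc m)" using km(1)[of m] by linarith
    then show ?thesis by simp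
  qed
  have z: "(\<lambda>m. T / real (Suc m)) \<longlonglongrightarrow> 0"
    using tendsto_mult[OF tendsto_const LIMSEQ_inverse_real_of_nat, of T] by (simp add: field_simps)
  have b: "b \<longlonglongrightarrow> t"
  proof (rule tendsto_sandwich[of "\<lambda>_. t" _ _ "\<lambda>m. t + T / real (Suc m)"])
    show "\<forall>\<^sub>F m in sequentially. b m \<le> t + T / real (Suc m)" using ba at by (auto intro!: always_eventually less_imp_le)
    show "(\<lambda>m. t + T / real (Suc m)) \<longlonglongrightarrow> t" using tendsto_add[OF tendsto_const z, of t] by simp
  qed (use bt in auto)
  have a: "a \<longlonglongrightarrow> t"
  proof -
    have "(\<lambda>m. b m - T / real (Suc m)) \<longlonglongrightarrow> t - 0" by (intro tendsto_diff b z)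
    then show ?thesis by (simp add: ba)
  qed
  have ev: "eventually (\<lambda>m. 1 / real (Suc r) < \<bar>h (b m) - h (a m)\<bar>) sequentially"
    if h: "cadlag h" and l: "(h \<longlongrightarrow> l) (at_left t)" and \<eta>: "\<eta> \<le> \<bar>h t - l\<bar>" for h l
  proof -
    have "(\<lambda>m. \<bar>h (b m) - h (a m)\<bar>) \<longlonglongrightarrow> \<bar>h t - l\<bar>"
      using t by (intro tendsto_rabs tendsto_diff tendsto_right_seq[OF _ b] tendsto_left_seq[OF l a] cadlag_right h bt at) auto
    then show ?thesis by (rule order_tendstoD) (use r \<eta> in linarith)
  qed
  have "eventually (\<lambda>m. 1 / real (Suc r) < \<bar>f (b m) - f (a m)\<bar> \<and> 1 / real (Suc r) < \<bar>g (b m) - g (a m)\<bar>) sequentially"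
    using ev[OF f lf] ev[OF g lg] by (intro eventually_conj) (auto simp: \<eta>_def)
  then have ev: "eventually (\<lambda>m. \<exists>k<Suc m. 1 / real (Suc r) < \<bar>f (real (Suc k) * (T / real (Suc m))) - f (real k * (T / real (Suc m)))\<bar> \<and>
    1 / real (Suc r) < \<bar>g (real (Suc k) * (T / real (Suc m))) - g (real k * (T / real (Suc m)))\<bar>) sequentially"
    unfolding a_def b_def by eventually_elim (use kl in blast)
  show ?thesis
    by (rule exI[of _ r], rule iffD1[OF eventually_sequentially_Suc], rule ev)
qed

lemma subseq_dichotomy:
  fixes P :: "nat \<Rightarrow> bool"
  obtains \<psi> :: "nat \<Rightarrow> nat" where "strict_mono \<psi>" "\<And>r. P (\<psi> r)" | \<psi> :: "nat \<Rightarrow> nat" where "strict_mono \<psi>" "\<And>r. \<not> P (\<psi> r)"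
proof -
  have "infinite {r. P r} \<or> infinite {r. \<not> P r}"
  proof (rule ccontr)
    assume "\<not> ?thesis"
    then have "finite ({r. P r} \<union> {r. \<not> P r})" by blast
    moreover have "{r. P r} \<union> {r. \<not> P r} = UNIV" by auto
    ultimately show False by simp
  qed
  then consider "infinite {r. P r}" | "infinite {r. \<not> P r}" by blast
  then show thesis
  proof cases
    case 1
    from infinite_enumerate[OF this] obtain \<psi> :: "nat \<Rightarrow> nat" where "strict_mono \<psi>" "\<And>r. P (\<psi> r)" by auto
    then show thesis by (rule that(1))
  next
    case 2
    from infinite_enumerate[OF this] obtain \<psi> :: "nat \<Rightarrow> nat" where "strict_mono \<psi>" "\<And>r. \<not> P (\<psi> r)" by auto
    then show thesis by (rule that(2))
  qed
qed

text \<open>Counterexamples with ever smaller clock differences accumulate at some time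
  \<open>t0\<close>. At most one coordinate jumps there, so along a subsequence the product tends to
  the value or to the left limit of the true product, and both are at most \<epsilon>.\<close>

lemma prod_near_path:
  fixes f :: "'i \<Rightarrow> real \<Rightarrow> real"
  assumes I: "finite I" and f: "\<And>i. i \<in> I \<Longrightarrow> cadlag (f i)"
    and nojump: "\<And>i j t. i \<in> I \<Longrightarrow> j \<in> I \<Longrightarrow> i \<noteq> j \<Longrightarrow> 0 < t \<Longrightarrow> t \<le> T \<Longrightarrow>
      (f i \<longlongrightarrow> f i t) (at_left t) \<or> (f j \<longlongrightarrow> f j t) (at_left t)"
    and le: "\<And>t. 0 \<le> t \<Longrightarrow> t \<le> T \<Longrightarrow> (\<Prod>i\<in>I. f i t) \<le> \<epsilon>" and \<epsilon>: "\<epsilon> < \<epsilon>'"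
  shows "\<exists>\<delta>>0. \<forall>t s. 0 \<le> t \<longrightarrow> t \<le> T \<longrightarrow> (\<forall>i\<in>I. 0 \<le> s i \<and> \<bar>s i - t\<bar> \<le> \<delta>) \<longrightarrow> (\<Prod>i\<in>I. f i (s i)) \<le> \<epsilon>'"
proof (rule ccontr)
  assume neg: "\<not> ?thesis"
  have "\<forall>r::nat. \<exists>t s. 0 \<le> t \<and> t \<le> T \<and> (\<forall>i\<in>I. 0 \<le> s i \<and> \<bar>s i - t\<bar> \<le> 1 / real (Suc r)) \<and> \<epsilon>' < (\<Prod>i\<in>I. f i (s i))"
  proof (intro allI)
    fix r :: nat
    have "0 < 1 / real (Suc r)" by simp
    then show "\<exists>t s. 0 \<le> t \<and> t \<le> T \<and> (\<forall>i\<in>I. 0 \<le> s i \<and> \<bar>s i - t\<bar> \<le> 1 / real (Suc r)) \<and> \<epsilon>' < (\<Prod>i\<in>I. f i (s i))"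
      using neg unfolding not_le[symmetric] by blast
  qed
  then obtain t s where ts: "\<And>r::nat. 0 \<le> t r" "\<And>r. t r \<le> T"
      "\<And>r i. i \<in> I \<Longrightarrow> 0 \<le> s r i" "\<And>r i. i \<in> I \<Longrightarrow> \<bar>s r i - t r\<bar> \<le> 1 / real (Suc r)"
      "\<And>r. \<epsilon>' < (\<Prod>i\<in>I. f i (s r i))"
    by metis
  have "\<forall>r. t r \<in> {0..T}" using ts by auto
  then obtain t0 \<phi> where t0: "t0 \<in> {0..T}" and \<phi>: "strict_mono \<phi>" "(t \<circ> \<phi>) \<longlonglongrightarrow> t0"
    using compact_Icc[of 0 T] unfolding compact_eq_seq_compact_metric seq_compact_def by metis
  have z: "(\<lambda>r. 1 / real (Suc (\<phi> r))) \<longlonglongrightarrow> 0"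
    using LIMSEQ_subseq_LIMSEQ[OF LIMSEQ_inverse_real_of_nat \<phi>(1)] by (simp add: comp_def inverse_eq_divide)
  have s0: "(\<lambda>r. s (\<phi> r) i) \<longlonglongrightarrow> t0" if "i \<in> I" for i
  proof -
    have "(\<lambda>r. s (\<phi> r) i - t (\<phi> r)) \<longlonglongrightarrow> 0"
      by (rule Lim_null_comparison[OF _ z]) (use ts(4)[OF that] in auto)
    from tendsto_add[OF this \<phi>(2)[unfolded comp_def]] show ?thesis by simp
  qed
  have right: "(f i \<longlongrightarrow> f i t0) (at_right t0)" if "i \<in> I" for i using f[OF that] t0 by (intro cadlag_right) auto
  \<comment> \<open>The coordinates that jump at \<open>t0\<close>. Time 0 is excluded: clocks are
    nonnegative and cannot reach it from the left.\<close>
  define J where "J = {i\<in>I. t0 \<noteq> 0 \<and> \<not> (f i \<longlongrightarrow> f i t0) (at_left t0)}"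
  have nonJ: "(\<lambda>r. f i (s (\<phi> (\<psi> r)) i)) \<longlonglongrightarrow> f i t0" if "i \<in> I" "i \<notin> J" "strict_mono \<psi>" for i and \<psi> :: "nat \<Rightarrow> nat"
  proof (rule tendsto_two_sided_seq[of "f i" t0 "\<lambda>r. s (\<phi> (\<psi> r)) i"])
    show "(f i \<longlongrightarrow> f i t0) (at_right t0)" by (rule right[OF that(1)])
    show "t0 = 0 \<or> (f i \<longlongrightarrow> f i t0) (at_left t0)" using that(1,2) unfolding J_def by blast
    show "(\<lambda>r. s (\<phi> (\<psi> r)) i) \<longlonglongrightarrow> t0"
      using LIMSEQ_subseq_LIMSEQ[OF s0[OF that(1)] that(3)] by (simp add: comp_def)
    show "0 \<le> s (\<phi> (\<psi> r)) i" for r by (rule ts(3)[OF that(1)])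
    show "0 \<le> t0" using t0 by simp
  qed
  have contra: False if "strict_mono \<psi>" "\<And>i. i \<in> I \<Longrightarrow> (\<lambda>r. f i (s (\<phi> (\<psi> r)) i)) \<longlonglongrightarrow> g i" "(\<Prod>i\<in>I. g i) \<le> \<epsilon>"
    for \<psi> :: "nat \<Rightarrow> nat" and g
  proof -
    have "(\<lambda>r. \<Prod>i\<in>I. f i (s (\<phi> (\<psi> r)) i)) \<longlonglongrightarrow> (\<Prod>i\<in>I. g i)" using that(2) by (intro tendsto_prod)
    then have "\<epsilon>' \<le> (\<Prod>i\<in>I. g i)" by (rule LIMSEQ_le_const) (use ts(5) in \<open>auto intro: less_imp_le\<close>)
    then show False using that(3) \<epsilon> by simp
  qed
  show False
  proof (cases "J = {}")
    case True
    then have "(\<lambda>r. f i (s (\<phi> r) i)) \<longlonglongrightarrow> f i t0" if "i \<in> I" for i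
      using nonJ[of i "\<lambda>r. r"] that by (auto simp: strict_mono_def)
    then show False using contra[of "\<lambda>r. r" "\<lambda>i. f i t0"] le[of t0] t0 by (auto simp: strict_mono_def)
  next
    case False
    then obtain j where j: "j \<in> J" by auto
    then have jI: "j \<in> I" and tpos: "0 < t0" using t0 by (auto simp: J_def)
    have only: "i \<notin> J" if "i \<in> I" "i \<noteq> j" for i
      using nojump[of i j t0] that j t0 tpos by (auto simp: J_def)
    obtain l where l: "(f j \<longlongrightarrow> l) (at_left t0)" using cadlag_left[OF f[OF jI] tpos] by auto
    show False
    proof (rule subseq_dichotomy[of "\<lambda>r. t0 \<le> s (\<phi> r) j"])
      fix \<psi> :: "nat \<Rightarrow> nat" assume \<psi>: "strict_mono \<psi>" "\<And>r. t0 \<le> s (\<phi> (\<psi> r)) j"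
      have "(\<lambda>r. f j (s (\<phi> (\<psi> r)) j)) \<longlonglongrightarrow> f j t0"
        using LIMSEQ_subseq_LIMSEQ[OF s0[OF jI] \<psi>(1)] \<psi>(2) by (intro tendsto_right_seq[of "f j" t0 "\<lambda>r. s (\<phi> (\<psi> r)) j"] right jI) (auto simp: comp_def)
      then have "(\<lambda>r. f i (s (\<phi> (\<psi> r)) i)) \<longlonglongrightarrow> f i t0" if "i \<in> I" for i
        using nonJ[OF that only[OF that] \<psi>(1)] by (cases "i = j") auto
      then show False using contra[OF \<psi>(1), of "\<lambda>i. f i t0"] le[of t0] t0 by auto
    next
      fix \<psi> :: "nat \<Rightarrow> nat" assume \<psi>: "strict_mono \<psi>" "\<And>r. \<not> t0 \<le> s (\<phi> (\<psi> r)) j"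
      \<comment> \<open>When the clock of \<open>j\<close> comes from the left, \<open>g\<close> is
        the left limit of every coordinate, the others being continuous at \<open>t0\<close>; so its
        product is a left limit along the true path.\<close>
      define g where "g = (\<lambda>i. if i = j then l else f i t0)"
      have "(\<lambda>r. f j (s (\<phi> (\<psi> r)) j)) \<longlonglongrightarrow> l"
        using LIMSEQ_subseq_LIMSEQ[OF s0[OF jI] \<psi>(1)] \<psi>(2) by (intro tendsto_left_seq[of "f j" l t0 "\<lambda>r. s (\<phi> (\<psi> r)) j"] l) (auto simp: comp_def not_le)
      then have *: "(\<lambda>r. f i (s (\<phi> (\<psi> r)) i)) \<longlonglongrightarrow> g i" if "i \<in> I" for i
        using nonJ[OF that only[OF that] \<psi>(1)] by (cases "i = j") (auto simp: g_def)
      have "((\<lambda>t. \<Prod>i\<in>I. f i t) \<longlongrightarrow> (\<Prod>i\<in>I. g i)) (at_left t0)"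
      proof (rule tendsto_prod)
        fix i assume "i \<in> I"
        then show "(f i \<longlongrightarrow> g i) (at_left t0)" using only[of i] l tpos by (cases "i = j") (auto simp: g_def J_def)
      qed
      moreover have "eventually (\<lambda>t. (\<Prod>i\<in>I. f i t) \<le> \<epsilon>) (at_left t0)"
        unfolding eventually_at_left_field using tpos t0 le by (intro exI[of _ 0]) auto
      ultimately have "(\<Prod>i\<in>I. g i) \<le> \<epsilon>" by (rule tendsto_upperbound) simp
      then show False using contra[OF \<psi>(1) *] by simp
    qed
  qed
qed

section \<open>Survival of one stable process below a level\<close>

locale stable_levy = levy M X for M :: "'a measure" and X +
  fixes \<alpha> b :: real
  assumes \<alpha>: "0 < \<alpha>" "\<alpha> < 2" and b: "0 < b"
    and char_X: "\<And>t \<theta>. 0 \<le> t \<Longrightarrow> char (distr M borel (X t)) \<theta> = complex_of_real (exp (- (b * t * \<bar>\<theta>\<bar> powr \<alpha>)))"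
begin

lemma real_distribution_X: "0 \<le> t \<Longrightarrow> real_distribution (distr M borel (X t))"
  by (rule real_distribution_distr) simp

lemma stable_law_X: "0 \<le> t \<Longrightarrow> stable_law \<alpha> (b * t) (distr M borel (X t))"
  unfolding stable_law_def using real_distribution_X char_X by simp

lemma shift_stable:
  assumes s: "0 \<le> s"
  shows "stable_levy M (\<lambda>r \<omega>. X (s + r) \<omega> - X s \<omega>) \<alpha> b"
proof -
  interpret S: levy M "\<lambda>r \<omega>. X (s + r) \<omega> - X s \<omega>" by (rule shift_levy[OF s])
  show ?thesis
  proof
    fix t \<theta> :: real assume t: "0 \<le> t"
    have "distr M borel (\<lambda>\<omega>. X (s + t) \<omega> - X s \<omega>) = distr M borel (X t)"
      using increment_law[of s "s + t"] s t by simp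
    then show "char (distr M borel (\<lambda>\<omega>. X (s + t) \<omega> - X s \<omega>)) \<theta> = complex_of_real (exp (- (b * t * \<bar>\<theta>\<bar> powr \<alpha>)))"
      using char_X[OF t] by simp
  qed (use \<alpha> b in auto)
qed

lemma char_scale: "f \<in> borel_measurable M \<Longrightarrow> char (distr M borel (\<lambda>\<omega>. c * f \<omega>)) \<theta> = char (distr M borel f) (c * \<theta>)"
  unfolding char_def by (simp add: integral_distr mult_ac)

text \<open>\<open>c\<close> may be negative, so self-similarity and reflection are covered at
  once.\<close>

lemma scale_stable:
  assumes a: "0 < a" and c: "\<bar>c\<bar> powr \<alpha> * a = 1"
  shows "stable_levy M (\<lambda>r \<omega>. c * X (a * r) \<omega>) \<alpha> b"
proof
  have cad: "Defs.cadlag (\<lambda>t. c * X (a * t) \<omega>)" if \<omega>: "\<omega> \<in> space M" for \<omega>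
    unfolding cadlag_def
  proof (intro conjI allI impI)
    fix t :: real assume t: "0 \<le> t"
    have "((\<lambda>t. X t \<omega>) \<longlongrightarrow> X (a * t) \<omega>) (at_right (a * t))"
      using cadlag[OF \<omega>] a t by (intro cadlag_right) auto
    moreover have "filterlim (\<lambda>t. a * t) (at_right (a * t)) (at_right t)"
      unfolding filterlim_at using a by (auto intro!: tendsto_intros simp: eventually_at_filter)
    ultimately show "((\<lambda>t. c * X (a * t) \<omega>) \<longlongrightarrow> c * X (a * t) \<omega>) (at_right t)"
      by (intro tendsto_mult_left) (rule filterlim_compose)
  next
    fix t :: real assume t: "0 < t"
    then obtain l where "((\<lambda>t. X t \<omega>) \<longlongrightarrow> l) (at_left (a * t))"
      using cadlag_left[OF cadlag[OF \<omega>], of "a * t"] a by auto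
    moreover have "filterlim (\<lambda>t. a * t) (at_left (a * t)) (at_left t)"
      unfolding filterlim_at using a by (auto intro!: tendsto_intros simp: eventually_at_filter)
    ultimately have "((\<lambda>t. c * X (a * t) \<omega>) \<longlongrightarrow> c * l) (at_left t)"
      by (intro tendsto_mult_left) (rule filterlim_compose)
    then show "\<exists>l. ((\<lambda>t. c * X (a * t) \<omega>) \<longlongrightarrow> l) (at_left t)" ..
  qed
  have ind: "indep_vars (\<lambda>_. borel) (\<lambda>j \<omega>. c * X (a * t (Suc j)) \<omega> - c * X (a * t j) \<omega>) {..<k}"
    if t: "0 \<le> t 0" "mono_on {..k} t" for k and t :: "nat \<Rightarrow> real"
  proof -
    have "mono_on {..k} (\<lambda>j. a * t j)" "0 \<le> a * t 0" using t a by (auto simp: mono_on_def)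
    from indep_vars_compose2[OF increments_indep[OF this(2,1)], of "\<lambda>_ x. c * x" "\<lambda>_. borel"]
    show ?thesis by (simp add: right_diff_distrib)
  qed
  have law: "distr M borel (\<lambda>\<omega>. c * X (a * (u + h)) \<omega> - c * X (a * u) \<omega>) = distr M borel (\<lambda>\<omega>. c * X (a * h) \<omega>)"
    if "0 \<le> u" "0 \<le> h" for u h
  proof -
    have "distr M borel (\<lambda>\<omega>. X (a * (u + h)) \<omega> - X (a * u) \<omega>) = distr M borel (X (a * h))"
      using increment_law[of "a * u" "a * (u + h)"] that a by (simp add: algebra_simps)
    then have "distr (distr M borel (\<lambda>\<omega>. X (a * (u + h)) \<omega> - X (a * u) \<omega>)) borel ((*) c) =
        distr (distr M borel (X (a * h))) borel ((*) c)" by simp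
    then show ?thesis
      using that a by (subst (asm) (1 2) distr_distr) (auto simp: comp_def right_diff_distrib)
  qed
  have m: "(\<lambda>\<omega>. c * X (a * t) \<omega>) \<in> borel_measurable M" if "0 \<le> t" for t
    using meas[of "a * t"] that a by simp
  show "levy_process M (\<lambda>r \<omega>. c * X (a * r) \<omega>)"
    unfolding levy_process_def using cad ind law m start by auto
  show "c * X (a * 0) \<omega> = 0" if "\<omega> \<in> space M" for \<omega> using start[OF that] by simp
  fix t \<theta> :: real assume t: "0 \<le> t"
  have "b * (a * t) * \<bar>c * \<theta>\<bar> powr \<alpha> = b * t * \<bar>\<theta>\<bar> powr \<alpha> * (\<bar>c\<bar> powr \<alpha> * a)"
    by (simp add: abs_mult powr_mult)
  also have "\<dots> = b * t * \<bar>\<theta>\<bar> powr \<alpha>" using c by simp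
  finally show "char (distr M borel (\<lambda>\<omega>. c * X (a * t) \<omega>)) \<theta> = complex_of_real (exp (- (b * t * \<bar>\<theta>\<bar> powr \<alpha>)))"
    using char_scale[OF meas[of "a * t"]] char_X[of "a * t" "c * \<theta>"] a t by simp
qed (use \<alpha> b in auto)

lemma minus_stable: "stable_levy M (\<lambda>r \<omega>. - X r \<omega>) \<alpha> b"
  using scale_stable[of 1 "-1"] by simp

end

lemma stable_traj_law:
  assumes "stable_levy M X \<alpha> b" "stable_levy M' X' \<alpha> b"
  shows "distr M paths (traj X) = distr M' paths (traj X')"
proof -
  interpret A: stable_levy M X \<alpha> b by fact
  interpret B: stable_levy M' X' \<alpha> b by fact
  show ?thesis
  proof (rule traj_law_cong)
    fix t :: real assume "0 \<le> t"
    then show "distr M borel (X t) = distr M' borel (X' t)"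
      using A.char_X B.char_X by (intro Levy_uniqueness A.real_distribution_X B.real_distribution_X) (auto simp: fun_eq_iff)
  qed (rule A.levy_axioms B.levy_axioms)+
qed

text \<open>Dyadic times make the predicate measurable on path space; on cadlag paths they suffice.\<close>

definition stays_below :: "real \<Rightarrow> real \<Rightarrow> (real \<Rightarrow> real) \<Rightarrow> bool" where
  "stays_below y T p \<longleftrightarrow> (\<forall>l. \<forall>k\<le>2 ^ l. p (real (k::nat) * (T / 2 ^ l)) \<le> y)"

lemma stays_below_measurable:
  "0 \<le> T \<Longrightarrow> Measurable.pred paths (stays_below y T)"
  unfolding stays_below_def by (intro pred_intros_logic pred_intros_countable pred_intros_finite) (auto simp: pred_def intro!: measurable_Collect_in[where K = borel, of _ _ "{..y}", simplified] measurable_component_singleton)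

context levy
begin

lemma stays_below_traj:
  assumes "\<omega> \<in> space M" "0 \<le> T"
  shows "stays_below y T (traj X \<omega>) \<longleftrightarrow> (\<forall>t\<in>{0..T}. X t \<omega> \<le> y)"
  unfolding stays_below_def traj_def
  using dyadic_le_iff[of 0 T "\<lambda>t. X t \<omega>" y] cadlag_right[OF cadlag[OF assms(1)]] assms(2) by simp

lemma stays_below_sets [measurable]:
  assumes "0 \<le> T"
  shows "{\<omega>\<in>space M. \<forall>t\<in>{0..T}. X t \<omega> \<le> y} \<in> sets M"
proof -
  have "{\<omega>\<in>space M. stays_below y T (traj X \<omega>)} \<in> sets M"
    using measurable_compose[OF traj_measurable stays_below_measurable[OF assms]] by (simp add: pred_def)
  also have "{\<omega>\<in>space M. stays_below y T (traj X \<omega>)} = {\<omega>\<in>space M. \<forall>t\<in>{0..T}. X t \<omega> \<le> y}"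
    using stays_below_traj assms by auto
  finally show ?thesis .
qed

lemma grid_sets [measurable]:
  assumes "0 \<le> h"
  shows "{\<omega>\<in>space M. \<forall>k\<le>N. X (real k * h) \<omega> \<le> y} \<in> sets M"
proof -
  have "{\<omega>\<in>space M. \<forall>k\<in>{..N}. X (real k * h) \<omega> \<le> y} \<in> sets M"
    using assms by (intro sets.sets_Collect_finite_All) (auto intro!: borel_measurable_le meas)
  then show ?thesis by (simp only: Ball_def atMost_iff)
qed

definition surv :: "real \<Rightarrow> real \<Rightarrow> real" where
  "surv y T = \<P>(\<omega> in M. \<forall>t\<in>{0..T}. X t \<omega> \<le> y)"

lemma surv_law:
  assumes "0 \<le> T"
  shows "surv y T = measure (distr M paths (traj X)) {p\<in>space paths. stays_below y T p}"
proof -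
  have "measure (distr M paths (traj X)) {p\<in>space paths. stays_below y T p} =
      prob (traj X -` {p\<in>space paths. stays_below y T p} \<inter> space M)"
    using stays_below_measurable[OF assms] by (intro measure_distr) (auto simp: pred_def)
  also have "traj X -` {p\<in>space paths. stays_below y T p} \<inter> space M = {\<omega>\<in>space M. \<forall>t\<in>{0..T}. X t \<omega> \<le> y}"
    using stays_below_traj assms measurable_space[OF traj_measurable] by auto
  finally show ?thesis by (simp add: surv_def)
qed

lemma surv_mono: "y \<le> y' \<Longrightarrow> T' \<le> T \<Longrightarrow> 0 \<le> T' \<Longrightarrow> surv y T \<le> surv y' T'"
  unfolding surv_def by (intro finite_measure_mono) (auto intro: order_trans)

lemma surv_nonneg: "0 \<le> surv y T" and surv_le_1: "surv y T \<le> 1"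
  unfolding surv_def by auto

text \<open>Dyadic grids are nested, so the grid events decrease to survival in continuous time;
  bounds uniform in the mesh pass to the limit.\<close>

lemma surv_ge_dyadic:
  assumes T: "0 \<le> T" and c: "\<And>l. c \<le> \<P>(\<omega> in M. \<forall>k\<le>2 ^ l. X (real k * (T / 2 ^ l)) \<omega> \<le> y)"
  shows "c \<le> surv y T"
proof -
  define A where "A = (\<lambda>l. {\<omega>\<in>space M. \<forall>k\<le>2 ^ l. X (real k * (T / 2 ^ l)) \<omega> \<le> y})"
  have Am: "A l \<in> events" for l
    unfolding A_def using T by (intro grid_sets) simp
  have "decseq A"
  proof (rule decseq_SucI, rule subsetI)
    fix l \<omega> assume \<omega>: "\<omega> \<in> A (Suc l)"
    show "\<omega> \<in> A l"
      unfolding A_def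
    proof (intro CollectI conjI allI impI)
      fix k :: nat assume "k \<le> 2 ^ l"
      then have "2 * k \<le> 2 ^ Suc l" by simp
      then have "X (real (2 * k) * (T / 2 ^ Suc l)) \<omega> \<le> y" using \<omega> unfolding A_def by blast
      then show "X (real k * (T / 2 ^ l)) \<omega> \<le> y" by simp
    qed (use \<omega> in \<open>simp add: A_def\<close>)
  qed
  then have "(\<lambda>l. prob (A l)) \<longlonglongrightarrow> prob (\<Inter>l. A l)"
    using Am by (intro finite_Lim_measure_decseq) auto
  then have "c \<le> prob (\<Inter>l. A l)"
    by (rule LIMSEQ_le_const) (use c in \<open>auto simp: A_def\<close>)
  also have "(\<Inter>l. A l) = {\<omega>\<in>space M. \<forall>t\<in>{0..T}. X t \<omega> \<le> y}"
    unfolding A_def using stays_below_traj[OF _ T, of _ y] T by (auto simp: stays_below_def traj_def)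
  finally show ?thesis by (simp add: surv_def)
qed

end

context stable_levy
begin

lemma prob_X: "0 \<le> t \<Longrightarrow> A \<in> sets borel \<Longrightarrow> \<P>(\<omega> in M. X t \<omega> \<in> A) = measure (distr M borel (X t)) A"
  by (subst measure_distr) (auto simp: vimage_def Int_def conj_commute)

lemma prob_minus_X:
  assumes t: "0 \<le> t" and A: "A \<in> sets borel"
  shows "\<P>(\<omega> in M. - X t \<omega> \<in> A) = \<P>(\<omega> in M. X t \<omega> \<in> A)"
proof -
  interpret m: stable_levy M "\<lambda>r \<omega>. - X r \<omega>" \<alpha> b by (rule minus_stable)
  have "distr M borel (\<lambda>\<omega>. - X t \<omega>) = distr M borel (X t)"
    using m.char_X char_X t by (intro Levy_uniqueness m.real_distribution_X real_distribution_X) (auto simp: fun_eq_iff)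
  then show ?thesis using prob_X[OF t A] m.prob_X[OF t A] by simp
qed

lemma X_tail_upper: "0 \<le> t \<Longrightarrow> 0 < x \<Longrightarrow> \<P>(\<omega> in M. x < \<bar>X t \<omega>\<bar>) \<le> 8 * b * t * x powr - \<alpha>"
  using stable_law_tail_upper[OF stable_law_X, of t x] prob_X[of t "{y. x < \<bar>y\<bar>}"] \<alpha> b by simp

text \<open>An atom at 0 would contradict concentration with arbitrarily small
  \<open>e\<close>.\<close>

lemma X_no_atom: "0 < t \<Longrightarrow> AE \<omega> in M. X t \<omega> \<noteq> 0"
proof -
  assume t: "0 < t"
  have "\<P>(\<omega> in M. X t \<omega> = 0) \<le> e" if e: "0 < e" for e
  proof -
    obtain \<rho> where \<rho>: "0 < \<rho>" "\<And>\<nu> t a. 0 < t \<Longrightarrow> stable_law \<alpha> (b * t) \<nu> \<Longrightarrow> measure \<nu> {y. \<bar>y - a\<bar> \<le> \<rho> * t powr (1 / \<alpha>)} \<le> e"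
      by (rule stable_law_concentration[OF \<alpha>(1) b e]) blast
    have "\<P>(\<omega> in M. X t \<omega> = 0) \<le> \<P>(\<omega> in M. X t \<omega> \<in> {y. \<bar>y - 0\<bar> \<le> \<rho> * t powr (1 / \<alpha>)})"
      using t \<rho>(1) by (intro finite_measure_mono) (auto intro!: measurable_Collect_in[where K = borel] meas)
    also have "\<dots> \<le> e" using \<rho>(2)[OF t stable_law_X, of 0] prob_X[of t "{y. \<bar>y - 0\<bar> \<le> \<rho> * t powr (1 / \<alpha>)}"] t by simp
    finally show ?thesis .
  qed
  then have "\<P>(\<omega> in M. X t \<omega> = 0) \<le> 0" by (rule field_le_epsilon[of _ 0, simplified])
  then have "\<P>(\<omega> in M. X t \<omega> = 0) = 0" by (simp add: measure_le_0_iff)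
  then show ?thesis using t by (subst (asm) prob_Collect_eq_0) (auto intro!: measurable_Collect_in[where K = borel, of _ _ "{0}", simplified] meas)
qed

text \<open>The process observed at multiples of \<open>h\<close>. Independence of the infinite
  family of increments is a statement about finite subfamilies, and ties are excluded by the absence
  of an atom at 0.\<close>

lemma walk:
  assumes h: "0 < h"
  shows "sym_walk M (\<lambda>p \<omega>. X (real (Suc p) * h) \<omega> - X (real p * h) \<omega>)"
    and "\<omega> \<in> space M \<Longrightarrow> (\<Sum>p<k. X (real (Suc p) * h) \<omega> - X (real p * h) \<omega>) = X (real k * h) \<omega>"
proof -
  show S: "\<omega> \<in> space M \<Longrightarrow> (\<Sum>p<k. X (real (Suc p) * h) \<omega> - X (real p * h) \<omega>) = X (real k * h) \<omega>" for k \<omega>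
    using sum_lessThan_telescope[of "\<lambda>p. X (real p * h) \<omega>" k] start[of \<omega>] by simp
  have L: "distr M borel (\<lambda>\<omega>. X (real (Suc p) * h) \<omega> - X (real p * h) \<omega>) = distr M borel (X h)" for p
    using increment_law[of "real p * h" "real (Suc p) * h"] h by (simp add: algebra_simps)
  show "sym_walk M (\<lambda>p \<omega>. X (real (Suc p) * h) \<omega> - X (real p * h) \<omega>)"
  proof
    show "indep_vars (\<lambda>_. borel) (\<lambda>p \<omega>. X (real (Suc p) * h) \<omega> - X (real p * h) \<omega>) UNIV"
      unfolding indep_vars_def2
    proof
      show "\<forall>i\<in>UNIV. (\<lambda>\<omega>. X (real (Suc i) * h) \<omega> - X (real i * h) \<omega>) \<in> borel_measurable M"
        using h by (auto intro!: borel_measurable_diff meas)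
      show "indep_sets (\<lambda>i. {(\<lambda>\<omega>. X (real (Suc i) * h) \<omega> - X (real i * h) \<omega>) -` A \<inter> space M |A. A \<in> sets borel}) UNIV"
      proof (subst indep_sets_finite_index_sets, intro allI impI)
        fix J :: "nat set" assume "finite J"
        then obtain k where k: "J \<subseteq> {..<k}" using finite_nat_iff_bounded by blast
        have "indep_vars (\<lambda>_. borel) (\<lambda>p \<omega>. X (real (Suc p) * h) \<omega> - X (real p * h) \<omega>) {..<k}"
          using h by (intro increments_indep) (auto simp: mono_on_def)
        from indep_vars_subset[OF this k]
        show "indep_sets (\<lambda>i. {(\<lambda>\<omega>. X (real (Suc i) * h) \<omega> - X (real i * h) \<omega>) -` A \<inter> space M |A. A \<in> sets borel}) J"
          unfolding indep_vars_def2 by blast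
      qed
    qed
    show "distr M borel (\<lambda>\<omega>. X (real (Suc p) * h) \<omega> - X (real p * h) \<omega>) =
        distr M borel (\<lambda>\<omega>. X (real (Suc 0) * h) \<omega> - X (real 0 * h) \<omega>)" for p
      unfolding L ..
    interpret m: stable_levy M "\<lambda>r \<omega>. - X r \<omega>" \<alpha> b by (rule minus_stable)
    have neg: "distr M borel (\<lambda>\<omega>. - (X (real (Suc 0) * h) \<omega> - X (real 0 * h) \<omega>)) = distr M borel (\<lambda>\<omega>. - X h \<omega>)"
      by (rule distr_cong) (auto simp: start)
    have pos: "distr M borel (\<lambda>\<omega>. X (real (Suc 0) * h) \<omega> - X (real 0 * h) \<omega>) = distr M borel (X h)"
      by (rule L)
    show "distr M borel (\<lambda>\<omega>. - (X (real (Suc 0) * h) \<omega> - X (real 0 * h) \<omega>)) =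
        distr M borel (\<lambda>\<omega>. X (real (Suc 0) * h) \<omega> - X (real 0 * h) \<omega>)"
      unfolding neg pos using m.char_X char_X h
      by (intro Levy_uniqueness m.real_distribution_X real_distribution_X) (auto simp: fun_eq_iff)
    show "AE \<omega> in M. (\<Sum>p<k. X (real (Suc p) * h) \<omega> - X (real p * h) \<omega>) \<noteq> 0" if "0 < k" for k
    proof -
      have "AE \<omega> in M. X (real k * h) \<omega> \<noteq> 0" using X_no_atom[of "real k * h"] h that by simp
      then show ?thesis using AE_space by eventually_elim (simp only: S simp_thms)
    qed
  qed
qed

lemma walk_G:
  assumes h: "0 < h"
  shows "sym_walk.G M (\<lambda>p \<omega>. X (real (Suc p) * h) \<omega> - X (real p * h) \<omega>) N y =
    \<P>(\<omega> in M. \<forall>k\<le>N. X (real k * h) \<omega> \<le> y)"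
proof -
  interpret W: sym_walk M "\<lambda>p \<omega>. X (real (Suc p) * h) \<omega> - X (real p * h) \<omega>"
    "\<lambda>k \<omega>. \<Sum>p<k. X (real (Suc p) * h) \<omega> - X (real p * h) \<omega>" by (rule walk[OF h])
  show ?thesis unfolding W.G_def using walk(2)[OF h] by (intro arg_cong[where f = prob]) auto
qed

lemma prob_pos_half: "0 \<le> t \<Longrightarrow> 0 \<le> x \<Longrightarrow> \<P>(\<omega> in M. x < \<bar>X t \<omega>\<bar>) = 2 * \<P>(\<omega> in M. x < X t \<omega>)"
proof -
  assume t: "0 \<le> t" and x: "0 \<le> x"
  have "\<P>(\<omega> in M. x < \<bar>X t \<omega>\<bar>) = prob ({\<omega>\<in>space M. x < X t \<omega>} \<union> {\<omega>\<in>space M. x < - X t \<omega>})"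
    by (intro arg_cong[where f = prob]) auto
  also have "\<dots> = \<P>(\<omega> in M. x < X t \<omega>) + \<P>(\<omega> in M. x < - X t \<omega>)"
    using t x by (intro finite_measure_Union) (auto intro!: borel_measurable_less meas borel_measurable_uminus)
  also have "\<P>(\<omega> in M. x < - X t \<omega>) = \<P>(\<omega> in M. x < X t \<omega>)"
    using prob_minus_X[OF t, of "{x<..}"] by simp
  finally show ?thesis by simp
qed

text \<open>Levy's inequality on every dyadic grid; twice the one-sided tail at time
  \<open>T\<close> is the two-sided tail, whatever the mesh.\<close>

lemma sup_tail: 
  assumes T: "0 < T" and x: "0 < x"
  shows "1 - surv x T \<le> 8 * b * T * x powr - \<alpha>"
proof -
  have "1 - 8 * b * T * x powr - \<alpha> \<le> surv x T"
  proof (rule surv_ge_dyadic)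
    fix l :: nat
    define h where "h = T / 2 ^ l"
    have h: "0 < h" unfolding h_def using T by simp
    interpret W: sym_walk M "\<lambda>p \<omega>. X (real (Suc p) * h) \<omega> - X (real p * h) \<omega>"
      "\<lambda>k \<omega>. \<Sum>p<k. X (real (Suc p) * h) \<omega> - X (real p * h) \<omega>" by (rule walk[OF h])
    have "1 - W.G (2 ^ l) x \<le> 2 * \<P>(\<omega> in M. x < (\<Sum>p<2 ^ l. X (real (Suc p) * h) \<omega> - X (real p * h) \<omega>))"
      by (rule W.max_inequality)
    also have "\<P>(\<omega> in M. x < (\<Sum>p<2 ^ l. X (real (Suc p) * h) \<omega> - X (real p * h) \<omega>)) = \<P>(\<omega> in M. x < X T \<omega>)"
      using walk(2)[OF h, of _ "2 ^ l"] unfolding h_def by (intro arg_cong[where f = prob]) auto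
    also have "2 * \<P>(\<omega> in M. x < X T \<omega>) \<le> 8 * b * T * x powr - \<alpha>"
      using prob_pos_half[of T x] X_tail_upper[of T x] T x by simp
    finally show "1 - 8 * b * T * x powr - \<alpha> \<le> \<P>(\<omega> in M. \<forall>k\<le>2 ^ l. X (real k * (T / 2 ^ l)) \<omega> \<le> x)"
      unfolding walk_G[OF h] by (simp add: h_def)
  qed (use T in simp)
  then show ?thesis by simp
qed

text \<open>The natural time scale of level \<open>y\<close> is y^\<alpha>. Up to a small multiple
  of it the walk stays below \<open>y\<close> with probability at least 3/4, and
  \<open>G_lower\<close> extends this to \<open>T\<close> at the cost of the square root of the
  ratio of times.\<close>

lemma surv_lower:
  assumes y: "0 < y" and T: "0 < T" and yT: "y powr \<alpha> \<le> T"
  shows "sqrt (min 1 (1 / (64 * b)) / 2) / 16 * (y powr (\<alpha> / 2) / sqrt T) \<le> surv y T"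
proof (rule surv_ge_dyadic)
  fix l :: nat
  define h where "h = T / 2 ^ l"
  have h: "0 < h" unfolding h_def using T by simp
  interpret W: sym_walk M "\<lambda>p \<omega>. X (real (Suc p) * h) \<omega> - X (real p * h) \<omega>"
    "\<lambda>k \<omega>. \<Sum>p<k. X (real (Suc p) * h) \<omega> - X (real p * h) \<omega>" by (rule walk[OF h])
  \<comment> \<open>Chosen so that up to time 2 \<kappa> y^\<alpha> the level \<open>y\<close> is
    passed with probability at most 16 b \<kappa> \<le> 1/4; \<kappa> \<le> 1 keeps
    \<open>N'\<close> within the grid.\<close>
  define \<kappa> where "\<kappa> = min 1 (1 / (64 * b))"
  have \<kappa>: "0 < \<kappa>" "\<kappa> \<le> 1" "\<kappa> \<le> 1 / (64 * b)" unfolding \<kappa>_def using b by auto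
  define N' where "N' = nat \<lfloor>\<kappa> * y powr \<alpha> / h\<rfloor>"
  have ya: "0 < y powr \<alpha>" using y by simp
  have fl: "0 \<le> \<kappa> * y powr \<alpha> / h" using \<kappa> ya h by simp
  have N': "real N' \<le> \<kappa> * y powr \<alpha> / h" "\<kappa> * y powr \<alpha> / h \<le> real N' + 1"
    unfolding N'_def using fl by (auto simp: of_nat_floor)
  have N'h: "real N' * h \<le> \<kappa> * y powr \<alpha>" using N'(1) h by (simp add: field_simps)
  have "\<kappa> * y powr \<alpha> \<le> 1 * T" using \<kappa> yT ya by (intro mult_mono) auto
  then have "real N' * h \<le> T" using N'h by linarith
  then have "real N' \<le> T / h" using h by (simp add: field_simps)
  also have "T / h = 2 ^ l" unfolding h_def using T by simp
  finally have N'N: "N' \<le> 2 ^ l" by (metis of_nat_le_iff of_nat_numeral of_nat_power)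
  have "1 - W.G (2 * N') y \<le> 1 / 4"
  \<comment> \<open>If the mesh is coarser than the time scale of \<open>y\<close>, only the
    starting point has to be examined.\<close>
  proof (cases "N' = 0")
    case True
    then have "{\<omega>\<in>space M. \<forall>k\<le>2 * N'. X (real k * h) \<omega> \<le> y} = space M" using y start by auto
    then show ?thesis unfolding walk_G[OF h] using prob_space by simp
  next
    case False
    define t where "t = real (2 * N') * h"
    have t: "0 < t" unfolding t_def using False h by simp
    have "1 - W.G (2 * N') y \<le> 2 * \<P>(\<omega> in M. y < (\<Sum>p<2 * N'. X (real (Suc p) * h) \<omega> - X (real p * h) \<omega>))"
      by (rule W.max_inequality)
    also have "\<P>(\<omega> in M. y < (\<Sum>p<2 * N'. X (real (Suc p) * h) \<omega> - X (real p * h) \<omega>)) = \<P>(\<omega> in M. y < X t \<omega>)"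
      using walk(2)[OF h, of _ "2 * N'"] unfolding t_def by (intro arg_cong[where f = prob]) auto
    also have "2 * \<P>(\<omega> in M. y < X t \<omega>) \<le> 8 * b * t * y powr - \<alpha>"
      using prob_pos_half[of t y] X_tail_upper[of t y] t y by simp
    also have "\<dots> \<le> 8 * b * (2 * (1 / (64 * b) * y powr \<alpha>)) * y powr - \<alpha>"
    proof -
      have "t \<le> 2 * (\<kappa> * y powr \<alpha>)" unfolding t_def using N'h by simp
      also have "\<dots> \<le> 2 * (1 / (64 * b) * y powr \<alpha>)" using \<kappa> ya by (intro mult_left_mono mult_right_mono) auto
      finally show ?thesis using b by (intro mult_right_mono mult_left_mono) auto
    qed
    also have "\<dots> = 1 / 4" using b y by (simp add: powr_minus)
    finally show ?thesis .
  qed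
  then have "sqrt ((real N' + 1) / (real (2 ^ l) + 1)) / 16 \<le> W.G (2 ^ l) y"
    by (intro W.G_lower N'N) simp
  moreover have "sqrt (\<kappa> / 2) * (y powr (\<alpha> / 2) / sqrt T) \<le> sqrt ((real N' + 1) / (real (2 ^ l) + 1))"
  proof -
    have "sqrt (\<kappa> / 2) * (y powr (\<alpha> / 2) / sqrt T) = sqrt (\<kappa> / 2 * y powr \<alpha> / T)"
      using y by (simp add: real_sqrt_mult real_sqrt_divide powr_half_sqrt[symmetric] powr_powr)
    also have "\<kappa> / 2 * y powr \<alpha> / T = (\<kappa> * y powr \<alpha> / h) / (2 * 2 ^ l)"
      unfolding h_def using T by (simp add: field_simps)
    also have "\<dots> \<le> (real N' + 1) / (real (2 ^ l) + 1)"
    proof (rule frac_le)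
      show "0 < real (2 ^ l) + 1" by (rule add_nonneg_pos) auto
    qed (use N'(2) fl in auto)
    finally show ?thesis by simp
  qed
  ultimately show "sqrt (min 1 (1 / (64 * b)) / 2) / 16 * (y powr (\<alpha> / 2) / sqrt T) \<le> \<P>(\<omega> in M. \<forall>k\<le>2 ^ l. X (real k * (T / 2 ^ l)) \<omega> \<le> y)"
    unfolding walk_G[OF h] by (simp add: h_def \<kappa>_def)
qed (use T in simp)

text \<open>With a step \<open>h\<close> of order y^\<alpha>, a single step exceeds \<open>y\<close>
  with probability at least 1/4, so \<open>G_upper\<close> with \<open>N' = 1\<close> bounds
  survival over about \<open>T / h\<close> steps by a multiple of
  \<open>sqrt (h / T)\<close>.\<close>

lemma surv_upper:
  obtains C where "0 < C" "\<And>y T. 0 < y \<Longrightarrow> 0 < T \<Longrightarrow> surv y T \<le> C * (y powr (\<alpha> / 2) / sqrt T)"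
proof -
  obtain \<rho> where \<rho>: "0 < \<rho>" "\<And>\<nu> t a. 0 < t \<Longrightarrow> stable_law \<alpha> (b * t) \<nu> \<Longrightarrow> measure \<nu> {y. \<bar>y - a\<bar> \<le> \<rho> * t powr (1 / \<alpha>)} \<le> 1 / 2"
    by (rule stable_law_concentration[OF \<alpha>(1) b, of "1 / 2"]) (simp, blast)
  define C where "C = 8 * sqrt 2 * \<rho> powr - (\<alpha> / 2)"
  show thesis
  proof (rule that[of C])
    show "0 < C" unfolding C_def using \<rho> by simp
    fix y T :: real assume y: "0 < y" and T: "0 < T"
    define h where "h = (y / \<rho>) powr \<alpha>"
    have h: "0 < h" unfolding h_def using y \<rho> by simp
    interpret W: sym_walk M "\<lambda>p \<omega>. X (real (Suc p) * h) \<omega> - X (real p * h) \<omega>"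
      "\<lambda>k \<omega>. \<Sum>p<k. X (real (Suc p) * h) \<omega> - X (real p * h) \<omega>" by (rule walk[OF h])
    have "\<rho> * h powr (1 / \<alpha>) = y" unfolding h_def using \<alpha> y \<rho> by (simp add: powr_powr)
    then have "\<P>(\<omega> in M. \<not> y < \<bar>X h \<omega>\<bar>) \<le> 1 / 2"
      using \<rho>(2)[OF h stable_law_X, of 0] prob_X[of h "{z. \<bar>z\<bar> \<le> y}"] h by (simp add: not_less)
    then have "1 / 2 \<le> \<P>(\<omega> in M. y < \<bar>X h \<omega>\<bar>)"
      using h by (subst (asm) prob_neg) (auto intro!: borel_measurable_less meas borel_measurable_abs)
    then have "1 / 4 \<le> \<P>(\<omega> in M. y < X h \<omega>)" using prob_pos_half[of h y] h y by simp
    also have "\<dots> \<le> \<P>(\<omega> in M. \<not> (\<forall>k\<le>1. X (real k * h) \<omega> \<le> y))"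
      using h by (intro finite_measure_mono) (auto intro!: exI[of _ 1] sets.sets_Collect_neg sets.sets_Collect_finite_All borel_measurable_le meas)
    also have "\<dots> = 1 - W.G 1 y"
      unfolding walk_G[OF h] using h by (intro prob_neg) (auto intro!: sets.sets_Collect_finite_All borel_measurable_le meas)
    finally have G1: "1 / 4 \<le> 1 - W.G 1 y" .
    define N where "N = nat \<lfloor>T / h\<rfloor>"
    have Th: "0 \<le> T / h" using T h by simp
    have N: "real N \<le> T / h" "T / h \<le> real N + 1"
      unfolding N_def using Th by (auto simp: of_nat_floor)
    have "surv y T \<le> W.G N y"
      unfolding surv_def walk_G[OF h]
    proof (intro finite_measure_mono subsetI CollectI conjI allI impI)
      fix \<omega> k assume \<omega>: "\<omega> \<in> {\<omega>\<in>space M. \<forall>t\<in>{0..T}. X t \<omega> \<le> y}" and k: "k \<le> N"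
      have "real k * h \<le> real N * h" using k h by simp
      also have "\<dots> \<le> T" using N(1) h by (simp add: field_simps)
      finally show "X (real k * h) \<omega> \<le> y" using \<omega> h by auto
    next
      show "{\<omega>\<in>space M. \<forall>k\<le>N. X (real k * h) \<omega> \<le> y} \<in> events"
        using h by (auto intro!: sets.sets_Collect_finite_All borel_measurable_le meas)
    qed auto
    moreover have "W.G N y * (1 / 4) \<le> W.G N y * (1 - W.G 1 y)"
      by (rule mult_left_mono[OF G1]) (simp only: W.G_def measure_nonneg)
    moreover have "W.G N y * (1 - W.G 1 y) \<le> 2 * sqrt 2 / sqrt (real N + 1)"
      using W.G_upper[of N y 1] by simp
    ultimately have "surv y T \<le> 8 * sqrt 2 / sqrt (real N + 1)" by simp
    also have "\<dots> \<le> 8 * sqrt 2 / sqrt (T / h)"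
      using N(2) T h by (intro divide_left_mono) auto
    also have "\<dots> = 8 * sqrt 2 * sqrt h / sqrt T" by (simp add: real_sqrt_divide)
    also have "sqrt h = y powr (\<alpha> / 2) * \<rho> powr - (\<alpha> / 2)"
      unfolding h_def using y \<rho> by (simp add: powr_half_sqrt[symmetric] powr_powr powr_divide powr_minus field_simps)
    finally show "surv y T \<le> C * (y powr (\<alpha> / 2) / sqrt T)" by (simp add: C_def mult_ac)
  qed
qed

lemma surv_scale:
  assumes a: "0 < a" and T: "0 \<le> T"
  shows "surv y (a * T) = surv (y * a powr - (1 / \<alpha>)) T"
proof -
  define c where "c = a powr - (1 / \<alpha>)"
  have c: "0 < c" unfolding c_def using a by simp
  have "c powr \<alpha> = a powr - 1" unfolding c_def powr_powr using \<alpha> by simp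
  then have "\<bar>c\<bar> powr \<alpha> * a = 1" using a c by (simp add: powr_minus)
  then have S: "stable_levy M (\<lambda>r \<omega>. c * X (a * r) \<omega>) \<alpha> b" by (rule scale_stable[OF a])
  then interpret S: stable_levy M "\<lambda>r \<omega>. c * X (a * r) \<omega>" \<alpha> b .
  have "surv (y * c) T = S.surv (y * c) T"
    unfolding surv_law[OF T] S.surv_law[OF T] stable_traj_law[OF stable_levy_axioms S] ..
  also have "\<dots> = surv y (a * T)"
    unfolding surv_def S.surv_def
  proof (intro arg_cong[where f = prob] Collect_cong conj_cong refl)
    fix \<omega>
    show "(\<forall>t\<in>{0..T}. c * X (a * t) \<omega> \<le> y * c) \<longleftrightarrow> (\<forall>t\<in>{0..a * T}. X t \<omega> \<le> y)"
    proof (intro iffI ballI)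
      fix t assume *: "\<forall>t\<in>{0..T}. c * X (a * t) \<omega> \<le> y * c" "t \<in> {0..a * T}"
      then have "t / a \<in> {0..T}" using a by (auto simp: field_simps)
      with * have "c * X (a * (t / a)) \<omega> \<le> y * c" by blast
      then show "X t \<omega> \<le> y" using a c by (simp add: mult.commute)
    next
      fix t assume *: "\<forall>t\<in>{0..a * T}. X t \<omega> \<le> y" "t \<in> {0..T}"
      then have "a * t \<in> {0..a * T}" using a by auto
      with * have "X (a * t) \<omega> \<le> y" by blast
      then show "c * X (a * t) \<omega> \<le> y * c" using c by (simp add: mult.commute)
    qed
  qed
  finally show ?thesis by (simp add: c_def)
qed

end

section \<open>The Markov property with side information\<close>

lemma (in prob_space) indep_pair_trivial:
  fixes c :: 'c
  assumes "Y \<in> M \<rightarrow>\<^sub>M T"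
  shows "indep_pair (count_space UNIV) (\<lambda>_. c) T Y"
  unfolding indep_pair_def
proof (intro conjI ballI)
  fix A :: "'c set" and B
  show "prob ((\<lambda>_. c) -` A \<inter> space M \<inter> (Y -` B \<inter> space M)) = prob ((\<lambda>_. c) -` A \<inter> space M) * prob (Y -` B \<inter> space M)"
    by (cases "c \<in> A") (auto simp: prob_space intro!: arg_cong[where f = prob])
qed (use assms in auto)

context levy
begin

text \<open>The natural filtration enlarged by \<open>V\<close>. A constant \<open>V\<close> gives
  the plain past; for several processes \<open>V\<close> consists of the complete paths of the other
  coordinates.\<close>

definition past :: "'s measure \<Rightarrow> ('a \<Rightarrow> 's) \<Rightarrow> real \<Rightarrow> 'a measure" where
  "past S V s = vimage_algebra (space M) (\<lambda>\<omega>. (V \<omega>, \<lambda>t\<in>{0..s}. X t \<omega>)) (S \<Otimes>\<^sub>M (\<Pi>\<^sub>M t\<in>{0..s}. borel))"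

lemma space_past [simp]: "space (past S V s) = space M"
  by (simp add: past_def)

lemma past_V:
  assumes V: "V \<in> M \<rightarrow>\<^sub>M S"
  shows "(\<lambda>\<omega>. (V \<omega>, \<lambda>t\<in>{0..s}. X t \<omega>)) \<in> past S V s \<rightarrow>\<^sub>M S \<Otimes>\<^sub>M (\<Pi>\<^sub>M t\<in>{0..s}. borel)"
  unfolding past_def
proof (rule measurable_vimage_algebra1)
  have "(\<lambda>\<omega>. \<lambda>t\<in>{0..s}. X t \<omega>) \<in> M \<rightarrow>\<^sub>M (\<Pi>\<^sub>M t\<in>{0..s}. borel)" by (intro measurable_restrict) auto
  then have "(\<lambda>\<omega>. (V \<omega>, \<lambda>t\<in>{0..s}. X t \<omega>)) \<in> M \<rightarrow>\<^sub>M S \<Otimes>\<^sub>M (\<Pi>\<^sub>M t\<in>{0..s}. borel)" using V by simp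
  then show "(\<lambda>\<omega>. (V \<omega>, \<lambda>t\<in>{0..s}. X t \<omega>)) \<in> space M \<rightarrow> space (S \<Otimes>\<^sub>M (\<Pi>\<^sub>M t\<in>{0..s}. borel))"
    by (auto dest: measurable_space)
qed

lemma past_measurable_V: "V \<in> M \<rightarrow>\<^sub>M S \<Longrightarrow> V \<in> past S V s \<rightarrow>\<^sub>M S"
  using measurable_compose[OF past_V measurable_fst] by simp

lemma past_measurable_X:
  assumes "V \<in> M \<rightarrow>\<^sub>M S" "0 \<le> t" "t \<le> s"
  shows "X t \<in> borel_measurable (past S V s)"
proof -
  have "(\<lambda>p. p t) \<in> (\<Pi>\<^sub>M t\<in>{0..s}. borel) \<rightarrow>\<^sub>M borel" using assms by (intro measurable_component_singleton) auto
  from measurable_compose[OF measurable_compose[OF past_V[OF assms(1), of s] measurable_snd] this]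
  show ?thesis using assms by simp
qed

text \<open>\<open>V\<close> is independent of the pair (past, future), and past and future are
  independent of each other; regrouping gives independence of (\<open>V\<close>, past) from the
  future.\<close>

lemma past_future_indep':
  assumes V: "indep_pair S V paths (traj X)" and s: "0 \<le> s"
  shows "indep_pair (past S V s) (\<lambda>\<omega>. \<omega>) paths (traj (\<lambda>r \<omega>. X (s + r) \<omega> - X s \<omega>))"
  unfolding past_def
proof (rule indep_pair_vimage_algebra, rule indep_pair_assoc)
  let ?P = "\<Pi>\<^sub>M t\<in>{0..s}. (borel :: real measure)"
  let ?g = "\<lambda>p :: real \<Rightarrow> real. (\<lambda>t\<in>{0..s}. p t, \<lambda>r\<in>{0..}. p (s + r) - p s)"
  show "indep_pair ?P (\<lambda>\<omega>. \<lambda>t\<in>{0..s}. X t \<omega>) paths (traj (\<lambda>r \<omega>. X (s + r) \<omega> - X s \<omega>))"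
    by (rule indep_var_imp_indep_pair) (rule past_future_indep[OF s])
  have "?g \<in> paths \<rightarrow>\<^sub>M ?P \<Otimes>\<^sub>M paths"
    using s by (intro measurable_Pair measurable_restrict borel_measurable_diff measurable_component_singleton) auto
  from indep_pair_compose[OF V measurable_ident this]
  show "indep_pair S V (?P \<Otimes>\<^sub>M paths) (\<lambda>\<omega>. (\<lambda>t\<in>{0..s}. X t \<omega>, traj (\<lambda>r \<omega>. X (s + r) \<omega> - X s \<omega>) \<omega>))"
    using s by (simp add: traj_def restrict_def if_distrib cong: if_cong)
qed

end

context stable_levy
begin

text \<open>The increments after \<open>s\<close> are independent of \<open>past S V s\<close> and
  have the path law of \<open>X\<close>, so the past may be frozen and a second copy
  integrated.\<close>

lemma markov:
  assumes V: "indep_pair S V paths (traj X)" and s: "0 \<le> s"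
    and F: "case_prod F \<in> borel_measurable (past S V s \<Otimes>\<^sub>M paths)"
  shows "(\<integral>\<^sup>+\<omega>. F \<omega> (traj (\<lambda>r \<omega>. X (s + r) \<omega> - X s \<omega>) \<omega>) \<partial>M) = (\<integral>\<^sup>+\<omega>. (\<integral>\<^sup>+\<omega>'. F \<omega> (traj X \<omega>') \<partial>M) \<partial>M)"
proof -
  have "(\<integral>\<^sup>+\<omega>. F \<omega> (traj (\<lambda>r \<omega>. X (s + r) \<omega> - X s \<omega>) \<omega>) \<partial>M) =
      (\<integral>\<^sup>+\<omega>. (\<integral>\<^sup>+p. F \<omega> p \<partial>distr M paths (traj X)) \<partial>M)"
    unfolding nn_integral_freeze[OF past_future_indep'[OF V s] F]
      stable_traj_law[OF shift_stable[OF s] stable_levy_axioms] ..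
  also have "\<dots> = (\<integral>\<^sup>+\<omega>. (\<integral>\<^sup>+\<omega>'. F \<omega> (traj X \<omega>') \<partial>M) \<partial>M)"
  proof (rule nn_integral_cong)
    fix \<omega> assume "\<omega> \<in> space M"
    then have "F \<omega> \<in> borel_measurable paths" using measurable_Pair2[OF F, of \<omega>] by simp
    then show "(\<integral>\<^sup>+p. F \<omega> p \<partial>distr M paths (traj X)) = (\<integral>\<^sup>+\<omega>'. F \<omega> (traj X \<omega>') \<partial>M)"
      by (intro nn_integral_distr) auto
  qed
  finally show ?thesis .
qed

lemma nn_integral_stays_below:
  "0 \<le> T \<Longrightarrow> (\<integral>\<^sup>+\<omega>. indicator {p. stays_below y T p} (traj X \<omega>) \<partial>M) = ennreal (surv y T)"
proof -
  assume T: "0 \<le> T"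
  have "(\<integral>\<^sup>+\<omega>. indicator {p. stays_below y T p} (traj X \<omega>) \<partial>M) =
      (\<integral>\<^sup>+\<omega>. indicator {\<omega>\<in>space M. \<forall>t\<in>{0..T}. X t \<omega> \<le> y} \<omega> \<partial>M)"
    by (rule nn_integral_cong) (auto simp: stays_below_traj[OF _ T] split: split_indicator)
  also have "\<dots> = ennreal (surv y T)"
    unfolding surv_def using T by (simp add: emeasure_eq_measure)
  finally show ?thesis .
qed

text \<open>Given the path up to \<open>t\<close>, survival until \<open>t + T\<close> requires the
  fresh path to stay below \<open>y - X t\<close> for a time \<open>T\<close>. The indicators are
  written over dyadic times to be measurable jointly in past and future.\<close>

lemma surv_markov:
  assumes t: "0 \<le> t" and T: "0 \<le> T"
  shows "(\<integral>\<^sup>+\<omega>. indicator {\<omega>\<in>space M. \<forall>r\<in>{0..t}. X r \<omega> \<le> y} \<omega> * ennreal (surv (y - X t \<omega>) T) \<partial>M) = ennreal (surv y (t + T))"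
proof -
  let ?S = "count_space UNIV :: unit measure" and ?V = "\<lambda>_::'a. ()"
  have V: "indep_pair ?S ?V paths (traj X)" by (rule indep_pair_trivial) simp
  have Vm: "?V \<in> M \<rightarrow>\<^sub>M ?S" by simp
  let ?N = "past ?S ?V t"
  let ?A = "{\<omega>\<in>space M. \<forall>r\<in>{0..t}. X r \<omega> \<le> y}"
  define F :: "'a \<Rightarrow> (real \<Rightarrow> real) \<Rightarrow> ennreal" where
    "F = (\<lambda>\<omega> p. indicator ?A \<omega> * indicator {p. stays_below (y - X t \<omega>) T p} p)"
  have Xm: "X r \<in> borel_measurable ?N" if "0 \<le> r" "r \<le> t" for r
    using past_measurable_X[OF Vm that] .
  have gm: "Measurable.pred ?N (\<lambda>\<omega>. X (real k * (t / 2 ^ l)) \<omega> \<le> y)" if "k \<le> 2 ^ l" for k l :: nat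
  proof -
    have "X (real k * (t / 2 ^ l)) \<in> borel_measurable ?N" using t that by (intro Xm dyadic_point_le) auto
    then show ?thesis unfolding pred_def by (rule borel_measurable_le) simp
  qed
  have "?A = {\<omega>\<in>space ?N. \<forall>l. \<forall>k\<in>{..2 ^ l}. X (real (k::nat) * (t / 2 ^ l)) \<omega> \<le> y}"
    using stays_below_traj[OF _ t, of _ y] t by (auto simp: stays_below_def traj_def)
  also have "\<dots> \<in> sets ?N"
    using gm by (intro sets.sets_Collect_countable_All sets.sets_Collect_finite_All) (auto simp: pred_def)
  finally have A: "?A \<in> sets ?N" .
  have pm: "(\<lambda>z. snd z (real k * (T / 2 ^ l))) \<in> borel_measurable (?N \<Otimes>\<^sub>M paths)" for k l :: nat
    using T by (intro measurable_compose[OF measurable_snd] measurable_component_singleton) auto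
  have xm: "(\<lambda>z. y - X t (fst z)) \<in> borel_measurable (?N \<Otimes>\<^sub>M paths)"
    using t by (intro borel_measurable_diff measurable_compose[OF measurable_fst Xm]) auto
  have B: "{z\<in>space (?N \<Otimes>\<^sub>M paths). \<forall>l. \<forall>k\<in>{..2 ^ l}. snd z (real (k::nat) * (T / 2 ^ l)) \<le> y - X t (fst z)} \<in> sets (?N \<Otimes>\<^sub>M paths)"
    by (intro sets.sets_Collect_countable_All sets.sets_Collect_finite_All borel_measurable_le pm xm) auto
  have "case_prod F = (\<lambda>z. indicator ?A (fst z) * indicator {z. stays_below (y - X t (fst z)) T (snd z)} z)"
    by (auto simp: F_def fun_eq_iff split: split_indicator)
  also have "\<dots> \<in> borel_measurable (?N \<Otimes>\<^sub>M paths)"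
  proof (intro borel_measurable_times_ennreal)
    show "(\<lambda>z. indicator ?A (fst z)) \<in> borel_measurable (?N \<Otimes>\<^sub>M paths)"
      by (rule measurable_compose[OF measurable_fst borel_measurable_indicator[OF A]])
    show "indicator {z. stays_below (y - X t (fst z)) T (snd z)} \<in> borel_measurable (?N \<Otimes>\<^sub>M paths)"
    proof (rule measurable_cong[THEN iffD2, OF _ borel_measurable_indicator[OF B]])
      fix z assume "z \<in> space (?N \<Otimes>\<^sub>M paths)"
      then show "indicator {z. stays_below (y - X t (fst z)) T (snd z)} z =
          indicator {z\<in>space (?N \<Otimes>\<^sub>M paths). \<forall>l. \<forall>k\<in>{..2 ^ l}. snd z (real (k::nat) * (T / 2 ^ l)) \<le> y - X t (fst z)} z"
        by (simp only: indicator_def mem_Collect_eq stays_below_def Ball_def atMost_iff simp_thms)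
    qed
  qed
  finally have Fm: "case_prod F \<in> borel_measurable (?N \<Otimes>\<^sub>M paths)" .
  have "(\<integral>\<^sup>+\<omega>. indicator ?A \<omega> * ennreal (surv (y - X t \<omega>) T) \<partial>M) = (\<integral>\<^sup>+\<omega>. (\<integral>\<^sup>+\<omega>'. F \<omega> (traj X \<omega>') \<partial>M) \<partial>M)"
  proof (rule nn_integral_cong)
    fix \<omega> assume "\<omega> \<in> space M"
    show "indicator ?A \<omega> * ennreal (surv (y - X t \<omega>) T) = (\<integral>\<^sup>+\<omega>'. F \<omega> (traj X \<omega>') \<partial>M)"
      unfolding F_def nn_integral_stays_below[OF T, symmetric]
      by (cases "\<omega> \<in> ?A") auto
  qed
  also have "\<dots> = (\<integral>\<^sup>+\<omega>. F \<omega> (traj (\<lambda>r \<omega>. X (t + r) \<omega> - X t \<omega>) \<omega>) \<partial>M)"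
    by (rule markov[OF V t Fm, symmetric])
  also have "\<dots> = (\<integral>\<^sup>+\<omega>. indicator {\<omega>\<in>space M. \<forall>r\<in>{0..t + T}. X r \<omega> \<le> y} \<omega> \<partial>M)"
  proof (rule nn_integral_cong)
    fix \<omega> assume \<omega>: "\<omega> \<in> space M"
    interpret S: levy M "\<lambda>r \<omega>. X (t + r) \<omega> - X t \<omega>" by (rule shift_levy[OF t])
    have "(\<forall>r\<in>{0..t}. X r \<omega> \<le> y) \<and> (\<forall>r\<in>{0..T}. X (t + r) \<omega> - X t \<omega> \<le> y - X t \<omega>) \<longleftrightarrow> (\<forall>r\<in>{0..t + T}. X r \<omega> \<le> y)"
    proof (intro iffI conjI ballI)
      fix r assume *: "(\<forall>r\<in>{0..t}. X r \<omega> \<le> y) \<and> (\<forall>r\<in>{0..T}. X (t + r) \<omega> - X t \<omega> \<le> y - X t \<omega>)" "r \<in> {0..t + T}"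
      show "X r \<omega> \<le> y"
      proof (cases "r \<le> t")
        case False
        then have "r - t \<in> {0..T}" using * by auto
        with * have "X (t + (r - t)) \<omega> - X t \<omega> \<le> y - X t \<omega>" by blast
        then show ?thesis by simp
      qed (use * in auto)
    qed (use t T in auto)
    then show "F \<omega> (traj (\<lambda>r \<omega>. X (t + r) \<omega> - X t \<omega>) \<omega>) = indicator {\<omega>\<in>space M. \<forall>r\<in>{0..t + T}. X r \<omega> \<le> y} \<omega>"
      using S.stays_below_traj[OF \<omega> T, of "y - X t \<omega>"] \<omega> by (auto simp: F_def split: split_indicator)
  qed
  also have "\<dots> = ennreal (surv y (t + T))"
    unfolding surv_def using t T by (simp add: emeasure_eq_measure)
  finally show ?thesis .
qed

section \<open>Powers of the distance to the level as supermartingales\<close>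

lemma surv_borel: "(\<lambda>y. surv y 1) \<in> borel_measurable borel"
  by (intro borel_measurable_mono monoI surv_mono) auto

lemma surv_scale1:
  assumes "0 < s"
  shows "surv (z * s) 1 = surv z (s powr - \<alpha>)"
proof -
  have "(s powr - \<alpha>) powr - (1 / \<alpha>) = s" using assms \<alpha> by (simp add: powr_powr)
  then show ?thesis using surv_scale[of "s powr - \<alpha>" 1 z] assms by simp
qed

text \<open>A Mellin-type transform of the survival probability. Level \<open>z * s\<close> at
  horizon 1 is level \<open>z\<close> at horizon s^(-\<alpha>), so this is a mixture over
  horizons.\<close>

definition mix :: "real \<Rightarrow> real \<Rightarrow> ennreal" where
  "mix \<beta> z = (\<integral>\<^sup>+s. ennreal (surv (z * s) 1) * ennreal (s powr (- \<beta> - 1)) * indicator {0<..} s \<partial>lborel)"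

text \<open>Substituting \<open>z * s\<close> for \<open>s\<close> extracts z^\<beta>; the weight
  has exactly the homogeneity that makes \<open>mix\<close> a pure power.\<close>

lemma mix_scale:
  assumes z: "0 < z"
  shows "mix \<beta> z = ennreal (z powr \<beta>) * mix \<beta> 1"
proof -
  have [measurable]: "(\<lambda>y. surv y 1) \<in> borel_measurable borel" by (rule surv_borel)
  have "mix \<beta> 1 = (\<integral>\<^sup>+s. ennreal (surv s 1) * ennreal (s powr (- \<beta> - 1)) * indicator {0<..} s \<partial>lborel)"
    by (simp add: mix_def)
  also have "\<dots> = ennreal \<bar>z\<bar> * (\<integral>\<^sup>+s. ennreal (surv (0 + z * s) 1) * ennreal ((0 + z * s) powr (- \<beta> - 1)) * indicator {0<..} (0 + z * s) \<partial>lborel)"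
    using z by (subst nn_integral_real_affine[of _ z 0]) auto
  also have "\<dots> = (\<integral>\<^sup>+s. ennreal (z powr - \<beta>) * (ennreal (surv (z * s) 1) * ennreal (s powr (- \<beta> - 1)) * indicator {0<..} s) \<partial>lborel)"
  proof (subst nn_integral_cmult[symmetric], simp, rule nn_integral_cong)
    fix s :: real
    show "ennreal \<bar>z\<bar> * (ennreal (surv (0 + z * s) 1) * ennreal ((0 + z * s) powr (- \<beta> - 1)) * indicator {0<..} (0 + z * s)) =
      ennreal (z powr - \<beta>) * (ennreal (surv (z * s) 1) * ennreal (s powr (- \<beta> - 1)) * indicator {0<..} s)"
    proof (cases "0 < s")
      case True
      have "z * ((z * s) powr (- \<beta> - 1)) = z powr - \<beta> * s powr (- \<beta> - 1)"
        using z True by (simp add: powr_mult powr_diff powr_minus)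
      then have "ennreal z * ennreal ((z * s) powr (- \<beta> - 1)) = ennreal (z powr - \<beta>) * ennreal (s powr (- \<beta> - 1))"
        using z by (simp add: ennreal_mult[symmetric])
      then have "ennreal (surv (z * s) 1) * (ennreal z * ennreal ((z * s) powr (- \<beta> - 1))) =
          ennreal (surv (z * s) 1) * (ennreal (z powr - \<beta>) * ennreal (s powr (- \<beta> - 1)))" by simp
      then have "ennreal z * (ennreal (surv (z * s) 1) * ennreal ((z * s) powr (- \<beta> - 1))) =
          ennreal (z powr - \<beta>) * (ennreal (surv (z * s) 1) * ennreal (s powr (- \<beta> - 1)))"
        by (simp only: mult.left_commute)
      then show ?thesis using z True by simp
    qed (use z in \<open>auto simp: zero_less_mult_iff\<close>)
  qed
  also have "\<dots> = ennreal (z powr - \<beta>) * mix \<beta> z"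
    unfolding mix_def by (rule nn_integral_cmult) simp
  finally have "ennreal (z powr \<beta>) * mix \<beta> 1 = ennreal (z powr \<beta>) * (ennreal (z powr - \<beta>) * mix \<beta> z)" by simp
  also have "\<dots> = ennreal (z powr \<beta> * z powr - \<beta>) * mix \<beta> z"
    by (simp add: ennreal_mult mult.assoc)
  also have "z powr \<beta> * z powr - \<beta> = 1" using z by (simp add: powr_minus)
  finally show ?thesis by simp
qed

text \<open>Near 0 the bound s^(\<alpha>/2) on survival requires \<beta> < \<alpha>/2; near infinity
  survival is at most 1, which requires \<beta> > 0.\<close>

lemma mix_finite:
  assumes \<beta>: "0 < \<beta>" "\<beta> < \<alpha> / 2"
  shows "mix \<beta> 1 < \<top>"
proof -
  obtain C where C: "0 < C" "\<And>y T. 0 < y \<Longrightarrow> 0 < T \<Longrightarrow> surv y T \<le> C * (y powr (\<alpha> / 2) / sqrt T)"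
    by (rule surv_upper) blast
  have "mix \<beta> 1 \<le> (\<integral>\<^sup>+s. ennreal C * (ennreal (s powr (\<alpha> / 2 - \<beta> - 1)) * indicator {0..1} s) +
      ennreal (s powr (- \<beta> - 1)) * indicator {1..} s \<partial>lborel)"
    unfolding mix_def
  proof (rule nn_integral_mono)
    fix s :: real
    show "ennreal (surv (1 * s) 1) * ennreal (s powr (- \<beta> - 1)) * indicator {0<..} s \<le>
      ennreal C * (ennreal (s powr (\<alpha> / 2 - \<beta> - 1)) * indicator {0..1} s) + ennreal (s powr (- \<beta> - 1)) * indicator {1..} s"
    proof -
      consider "s \<le> 0" | "0 < s" "s \<le> 1" | "1 < s" by linarith
      then show ?thesis
      proof cases
        case 2
        have "surv s 1 * s powr (- \<beta> - 1) \<le> C * s powr (\<alpha> / 2) * s powr (- \<beta> - 1)"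
          using C(2)[OF 2(1), of 1] by (intro mult_right_mono) auto
        also have "\<dots> = C * s powr (\<alpha> / 2 + (- \<beta> - 1))" by (simp only: mult.assoc powr_add)
        also have "\<alpha> / 2 + (- \<beta> - 1) = \<alpha> / 2 - \<beta> - 1" by simp
        finally have "ennreal (surv s 1) * ennreal (s powr (- \<beta> - 1)) \<le> ennreal C * ennreal (s powr (\<alpha> / 2 - \<beta> - 1))"
          using C(1) by (simp add: ennreal_mult[symmetric] surv_nonneg ennreal_leI)
        then show ?thesis using 2 by (simp add: add_increasing2)
      next
        case 3
        have "ennreal (surv s 1) * ennreal (s powr (- \<beta> - 1)) \<le> 1 * ennreal (s powr (- \<beta> - 1))"
          using surv_le_1[of s 1] by (intro mult_right_mono) (auto simp: ennreal_le_1)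
        then show ?thesis using 3 by simp
      qed simp
    qed
  qed
  also have "\<dots> = ennreal C * (\<integral>\<^sup>+s. ennreal (s powr (\<alpha> / 2 - \<beta> - 1)) * indicator {0..1} s \<partial>lborel) +
      (\<integral>\<^sup>+s. ennreal (s powr (- \<beta> - 1)) * indicator {1..} s \<partial>lborel)"
    by (subst nn_integral_add) (auto simp: nn_integral_cmult)
  also have "(\<integral>\<^sup>+s. ennreal (s powr (\<alpha> / 2 - \<beta> - 1)) * indicator {0..1} s \<partial>lborel) =
      ennreal (1 powr (\<alpha> / 2 - \<beta> - 1 + 1) / (\<alpha> / 2 - \<beta> - 1 + 1))"
    using \<beta> by (intro nn_integral_has_integral_lebesgue' has_integral_powr_from_0) auto
  also have "(\<integral>\<^sup>+s. ennreal (s powr (- \<beta> - 1)) * indicator {1..} s \<partial>lborel) =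
      ennreal (- (1 powr (- \<beta> - 1 + 1)) / (- \<beta> - 1 + 1))"
    using \<beta> by (intro nn_integral_has_integral_lebesgue' has_integral_powr_to_inf) auto
  also have "ennreal C * ennreal (1 powr (\<alpha> / 2 - \<beta> - 1 + 1) / (\<alpha> / 2 - \<beta> - 1 + 1)) + ennreal (- (1 powr (- \<beta> - 1 + 1)) / (- \<beta> - 1 + 1)) =
      ennreal (C * (1 / (\<alpha> / 2 - \<beta>)) + 1 / \<beta>)"
    using C(1) \<beta> by (simp add: ennreal_mult[symmetric] ennreal_plus[symmetric] del: ennreal_plus)
  also have "\<dots> < \<top>" by simp
  finally show ?thesis .
qed

text \<open>Allows cancelling this constant; survival is positive on (0, 1] by
  \<open>surv_lower\<close>.\<close>

lemma mix_pos: "mix \<beta> 1 \<noteq> 0"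
proof
  have [measurable]: "(\<lambda>y. surv y 1) \<in> borel_measurable borel" by (rule surv_borel)
  assume "mix \<beta> 1 = 0"
  then have "AE s in lborel. ennreal (surv (1 * s) 1) * ennreal (s powr (- \<beta> - 1)) * indicator {0<..} s = 0"
    unfolding mix_def by (subst (asm) nn_integral_0_iff_AE) auto
  then have "AE s in lborel. s \<notin> {0<..1 :: real}"
  proof eventually_elim
    fix s :: real assume 0: "ennreal (surv (1 * s) 1) * ennreal (s powr (- \<beta> - 1)) * indicator {0<..} s = 0"
    show "s \<notin> {0<..1}"
    proof
      assume s: "s \<in> {0<..1}"
      then have "s powr \<alpha> \<le> 1 powr \<alpha>" using \<alpha> by (intro powr_mono2) auto
      then have "sqrt (min 1 (1 / (64 * b)) / 2) / 16 * (s powr (\<alpha> / 2) / sqrt 1) \<le> surv s 1"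
        using s by (intro surv_lower) auto
      moreover have "0 < sqrt (min 1 (1 / (64 * b)) / 2) / 16 * (s powr (\<alpha> / 2) / sqrt 1)" using s b by auto
      ultimately have "0 < surv s 1" by linarith
      then show False using 0 s by simp
    qed
  qed
  then have "emeasure lborel {0<..1 :: real} = 0"
    by (subst (asm) AE_iff_measurable[where N = "{0<..1 :: real}"]) auto
  then show False by simp
qed

text \<open>Multiplied by \<open>mix \<beta> 1\<close>, the power becomes the mixture of survival
  probabilities. Exchanging the integrals reduces the claim to a single horizon.\<close>

lemma power_supermartingale_aux:
  assumes y: "0 < y" and t: "0 < t" and \<beta>: "0 < \<beta>" "\<beta> < \<alpha> / 2"
  shows "(\<integral>\<^sup>+\<omega>. indicator {\<omega>\<in>space M. \<forall>r\<in>{0..t}. X r \<omega> \<le> y} \<omega> * ennreal ((y - X t \<omega>) powr \<beta>) \<partial>M) \<le> ennreal (y powr \<beta>)"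
proof -
  have [measurable]: "(\<lambda>y. surv y 1) \<in> borel_measurable borel" by (rule surv_borel)
  have [measurable]: "X t \<in> borel_measurable M" using t by simp
  let ?A = "{\<omega>\<in>space M. \<forall>r\<in>{0..t}. X r \<omega> \<le> y}"
  have [measurable]: "?A \<in> sets M" using t by (intro stays_below_sets) simp
  interpret P: pair_sigma_finite lborel M ..
  define w where "w = (\<lambda>s :: real. ennreal (s powr (- \<beta> - 1)) * indicator {0<..} s)"
  have [measurable]: "w \<in> borel_measurable borel" unfolding w_def by measurable
  have "(\<integral>\<^sup>+\<omega>. indicator ?A \<omega> * ennreal ((y - X t \<omega>) powr \<beta>) \<partial>M) * mix \<beta> 1 =
      (\<integral>\<^sup>+\<omega>. indicator ?A \<omega> * ennreal ((y - X t \<omega>) powr \<beta>) * mix \<beta> 1 \<partial>M)"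
    by (rule nn_integral_multc[symmetric]) measurable
  also have "\<dots> \<le> (\<integral>\<^sup>+\<omega>. (\<integral>\<^sup>+s. indicator ?A \<omega> * ennreal (surv ((y - X t \<omega>) * s) 1) * w s \<partial>lborel) \<partial>M)"
  proof (rule nn_integral_mono)
    fix \<omega>
    have eq: "(\<integral>\<^sup>+s. indicator ?A \<omega> * ennreal (surv ((y - X t \<omega>) * s) 1) * w s \<partial>lborel) = indicator ?A \<omega> * mix \<beta> (y - X t \<omega>)"
      unfolding mix_def by (subst nn_integral_cmult[symmetric]) (auto simp: w_def mult_ac)
    show "indicator ?A \<omega> * ennreal ((y - X t \<omega>) powr \<beta>) * mix \<beta> 1 \<le>
        (\<integral>\<^sup>+s. indicator ?A \<omega> * ennreal (surv ((y - X t \<omega>) * s) 1) * w s \<partial>lborel)"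
    \<comment> \<open>At distance 0 from the level the power vanishes, so only positive distances
      need the scaling identity.\<close>
    proof (cases "\<omega> \<in> ?A \<and> X t \<omega> \<noteq> y")
      case True
      then have "X t \<omega> \<le> y" using t by auto
      then have "0 < y - X t \<omega>" using True by simp
      then show ?thesis unfolding eq mix_scale[OF \<open>0 < y - X t \<omega>\<close>] by (simp add: mult.assoc)
    next
      case False
      then have "indicator ?A \<omega> * ennreal ((y - X t \<omega>) powr \<beta>) = 0" by (cases "\<omega> \<in> ?A") simp_all
      then show ?thesis by (simp only: mult_zero_left zero_le)
    qed
  qed
  also have "\<dots> = (\<integral>\<^sup>+s. (\<integral>\<^sup>+\<omega>. indicator ?A \<omega> * ennreal (surv ((y - X t \<omega>) * s) 1) * w s \<partial>M) \<partial>lborel)"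
    by (rule P.Fubini') measurable
  also have "\<dots> \<le> (\<integral>\<^sup>+s. ennreal (surv (y * s) 1) * w s \<partial>lborel)"
  proof (rule nn_integral_mono)
    fix s :: real
    show "(\<integral>\<^sup>+\<omega>. indicator ?A \<omega> * ennreal (surv ((y - X t \<omega>) * s) 1) * w s \<partial>M) \<le> ennreal (surv (y * s) 1) * w s"
    proof (cases "0 < s")
      case True
      have "(\<integral>\<^sup>+\<omega>. indicator ?A \<omega> * ennreal (surv ((y - X t \<omega>) * s) 1) * w s \<partial>M) =
          (\<integral>\<^sup>+\<omega>. indicator ?A \<omega> * ennreal (surv ((y - X t \<omega>) * s) 1) \<partial>M) * w s"
        by (rule nn_integral_multc) measurable
      \<comment> \<open>The Markov property lengthens the horizon s^(-\<alpha>) by \<open>t\<close>,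
        and survival decreases with the horizon.\<close>
      also have "(\<integral>\<^sup>+\<omega>. indicator ?A \<omega> * ennreal (surv ((y - X t \<omega>) * s) 1) \<partial>M) = ennreal (surv y (t + s powr - \<alpha>))"
        unfolding surv_scale1[OF True] using t by (intro surv_markov) auto
      also have "\<dots> \<le> ennreal (surv (y * s) 1)"
        unfolding surv_scale1[OF True] using t by (intro ennreal_leI surv_mono) auto
      finally show ?thesis by (simp add: mult_right_mono)
    qed (simp add: w_def)
  qed
  also have "\<dots> = mix \<beta> y" unfolding mix_def w_def by (simp add: mult.assoc)
  also have "\<dots> = ennreal (y powr \<beta>) * mix \<beta> 1" by (rule mix_scale[OF y])
  finally have *: "mix \<beta> 1 * (\<integral>\<^sup>+\<omega>. indicator ?A \<omega> * ennreal ((y - X t \<omega>) powr \<beta>) \<partial>M) \<le> mix \<beta> 1 * ennreal (y powr \<beta>)"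
    by (simp add: mult.commute)
  show ?thesis
    using * mix_pos[of \<beta>] mix_finite[OF \<beta>] by (subst (asm) ennreal_mult_le_mult_iff) auto
qed

text \<open>Fatou's lemma along exponents increasing to \<alpha>/2: the inequality survives although
  the mixing integral does not.\<close>

lemma power_supermartingale:
  assumes y: "0 \<le> y" and t: "0 < t"
  shows "(\<integral>\<^sup>+\<omega>. indicator {\<omega>\<in>space M. \<forall>r\<in>{0..t}. X r \<omega> \<le> y} \<omega> * ennreal ((y - X t \<omega>) powr (\<alpha> / 2)) \<partial>M) \<le> ennreal (y powr (\<alpha> / 2))"
proof -
  have [measurable]: "X t \<in> borel_measurable M" using t by simp
  define A where "A = (\<lambda>y. {\<omega>\<in>space M. \<forall>r\<in>{0..t}. X r \<omega> \<le> y})"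
  have [measurable]: "A y \<in> sets M" for y unfolding A_def using t by (intro stays_below_sets) simp
  have pos: "(\<integral>\<^sup>+\<omega>. indicator (A y) \<omega> * ennreal ((y - X t \<omega>) powr (\<alpha> / 2)) \<partial>M) \<le> ennreal (y powr (\<alpha> / 2))" if y: "0 < y" for y
  proof -
    define \<beta> where "\<beta> = (\<lambda>m::nat. \<alpha> / 2 * (1 - 1 / real (Suc (Suc m))))"
    have \<beta>: "0 < \<beta> m" "\<beta> m < \<alpha> / 2" for m unfolding \<beta>_def using \<alpha> by (auto simp: field_simps intro: add_pos_nonneg)
    have "(\<lambda>m. 1 / real (Suc (Suc m))) \<longlonglongrightarrow> 0"
      using LIMSEQ_Suc[OF LIMSEQ_inverse_real_of_nat] by (simp add: inverse_eq_divide)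
    then have "(\<lambda>m. \<alpha> / 2 * (1 - 1 / real (Suc (Suc m)))) \<longlonglongrightarrow> \<alpha> / 2 * (1 - 0)"
      by (intro tendsto_mult tendsto_const tendsto_diff)
    then have lim: "\<beta> \<longlonglongrightarrow> \<alpha> / 2" unfolding \<beta>_def by simp
    have pl: "(\<lambda>m. z powr \<beta> m) \<longlonglongrightarrow> z powr (\<alpha> / 2)" if "0 \<le> z" for z
      using that lim by (cases "z = 0") (auto intro!: tendsto_powr)
    have lm: "(\<lambda>m. indicator (A y) \<omega> * ennreal ((y - X t \<omega>) powr \<beta> m)) \<longlonglongrightarrow> indicator (A y) \<omega> * ennreal ((y - X t \<omega>) powr (\<alpha> / 2))" for \<omega>
    proof (cases "\<omega> \<in> A y")
      case True
      then have "X t \<omega> \<le> y" using t unfolding A_def by auto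
      then show ?thesis using True by (auto intro!: tendsto_ennrealI pl)
    qed simp
    have "(\<integral>\<^sup>+\<omega>. indicator (A y) \<omega> * ennreal ((y - X t \<omega>) powr (\<alpha> / 2)) \<partial>M) =
        (\<integral>\<^sup>+\<omega>. liminf (\<lambda>m. indicator (A y) \<omega> * ennreal ((y - X t \<omega>) powr \<beta> m)) \<partial>M)"
      by (intro nn_integral_cong lim_imp_Liminf[symmetric] lm) simp
    also have "\<dots> \<le> liminf (\<lambda>m. \<integral>\<^sup>+\<omega>. indicator (A y) \<omega> * ennreal ((y - X t \<omega>) powr \<beta> m) \<partial>M)"
      by (rule nn_integral_liminf) measurable
    also have "\<dots> \<le> liminf (\<lambda>m. ennreal (y powr \<beta> m))"
      using power_supermartingale_aux[OF y t \<beta>] unfolding A_def by (intro Liminf_mono always_eventually) auto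
    also have "\<dots> = ennreal (y powr (\<alpha> / 2))"
      using y by (intro lim_imp_Liminf tendsto_ennrealI pl) auto
    finally show ?thesis .
  qed
  show ?thesis
  proof (cases "y = 0")
    case False
    then show ?thesis using pos[of y] y by (simp add: A_def)
  next
    \<comment> \<open>Scaling needs a positive level, so level 0 is compared with levels \<delta>
      tending to 0.\<close>
    case True
    have le: "(\<integral>\<^sup>+\<omega>. indicator (A y) \<omega> * ennreal ((y - X t \<omega>) powr (\<alpha> / 2)) \<partial>M) \<le> ennreal (\<delta> powr (\<alpha> / 2))" if \<delta>: "0 < \<delta>" for \<delta>
    proof -
      have "(\<integral>\<^sup>+\<omega>. indicator (A y) \<omega> * ennreal ((y - X t \<omega>) powr (\<alpha> / 2)) \<partial>M) \<le>
          (\<integral>\<^sup>+\<omega>. indicator (A \<delta>) \<omega> * ennreal ((\<delta> - X t \<omega>) powr (\<alpha> / 2)) \<partial>M)"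
      proof (rule nn_integral_mono)
        fix \<omega> assume "\<omega> \<in> space M"
        show "indicator (A y) \<omega> * ennreal ((y - X t \<omega>) powr (\<alpha> / 2)) \<le> indicator (A \<delta>) \<omega> * ennreal ((\<delta> - X t \<omega>) powr (\<alpha> / 2))"
        proof (cases "\<omega> \<in> A y")
          case a: True
          then have "\<omega> \<in> A \<delta>" "X t \<omega> \<le> 0" using True \<delta> t unfolding A_def by force+
          then show ?thesis using a True \<delta> \<alpha> by (auto intro!: ennreal_leI powr_mono2)
        qed simp
      qed
      also have "\<dots> \<le> ennreal (\<delta> powr (\<alpha> / 2))" by (rule pos[OF \<delta>])
      finally show ?thesis .
    qed
    have z: "(\<lambda>m. ennreal ((1 / real (Suc m)) powr (\<alpha> / 2))) \<longlonglongrightarrow> ennreal (0 powr (\<alpha> / 2))"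
    proof (intro tendsto_ennrealI tendsto_powr')
      show "(\<lambda>m. 1 / real (Suc m)) \<longlonglongrightarrow> 0" using LIMSEQ_inverse_real_of_nat by (simp add: inverse_eq_divide)
    qed (use \<alpha> in auto)
    have "(\<integral>\<^sup>+\<omega>. indicator (A y) \<omega> * ennreal ((y - X t \<omega>) powr (\<alpha> / 2)) \<partial>M) \<le> ennreal (0 powr (\<alpha> / 2))"
      by (rule LIMSEQ_le_const[OF z]) (auto intro!: le)
    then show ?thesis using True by (simp add: A_def)
  qed
qed

end

text \<open>Extension to an arbitrary slope: a positive slope rescales the level, a negative one
  reflects the process, slope 0 leaves a constant. The slope will be the product of the coordinates
  that stand still.\<close>

lemma (in stable_levy) linear_supermartingale:
  assumes c: "0 \<le> c" and h: "0 < h"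
  shows "(\<integral>\<^sup>+\<omega>. indicator {\<omega>\<in>space M. \<forall>r\<in>{0..h}. B * X r \<omega> \<le> c} \<omega> * ennreal ((c - B * X h \<omega>) powr (\<alpha> / 2)) \<partial>M) \<le> ennreal (c powr (\<alpha> / 2))"
proof -
  have pos: "(\<integral>\<^sup>+\<omega>. indicator {\<omega>\<in>space M. \<forall>r\<in>{0..h}. B * X r \<omega> \<le> c} \<omega> * ennreal ((c - B * X h \<omega>) powr (\<alpha> / 2)) \<partial>M) \<le> ennreal (c powr (\<alpha> / 2))"
    if X: "stable_levy M X \<alpha> b" and B: "0 < B" for X and B :: real
  proof -
    interpret X: stable_levy M X \<alpha> b by fact
    have [measurable]: "X h \<in> borel_measurable M" using h by simp
    have [measurable]: "{\<omega>\<in>space M. \<forall>r\<in>{0..h}. X r \<omega> \<le> c / B} \<in> sets M" using h by (intro X.stays_below_sets) simp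
    have "(\<integral>\<^sup>+\<omega>. indicator {\<omega>\<in>space M. \<forall>r\<in>{0..h}. B * X r \<omega> \<le> c} \<omega> * ennreal ((c - B * X h \<omega>) powr (\<alpha> / 2)) \<partial>M) =
        (\<integral>\<^sup>+\<omega>. ennreal (B powr (\<alpha> / 2)) * (indicator {\<omega>\<in>space M. \<forall>r\<in>{0..h}. X r \<omega> \<le> c / B} \<omega> * ennreal ((c / B - X h \<omega>) powr (\<alpha> / 2))) \<partial>M)"
    proof (rule nn_integral_cong)
      fix \<omega>
      have eq: "{\<omega>\<in>space M. \<forall>r\<in>{0..h}. B * X r \<omega> \<le> c} = {\<omega>\<in>space M. \<forall>r\<in>{0..h}. X r \<omega> \<le> c / B}"
        using B by (simp add: field_simps)
      show "indicator {\<omega>\<in>space M. \<forall>r\<in>{0..h}. B * X r \<omega> \<le> c} \<omega> * ennreal ((c - B * X h \<omega>) powr (\<alpha> / 2)) =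
        ennreal (B powr (\<alpha> / 2)) * (indicator {\<omega>\<in>space M. \<forall>r\<in>{0..h}. X r \<omega> \<le> c / B} \<omega> * ennreal ((c / B - X h \<omega>) powr (\<alpha> / 2)))"
        unfolding eq
      proof (cases "\<omega> \<in> {\<omega>\<in>space M. \<forall>r\<in>{0..h}. X r \<omega> \<le> c / B}")
        case True
        then have "X h \<omega> \<le> c / B" using h by auto
        moreover have "c - B * X h \<omega> = B * (c / B - X h \<omega>)" using B by (simp add: field_simps)
        ultimately have "(c - B * X h \<omega>) powr (\<alpha> / 2) = B powr (\<alpha> / 2) * (c / B - X h \<omega>) powr (\<alpha> / 2)"
          using B by (simp only: powr_mult)
        then show "indicator {\<omega>\<in>space M. \<forall>r\<in>{0..h}. X r \<omega> \<le> c / B} \<omega> * ennreal ((c - B * X h \<omega>) powr (\<alpha> / 2)) =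
            ennreal (B powr (\<alpha> / 2)) * (indicator {\<omega>\<in>space M. \<forall>r\<in>{0..h}. X r \<omega> \<le> c / B} \<omega> * ennreal ((c / B - X h \<omega>) powr (\<alpha> / 2)))"
          using True by (simp only: indicator_simps ennreal_mult powr_ge_zero mult_1_left)
      next
        case False
        then show "indicator {\<omega>\<in>space M. \<forall>r\<in>{0..h}. X r \<omega> \<le> c / B} \<omega> * ennreal ((c - B * X h \<omega>) powr (\<alpha> / 2)) =
            ennreal (B powr (\<alpha> / 2)) * (indicator {\<omega>\<in>space M. \<forall>r\<in>{0..h}. X r \<omega> \<le> c / B} \<omega> * ennreal ((c / B - X h \<omega>) powr (\<alpha> / 2)))"
          by (simp only: indicator_simps mult_zero_left mult_zero_right simp_thms)
      qed
    qed
    also have "\<dots> = ennreal (B powr (\<alpha> / 2)) * (\<integral>\<^sup>+\<omega>. indicator {\<omega>\<in>space M. \<forall>r\<in>{0..h}. X r \<omega> \<le> c / B} \<omega> * ennreal ((c / B - X h \<omega>) powr (\<alpha> / 2)) \<partial>M)"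
      by (rule nn_integral_cmult) measurable
    also have "\<dots> \<le> ennreal (B powr (\<alpha> / 2)) * ennreal ((c / B) powr (\<alpha> / 2))"
      using c B h by (intro mult_left_mono X.power_supermartingale) auto
    also have "\<dots> = ennreal (c powr (\<alpha> / 2))"
      using c B by (simp add: ennreal_mult[symmetric] powr_mult[symmetric])
    finally show ?thesis .
  qed
  consider "B = 0" | "0 < B" | "B < 0" by linarith
  then show ?thesis
  proof cases
    case 1
    then show ?thesis using c by (simp add: nn_integral_multc emeasure_space_1)
  next
    case 2
    then show ?thesis using pos[OF stable_levy_axioms] by simp
  next
    case 3
    then show ?thesis using pos[OF minus_stable, of "- B"] by simp
  qed
qed

section \<open>Independent stable processes\<close>

locale iid_stable = prob_space M for M :: "'a measure" +
  fixes L :: "nat \<Rightarrow> real \<Rightarrow> 'a \<Rightarrow> real" and n :: nat and \<alpha> b :: real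
  assumes n: "1 \<le> n"
    and stable: "\<And>i. i \<in> {1..n} \<Longrightarrow> stable_levy M (L i) \<alpha> b"
    and indep: "indep_vars (\<lambda>_. paths) (\<lambda>i. traj (L i)) {1..n}"
begin

lemma \<alpha>: "0 < \<alpha>" "\<alpha> < 2" and b: "0 < b"
  using stable_levy.\<alpha>[OF stable[of 1]] stable_levy.b[OF stable[of 1]] n by auto

lemma levy_L: "i \<in> {1..n} \<Longrightarrow> levy M (L i)"
  using stable by (auto simp: stable_levy_def)

lemma meas_L [measurable]: "i \<in> {1..n} \<Longrightarrow> 0 \<le> t \<Longrightarrow> L i t \<in> borel_measurable M"
  by (rule levy.meas[OF levy_L])

lemma cadlag_L: "i \<in> {1..n} \<Longrightarrow> \<omega> \<in> space M \<Longrightarrow> cadlag (\<lambda>t. L i t \<omega>)"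
  by (rule levy.cadlag[OF levy_L])

lemma start_L: "i \<in> {1..n} \<Longrightarrow> \<omega> \<in> space M \<Longrightarrow> L i 0 \<omega> = 0"
  by (rule levy.start[OF levy_L])

definition others :: "nat \<Rightarrow> 'a \<Rightarrow> nat \<Rightarrow> real \<Rightarrow> real" where
  "others i \<omega> = (\<lambda>j\<in>{1..n} - {i}. traj (L j) \<omega>)"

abbreviation (input) others_space :: "nat \<Rightarrow> (nat \<Rightarrow> real \<Rightarrow> real) measure" where
  "others_space i \<equiv> \<Pi>\<^sub>M j\<in>{1..n} - {i}. paths"

lemma others_indep:
  assumes i: "i \<in> {1..n}"
  shows "indep_pair (others_space i) (others i) paths (traj (L i))"
proof -
  have "indep_var (others_space i) (\<lambda>\<omega>. \<lambda>j\<in>{1..n} - {i}. traj (L j) \<omega>) (\<Pi>\<^sub>M j\<in>{i}. paths) (\<lambda>\<omega>. \<lambda>j\<in>{i}. traj (L j) \<omega>)"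
    using i by (intro indep_var_restrict[OF indep]) auto
  then have ip: "indep_pair (others_space i) (others i) (\<Pi>\<^sub>M j\<in>{i}. paths) (\<lambda>\<omega>. \<lambda>j\<in>{i}. traj (L j) \<omega>)"
    unfolding others_def by (rule indep_var_imp_indep_pair)
  have "(\<lambda>p. p i) \<in> (\<Pi>\<^sub>M j\<in>{i}. paths) \<rightarrow>\<^sub>M paths" by (intro measurable_component_singleton) simp
  from indep_pair_compose[OF ip measurable_ident this] show ?thesis by simp
qed

text \<open>What is known at time \<open>s\<close> when only coordinate \<open>i\<close> moves: the whole paths of the other coordinates
  and the path of \<open>L i\<close> up to \<open>s\<close>.\<close>

definition known :: "nat \<Rightarrow> real \<Rightarrow> 'a measure" where
  "known i s = levy.past M (L i) (others_space i) (others i) s"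

lemma space_known [simp]: "i \<in> {1..n} \<Longrightarrow> space (known i s) = space M"
  unfolding known_def by (rule levy.space_past[OF levy_L])

lemma known_measurable:
  assumes i: "i \<in> {1..n}" and j: "j \<in> {1..n}" and t: "0 \<le> t" "j = i \<Longrightarrow> t \<le> s"
  shows "L j t \<in> borel_measurable (known i s)"
proof -
  interpret levy M "L i" by (rule levy_L[OF i])
  have V: "others i \<in> M \<rightarrow>\<^sub>M others_space i" using others_indep[OF i] by (simp add: indep_pair_def)
  show ?thesis
  proof (cases "j = i")
    case True
    then show ?thesis unfolding known_def using past_measurable_X[OF V t(1)] t(2) by simp
  next
    case False
    have "(\<lambda>p. p j t) \<in> others_space i \<rightarrow>\<^sub>M borel"
      using j t False by (intro measurable_compose[OF measurable_component_singleton[of j] measurable_component_singleton]) auto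
    from measurable_compose[OF past_measurable_V[OF V] this]
    have "(\<lambda>\<omega>. others i \<omega> j t) \<in> borel_measurable (known i s)" unfolding known_def .
    then show ?thesis using j t False by (simp add: others_def traj_def)
  qed
qed

text \<open>Given \<open>known i s\<close> the slope \<open>B\<close> is a constant and only
  \<open>L i\<close> moves, so \<open>linear_supermartingale\<close> applies with level
  \<open>\<epsilon> - B \<omega> * L i s \<omega>\<close>; hypothesis \<open>le\<close> makes that
  level nonnegative on \<open>A\<close>.\<close>

lemma stage:
  assumes i: "i \<in> {1..n}" and s: "0 \<le> s" and h: "0 < h"
    and A: "A \<in> sets (known i s)" and B: "B \<in> borel_measurable (known i s)"
    and le: "\<And>\<omega>. \<omega> \<in> A \<Longrightarrow> B \<omega> * L i s \<omega> \<le> \<epsilon>"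
  shows "(\<integral>\<^sup>+\<omega>. indicator {\<omega>\<in>A. \<forall>r\<in>{0..h}. B \<omega> * L i (s + r) \<omega> \<le> \<epsilon>} \<omega> * ennreal ((\<epsilon> - B \<omega> * L i (s + h) \<omega>) powr (\<alpha> / 2)) \<partial>M) \<le>
    (\<integral>\<^sup>+\<omega>. indicator A \<omega> * ennreal ((\<epsilon> - B \<omega> * L i s \<omega>) powr (\<alpha> / 2)) \<partial>M)"
proof -
  interpret X: stable_levy M "L i" \<alpha> b by (rule stable[OF i])
  interpret D: levy M "\<lambda>r \<omega>. L i (s + r) \<omega> - L i s \<omega>" by (rule X.shift_levy[OF s])
  let ?N = "known i s"
  define ok where "ok = (\<lambda>\<omega> p. \<forall>l. \<forall>k\<in>{..2 ^ l}. B \<omega> * (L i s \<omega> + p (real (k::nat) * (h / 2 ^ l))) \<le> \<epsilon>)"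
  define F :: "'a \<Rightarrow> (real \<Rightarrow> real) \<Rightarrow> ennreal" where
    "F = (\<lambda>\<omega> p. indicator A \<omega> * (indicator {p. ok \<omega> p} p * ennreal ((\<epsilon> - B \<omega> * (L i s \<omega> + p h)) powr (\<alpha> / 2))))"
  have okX: "ok \<omega> (traj Y \<omega>') \<longleftrightarrow> (\<forall>r\<in>{0..h}. B \<omega> * (L i s \<omega> + Y r \<omega>') \<le> \<epsilon>)" if Y: "levy M Y" "\<omega>' \<in> space M" for \<omega> \<omega>' Y
  proof -
    interpret Y: levy M Y by fact
    have "((\<lambda>t. B \<omega> * (L i s \<omega> + Y t \<omega>')) \<longlongrightarrow> B \<omega> * (L i s \<omega> + Y t \<omega>')) (at_right t)" if "0 \<le> t" for t
      by (intro tendsto_intros cadlag_right[OF Y.cadlag[OF Y(2)] that])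
    from dyadic_le_iff[of 0 h "\<lambda>t. B \<omega> * (L i s \<omega> + Y t \<omega>')" \<epsilon>, OF this]
    show ?thesis using h unfolding ok_def traj_def by (simp add: Ball_def)
  qed
  have Bm: "(\<lambda>z. B (fst z)) \<in> borel_measurable (?N \<Otimes>\<^sub>M paths)" by (rule measurable_compose[OF measurable_fst B])
  have Lm: "(\<lambda>z. L i s (fst z)) \<in> borel_measurable (?N \<Otimes>\<^sub>M paths)"
    using i s by (intro measurable_compose[OF measurable_fst known_measurable]) auto
  have pm: "(\<lambda>z. snd z r) \<in> borel_measurable (?N \<Otimes>\<^sub>M paths)" if "0 \<le> r" for r
    using that by (intro measurable_compose[OF measurable_snd] measurable_component_singleton) auto
  have okm: "{z\<in>space (?N \<Otimes>\<^sub>M paths). ok (fst z) (snd z)} \<in> sets (?N \<Otimes>\<^sub>M paths)"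
    unfolding ok_def using h
    by (intro sets.sets_Collect_countable_All sets.sets_Collect_finite_All borel_measurable_le borel_measurable_times borel_measurable_add borel_measurable_const Bm Lm pm) auto
  have "(\<lambda>z. indicator A (fst z) * (indicator {z\<in>space (?N \<Otimes>\<^sub>M paths). ok (fst z) (snd z)} z *
      ennreal ((\<epsilon> - B (fst z) * (L i s (fst z) + snd z h)) powr (\<alpha> / 2)))) \<in> borel_measurable (?N \<Otimes>\<^sub>M paths)"
    using h by (intro borel_measurable_times_ennreal measurable_compose[OF measurable_fst borel_measurable_indicator[OF A]]
        borel_measurable_indicator[OF okm] measurable_compose[OF _ measurable_ennreal] measurable_compose[OF _ measurable_ennreal]
        powr_real_measurable borel_measurable_diff borel_measurable_times borel_measurable_add borel_measurable_const Bm Lm pm) auto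
  then have Fm: "case_prod F \<in> borel_measurable (?N \<Otimes>\<^sub>M paths)"
    by (rule measurable_cong[THEN iffD1, rotated]) (auto simp: F_def split: split_indicator)
  have "(\<integral>\<^sup>+\<omega>. indicator {\<omega>\<in>A. \<forall>r\<in>{0..h}. B \<omega> * L i (s + r) \<omega> \<le> \<epsilon>} \<omega> * ennreal ((\<epsilon> - B \<omega> * L i (s + h) \<omega>) powr (\<alpha> / 2)) \<partial>M) =
      (\<integral>\<^sup>+\<omega>. F \<omega> (traj (\<lambda>r \<omega>. L i (s + r) \<omega> - L i s \<omega>) \<omega>) \<partial>M)"
  proof (rule nn_integral_cong)
    fix \<omega> assume \<omega>: "\<omega> \<in> space M"
    have "indicator {\<omega>\<in>A. \<forall>r\<in>{0..h}. B \<omega> * L i (s + r) \<omega> \<le> \<epsilon>} \<omega> = (indicator A \<omega> * indicator {p. ok \<omega> p} (traj (\<lambda>r \<omega>. L i (s + r) \<omega> - L i s \<omega>) \<omega>) :: ennreal)"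
      using okX[OF D.levy_axioms \<omega>, of \<omega>] by (auto split: split_indicator)
    moreover have "traj (\<lambda>r \<omega>. L i (s + r) \<omega> - L i s \<omega>) \<omega> h = L i (s + h) \<omega> - L i s \<omega>" using h by (simp add: traj_def)
    ultimately show "indicator {\<omega>\<in>A. \<forall>r\<in>{0..h}. B \<omega> * L i (s + r) \<omega> \<le> \<epsilon>} \<omega> * ennreal ((\<epsilon> - B \<omega> * L i (s + h) \<omega>) powr (\<alpha> / 2)) =
        F \<omega> (traj (\<lambda>r \<omega>. L i (s + r) \<omega> - L i s \<omega>) \<omega>)"
      unfolding F_def by (simp add: mult.assoc)
  qed
  also have "\<dots> = (\<integral>\<^sup>+\<omega>. (\<integral>\<^sup>+\<omega>'. F \<omega> (traj (L i) \<omega>') \<partial>M) \<partial>M)"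
    using Fm unfolding known_def by (intro X.markov[OF others_indep[OF i] s])
  also have "\<dots> \<le> (\<integral>\<^sup>+\<omega>. indicator A \<omega> * ennreal ((\<epsilon> - B \<omega> * L i s \<omega>) powr (\<alpha> / 2)) \<partial>M)"
  proof (rule nn_integral_mono)
    fix \<omega> assume "\<omega> \<in> space M"
    show "(\<integral>\<^sup>+\<omega>'. F \<omega> (traj (L i) \<omega>') \<partial>M) \<le> indicator A \<omega> * ennreal ((\<epsilon> - B \<omega> * L i s \<omega>) powr (\<alpha> / 2))"
    proof (cases "\<omega> \<in> A")
      case True
      define c where "c = \<epsilon> - B \<omega> * L i s \<omega>"
      have c: "0 \<le> c" unfolding c_def using le[OF True] by simp
      have "(\<integral>\<^sup>+\<omega>'. F \<omega> (traj (L i) \<omega>') \<partial>M) = (\<integral>\<^sup>+\<omega>'. indicator {\<omega>'\<in>space M. \<forall>r\<in>{0..h}. B \<omega> * L i r \<omega>' \<le> c} \<omega>' * ennreal ((c - B \<omega> * L i h \<omega>') powr (\<alpha> / 2)) \<partial>M)"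
      proof (rule nn_integral_cong)
        fix \<omega>' assume \<omega>': "\<omega>' \<in> space M"
        have "ok \<omega> (traj (L i) \<omega>') \<longleftrightarrow> (\<forall>r\<in>{0..h}. B \<omega> * L i r \<omega>' \<le> c)"
          unfolding okX[OF X.levy_axioms \<omega>'] c_def by (simp add: algebra_simps)
        moreover have "\<epsilon> - B \<omega> * (L i s \<omega> + traj (L i) \<omega>' h) = c - B \<omega> * L i h \<omega>'"
          using h by (simp add: traj_def c_def algebra_simps)
        ultimately show "F \<omega> (traj (L i) \<omega>') = indicator {\<omega>'\<in>space M. \<forall>r\<in>{0..h}. B \<omega> * L i r \<omega>' \<le> c} \<omega>' * ennreal ((c - B \<omega> * L i h \<omega>') powr (\<alpha> / 2))"
          unfolding F_def using True \<omega>' by (auto split: split_indicator)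
      qed
      also have "\<dots> \<le> ennreal (c powr (\<alpha> / 2))" by (rule X.linear_supermartingale[OF c h])
      finally show ?thesis using True by (simp add: c_def)
    qed (simp add: F_def)
  qed
  finally show ?thesis .
qed

text \<open>The increment after \<open>s\<close> is independent of what is known, so a bound that is
  uniform in the shift \<open>a\<close> holds on top of any known event.\<close>

lemma joint_freeze:
  assumes i: "i \<in> {1..n}" and s: "0 \<le> s" and A: "A \<in> sets (known i s)"
    and e: "\<And>a. \<P>(\<omega> in M. \<bar>a + L i t \<omega>\<bar> \<le> \<rho>) \<le> e" and t: "0 \<le> t"
  shows "prob {\<omega>\<in>A. \<bar>L i (s + t) \<omega>\<bar> \<le> \<rho>} \<le> e * prob A"
proof -
  interpret X: stable_levy M "L i" \<alpha> b by (rule stable[OF i])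
  let ?N = "known i s"
  have AM: "A \<subseteq> space M" using sets.sets_into_space[OF A] i by simp
  have id: "(\<lambda>\<omega>. \<omega>) \<in> M \<rightarrow>\<^sub>M ?N"
    using X.past_future_indep'[OF others_indep[OF i] s] unfolding indep_pair_def known_def by blast
  have A': "A \<in> sets M"
  proof -
    have "A = (\<lambda>\<omega>. \<omega>) -` A \<inter> space M" using AM by auto
    then show ?thesis using measurable_sets[OF id A] by simp
  qed
  have [measurable]: "L i s \<in> borel_measurable M" "L i t \<in> borel_measurable M" "L i (s + t) \<in> borel_measurable M"
    using i s t by auto
  have e0: "0 \<le> e" using e[of 0] measure_nonneg order_trans by blast
  define F :: "'a \<Rightarrow> (real \<Rightarrow> real) \<Rightarrow> ennreal" where
    "F = (\<lambda>\<omega> p. indicator A \<omega> * indicator {x. \<bar>x\<bar> \<le> \<rho>} (L i s \<omega> + p t))"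
  have Lm: "(\<lambda>z. L i s (fst z)) \<in> borel_measurable (?N \<Otimes>\<^sub>M paths)"
    using i s by (intro measurable_compose[OF measurable_fst known_measurable]) auto
  have pm: "(\<lambda>z. snd z t) \<in> borel_measurable (?N \<Otimes>\<^sub>M paths)"
    using t by (intro measurable_compose[OF measurable_snd] measurable_component_singleton) auto
  have S: "{x. \<bar>x\<bar> \<le> \<rho>} \<in> sets (borel :: real measure)" by measurable
  have Fm: "case_prod F \<in> borel_measurable (?N \<Otimes>\<^sub>M paths)"
    unfolding F_def case_prod_beta
    by (intro borel_measurable_times_ennreal measurable_compose[OF measurable_fst borel_measurable_indicator[OF A]]
      measurable_compose[OF borel_measurable_add[OF Lm pm] borel_measurable_indicator[OF S]])
  have "ennreal (prob {\<omega>\<in>A. \<bar>L i (s + t) \<omega>\<bar> \<le> \<rho>}) = (\<integral>\<^sup>+\<omega>. indicator {\<omega>\<in>A. \<bar>L i (s + t) \<omega>\<bar> \<le> \<rho>} \<omega> \<partial>M)"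
  proof -
    have "{\<omega>\<in>A. \<bar>L i (s + t) \<omega>\<bar> \<le> \<rho>} = A \<inter> {\<omega>\<in>space M. \<bar>L i (s + t) \<omega>\<bar> \<le> \<rho>}" using AM by auto
    then have "{\<omega>\<in>A. \<bar>L i (s + t) \<omega>\<bar> \<le> \<rho>} \<in> sets M" using A' by simp
    then show ?thesis by (simp add: emeasure_eq_measure)
  qed
  also have "\<dots> = (\<integral>\<^sup>+\<omega>. F \<omega> (traj (\<lambda>r \<omega>. L i (s + r) \<omega> - L i s \<omega>) \<omega>) \<partial>M)"
    using t by (intro nn_integral_cong) (auto simp: F_def traj_def split: split_indicator)
  also have "\<dots> = (\<integral>\<^sup>+\<omega>. (\<integral>\<^sup>+\<omega>'. F \<omega> (traj (L i) \<omega>') \<partial>M) \<partial>M)"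
    using Fm unfolding known_def by (intro X.markov[OF others_indep[OF i] s])
  also have "\<dots> \<le> (\<integral>\<^sup>+\<omega>. ennreal e * indicator A \<omega> \<partial>M)"
  proof (rule nn_integral_mono)
    fix \<omega>
    have "(\<integral>\<^sup>+\<omega>'. F \<omega> (traj (L i) \<omega>') \<partial>M) = indicator A \<omega> * (\<integral>\<^sup>+\<omega>'. indicator {\<omega>'\<in>space M. \<bar>L i s \<omega> + L i t \<omega>'\<bar> \<le> \<rho>} \<omega>' \<partial>M)"
    proof -
      have "(\<integral>\<^sup>+\<omega>'. indicator {x. \<bar>x\<bar> \<le> \<rho>} (L i s \<omega> + traj (L i) \<omega>' t) \<partial>M) =
          (\<integral>\<^sup>+\<omega>'. indicator {\<omega>'\<in>space M. \<bar>L i s \<omega> + L i t \<omega>'\<bar> \<le> \<rho>} \<omega>' \<partial>M)"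
        by (rule nn_integral_cong) (use t in \<open>auto simp: traj_def split: split_indicator\<close>)
      then show ?thesis by (cases "\<omega> \<in> A") (simp_all add: F_def)
    qed
    also have "(\<integral>\<^sup>+\<omega>'. indicator {\<omega>'\<in>space M. \<bar>L i s \<omega> + L i t \<omega>'\<bar> \<le> \<rho>} \<omega>' \<partial>M) = ennreal (\<P>(\<omega>' in M. \<bar>L i s \<omega> + L i t \<omega>'\<bar> \<le> \<rho>))"
      by (simp add: emeasure_eq_measure)
    also have "indicator A \<omega> * \<dots> \<le> indicator A \<omega> * ennreal e" by (intro mult_left_mono ennreal_leI[OF e]) simp
    finally show "(\<integral>\<^sup>+\<omega>'. F \<omega> (traj (L i) \<omega>') \<partial>M) \<le> ennreal e * indicator A \<omega>"
      by (simp only: mult.commute)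
  qed
  also have "\<dots> = ennreal (e * prob A)"
    using A' e0 by (simp add: nn_integral_cmult emeasure_eq_measure ennreal_mult)
  finally show ?thesis using e0 by (simp add: ennreal_le_iff)
qed

end

section \<open>Staircases: one clock at a time\<close>

context iid_stable
begin

text \<open>In the staircase with step \<open>h\<close>, stage \<open>\<sigma>\<close> lets the clock of coordinate \<open>mover \<sigma>\<close> run from
  \<open>tau h (mover \<sigma>) \<sigma>\<close> for a time \<open>h\<close> while all other clocks stand still.\<close>

definition tau :: "real \<Rightarrow> nat \<Rightarrow> nat \<Rightarrow> real" where
  "tau h j \<sigma> = real ((\<sigma> + n - j) div n) * h"

definition mover :: "nat \<Rightarrow> nat" where
  "mover \<sigma> = \<sigma> mod n + 1"

lemma mover_in: "mover \<sigma> \<in> {1..n}"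
  using n by (auto simp: mover_def Suc_le_eq)

lemma tau_0: "j \<in> {1..n} \<Longrightarrow> tau h j 0 = 0"
  by (auto simp: tau_def)

lemma tau_end: "j \<in> {1..n} \<Longrightarrow> tau h j (m * n) = real m * h"
proof -
  assume j: "j \<in> {1..n}"
  then have "m * n + n - j = (n - j) + m * n" by auto
  moreover have "(n - j + m * n) div n = m" using j by (subst div_mult_self1) auto
  ultimately show ?thesis unfolding tau_def by simp
qed

text \<open>Writing \<sigma> = k n + i with i < n, the quotient that defines the clock of
  \<open>j\<close> jumps exactly at i = j - 1, that is when \<open>j\<close> is the mover.\<close>

lemma tau_Suc:
  assumes j: "j \<in> {1..n}"
  shows "tau h j (Suc \<sigma>) = (if j = mover \<sigma> then tau h j \<sigma> + h else tau h j \<sigma>)"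
proof -
  define k where "k = \<sigma> div n"
  define i where "i = \<sigma> mod n"
  have \<sigma>: "\<sigma> = k * n + i" and i: "i < n" unfolding k_def i_def using n by auto
  have q: "(k * n + a) div n = k + a div n" for a using n by (subst add.commute) (subst div_mult_self1, auto)
  have 1: "\<sigma> + n - j = k * n + (i + n - j)" "Suc \<sigma> + n - j = k * n + (Suc i + n - j)" using \<sigma> j by auto
  have d: "a div n = (if a < n then 0 else 1)" if "a < 2 * n" for a
  proof (cases "a < n")
    case False
    then have "a div n = 1 + (a - n) div n" using n le_div_geq[of n a] by simp
    moreover have "(a - n) div n = 0" using that by simp
    ultimately show ?thesis using False by simp
  qed simp
  have e1: "(\<sigma> + n - j) div n = k + (if i + n - j < n then 0 else 1)"
    unfolding 1 q using i j by (subst d) auto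
  have e2: "(Suc \<sigma> + n - j) div n = k + (if Suc i + n - j < n then 0 else 1)"
    unfolding 1 q using i j by (subst d) auto
  show ?thesis
    unfolding tau_def e1 e2 mover_def i_def[symmetric] using i j by (auto simp: algebra_simps)
qed

lemma tau_nonneg: "0 \<le> h \<Longrightarrow> 0 \<le> tau h j \<sigma>"
  by (simp add: tau_def)

lemma tau_mono: "0 \<le> h \<Longrightarrow> \<sigma> \<le> \<rho> \<Longrightarrow> tau h j \<sigma> \<le> tau h j \<rho>"
  unfolding tau_def by (intro mult_right_mono) (auto intro!: div_le_mono)

lemma tau_close:
  assumes "i \<in> {1..n}" "j \<in> {1..n}" "0 \<le> h"
  shows "\<bar>tau h i \<sigma> - tau h j \<sigma>\<bar> \<le> h"
proof -
  have b: "\<sigma> div n \<le> (\<sigma> + n - j) div n" "(\<sigma> + n - j) div n \<le> \<sigma> div n + 1" if "j \<in> {1..n}" for j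
  proof -
    show "\<sigma> div n \<le> (\<sigma> + n - j) div n" using that by (intro div_le_mono) auto
    have "(\<sigma> + n - j) div n \<le> (\<sigma> + n) div n" by (intro div_le_mono) auto
    also have "\<dots> = \<sigma> div n + 1" using n by simp
    finally show "(\<sigma> + n - j) div n \<le> \<sigma> div n + 1" .
  qed
  have "\<bar>real ((\<sigma> + n - i) div n) - real ((\<sigma> + n - j) div n)\<bar> \<le> 1"
    using b[OF assms(1)] b[OF assms(2)] by linarith
  then have "\<bar>real ((\<sigma> + n - i) div n) - real ((\<sigma> + n - j) div n)\<bar> * h \<le> 1 * h"
    using assms(3) by (intro mult_right_mono)
  then show ?thesis using assms(3) by (simp add: tau_def left_diff_distrib[symmetric] abs_mult)
qed

definition rest :: "real \<Rightarrow> nat \<Rightarrow> 'a \<Rightarrow> real" where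
  "rest h \<sigma> \<omega> = (\<Prod>j\<in>{1..n} - {mover \<sigma>}. L j (tau h j \<sigma>) \<omega>)"

definition corner :: "real \<Rightarrow> nat \<Rightarrow> 'a \<Rightarrow> real" where
  "corner h \<sigma> \<omega> = (\<Prod>j\<in>{1..n}. L j (tau h j \<sigma>) \<omega>)"

text \<open>The whole segment of each stage is constrained and not just the corners, because the
  one-dimensional bound concerns the process killed in continuous time.\<close>

definition staircase :: "real \<Rightarrow> real \<Rightarrow> nat \<Rightarrow> 'a set" where
  "staircase \<epsilon> h \<sigma> = {\<omega>\<in>space M. \<forall>\<rho><\<sigma>. \<forall>r\<in>{0..h}.
     rest h \<rho> \<omega> * L (mover \<rho>) (tau h (mover \<rho>) \<rho> + r) \<omega> \<le> \<epsilon>}"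

lemma corner_rest: "corner h \<sigma> \<omega> = rest h \<sigma> \<omega> * L (mover \<sigma>) (tau h (mover \<sigma>) \<sigma>) \<omega>"
  unfolding corner_def rest_def using mover_in[of \<sigma>]
  by (subst prod.remove[of _ "mover \<sigma>"]) (auto simp: mult.commute)

lemma corner_Suc: "corner h (Suc \<sigma>) \<omega> = rest h \<sigma> \<omega> * L (mover \<sigma>) (tau h (mover \<sigma>) \<sigma> + h) \<omega>"
proof -
  have "corner h (Suc \<sigma>) \<omega> = L (mover \<sigma>) (tau h (mover \<sigma>) (Suc \<sigma>)) \<omega> * (\<Prod>j\<in>{1..n} - {mover \<sigma>}. L j (tau h j (Suc \<sigma>)) \<omega>)"
    unfolding corner_def using mover_in[of \<sigma>] by (subst prod.remove[of _ "mover \<sigma>"]) auto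
  also have "(\<Prod>j\<in>{1..n} - {mover \<sigma>}. L j (tau h j (Suc \<sigma>)) \<omega>) = rest h \<sigma> \<omega>"
    unfolding rest_def by (intro prod.cong) (auto simp: tau_Suc)
  finally show ?thesis using mover_in[of \<sigma>] by (simp add: tau_Suc mult.commute)
qed

lemma corner_0: "\<omega> \<in> space M \<Longrightarrow> corner h 0 \<omega> = 0"
  unfolding corner_def using n start_L[of 1 \<omega>] tau_0[of 1 h] by (intro prod_zero bexI[of _ 1]) auto

lemma staircase_le:
  assumes "\<omega> \<in> staircase \<epsilon> h \<sigma>" "0 \<le> \<epsilon>" "0 \<le> h"
  shows "corner h \<sigma> \<omega> \<le> \<epsilon>"
proof (cases \<sigma>)
  case 0
  then show ?thesis using assms corner_0 by (simp add: staircase_def)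
next
  case (Suc \<rho>)
  have "\<forall>r\<in>{0..h}. rest h \<rho> \<omega> * L (mover \<rho>) (tau h (mover \<rho>) \<rho> + r) \<omega> \<le> \<epsilon>"
    using assms(1) unfolding staircase_def Suc by blast
  then show ?thesis using assms(3) unfolding Suc corner_Suc by auto
qed

lemma rest_known: "0 \<le> h \<Longrightarrow> i \<in> {1..n} \<Longrightarrow> \<sigma> \<le> \<rho> \<Longrightarrow> rest h \<sigma> \<in> borel_measurable (known i (tau h i \<rho>))"
  unfolding rest_def by (intro borel_measurable_prod known_measurable tau_nonneg) (auto intro!: tau_mono)

text \<open>Stages of other coordinates use their complete paths, which are known; stages of
  coordinate \<open>i\<close> before \<sigma> end no later than its present clock.\<close>

lemma staircase_known:
  assumes h: "0 < h" and i: "i \<in> {1..n}"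
  shows "staircase \<epsilon> h \<sigma> \<in> sets (known i (tau h i \<sigma>))"
proof -
  let ?N = "known i (tau h i \<sigma>)"
  have "staircase \<epsilon> h \<sigma> = {\<omega>\<in>space ?N. \<forall>\<rho>\<in>{..<\<sigma>}. \<forall>l. \<forall>k\<in>{..2 ^ l}.
      rest h \<rho> \<omega> * L (mover \<rho>) (tau h (mover \<rho>) \<rho> + real (k::nat) * (h / 2 ^ l)) \<omega> \<le> \<epsilon>}"
  proof -
    have "(\<forall>r\<in>{0..h}. rest h \<rho> \<omega> * L (mover \<rho>) (tau h (mover \<rho>) \<rho> + r) \<omega> \<le> \<epsilon>) \<longleftrightarrow>
      (\<forall>l. \<forall>k\<in>{..2 ^ l}. rest h \<rho> \<omega> * L (mover \<rho>) (tau h (mover \<rho>) \<rho> + real (k::nat) * (h / 2 ^ l)) \<omega> \<le> \<epsilon>)"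
      if \<omega>: "\<omega> \<in> space M" for \<omega> \<rho>
    proof -
      interpret S: levy M "\<lambda>r \<omega>. L (mover \<rho>) (tau h (mover \<rho>) \<rho> + r) \<omega> - L (mover \<rho>) (tau h (mover \<rho>) \<rho>) \<omega>"
        using h by (intro levy.shift_levy levy_L mover_in tau_nonneg) simp
      define x where "x = L (mover \<rho>) (tau h (mover \<rho>) \<rho>) \<omega>"
      have "((\<lambda>t. rest h \<rho> \<omega> * (x + (L (mover \<rho>) (tau h (mover \<rho>) \<rho> + t) \<omega> - x))) \<longlongrightarrow>
          rest h \<rho> \<omega> * (x + (L (mover \<rho>) (tau h (mover \<rho>) \<rho> + t) \<omega> - x))) (at_right t)" if "0 \<le> t" for t
        unfolding x_def by (intro tendsto_mult tendsto_add tendsto_const cadlag_right[OF S.cadlag[OF \<omega>] that])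
      then show ?thesis
        using dyadic_le_iff[of 0 h "\<lambda>r. rest h \<rho> \<omega> * L (mover \<rho>) (tau h (mover \<rho>) \<rho> + r) \<omega>" \<epsilon>] h
        by (simp add: Ball_def)
    qed
    then have "(\<forall>\<rho><\<sigma>. \<forall>r\<in>{0..h}. rest h \<rho> \<omega> * L (mover \<rho>) (tau h (mover \<rho>) \<rho> + r) \<omega> \<le> \<epsilon>) \<longleftrightarrow>
      (\<forall>\<rho>\<in>{..<\<sigma>}. \<forall>l. \<forall>k\<in>{..2 ^ l}. rest h \<rho> \<omega> * L (mover \<rho>) (tau h (mover \<rho>) \<rho> + real (k::nat) * (h / 2 ^ l)) \<omega> \<le> \<epsilon>)"
      if "\<omega> \<in> space M" for \<omega>
      using that by (simp only: Ball_def[of "{..<\<sigma>}"] lessThan_iff)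
    then show ?thesis unfolding staircase_def space_known[OF i] by (intro Collect_cong conj_cong refl)
  qed
  also have "\<dots> \<in> sets ?N"
  proof (intro sets.sets_Collect_countable_All sets.sets_Collect_finite_All borel_measurable_le borel_measurable_times borel_measurable_const)
    fix \<rho> l k :: nat assume \<rho>: "\<rho> \<in> {..<\<sigma>}" and k: "k \<in> {..2 ^ l}"
    show "rest h \<rho> \<in> borel_measurable ?N" using h i \<rho> by (intro rest_known) auto
    have kh: "real k * (h / 2 ^ l) \<le> h" using k h by (intro dyadic_point_le) auto
    show "L (mover \<rho>) (tau h (mover \<rho>) \<rho> + real k * (h / 2 ^ l)) \<in> borel_measurable ?N"
    proof (rule known_measurable[OF i mover_in])
      show "0 \<le> tau h (mover \<rho>) \<rho> + real k * (h / 2 ^ l)" using h tau_nonneg[of h "mover \<rho>" \<rho>] by simp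
      assume "mover \<rho> = i"
      then have "tau h (mover \<rho>) \<rho> + real k * (h / 2 ^ l) \<le> tau h i (Suc \<rho>)" using tau_Suc[OF i, of h \<rho>] kh by simp
      also have "\<dots> \<le> tau h i \<sigma>" using h \<rho> by (intro tau_mono) auto
      finally show "tau h (mover \<rho>) \<rho> + real k * (h / 2 ^ l) \<le> tau h i \<sigma>" .
    qed
  qed auto
  finally show ?thesis .
qed

text \<open>Induction over the stages; the mover changes while the rest is a known slope. It starts
  from corner value 0, which gives the right-hand side.\<close>

lemma staircase_supermartingale:
  assumes h: "0 < h" and \<epsilon>: "0 \<le> \<epsilon>"
  shows "(\<integral>\<^sup>+\<omega>. indicator (staircase \<epsilon> h \<sigma>) \<omega> * ennreal ((\<epsilon> - corner h \<sigma> \<omega>) powr (\<alpha> / 2)) \<partial>M) \<le> ennreal (\<epsilon> powr (\<alpha> / 2))"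
proof (induction \<sigma>)
  case 0
  have "(\<integral>\<^sup>+\<omega>. indicator (staircase \<epsilon> h 0) \<omega> * ennreal ((\<epsilon> - corner h 0 \<omega>) powr (\<alpha> / 2)) \<partial>M) = (\<integral>\<^sup>+\<omega>. ennreal (\<epsilon> powr (\<alpha> / 2)) \<partial>M)"
    by (intro nn_integral_cong) (simp add: corner_0 staircase_def)
  then show ?case by (simp add: emeasure_space_1)
next
  case (Suc \<sigma>)
  let ?i = "mover \<sigma>"
  have st: "staircase \<epsilon> h (Suc \<sigma>) = {\<omega>\<in>staircase \<epsilon> h \<sigma>. \<forall>r\<in>{0..h}. rest h \<sigma> \<omega> * L ?i (tau h ?i \<sigma> + r) \<omega> \<le> \<epsilon>}"
    unfolding staircase_def by (auto simp: less_Suc_eq)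
  have "(\<integral>\<^sup>+\<omega>. indicator (staircase \<epsilon> h (Suc \<sigma>)) \<omega> * ennreal ((\<epsilon> - corner h (Suc \<sigma>) \<omega>) powr (\<alpha> / 2)) \<partial>M) \<le>
      (\<integral>\<^sup>+\<omega>. indicator (staircase \<epsilon> h \<sigma>) \<omega> * ennreal ((\<epsilon> - corner h \<sigma> \<omega>) powr (\<alpha> / 2)) \<partial>M)"
    unfolding st corner_Suc unfolding corner_rest[of h \<sigma>] using h \<epsilon> staircase_le[of _ \<epsilon> h \<sigma>] corner_rest[of h \<sigma>]
    by (intro stage mover_in staircase_known rest_known tau_nonneg) auto
  then show ?case using Suc.IH by (rule order_trans)
qed

section \<open>From staircases to the product process\<close>

definition below :: "real \<Rightarrow> real \<Rightarrow> 'a set" where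
  "below \<epsilon> T = {\<omega>\<in>space M. \<forall>t\<in>{0..T}. (\<Prod>i=1..n. L i t \<omega>) \<le> \<epsilon>}"

lemma prod_right: "\<omega> \<in> space M \<Longrightarrow> 0 \<le> t \<Longrightarrow>
    ((\<lambda>t. \<Prod>i=1..n. L i t \<omega>) \<longlongrightarrow> (\<Prod>i=1..n. L i t \<omega>)) (at_right t)"
  by (intro tendsto_prod cadlag_right cadlag_L) auto

lemma below_eq:
  "0 \<le> T \<Longrightarrow> below \<epsilon> T = {\<omega>\<in>space M. \<forall>l. \<forall>k\<in>{..2 ^ l}. (\<Prod>i=1..n. L i (real (k::nat) * (T / 2 ^ l)) \<omega>) \<le> \<epsilon>}"
  unfolding below_def using dyadic_le_iff[of 0 T "\<lambda>t. \<Prod>i=1..n. L i t _" \<epsilon>] prod_right by (auto simp: Ball_def)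

lemma below_known:
  assumes i: "i \<in> {1..n}" and T: "0 \<le> T"
  shows "below \<epsilon> T \<in> sets (known i T)"
proof -
  have "{\<omega>\<in>space (known i T). \<forall>l. \<forall>k\<in>{..2 ^ l}. (\<Prod>i=1..n. L i (real (k::nat) * (T / 2 ^ l)) \<omega>) \<le> \<epsilon>} \<in> sets (known i T)"
  proof (intro sets.sets_Collect_countable_All sets.sets_Collect_finite_All borel_measurable_le borel_measurable_prod borel_measurable_const)
    fix l k j :: nat assume k: "k \<in> {..2 ^ l}" and j: "j \<in> {1..n}"
    show "L j (real k * (T / 2 ^ l)) \<in> borel_measurable (known i T)"
      using T k by (intro known_measurable i j dyadic_point_le) auto
  qed auto
  then show ?thesis using below_eq[OF T] i by simp
qed

lemma below_sets [measurable]: "0 \<le> T \<Longrightarrow> below \<epsilon> T \<in> sets M"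
proof -
  assume T: "0 \<le> T"
  have "{\<omega>\<in>space M. \<forall>l. \<forall>k\<in>{..2 ^ l}. (\<Prod>i=1..n. L i (real (k::nat) * (T / 2 ^ l)) \<omega>) \<le> \<epsilon>} \<in> sets M"
    using T by (intro sets.sets_Collect_countable_All sets.sets_Collect_finite_All borel_measurable_le borel_measurable_prod borel_measurable_const) auto
  then show ?thesis using below_eq[OF T] by simp
qed

text \<open>A common jump would show up in both increments over one cell of every fine grid. By
  independence two large increments in the same cell have probability O(1/m^2), and there are
  \<open>m\<close> cells, so the chance is O(1/m).\<close>

lemma no_common_jump_pair:
  assumes i: "i \<in> {1..n}" and j: "j \<in> {1..n}" and ij: "i \<noteq> j" and T: "0 < T"
  shows "AE \<omega> in M. \<forall>t. 0 < t \<longrightarrow> t \<le> T \<longrightarrow>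
    ((\<lambda>t. L i t \<omega>) \<longlongrightarrow> L i t \<omega>) (at_left t) \<or> ((\<lambda>t. L j t \<omega>) \<longlongrightarrow> L j t \<omega>) (at_left t)"
proof -
  interpret Li: stable_levy M "L i" \<alpha> b by (rule stable[OF i])
  interpret Lj: stable_levy M "L j" \<alpha> b by (rule stable[OF j])
  define D where "D = (\<lambda>q r m k. {\<omega>\<in>space M. 1 / real (Suc r) < \<bar>L q (real (Suc k) * (T / real m)) \<omega> - L q (real k * (T / real m)) \<omega>\<bar>})"
  define C where "C = (\<lambda>r m. \<Union>k\<in>{..<m}. D i r m k \<inter> D j r m k)"
  have Dm: "D q r m k \<in> events" if "q \<in> {1..n}" for q r m k
    unfolding D_def using that T by (intro borel_measurable_less borel_measurable_abs borel_measurable_diff borel_measurable_const meas_L) auto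
  have Cm: "C r m \<in> events" for r m unfolding C_def using Dm i j by auto
  have pD: "prob (D q r m k) \<le> 8 * b * (T / real m) * (1 / real (Suc r)) powr - \<alpha>" if q: "q \<in> {1..n}" and m: "0 < m" for q r m k
  proof -
    interpret Q: stable_levy M "L q" \<alpha> b by (rule stable[OF q])
    interpret S: stable_levy M "\<lambda>r \<omega>. L q (real k * (T / real m) + r) \<omega> - L q (real k * (T / real m)) \<omega>" \<alpha> b
      using T by (intro Q.shift_stable) simp
    have "D q r m k = {\<omega>\<in>space M. 1 / real (Suc r) < \<bar>L q (real k * (T / real m) + T / real m) \<omega> - L q (real k * (T / real m)) \<omega>\<bar>}"
      unfolding D_def by (simp add: algebra_simps add_divide_distrib)
    then show ?thesis using S.X_tail_upper[of "T / real m" "1 / real (Suc r)"] T m by simp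
  qed
  have indD: "prob (D i r m k \<inter> D j r m k) = prob (D i r m k) * prob (D j r m k)" for r m k
  proof -
    have "indep_vars (\<lambda>_. borel) (\<lambda>q \<omega>. traj (L q) \<omega> (real (Suc k) * (T / real m)) - traj (L q) \<omega> (real k * (T / real m))) {1..n}"
      using T by (intro indep_vars_compose2[OF indep] borel_measurable_diff measurable_component_singleton) auto
    then have "indep_vars (\<lambda>_. borel) (\<lambda>q \<omega>. L q (real (Suc k) * (T / real m)) \<omega> - L q (real k * (T / real m)) \<omega>) {1..n}"
      using T by (simp add: traj_def)
    from indep_varsD[OF this, of "{i, j}" "\<lambda>_. {x. 1 / real (Suc r) < \<bar>x\<bar>}"]
    show ?thesis using i j ij unfolding D_def by (simp add: vimage_def Int_def conj_ac)
  qed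
  have "AE \<omega> in M. \<not> eventually (\<lambda>m. \<omega> \<in> C r m) sequentially" for r
  proof -
    define K where "K = (8 * b * T * (1 / real (Suc r)) powr - \<alpha>)\<^sup>2"
    have pC: "prob (C r m) \<le> K / real m" if m: "0 < m" for m
    proof -
      have "prob (C r m) \<le> (\<Sum>k<m. prob (D i r m k \<inter> D j r m k))"
        unfolding C_def using Dm i j by (intro finite_measure_subadditive_finite) auto
      also have "\<dots> \<le> (\<Sum>k<m. (8 * b * (T / real m) * (1 / real (Suc r)) powr - \<alpha>) * (8 * b * (T / real m) * (1 / real (Suc r)) powr - \<alpha>))"
        unfolding indD using b T by (intro sum_mono mult_mono pD i j m) auto
      also have "\<dots> = K / real m" unfolding K_def using m by (simp add: power2_eq_square field_simps)
      finally show ?thesis .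
    qed
    have "AE \<omega> in M. \<not> (\<forall>m\<ge>N. \<omega> \<in> C r m)" for N
    proof -
      define E where "E = (\<Inter>m\<in>{N..}. C r m)"
      have Em: "E \<in> events" unfolding E_def using Cm by (intro sets.countable_INT') auto
      have "prob E \<le> K / real (Suc m)" if "N \<le> Suc m" for m
      proof -
        have "prob E \<le> prob (C r (Suc m))" unfolding E_def using that Cm by (intro finite_measure_mono) auto
        then show ?thesis using pC[of "Suc m"] by simp
      qed
      moreover have "(\<lambda>m. K / real (Suc m)) \<longlonglongrightarrow> 0"
        using tendsto_mult[OF tendsto_const LIMSEQ_inverse_real_of_nat, of K] by (simp add: divide_inverse)
      ultimately have "prob E \<le> 0" by (intro LIMSEQ_le_const[of "\<lambda>m. K / real (Suc m)"]) (auto intro!: exI[of _ N])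
      then have "E \<in> null_sets M" using Em by (simp add: null_sets_def emeasure_eq_measure measure_le_0_iff)
      then have "AE \<omega> in M. \<omega> \<notin> E" by (rule AE_not_in)
      then show ?thesis by eventually_elim (auto simp: E_def)
    qed
    then have "AE \<omega> in M. \<forall>N. \<not> (\<forall>m\<ge>N. \<omega> \<in> C r m)" by (simp add: AE_all_countable)
    then show ?thesis by eventually_elim (simp only: eventually_sequentially not_ex simp_thms)
  qed
  then have "AE \<omega> in M. \<forall>r. \<not> eventually (\<lambda>m. \<omega> \<in> C r m) sequentially" by (simp add: AE_all_countable)
  then show ?thesis using AE_space
  proof eventually_elim
    fix \<omega> assume no: "\<forall>r. \<not> eventually (\<lambda>m. \<omega> \<in> C r m) sequentially" and \<omega>: "\<omega> \<in> space M"
    show "\<forall>t. 0 < t \<longrightarrow> t \<le> T \<longrightarrow>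
      ((\<lambda>t. L i t \<omega>) \<longlongrightarrow> L i t \<omega>) (at_left t) \<or> ((\<lambda>t. L j t \<omega>) \<longlongrightarrow> L j t \<omega>) (at_left t)"
    proof (intro allI impI, rule ccontr)
      fix t assume t: "0 < t" "t \<le> T" and bad: "\<not> (((\<lambda>t. L i t \<omega>) \<longlongrightarrow> L i t \<omega>) (at_left t) \<or> ((\<lambda>t. L j t \<omega>) \<longlongrightarrow> L j t \<omega>) (at_left t))"
      then obtain r where "eventually (\<lambda>m. \<exists>k<m. 1 / real (Suc r) < \<bar>L i (real (Suc k) * (T / real m)) \<omega> - L i (real k * (T / real m)) \<omega>\<bar> \<and>
          1 / real (Suc r) < \<bar>L j (real (Suc k) * (T / real m)) \<omega> - L j (real k * (T / real m)) \<omega>\<bar>) sequentially"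
        using common_jump_detected[OF cadlag_L[OF i \<omega>] cadlag_L[OF j \<omega>] t] by blast
      then have "eventually (\<lambda>m. \<omega> \<in> C r m) sequentially"
        by eventually_elim (use \<omega> in \<open>auto simp: C_def D_def\<close>)
      then show False using no by blast
    qed
  qed
qed

text \<open>The factor \<open>2\<close> leaves room for the staircase paths, which stay close to the true path only in the
  limit of small steps.\<close>

lemma product_supermartingale:
  assumes \<epsilon>: "0 < \<epsilon>" and T: "0 < T"
  shows "(\<integral>\<^sup>+\<omega>. indicator (below \<epsilon> T) \<omega> * ennreal ((2 * \<epsilon> - (\<Prod>i=1..n. L i T \<omega>)) powr (\<alpha> / 2)) \<partial>M) \<le> ennreal ((2 * \<epsilon>) powr (\<alpha> / 2))"
proof -
  define f where "f = (\<lambda>m \<omega>. indicator (staircase (2 * \<epsilon>) (T / real (Suc m)) (Suc m * n)) \<omega> *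
      ennreal ((2 * \<epsilon> - corner (T / real (Suc m)) (Suc m * n) \<omega>) powr (\<alpha> / 2)))"
  \<comment> \<open>After \<open>Suc m\<close> full rounds of length \<open>T / Suc m\<close> all
    clocks show \<open>T\<close>.\<close>
  have ce: "corner (T / real (Suc m)) (Suc m * n) \<omega> = (\<Prod>i=1..n. L i T \<omega>)" for m \<omega>
    unfolding corner_def using tau_end[of _ "T / real (Suc m)" "Suc m"] by (intro prod.cong) (auto simp del: mult_Suc)
  have stm: "staircase (2 * \<epsilon>) h \<sigma> \<in> events" if h: "0 < h" for h \<sigma>
  proof -
    have n1: "1 \<in> {1..n}" using n by simp
    interpret X: stable_levy M "L 1" \<alpha> b by (rule stable[OF n1])
    have t0: "0 \<le> tau h 1 \<sigma>" using h by (intro tau_nonneg) simp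
    have id: "(\<lambda>\<omega>. \<omega>) \<in> M \<rightarrow>\<^sub>M known 1 (tau h 1 \<sigma>)"
      unfolding known_def by (rule X.past_future_indep'[OF others_indep[OF n1] t0, unfolded indep_pair_def, THEN conjunct1])
    have "staircase (2 * \<epsilon>) h \<sigma> \<subseteq> space M" unfolding staircase_def by (rule Collect_restrict)
    then have "(\<lambda>\<omega>. \<omega>) -` staircase (2 * \<epsilon>) h \<sigma> \<inter> space M = staircase (2 * \<epsilon>) h \<sigma>"
      unfolding vimage_ident by (rule Int_absorb2)
    then show ?thesis using measurable_sets[OF id staircase_known[OF h n1, of "2 * \<epsilon>" \<sigma>]] by (simp only:)
  qed
  have fm: "f m \<in> borel_measurable M" for m
    unfolding f_def ce using T stm[of "T / real (Suc m)"]
    by (intro borel_measurable_times_ennreal borel_measurable_indicator measurable_compose[OF _ measurable_ennreal]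
       powr_real_measurable borel_measurable_diff borel_measurable_prod borel_measurable_const meas_L) auto
  have "AE \<omega> in M. \<forall>i\<in>{1..n}. \<forall>j\<in>{1..n}. i \<noteq> j \<longrightarrow> (\<forall>t. 0 < t \<longrightarrow> t \<le> T \<longrightarrow>
    ((\<lambda>t. L i t \<omega>) \<longlongrightarrow> L i t \<omega>) (at_left t) \<or> ((\<lambda>t. L j t \<omega>) \<longlongrightarrow> L j t \<omega>) (at_left t))"
    using no_common_jump_pair[OF _ _ _ T] by (intro AE_finite_allI) auto
  then have "AE \<omega> in M. indicator (below \<epsilon> T) \<omega> * ennreal ((2 * \<epsilon> - (\<Prod>i=1..n. L i T \<omega>)) powr (\<alpha> / 2)) \<le> liminf (\<lambda>m. f m \<omega>)"
  proof eventually_elim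
    fix \<omega> assume nj: "\<forall>i\<in>{1..n}. \<forall>j\<in>{1..n}. i \<noteq> j \<longrightarrow> (\<forall>t. 0 < t \<longrightarrow> t \<le> T \<longrightarrow>
      ((\<lambda>t. L i t \<omega>) \<longlongrightarrow> L i t \<omega>) (at_left t) \<or> ((\<lambda>t. L j t \<omega>) \<longlongrightarrow> L j t \<omega>) (at_left t))"
    show "indicator (below \<epsilon> T) \<omega> * ennreal ((2 * \<epsilon> - (\<Prod>i=1..n. L i T \<omega>)) powr (\<alpha> / 2)) \<le> liminf (\<lambda>m. f m \<omega>)"
    proof (cases "\<omega> \<in> below \<epsilon> T")
      case True
      then have \<omega>: "\<omega> \<in> space M" and le: "\<And>t. 0 \<le> t \<Longrightarrow> t \<le> T \<Longrightarrow> (\<Prod>i\<in>{1..n}. L i t \<omega>) \<le> \<epsilon>"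
        by (auto simp: below_def)
      have "\<exists>\<delta>>0. \<forall>t s. 0 \<le> t \<longrightarrow> t \<le> T \<longrightarrow> (\<forall>i\<in>{1..n}. 0 \<le> s i \<and> \<bar>s i - t\<bar> \<le> \<delta>) \<longrightarrow> (\<Prod>i\<in>{1..n}. L i (s i) \<omega>) \<le> 2 * \<epsilon>"
      proof (rule prod_near_path[where f = "\<lambda>i t. L i t \<omega>" and \<epsilon> = \<epsilon>])
        show "\<epsilon> < 2 * \<epsilon>" using \<epsilon> by simp
      qed (use cadlag_L[OF _ \<omega>] nj le in auto)
      then obtain \<delta> where \<delta>: "0 < \<delta>" "\<And>t s. 0 \<le> t \<Longrightarrow> t \<le> T \<Longrightarrow> (\<forall>i\<in>{1..n}. 0 \<le> s i \<and> \<bar>s i - t\<bar> \<le> \<delta>) \<Longrightarrow> (\<Prod>i\<in>{1..n}. L i (s i) \<omega>) \<le> 2 * \<epsilon>"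
        by blast
      have "(\<lambda>m. T / real (Suc m)) \<longlonglongrightarrow> 0"
        using tendsto_mult[OF tendsto_const LIMSEQ_inverse_real_of_nat, of T] by (simp add: divide_inverse)
      then have "eventually (\<lambda>m. T / real (Suc m) < \<delta>) sequentially" using \<delta>(1) by (rule order_tendstoD)
      then have "eventually (\<lambda>m. indicator (below \<epsilon> T) \<omega> * ennreal ((2 * \<epsilon> - (\<Prod>i=1..n. L i T \<omega>)) powr (\<alpha> / 2)) \<le> f m \<omega>) sequentially"
      proof eventually_elim
        fix m :: nat assume hd: "T / real (Suc m) < \<delta>"
        define h where "h = T / real (Suc m)"
        have h: "0 < h" "h < \<delta>" unfolding h_def using T hd by auto
        have "\<omega> \<in> staircase (2 * \<epsilon>) h (Suc m * n)"
          unfolding staircase_def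
        proof (intro CollectI conjI allI impI ballI \<omega>)
          fix \<rho> r assume \<rho>: "\<rho> < Suc m * n" and r: "r \<in> {0..h}"
          let ?i = "mover \<rho>"
          \<comment> \<open>The clocks in the middle of stage \<rho>: all are within one step of the
            mover's clock at the beginning of the stage, so the product there is close to the true
            path.\<close>
          define s where "s = (\<lambda>j. if j = ?i then tau h ?i \<rho> + r else tau h j \<rho>)"
          have "tau h ?i \<rho> \<le> tau h ?i (Suc m * n)" using h \<rho> by (intro tau_mono) auto
          also have "\<dots> = T" unfolding tau_end[OF mover_in] h_def by simp
          finally have tT: "tau h ?i \<rho> \<le> T" .
          have "\<forall>j\<in>{1..n}. 0 \<le> s j \<and> \<bar>s j - tau h ?i \<rho>\<bar> \<le> \<delta>"
          proof
            fix j assume j: "j \<in> {1..n}"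
            show "0 \<le> s j \<and> \<bar>s j - tau h ?i \<rho>\<bar> \<le> \<delta>"
              using tau_close[OF j mover_in[of \<rho>], of h \<rho>] h r tau_nonneg[of h j \<rho>] by (auto simp: s_def)
          qed
          then have "(\<Prod>i\<in>{1..n}. L i (s i) \<omega>) \<le> 2 * \<epsilon>"
            using tau_nonneg[of h ?i \<rho>] h tT by (intro \<delta>(2)) auto
          also have "(\<Prod>i\<in>{1..n}. L i (s i) \<omega>) = L ?i (s ?i) \<omega> * (\<Prod>i\<in>{1..n} - {?i}. L i (s i) \<omega>)"
            using mover_in[of \<rho>] by (intro prod.remove) auto
          also have "(\<Prod>i\<in>{1..n} - {?i}. L i (s i) \<omega>) = rest h \<rho> \<omega>"
            unfolding rest_def s_def by (intro prod.cong) auto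
          finally show "rest h \<rho> \<omega> * L ?i (tau h ?i \<rho> + r) \<omega> \<le> 2 * \<epsilon>" by (simp add: s_def mult.commute)
        qed
        then show "indicator (below \<epsilon> T) \<omega> * ennreal ((2 * \<epsilon> - (\<Prod>i=1..n. L i T \<omega>)) powr (\<alpha> / 2)) \<le> f m \<omega>"
          using True unfolding f_def ce h_def by (simp del: mult_Suc)
      qed
      \<comment> \<open>A lower bound for the limes inferior is all that Fatou's lemma needs, so
        convergence of the staircase indicators is not asked for.\<close>
      then show ?thesis by (rule Liminf_bounded)
    qed simp
  qed
  then have "(\<integral>\<^sup>+\<omega>. indicator (below \<epsilon> T) \<omega> * ennreal ((2 * \<epsilon> - (\<Prod>i=1..n. L i T \<omega>)) powr (\<alpha> / 2)) \<partial>M) \<le> (\<integral>\<^sup>+\<omega>. liminf (\<lambda>m. f m \<omega>) \<partial>M)"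
    by (rule nn_integral_mono_AE)
  also have "\<dots> \<le> liminf (\<lambda>m. \<integral>\<^sup>+\<omega>. f m \<omega> \<partial>M)" by (rule nn_integral_liminf[OF fm])
  also have "\<dots> \<le> liminf (\<lambda>m::nat. ennreal ((2 * \<epsilon>) powr (\<alpha> / 2)))"
    unfolding f_def using T \<epsilon> by (intro Liminf_mono always_eventually allI staircase_supermartingale) auto
  also have "\<dots> = ennreal ((2 * \<epsilon>) powr (\<alpha> / 2))" by (simp add: Liminf_const)
  finally show ?thesis .
qed

end

section \<open>Persistence\<close>

text \<open>Unrolling the recursion gives a geometric series; boundedness of \<open>q\<close>
  removes the remainder.\<close>

lemma halving_bound:
  fixes q :: "nat \<Rightarrow> real"
  assumes rec: "\<And>j. q j \<le> a + q (Suc j) / 2" and q: "\<And>j. q j \<le> 1"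
  shows "q 0 \<le> 2 * a"
proof -
  have "q 0 \<le> 2 * a * (1 - (1 / 2) ^ J) + (1 / 2) ^ J * q J" for J
  proof (induction J)
    case (Suc J)
    have "(1 / 2) ^ J * q J \<le> (1 / 2) ^ J * (a + q (Suc J) / 2)" by (intro mult_left_mono rec) simp
    then show ?case using Suc by (simp add: algebra_simps)
  qed simp
  moreover have "(1 / 2) ^ J * q J \<le> (1 / 2) ^ J * 1" for J by (intro mult_left_mono q) simp
  ultimately have "q 0 \<le> 2 * a * (1 - (1 / 2) ^ J) + (1 / 2) ^ J" for J
    by (smt (verit) mult.right_neutral)
  moreover have "(\<lambda>J. 2 * a * (1 - (1 / 2) ^ J) + (1 / 2) ^ J) \<longlonglongrightarrow> 2 * a * (1 - 0) + 0"
    by (intro tendsto_intros LIMSEQ_power_zero) auto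
  ultimately have "q 0 \<le> 2 * a * (1 - 0) + 0" by (intro LIMSEQ_le_const) auto
  then show ?thesis by simp
qed

text \<open>Compare horizon T = 2 s with horizon s. If all coordinates exceed a threshold of order
  s^(1/\<alpha>) at \<open>T\<close>, the supermartingale bound and Markov's inequality apply.
  Otherwise one coordinate is small at \<open>T\<close>, which after survival up to \<open>s\<close>
  has conditional probability at most \<open>e\<close>.\<close>

lemma persistence_upper:
  assumes \<alpha>: "0 < \<alpha>" and b: "0 < b" and n: "1 \<le> n"
  obtains C where "0 < C" "\<And>(M :: 'a measure) L \<epsilon>. iid_stable M L n \<alpha> b \<Longrightarrow> 0 < \<epsilon> \<Longrightarrow>
    measure M (iid_stable.below M L n \<epsilon> 1) \<le> C * \<epsilon> powr (\<alpha> / 2)"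
proof -
  \<comment> \<open>The threshold \<rho> scales as s^(1/\<alpha>), so (\<rho>^n)^(-\<alpha>/2)
    scales as s^(-n/2): halving the horizon multiplies the bound by G.\<close>
  define G where "G = 2 powr (real n / 2)"
  have G: "0 < G" unfolding G_def by simp
  \<comment> \<open>Summed over the \<open>n\<close> coordinates this leaves
    \<open>p (Suc j) / (2 * G)\<close>, a contraction by 1/2 once \<open>p\<close> is normalised by
    powers of \<open>G\<close>.\<close>
  define e where "e = 1 / (2 * real n * G)"
  have e: "0 < e" unfolding e_def using n G by simp
  obtain \<rho>0 where \<rho>0: "0 < \<rho>0"
    "\<And>\<nu> t a. 0 < t \<Longrightarrow> stable_law \<alpha> (b * t) \<nu> \<Longrightarrow> measure \<nu> {y. \<bar>y - a\<bar> \<le> \<rho>0 * t powr (1 / \<alpha>)} \<le> e"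
    by (rule stable_law_concentration[OF \<alpha> b e]) blast
  define K where "K = 2 powr (\<alpha> / 2) * \<rho>0 powr - (real n * \<alpha> / 2) * G"
  have K: "0 < K" unfolding K_def using G \<rho>0 by simp
  show thesis
  proof (rule that[of "2 * K"])
    show "0 < 2 * K" using K by simp
    fix M :: "'a measure" and L \<epsilon> assume iid: "iid_stable M L n \<alpha> b" and \<epsilon>: "0 < (\<epsilon> :: real)"
    interpret iid_stable M L n \<alpha> b by fact
    define p where "p = (\<lambda>j :: nat. prob (below \<epsilon> ((1 / 2) ^ j)))"
    define q where "q = (\<lambda>j. p j / G ^ j)"
    have "q j \<le> K * \<epsilon> powr (\<alpha> / 2) + q (Suc j) / 2" for j
    proof -
      define s :: real where "s = (1 / 2) ^ Suc j"
      define T where "T = s + s"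
      have s: "0 < s" unfolding s_def by simp
      have T: "0 < T" "T = (1 / 2) ^ j" unfolding T_def s_def by auto
      define \<rho> where "\<rho> = \<rho>0 * s powr (1 / \<alpha>)"
      have \<rho>: "0 < \<rho>" unfolding \<rho>_def using \<rho>0 s by simp
      \<comment> \<open>Survival is required only up to \<open>s\<close>, so that the increment over
        the second half of the horizon is independent of it.\<close>
      define D where "D = (\<lambda>i. {\<omega>\<in>below \<epsilon> s. \<bar>L i (s + s) \<omega>\<bar> \<le> \<rho>})"
      define H where "H = {\<omega>\<in>below \<epsilon> T. \<forall>i\<in>{1..n}. \<rho> < \<bar>L i T \<omega>\<bar>}"
      have bT: "below \<epsilon> T \<in> events" "below \<epsilon> s \<in> events" using T s by (auto intro!: below_sets)
      have Hm: "H \<in> events"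
      proof -
        have "H = below \<epsilon> T \<inter> {\<omega>\<in>space M. \<forall>i\<in>{1..n}. \<rho> < \<bar>L i T \<omega>\<bar>}"
          unfolding H_def below_def by auto
        also have "\<dots> \<in> events" using T bT by (intro sets.Int sets.sets_Collect_finite_All borel_measurable_less borel_measurable_abs meas_L) auto
        finally show ?thesis .
      qed
      have Dm: "D i \<in> events" if "i \<in> {1..n}" for i
      proof -
        have "D i = below \<epsilon> s \<inter> {\<omega>\<in>space M. \<bar>L i (s + s) \<omega>\<bar> \<le> \<rho>}" unfolding D_def below_def by auto
        also have "\<dots> \<in> events" using s bT that by (intro sets.Int borel_measurable_le borel_measurable_abs meas_L) auto
        finally show ?thesis .
      qed
      have pD: "prob (D i) \<le> e * p (Suc j)" if i: "i \<in> {1..n}" for i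
      proof -
        interpret X: stable_levy M "L i" \<alpha> b by (rule stable[OF i])
        have "\<P>(\<omega> in M. \<bar>a + L i s \<omega>\<bar> \<le> \<rho>) \<le> e" for a
          using \<rho>0(2)[OF s X.stable_law_X, of "- a"] X.prob_X[of s "{y. \<bar>y - - a\<bar> \<le> \<rho>}"] s by (simp add: \<rho>_def add.commute)
        then show ?thesis unfolding D_def p_def s_def[symmetric] using s
          by (intro joint_freeze[OF i] below_known i) auto
      qed
      have pH: "prob H \<le> (2 * \<epsilon>) powr (\<alpha> / 2) * (\<rho> ^ n) powr - (\<alpha> / 2)"
      proof -
        define w where "w = (\<rho> ^ n) powr (\<alpha> / 2)"
        have w: "0 < w" unfolding w_def using \<rho> by simp
        have "ennreal (w * prob H) = (\<integral>\<^sup>+\<omega>. ennreal w * indicator H \<omega> \<partial>M)"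
          using Hm w by (simp add: nn_integral_cmult emeasure_eq_measure ennreal_mult)
        also have "\<dots> \<le> (\<integral>\<^sup>+\<omega>. indicator (below \<epsilon> T) \<omega> * ennreal ((2 * \<epsilon> - (\<Prod>i=1..n. L i T \<omega>)) powr (\<alpha> / 2)) \<partial>M)"
        proof (rule nn_integral_mono)
          fix \<omega>
          show "ennreal w * indicator H \<omega> \<le> indicator (below \<epsilon> T) \<omega> * ennreal ((2 * \<epsilon> - (\<Prod>i=1..n. L i T \<omega>)) powr (\<alpha> / 2))"
          proof (cases "\<omega> \<in> H")
            case True
            then have H: "\<omega> \<in> below \<epsilon> T" "\<And>i. i \<in> {1..n} \<Longrightarrow> \<rho> < \<bar>L i T \<omega>\<bar>" by (auto simp: H_def)
            define x where "x = (\<Prod>i=1..n. L i T \<omega>)"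
            have "x \<le> \<epsilon>" using H(1) T unfolding below_def x_def by auto
            have "(\<Prod>i=1..n. \<rho>) \<le> (\<Prod>i=1..n. \<bar>L i T \<omega>\<bar>)"
              using H(2) \<rho> by (intro prod_mono) (auto intro: less_imp_le)
            then have "\<rho> ^ n \<le> \<bar>x\<bar>" by (simp add: x_def abs_prod)
            \<comment> \<open>If \<open>x\<close> is negative this is immediate. If it is positive,
              \<rho>^n \<le> x \<le> \<epsilon> \<le> 2 \<epsilon> - x, so the sign of the product
              needs no separate estimate.\<close>
            then have "\<rho> ^ n \<le> 2 * \<epsilon> - x" using \<open>x \<le> \<epsilon>\<close> \<epsilon> by linarith
            then have "w \<le> (2 * \<epsilon> - x) powr (\<alpha> / 2)" unfolding w_def using \<rho> \<alpha> by (intro powr_mono2) auto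
            then show ?thesis using True H(1) by (simp add: x_def ennreal_leI)
          qed simp
        qed
        also have "\<dots> \<le> ennreal ((2 * \<epsilon>) powr (\<alpha> / 2))" by (rule product_supermartingale[OF \<epsilon> T(1)])
        finally have "w * prob H \<le> (2 * \<epsilon>) powr (\<alpha> / 2)" by (simp add: ennreal_le_iff)
        then show ?thesis using w unfolding powr_minus w_def[symmetric] by (simp add: field_simps)
      qed
      have sub: "below \<epsilon> T \<subseteq> H \<union> (\<Union>i\<in>{1..n}. D i)"
      proof
        fix \<omega> assume \<omega>: "\<omega> \<in> below \<epsilon> T"
        then have "\<omega> \<in> below \<epsilon> s" unfolding below_def T_def using s by auto
        then show "\<omega> \<in> H \<union> (\<Union>i\<in>{1..n}. D i)"
          using \<omega> unfolding H_def D_def T_def[symmetric] by (auto simp: not_less)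
      qed
      have "p j = prob (below \<epsilon> T)" unfolding p_def T(2) ..
      also have "\<dots> \<le> prob (H \<union> (\<Union>i\<in>{1..n}. D i))" using Hm Dm by (intro finite_measure_mono sub) auto
      also have "\<dots> \<le> prob H + prob (\<Union>i\<in>{1..n}. D i)" using Hm Dm by (intro measure_Un_le) auto
      also have "prob (\<Union>i\<in>{1..n}. D i) \<le> (\<Sum>i\<in>{1..n}. prob (D i))" using Dm by (intro finite_measure_subadditive_finite) auto
      also have "\<dots> \<le> (\<Sum>i\<in>{1..n}. e * p (Suc j))" by (intro sum_mono pD)
      also have "\<dots> = p (Suc j) / (2 * G)" unfolding e_def using n by simp
      finally have "p j \<le> prob H + p (Suc j) / (2 * G)" by simp
      moreover have "(2 * \<epsilon>) powr (\<alpha> / 2) * (\<rho> ^ n) powr - (\<alpha> / 2) = K * \<epsilon> powr (\<alpha> / 2) * G ^ j"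
      proof -
        have "(\<rho> ^ n) powr - (\<alpha> / 2) = \<rho> powr - (real n * \<alpha> / 2)"
          using \<rho> by (simp add: powr_realpow[symmetric] powr_powr)
        also have "\<dots> = \<rho>0 powr - (real n * \<alpha> / 2) * s powr - (real n / 2)"
          unfolding \<rho>_def using \<rho>0 s \<alpha> by (simp add: powr_mult powr_powr)
        also have "s powr - (real n / 2) = G ^ Suc j"
        proof -
          have "s = 2 powr - real (Suc j)" unfolding s_def by (simp only: powr_minus powr_realpow) (simp add: power_one_over inverse_eq_divide)
          then have "s powr - (real n / 2) = 2 powr (- real (Suc j) * - (real n / 2))" by (simp only: powr_powr)
          also have "- real (Suc j) * - (real n / 2) = real n / 2 * real (Suc j)" by (simp only: minus_mult_minus mult.commute)
          also have "2 powr (real n / 2 * real (Suc j)) = G powr real (Suc j)" unfolding G_def powr_powr ..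
          also have "\<dots> = G ^ Suc j" using G by (rule powr_realpow)
          finally show ?thesis .
        qed
        finally show ?thesis unfolding K_def using \<epsilon> by (simp add: powr_mult mult_ac)
      qed
      ultimately have "p j \<le> K * \<epsilon> powr (\<alpha> / 2) * G ^ j + p (Suc j) / (2 * G)" using pH by linarith
      then have "p j / G ^ j \<le> (K * \<epsilon> powr (\<alpha> / 2) * G ^ j + p (Suc j) / (2 * G)) / G ^ j" using G by (intro divide_right_mono) auto
      also have "\<dots> = K * \<epsilon> powr (\<alpha> / 2) + p (Suc j) / (2 * G) / G ^ j" using G by (simp add: add_divide_distrib)
      finally show ?thesis unfolding q_def by (simp add: mult_ac)
    qed
    moreover have "q j \<le> 1" for j
    proof -
      have "1 \<le> G" unfolding G_def by (simp add: ge_one_powr_ge_zero)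
      then have "1 \<le> G ^ j" by (rule one_le_power)
      moreover have "p j \<le> 1" unfolding p_def by simp
      ultimately have "p j \<le> G ^ j" by linarith
      then show ?thesis unfolding q_def using G by (simp add: divide_le_eq)
    qed
    ultimately have "q 0 \<le> 2 * (K * \<epsilon> powr (\<alpha> / 2))" by (rule halving_bound)
    then show "prob (below \<epsilon> 1) \<le> 2 * K * \<epsilon> powr (\<alpha> / 2)" by (simp add: q_def p_def)
  qed
qed

section \<open>Lower bound for persistence\<close>

lemma (in levy) past_le:
  assumes V: "V \<in> M \<rightarrow>\<^sub>M S" and t: "0 \<le> t"
  shows "{\<omega>\<in>space M. \<forall>r\<in>{0..t}. c * X r \<omega> \<le> y} \<in> sets (past S V t)"
proof -
  have "(\<forall>r\<in>{0..t}. c * X r \<omega> \<le> y) \<longleftrightarrow> (\<forall>l. \<forall>k\<in>{..2 ^ l}. c * X (real (k::nat) * (t / 2 ^ l)) \<omega> \<le> y)" if \<omega>: "\<omega> \<in> space M" for \<omega>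
    using dyadic_le_iff[of 0 t "\<lambda>r. c * X r \<omega>" y] tendsto_mult_left[OF cadlag_right[OF cadlag[OF \<omega>]], of _ c] t by (simp add: Ball_def)
  then have "{\<omega>\<in>space M. \<forall>r\<in>{0..t}. c * X r \<omega> \<le> y} = {\<omega>\<in>space (past S V t). \<forall>l. \<forall>k\<in>{..2 ^ l}. c * X (real (k::nat) * (t / 2 ^ l)) \<omega> \<le> y}"
    unfolding space_past by (intro Collect_cong conj_cong refl)
  also have "\<dots> \<in> sets (past S V t)"
  proof (intro sets.sets_Collect_countable_All sets.sets_Collect_finite_All borel_measurable_le borel_measurable_times borel_measurable_const)
    fix l k :: nat assume "k \<in> {..2 ^ l}"
    then show "X (real k * (t / 2 ^ l)) \<in> borel_measurable (past S V t)" using t by (intro past_measurable_X V dyadic_point_le) auto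
  qed auto
  finally show ?thesis .
qed

text \<open>Up to a time of order \<delta>^\<alpha> the process stays within \<delta> and ends below
  a negative multiple of \<delta> with probability at least 1/4. After that it suffices that the
  fresh process does not climb back before time 1, which has probability of order
  \<delta>^(\<alpha>/2).\<close>

lemma stays_negative_lower:
  assumes \<alpha>: "0 < \<alpha>" "\<alpha> < 2" and b: "0 < b"
  obtains c \<eta> where "0 < c" "0 < \<eta>" "\<eta> \<le> 1"
    "\<And>(M :: 'a measure) X \<delta>. stable_levy M X \<alpha> b \<Longrightarrow> 0 < \<delta> \<Longrightarrow> \<delta> < 1 \<Longrightarrow>
      c * \<delta> powr (\<alpha> / 2) \<le> \<P>(\<omega> in M. (\<forall>t\<in>{0..\<eta> * \<delta> powr \<alpha>}. \<bar>X t \<omega>\<bar> \<le> \<delta>) \<and> (\<forall>t\<in>{\<eta> * \<delta> powr \<alpha>..1}. X t \<omega> \<le> 0))"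
proof -
  \<comment> \<open>Leaving the interval on either side then has probability at most 8 b \<eta>
    \<le> 1/16, so 3/8 - 1/8 = 1/4 remains.\<close>
  define \<eta> where "\<eta> = min 1 (1 / (128 * b))"
  have \<eta>: "0 < \<eta>" "\<eta> \<le> 1" "\<eta> \<le> 1 / (128 * b)" unfolding \<eta>_def using b by auto
  obtain \<rho>' where \<rho>': "0 < \<rho>'"
    "\<And>\<nu> t a. 0 < t \<Longrightarrow> stable_law \<alpha> (b * t) \<nu> \<Longrightarrow> measure \<nu> {y. \<bar>y - a\<bar> \<le> \<rho>' * t powr (1 / \<alpha>)} \<le> 1 / 4"
    by (rule stable_law_concentration[OF \<alpha>(1) b, of "1 / 4"]) (simp, blast)
  \<comment> \<open>Concentration puts at least 3/4 outside the interval of radius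
    \<open>y0\<close>, hence by symmetry 3/8 below \<open>- y0\<close>. The cap at 1 keeps
    \<open>y0\<close> below 1, where \<open>surv_lower\<close> is available for horizon 1.\<close>
  define \<rho> where "\<rho> = min 1 \<rho>'"
  have \<rho>: "0 < \<rho>" "\<rho> \<le> 1" "\<rho> \<le> \<rho>'" unfolding \<rho>_def using \<rho>' by auto
  define g where "g = \<rho> * \<eta> powr (1 / \<alpha>)"
  have g: "0 < g" "g \<le> 1"
  proof -
    show "0 < g" unfolding g_def using \<rho> \<eta> by simp
    have "\<eta> powr (1 / \<alpha>) \<le> 1 powr (1 / \<alpha>)" using \<eta> \<alpha> by (intro powr_mono2) auto
    then have "\<eta> powr (1 / \<alpha>) \<le> 1" by simp
    then show "g \<le> 1" unfolding g_def using \<rho> by (intro mult_le_one) auto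
  qed
  define d where "d = sqrt (min 1 (1 / (64 * b)) / 2) / 16"
  have d: "0 < d" unfolding d_def using b by simp
  show thesis
  proof (rule that[of "1 / 4 * (d * g powr (\<alpha> / 2))" \<eta>])
    show "0 < 1 / 4 * (d * g powr (\<alpha> / 2))" using d g by simp
    fix M :: "'a measure" and X \<delta> assume X: "stable_levy M X \<alpha> b" and \<delta>: "0 < \<delta>" "\<delta> < (1 :: real)"
    interpret stable_levy M X \<alpha> b by fact
    interpret m: stable_levy M "\<lambda>t \<omega>. - X t \<omega>" \<alpha> b by (rule minus_stable)
    define t0 where "t0 = \<eta> * \<delta> powr \<alpha>"
    have t0: "0 < t0" unfolding t0_def using \<eta> \<delta> by simp
    have t01: "t0 \<le> 1"
    proof -
      have "\<delta> powr \<alpha> \<le> 1 powr \<alpha>" using \<delta> \<alpha> by (intro powr_mono2) auto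
      then show ?thesis unfolding t0_def using \<eta> by (intro mult_le_one) auto
    qed
    interpret S: stable_levy M "\<lambda>r \<omega>. X (t0 + r) \<omega> - X t0 \<omega>" \<alpha> b using t0 by (intro shift_stable) simp
    have [measurable]: "X t0 \<in> borel_measurable M" using t0 by simp
    define y0 where "y0 = g * \<delta>"
    have y0: "0 < y0" "y0 < 1"
    proof -
      show "0 < y0" unfolding y0_def using g \<delta> by simp
      have "g * \<delta> \<le> 1 * \<delta>" using g \<delta> by (intro mult_right_mono) auto
      then show "y0 < 1" unfolding y0_def using \<delta> by linarith
    qed
    have yt: "y0 = \<rho> * t0 powr (1 / \<alpha>)"
      unfolding y0_def g_def t0_def using \<eta> \<delta> \<alpha> by (simp add: powr_mult powr_powr)
    let ?V = "\<lambda>_::'a. ()" and ?S = "count_space UNIV :: unit measure"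
    have V: "indep_pair ?S ?V paths (traj X)" by (rule indep_pair_trivial) simp
    have Vm: "?V \<in> M \<rightarrow>\<^sub>M ?S" by simp
    define P1 where "P1 = {\<omega>\<in>space M. \<forall>r\<in>{0..t0}. 1 * X r \<omega> \<le> \<delta>}"
    define P2 where "P2 = {\<omega>\<in>space M. \<forall>r\<in>{0..t0}. (- 1) * X r \<omega> \<le> \<delta>}"
    define P3 where "P3 = {\<omega>\<in>space M. X t0 \<omega> \<le> - y0}"
    define Q where "Q = {\<omega>\<in>space M. \<forall>r\<in>{0..1}. X (t0 + r) \<omega> - X t0 \<omega> \<le> y0}"
    have pm: "P1 \<in> sets (past ?S ?V t0)" "P2 \<in> sets (past ?S ?V t0)"
      unfolding P1_def P2_def using t0 by (intro past_le Vm; simp)+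
    have "{\<omega>\<in>space (past ?S ?V t0). X t0 \<omega> \<le> - y0} \<in> sets (past ?S ?V t0)"
      using t0 by (intro borel_measurable_le past_measurable_X Vm) auto
    then have pm3: "P3 \<in> sets (past ?S ?V t0)" by (simp add: P3_def)
    have P12: "P1 \<in> events" "P2 \<in> events" "P3 \<in> events"
      using stays_below_sets[of t0 \<delta>] m.stays_below_sets[of t0 \<delta>] t0 unfolding P1_def P2_def P3_def by auto
    have "prob (space M - P1) \<le> 1 / 16"
    proof -
      have "prob (space M - P1) = 1 - surv \<delta> t0" using P12 by (subst prob_compl) (auto simp: P1_def surv_def)
      also have "\<dots> \<le> 8 * b * t0 * \<delta> powr - \<alpha>" using t0 \<delta> by (intro sup_tail) auto
      also have "\<dots> = 8 * b * \<eta>" unfolding t0_def using \<delta> by (simp add: powr_minus)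
      also have "\<dots> \<le> 8 * b * (1 / (128 * b))" using \<eta> b by (intro mult_left_mono) auto
      finally show ?thesis using b by simp
    qed
    moreover have "prob (space M - P2) \<le> 1 / 16"
    proof -
      have "prob (space M - P2) = 1 - m.surv \<delta> t0" using P12 by (subst prob_compl) (auto simp: P2_def m.surv_def)
      also have "\<dots> \<le> 8 * b * t0 * \<delta> powr - \<alpha>" using t0 \<delta> by (intro m.sup_tail) auto
      also have "\<dots> = 8 * b * \<eta>" unfolding t0_def using \<delta> by (simp add: powr_minus)
      also have "\<dots> \<le> 8 * b * (1 / (128 * b))" using \<eta> b by (intro mult_left_mono) auto
      finally show ?thesis using b by simp
    qed
    moreover have "3 / 8 \<le> prob P3"
    proof -
      have "\<P>(\<omega> in M. \<not> y0 < \<bar>X t0 \<omega>\<bar>) \<le> \<P>(\<omega> in M. X t0 \<omega> \<in> {z. \<bar>z - 0\<bar> \<le> \<rho>' * t0 powr (1 / \<alpha>)})"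
        unfolding yt using \<rho> mult_right_mono[OF \<rho>(3), of "t0 powr (1 / \<alpha>)"] by (intro finite_measure_mono) auto
      also have "\<dots> \<le> 1 / 4"
        using \<rho>'(2)[OF t0 stable_law_X, of 0] prob_X[of t0 "{z. \<bar>z - 0\<bar> \<le> \<rho>' * t0 powr (1 / \<alpha>)}"] t0 by simp
      finally have "3 / 4 \<le> \<P>(\<omega> in M. y0 < \<bar>X t0 \<omega>\<bar>)" by (subst (asm) prob_neg) auto
      then have "3 / 8 \<le> \<P>(\<omega> in M. y0 < - X t0 \<omega>)"
        using m.prob_pos_half[of t0 y0] t0 y0 by simp
      also have "\<dots> \<le> prob P3" unfolding P3_def by (intro finite_measure_mono) auto
      finally show ?thesis .
    qed
    moreover have "prob P3 \<le> prob (P1 \<inter> P2 \<inter> P3) + prob (space M - P1) + prob (space M - P2)"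
    proof -
      have "P3 \<subseteq> space M" unfolding P3_def by auto
      then have "prob P3 \<le> prob ((P1 \<inter> P2 \<inter> P3) \<union> ((space M - P1) \<union> (space M - P2)))"
        using P12 by (intro finite_measure_mono) auto
      also have "\<dots> \<le> prob (P1 \<inter> P2 \<inter> P3) + prob ((space M - P1) \<union> (space M - P2))"
        using P12 by (intro measure_Un_le) auto
      also have "prob ((space M - P1) \<union> (space M - P2)) \<le> prob (space M - P1) + prob (space M - P2)"
        using P12 by (intro measure_Un_le) auto
      finally show ?thesis by simp
    qed
    ultimately have pP: "1 / 4 \<le> prob (P1 \<inter> P2 \<inter> P3)" by linarith
    have pQ: "d * (g powr (\<alpha> / 2) * \<delta> powr (\<alpha> / 2)) \<le> prob Q"
    proof -
      have "y0 powr \<alpha> \<le> 1 powr \<alpha>" using y0 \<alpha> by (intro powr_mono2) auto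
      then have "d * (y0 powr (\<alpha> / 2) / sqrt 1) \<le> S.surv y0 1"
        unfolding d_def using y0 by (intro S.surv_lower) auto
      then show ?thesis unfolding Q_def S.surv_def y0_def using g \<delta> by (simp add: powr_mult)
    qed
    have ind: "prob ((P1 \<inter> P2 \<inter> P3) \<inter> Q) = prob (P1 \<inter> P2 \<inter> P3) * prob Q"
    proof -
      let ?R = "{p\<in>space paths. stays_below y0 1 p}"
      have R: "?R \<in> sets paths" using stays_below_measurable[of 1 y0] by (simp add: pred_def)
      have QR: "traj (\<lambda>r \<omega>. X (t0 + r) \<omega> - X t0 \<omega>) -` ?R \<inter> space M = Q"
        unfolding Q_def using S.stays_below_traj[of _ 1 y0] measurable_space[OF S.traj_measurable] by auto
      have PP: "P1 \<inter> P2 \<inter> P3 \<in> sets (past ?S ?V t0)" using pm pm3 by (intro sets.Int)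
      have Pid: "(\<lambda>\<omega>. \<omega>) -` (P1 \<inter> P2 \<inter> P3) \<inter> space M = P1 \<inter> P2 \<inter> P3" unfolding P1_def by auto
      have ip: "indep_pair (past ?S ?V t0) (\<lambda>\<omega>. \<omega>) paths (traj (\<lambda>r \<omega>. X (t0 + r) \<omega> - X t0 \<omega>))"
        using t0 by (intro past_future_indep' V) simp
      show ?thesis
        using ip[unfolded indep_pair_def, THEN conjunct2, THEN conjunct2, rule_format, OF PP R]
        unfolding QR Pid .
    qed
    have "1 / 4 * (d * g powr (\<alpha> / 2)) * \<delta> powr (\<alpha> / 2) = 1 / 4 * (d * (g powr (\<alpha> / 2) * \<delta> powr (\<alpha> / 2)))" by simp
    also have "\<dots> \<le> prob (P1 \<inter> P2 \<inter> P3) * prob Q" using pP pQ d by (intro mult_mono) auto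
    also have "\<dots> = prob ((P1 \<inter> P2 \<inter> P3) \<inter> Q)" by (rule ind[symmetric])
    also have "\<dots> \<le> \<P>(\<omega> in M. (\<forall>t\<in>{0..t0}. \<bar>X t \<omega>\<bar> \<le> \<delta>) \<and> (\<forall>t\<in>{t0..1}. X t \<omega> \<le> 0))"
    proof (rule finite_measure_mono)
      show "(P1 \<inter> P2 \<inter> P3) \<inter> Q \<subseteq> {\<omega>\<in>space M. (\<forall>t\<in>{0..t0}. \<bar>X t \<omega>\<bar> \<le> \<delta>) \<and> (\<forall>t\<in>{t0..1}. X t \<omega> \<le> 0)}"
      proof (intro subsetI CollectI conjI ballI)
        fix \<omega> t assume \<omega>: "\<omega> \<in> (P1 \<inter> P2 \<inter> P3) \<inter> Q"
        show "\<bar>X t \<omega>\<bar> \<le> \<delta>" if "t \<in> {0..t0}" using \<omega> that unfolding P1_def P2_def by (auto simp: abs_le_iff)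
        show "X t \<omega> \<le> 0" if t: "t \<in> {t0..1}"
        proof -
          have "t - t0 \<in> {0..1}" using t t0 by auto
          then have "X (t0 + (t - t0)) \<omega> - X t0 \<omega> \<le> y0" using \<omega> unfolding Q_def by blast
          moreover have "X t0 \<omega> \<le> - y0" using \<omega> unfolding P3_def by blast
          ultimately show ?thesis by simp
        qed
      qed (simp add: P1_def)
      have "{\<omega>\<in>space M. (\<forall>t\<in>{0..t0}. \<bar>X t \<omega>\<bar> \<le> \<delta>) \<and> (\<forall>t\<in>{t0..1}. X t \<omega> \<le> 0)} =
          P1 \<inter> P2 \<inter> {\<omega>\<in>space M. \<forall>l. \<forall>k\<in>{..2 ^ l}. X (t0 + real (k::nat) * ((1 - t0) / 2 ^ l)) \<omega> \<le> 0}"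
      proof -
        have "(\<forall>t\<in>{t0..1}. X t \<omega> \<le> 0) \<longleftrightarrow> (\<forall>l. \<forall>k\<in>{..2 ^ l}. X (t0 + real (k::nat) * ((1 - t0) / 2 ^ l)) \<omega> \<le> 0)" if \<omega>: "\<omega> \<in> space M" for \<omega>
          using dyadic_le_iff[of t0 1 "\<lambda>t. X t \<omega>" 0] cadlag_right[OF cadlag[OF \<omega>]] t0 t01 by (simp add: Ball_def)
        then show ?thesis unfolding P1_def P2_def by (auto simp: abs_le_iff)
      qed
      also have "\<dots> \<in> events"
        using P12 t0 by (intro sets.Int sets.sets_Collect_countable_All sets.sets_Collect_finite_All) (use t01 in \<open>auto intro!: borel_measurable_le meas add_nonneg_nonneg\<close>)
      finally show "{\<omega>\<in>space M. (\<forall>t\<in>{0..t0}. \<bar>X t \<omega>\<bar> \<le> \<delta>) \<and> (\<forall>t\<in>{t0..1}. X t \<omega> \<le> 0)} \<in> events" .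
    qed
    finally show "1 / 4 * (d * g powr (\<alpha> / 2)) * \<delta> powr (\<alpha> / 2) \<le>
        \<P>(\<omega> in M. (\<forall>t\<in>{0..\<eta> * \<delta> powr \<alpha>}. \<bar>X t \<omega>\<bar> \<le> \<delta>) \<and> (\<forall>t\<in>{\<eta> * \<delta> powr \<alpha>..1}. X t \<omega> \<le> 0))"
      by (simp add: t0_def)
  qed (use \<eta> in auto)
qed

text \<open>Written over dyadic times to be measurable on path space; the factor \<open>c\<close>
  carries the sign that the path avoids after time \<open>t\<close>.\<close>

definition quiet :: "real \<Rightarrow> real \<Rightarrow> real \<Rightarrow> (real \<Rightarrow> real) \<Rightarrow> bool" where
  "quiet c \<delta> t p \<longleftrightarrow> (\<forall>l. \<forall>k\<in>{..2 ^ l}. \<bar>p (real (k::nat) * (t / 2 ^ l))\<bar> \<le> \<delta>) \<and>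
     (\<forall>l. \<forall>k\<in>{..2 ^ l}. c * p (t + real (k::nat) * ((1 - t) / 2 ^ l)) \<le> 0)"

lemma quiet_sets:
  assumes "0 \<le> t" "t \<le> 1"
  shows "{p\<in>space paths. quiet c \<delta> t p} \<in> sets paths"
  unfolding quiet_def using assms
  by (intro sets.sets_Collect_conj sets.sets_Collect_countable_All sets.sets_Collect_finite_All borel_measurable_le
      borel_measurable_abs borel_measurable_times borel_measurable_const measurable_component_singleton)
    (auto intro!: add_nonneg_nonneg)

lemma (in levy) quiet_traj:
  assumes \<omega>: "\<omega> \<in> space M" and t: "0 \<le> t" "t \<le> 1"
  shows "quiet c \<delta> t (traj X \<omega>) \<longleftrightarrow> (\<forall>s\<in>{0..t}. \<bar>X s \<omega>\<bar> \<le> \<delta>) \<and> (\<forall>s\<in>{t..1}. c * X s \<omega> \<le> 0)"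
proof -
  have r: "((\<lambda>t. X t \<omega>) \<longlongrightarrow> X s \<omega>) (at_right s)" if "0 \<le> s" for s by (rule cadlag_right[OF cadlag[OF \<omega>] that])
  have pos: "0 \<le> t + real k * ((1 - t) / 2 ^ l)" for k l :: nat using t by (intro add_nonneg_nonneg) auto
  have "(\<forall>s\<in>{0..t}. \<bar>X s \<omega>\<bar> \<le> \<delta>) \<longleftrightarrow> (\<forall>l. \<forall>k\<in>{..2 ^ l}. \<bar>X (real (k::nat) * (t / 2 ^ l)) \<omega>\<bar> \<le> \<delta>)"
    using dyadic_le_iff[of 0 t "\<lambda>s. \<bar>X s \<omega>\<bar>" \<delta>] tendsto_rabs[OF r] t by (simp add: Ball_def)
  moreover have "(\<forall>s\<in>{t..1}. c * X s \<omega> \<le> 0) \<longleftrightarrow> (\<forall>l. \<forall>k\<in>{..2 ^ l}. c * X (t + real (k::nat) * ((1 - t) / 2 ^ l)) \<omega> \<le> 0)"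
    using dyadic_le_iff[of t 1 "\<lambda>s. c * X s \<omega>" 0] tendsto_mult_left[OF r, of _ c] t by (simp add: Ball_def)
  ultimately show ?thesis unfolding quiet_def traj_def using pos t by simp
qed

context iid_stable
begin

lemma prob_joint:
  assumes A: "\<And>i. i \<in> {1..n} \<Longrightarrow> A i \<in> sets paths"
  shows "\<P>(\<omega> in M. \<forall>i\<in>{1..n}. traj (L i) \<omega> \<in> A i) = (\<Prod>i=1..n. \<P>(\<omega> in M. traj (L i) \<omega> \<in> A i))"
proof -
  have "prob (\<Inter>i\<in>{1..n}. traj (L i) -` A i \<inter> space M) = (\<Prod>i\<in>{1..n}. prob (traj (L i) -` A i \<inter> space M))"
    using n A by (intro indep_varsD_finite[OF indep]) auto
  moreover have "(\<Inter>i\<in>{1..n}. traj (L i) -` A i \<inter> space M) = {\<omega>\<in>space M. \<forall>i\<in>{1..n}. traj (L i) \<omega> \<in> A i}"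
    using n by auto
  ultimately show ?thesis by (simp add: vimage_def Int_def conj_commute)
qed

end

text \<open>All \<open>n\<close> coordinates are made quiet independently; the product of
  \<open>n\<close> bounds of order \<delta>^(\<alpha>/2) is of order
  \<epsilon>^(\<alpha>/2).\<close>

lemma persistence_lower:
  assumes \<alpha>: "0 < \<alpha>" "\<alpha> < 2" and b: "0 < b" and n: "1 \<le> n"
  obtains c where "0 < c" "\<And>(M :: 'a measure) L \<epsilon>. iid_stable M L n \<alpha> b \<Longrightarrow> 0 < \<epsilon> \<Longrightarrow> \<epsilon> < 1 \<Longrightarrow>
    c * \<epsilon> powr (\<alpha> / 2) \<le> measure M (iid_stable.below M L n \<epsilon> 1)"
proof -
  obtain c \<eta> where c: "0 < c" and \<eta>: "0 < \<eta>" "\<eta> \<le> 1"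
    and low: "\<And>(M :: 'a measure) X \<delta>. stable_levy M X \<alpha> b \<Longrightarrow> 0 < \<delta> \<Longrightarrow> \<delta> < 1 \<Longrightarrow>
      c * \<delta> powr (\<alpha> / 2) \<le> \<P>(\<omega> in M. (\<forall>t\<in>{0..\<eta> * \<delta> powr \<alpha>}. \<bar>X t \<omega>\<bar> \<le> \<delta>) \<and> (\<forall>t\<in>{\<eta> * \<delta> powr \<alpha>..1}. X t \<omega> \<le> 0))"
    by (rule stays_negative_lower[OF \<alpha> b]) blast
  show thesis
  proof (rule that[of "c ^ n"])
    show "0 < c ^ n" using c by simp
    fix M :: "'a measure" and L \<epsilon> assume iid: "iid_stable M L n \<alpha> b" and \<epsilon>: "0 < \<epsilon>" "\<epsilon> < (1::real)"
    interpret iid_stable M L n \<alpha> b by fact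
    \<comment> \<open>Until \<open>t0\<close> the product is then at most \<delta>^n = \<epsilon> in
      modulus.\<close>
    define \<delta> where "\<delta> = \<epsilon> powr (1 / real n)"
    have "\<epsilon> powr (1 / real n) < 1 powr (1 / real n)" using \<epsilon> n by (intro powr_less_mono2) auto
    then have \<delta>: "0 < \<delta>" "\<delta> < 1" unfolding \<delta>_def using \<epsilon> by auto
    have \<delta>n: "\<delta> ^ n = \<epsilon>" unfolding \<delta>_def using \<epsilon> n by (simp add: powr_realpow[symmetric] powr_powr)
    define t0 where "t0 = \<eta> * \<delta> powr \<alpha>"
    have t0: "0 \<le> t0" "t0 \<le> 1"
    proof -
      show "0 \<le> t0" unfolding t0_def using \<eta> by simp
      have "\<delta> powr \<alpha> \<le> 1 powr \<alpha>" using \<delta> \<alpha> by (intro powr_mono2) auto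
      then show "t0 \<le> 1" unfolding t0_def using \<eta> by (intro mult_le_one) auto
    qed
    \<comment> \<open>After \<open>t0\<close> coordinate 1 is nonpositive and all others are
      nonnegative, so the product is nonpositive for every \<open>n\<close>.\<close>
    define s where "s = (\<lambda>i::nat. if i = 1 then 1 else - 1 :: real)"
    define A where "A = (\<lambda>i. {p\<in>space paths. quiet (s i) \<delta> t0 p})"
    have A: "A i \<in> sets paths" for i unfolding A_def by (rule quiet_sets[OF t0])
    have Aeq: "traj (L i) \<omega> \<in> A i \<longleftrightarrow> (\<forall>t\<in>{0..t0}. \<bar>L i t \<omega>\<bar> \<le> \<delta>) \<and> (\<forall>t\<in>{t0..1}. s i * L i t \<omega> \<le> 0)"
      if i: "i \<in> {1..n}" and \<omega>: "\<omega> \<in> space M" for i \<omega>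
    proof -
      interpret X: levy M "L i" by (rule levy_L[OF i])
      show ?thesis
        unfolding A_def using X.quiet_traj[OF \<omega> t0] measurable_space[OF X.traj_measurable \<omega>] by simp
    qed
    have pi: "c * \<delta> powr (\<alpha> / 2) \<le> \<P>(\<omega> in M. traj (L i) \<omega> \<in> A i)" if i: "i \<in> {1..n}" for i
    proof -
      interpret X: stable_levy M "L i" \<alpha> b by (rule stable[OF i])
      define Y where "Y = (\<lambda>t \<omega>. s i * L i t \<omega>)"
      have "stable_levy M Y \<alpha> b"
        unfolding Y_def s_def using X.stable_levy_axioms X.minus_stable by (cases "i = 1") auto
      from low[OF this \<delta>]
      have "c * \<delta> powr (\<alpha> / 2) \<le> \<P>(\<omega> in M. (\<forall>t\<in>{0..t0}. \<bar>Y t \<omega>\<bar> \<le> \<delta>) \<and> (\<forall>t\<in>{t0..1}. Y t \<omega> \<le> 0))"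
        by (simp add: t0_def)
      also have "\<dots> = \<P>(\<omega> in M. traj (L i) \<omega> \<in> A i)"
      proof (intro arg_cong[where f = prob] Collect_cong conj_cong refl)
        fix \<omega> assume \<omega>: "\<omega> \<in> space M"
        have "\<bar>Y t \<omega>\<bar> = \<bar>L i t \<omega>\<bar>" for t unfolding Y_def s_def by (simp add: abs_mult)
        then show "((\<forall>t\<in>{0..t0}. \<bar>Y t \<omega>\<bar> \<le> \<delta>) \<and> (\<forall>t\<in>{t0..1}. Y t \<omega> \<le> 0)) = (traj (L i) \<omega> \<in> A i)"
          unfolding Aeq[OF i \<omega>] by (simp add: Y_def)
      qed
      finally show ?thesis .
    qed
    have "c ^ n * \<epsilon> powr (\<alpha> / 2) = (c * \<delta> powr (\<alpha> / 2)) ^ n"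
    proof -
      have "\<epsilon> powr (\<alpha> / 2) = (\<delta> powr real n) powr (\<alpha> / 2)" using \<delta> \<delta>n by (simp add: powr_realpow)
      also have "\<dots> = (\<delta> powr (\<alpha> / 2)) powr real n" by (simp add: powr_powr mult.commute)
      also have "\<dots> = (\<delta> powr (\<alpha> / 2)) ^ n" using \<delta> by (simp add: powr_realpow)
      finally show ?thesis by (simp add: power_mult_distrib)
    qed
    also have "\<dots> = (\<Prod>i=1..n. c * \<delta> powr (\<alpha> / 2))" by simp
    also have "\<dots> \<le> (\<Prod>i=1..n. \<P>(\<omega> in M. traj (L i) \<omega> \<in> A i))"
      using c \<delta> by (intro prod_mono) (use pi in auto)
    also have "\<dots> = \<P>(\<omega> in M. \<forall>i\<in>{1..n}. traj (L i) \<omega> \<in> A i)" by (rule prob_joint[OF A, symmetric])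
    also have "\<dots> \<le> prob (below \<epsilon> 1)"
    proof (rule finite_measure_mono)
      show "{\<omega>\<in>space M. \<forall>i\<in>{1..n}. traj (L i) \<omega> \<in> A i} \<subseteq> below \<epsilon> 1"
      proof
        fix \<omega> assume "\<omega> \<in> {\<omega>\<in>space M. \<forall>i\<in>{1..n}. traj (L i) \<omega> \<in> A i}"
        then have \<omega>: "\<omega> \<in> space M" and q1: "\<And>i t. i \<in> {1..n} \<Longrightarrow> t \<in> {0..t0} \<Longrightarrow> \<bar>L i t \<omega>\<bar> \<le> \<delta>"
          and q2: "\<And>i t. i \<in> {1..n} \<Longrightarrow> t \<in> {t0..1} \<Longrightarrow> s i * L i t \<omega> \<le> 0" using Aeq by auto
        have "(\<Prod>i=1..n. L i t \<omega>) \<le> \<epsilon>" if t: "t \<in> {0..1}" for t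
        proof (cases "t \<le> t0")
          case True
          have "(\<Prod>i=1..n. L i t \<omega>) \<le> (\<Prod>i=1..n. \<bar>L i t \<omega>\<bar>)" unfolding abs_prod[symmetric] by (rule abs_ge_self)
          also have "\<dots> \<le> (\<Prod>i=1..n. \<delta>)" using True t q1 by (intro prod_mono) auto
          also have "\<dots> = \<epsilon>" using \<delta>n by simp
          finally show ?thesis .
        next
          case False
          then have tt: "t \<in> {t0..1}" using t by auto
          have "(\<Prod>i=1..n. L i t \<omega>) = L 1 t \<omega> * (\<Prod>i\<in>{1..n} - {1}. L i t \<omega>)"
            using n by (intro prod.remove) auto
          also have "\<dots> \<le> 0"
          proof (rule mult_nonpos_nonneg)
            show "L 1 t \<omega> \<le> 0" using q2[OF _ tt, of 1] n by (simp add: s_def)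
            show "0 \<le> (\<Prod>i\<in>{1..n} - {1}. L i t \<omega>)" proof (rule prod_nonneg)
              fix i assume i: "i \<in> {1..n} - {1}"
              then have "s i * L i t \<omega> \<le> 0" by (intro q2 tt) auto
              then show "0 \<le> L i t \<omega>" using i by (simp add: s_def)
            qed
          qed
          finally show ?thesis using \<epsilon> by simp
        qed
        then show "\<omega> \<in> below \<epsilon> 1" using \<omega> unfolding below_def by auto
      qed
    qed (auto intro: below_sets)
    finally show "c ^ n * \<epsilon> powr (\<alpha> / 2) \<le> prob (below \<epsilon> 1)" .
  qed
qed

section \<open>Large deviations\<close>

text \<open>Lowering the dyadic levels until they add up to exactly \<open>m\<close> replaces the
  infinitely many tuples with sum at least \<open>m\<close> by finitely many.\<close>

lemma exists_smaller_with_sum: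
  fixes k :: "'i \<Rightarrow> nat"
  assumes "finite I" "m \<le> sum k I"
  shows "\<exists>f. (\<forall>i\<in>I. f i \<le> k i) \<and> sum f I = m"
  using assms
proof (induction I arbitrary: m rule: finite_induct)
  case (insert x I)
  define a where "a = min m (k x)"
  have "m - a \<le> sum k I" using insert unfolding a_def by auto
  from insert.IH[OF this] obtain f where f: "\<forall>i\<in>I. f i \<le> k i" "sum f I = m - a" by auto
  have "sum (f(x := a)) I = sum f I" using insert by (intro sum.cong) auto
  then show ?case using insert f by (intro exI[of _ "f(x := a)"]) (auto simp: a_def)
qed simp

definition compositions :: "nat \<Rightarrow> nat \<Rightarrow> (nat \<Rightarrow> nat) set" where
  "compositions n m = {f \<in> {1..n} \<rightarrow>\<^sub>E {..m}. sum f {1..n} = m}"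

lemma finite_compositions: "finite (compositions n m)"
  unfolding compositions_def by (rule finite_subset[of _ "{1..n} \<rightarrow>\<^sub>E {..m}"]) (auto intro: finite_PiE)

text \<open>The last entry is determined by the others.\<close>

lemma card_compositions:
  assumes n: "1 \<le> n"
  shows "card (compositions n m) \<le> (m + 1) ^ (n - 1)"
proof -
  have "card (compositions n m) \<le> card ({1..n-1} \<rightarrow>\<^sub>E {..m})"
  proof (rule card_inj_on_le[where f = "\<lambda>f. restrict f {1..n-1}"])
    show "inj_on (\<lambda>f. restrict f {1..n-1}) (compositions n m)"
    proof (rule inj_onI)
      fix f g assume f: "f \<in> compositions n m" and g: "g \<in> compositions n m"
        and eq: "restrict f {1..n-1} = restrict g {1..n-1}"
      have e: "f i = g i" if "i \<in> {1..n-1}" for i using fun_cong[OF eq, of i] that by simp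
      have s: "{1..n} = insert n {1..n-1}" "n \<notin> {1..n-1}" using n by auto
      have "sum f {1..n-1} = sum g {1..n-1}" using e by (intro sum.cong) auto
      moreover have "f n + sum f {1..n-1} = g n + sum g {1..n-1}"
        using f g s unfolding compositions_def by auto
      ultimately have "f n = g n" by simp
      then have "f i = g i" if "i \<in> {1..n}" for i using e that s by (cases "i = n") auto
      moreover have "f \<in> {1..n} \<rightarrow>\<^sub>E {..m}" "g \<in> {1..n} \<rightarrow>\<^sub>E {..m}" using f g unfolding compositions_def by auto
      ultimately show "f = g" by (intro PiE_ext[of f "{1..n}" "\<lambda>_. {..m}" g])
    qed
    show "(\<lambda>f. restrict f {1..n-1}) ` compositions n m \<subseteq> {1..n-1} \<rightarrow>\<^sub>E {..m}"
      unfolding compositions_def by (auto simp: PiE_iff)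
  qed (auto intro: finite_PiE)
  also have "\<dots> = (m + 1) ^ (n - 1)" by (simp add: card_PiE)
  finally show ?thesis .
qed

context iid_stable
begin

text \<open>If the product exceeds \<open>y\<close> at some time, the coordinates at that time have
  dyadic levels of sum at least \<open>m\<close>. Asking each coordinate only to exceed its level at
  some time of its own makes the events independent. The bounds multiply to the same power of 2 for
  every composition.\<close>

lemma exceed_bound:
  assumes m: "2 ^ (m + n) \<le> (y :: real)"
  shows "1 - prob (below y 1) \<le> real ((m + 1) ^ (n - 1)) * (max 1 (16 * b)) ^ n * 2 powr - (\<alpha> * real m)"
proof -
  define K where "K = max 1 (16 * b)"
  have K: "1 \<le> K" "16 * b \<le> K" unfolding K_def by auto
  define B where "B = (\<lambda>k. {p\<in>space paths. \<not> (\<forall>l. \<forall>j\<in>{..2 ^ l}. \<bar>p (real (j::nat) * (1 / 2 ^ l))\<bar> \<le> (2::real) ^ k)})"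
  \<comment> \<open>Level 0 imposes no condition, since a coordinate at level 0 may be arbitrarily
    small; \<open>K \<ge> 1\<close> keeps the bound valid there.\<close>
  define A where "A = (\<lambda>k::nat. if k = 0 then space paths else B k)"
  have B: "B k \<in> sets paths" for k
    unfolding B_def
    by (intro sets.sets_Collect_neg sets.sets_Collect_countable_All sets.sets_Collect_finite_All borel_measurable_le
        borel_measurable_abs borel_measurable_const measurable_component_singleton) auto
  have A: "A k \<in> sets paths" for k unfolding A_def using B by auto
  have Beq: "traj (L i) \<omega> \<in> B k \<longleftrightarrow> (\<exists>t\<in>{0..1}. 2 ^ k < \<bar>L i t \<omega>\<bar>)" if i: "i \<in> {1..n}" and \<omega>: "\<omega> \<in> space M" for i k \<omega>
  proof -
    interpret X: levy M "L i" by (rule levy_L[OF i])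
    have "(\<forall>t\<in>{0..1}. \<bar>L i t \<omega>\<bar> \<le> 2 ^ k) \<longleftrightarrow> (\<forall>l. \<forall>j\<in>{..2 ^ l}. \<bar>L i (real (j::nat) * (1 / 2 ^ l)) \<omega>\<bar> \<le> 2 ^ k)"
      using dyadic_le_iff[of 0 1 "\<lambda>t. \<bar>L i t \<omega>\<bar>" "2 ^ k"] tendsto_rabs[OF cadlag_right[OF X.cadlag[OF \<omega>]]] by (simp add: Ball_def)
    moreover have "traj (L i) \<omega> \<in> B k \<longleftrightarrow> \<not> (\<forall>l. \<forall>j\<in>{..2 ^ l}. \<bar>L i (real (j::nat) * (1 / 2 ^ l)) \<omega>\<bar> \<le> 2 ^ k)"
      unfolding B_def using measurable_space[OF X.traj_measurable \<omega>] by (simp add: traj_def)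
    moreover have "(\<exists>t\<in>{0..1}. 2 ^ k < \<bar>L i t \<omega>\<bar>) \<longleftrightarrow> \<not> (\<forall>t\<in>{0..1}. \<bar>L i t \<omega>\<bar> \<le> 2 ^ k)"
      unfolding not_le[symmetric] by blast
    ultimately show ?thesis by blast
  qed
  have pA: "\<P>(\<omega> in M. traj (L i) \<omega> \<in> A k) \<le> K * 2 powr - (\<alpha> * real k)" if i: "i \<in> {1..n}" for i k
  proof (cases "k = 0")
    case True
    then show ?thesis using K prob_le_1 by (auto intro: order_trans)
  next
    case False
    interpret X: stable_levy M "L i" \<alpha> b by (rule stable[OF i])
    interpret m: stable_levy M "\<lambda>t \<omega>. - L i t \<omega>" \<alpha> b by (rule X.minus_stable)
    let ?z = "2 ^ k :: real"
    have "\<P>(\<omega> in M. traj (L i) \<omega> \<in> A k) \<le> prob ((space M - {\<omega>\<in>space M. \<forall>t\<in>{0..1}. L i t \<omega> \<le> ?z}) \<union>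
        (space M - {\<omega>\<in>space M. \<forall>t\<in>{0..1}. - L i t \<omega> \<le> ?z}))"
    proof (rule finite_measure_mono)
      show "{\<omega>\<in>space M. traj (L i) \<omega> \<in> A k} \<subseteq> (space M - {\<omega>\<in>space M. \<forall>t\<in>{0..1}. L i t \<omega> \<le> ?z}) \<union>
        (space M - {\<omega>\<in>space M. \<forall>t\<in>{0..1}. - L i t \<omega> \<le> ?z})"
      proof
        fix \<omega> assume "\<omega> \<in> {\<omega>\<in>space M. traj (L i) \<omega> \<in> A k}"
        then have \<omega>: "\<omega> \<in> space M" and "\<exists>t\<in>{0..1}. ?z < \<bar>L i t \<omega>\<bar>" using False Beq[OF i] by (auto simp: A_def)
        then obtain t where "t \<in> {0..1}" "?z < \<bar>L i t \<omega>\<bar>" by blast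
        then have "\<not> L i t \<omega> \<le> ?z \<or> \<not> - L i t \<omega> \<le> ?z" by linarith
        then show "\<omega> \<in> (space M - {\<omega>\<in>space M. \<forall>t\<in>{0..1}. L i t \<omega> \<le> ?z}) \<union> (space M - {\<omega>\<in>space M. \<forall>t\<in>{0..1}. - L i t \<omega> \<le> ?z})"
          using \<omega> \<open>t \<in> {0..1}\<close> by blast
      qed
    qed (use X.stays_below_sets[of 1 ?z] m.stays_below_sets[of 1 ?z] in auto)
    also have "\<dots> \<le> prob (space M - {\<omega>\<in>space M. \<forall>t\<in>{0..1}. L i t \<omega> \<le> ?z}) + prob (space M - {\<omega>\<in>space M. \<forall>t\<in>{0..1}. - L i t \<omega> \<le> ?z})"
      using X.stays_below_sets[of 1 ?z] m.stays_below_sets[of 1 ?z] by (intro measure_Un_le) auto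
    also have "prob (space M - {\<omega>\<in>space M. \<forall>t\<in>{0..1}. L i t \<omega> \<le> ?z}) = 1 - X.surv ?z 1"
      using X.stays_below_sets[of 1 ?z] by (subst prob_compl) (auto simp: X.surv_def)
    also have "prob (space M - {\<omega>\<in>space M. \<forall>t\<in>{0..1}. - L i t \<omega> \<le> ?z}) = 1 - m.surv ?z 1"
      using m.stays_below_sets[of 1 ?z] by (subst prob_compl) (auto simp: m.surv_def)
    also have "(1 - X.surv ?z 1) + (1 - m.surv ?z 1) \<le> 8 * b * 1 * ?z powr - \<alpha> + 8 * b * 1 * ?z powr - \<alpha>"
      by (intro add_mono X.sup_tail m.sup_tail) auto
    also have "\<dots> = 16 * b * ?z powr - \<alpha>" by simp
    also have "\<dots> \<le> K * ?z powr - \<alpha>" using K by (intro mult_right_mono) auto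
    also have "?z powr - \<alpha> = 2 powr - (\<alpha> * real k)"
      by (simp add: powr_realpow[symmetric] powr_powr mult.commute)
    finally show ?thesis .
  qed
  have "1 - prob (below y 1) = prob (space M - below y 1)" by (rule prob_compl[symmetric]) (rule below_sets, simp)
  also have "\<dots> \<le> prob (\<Union>f\<in>compositions n m. {\<omega>\<in>space M. \<forall>i\<in>{1..n}. traj (L i) \<omega> \<in> A (f i)})"
  proof (rule finite_measure_mono)
    show "space M - below y 1 \<subseteq> (\<Union>f\<in>compositions n m. {\<omega>\<in>space M. \<forall>i\<in>{1..n}. traj (L i) \<omega> \<in> A (f i)})"
    proof
      fix \<omega> assume "\<omega> \<in> space M - below y 1"
      then obtain t where \<omega>: "\<omega> \<in> space M" and t: "t \<in> {0..1}" "y < (\<Prod>i=1..n. L i t \<omega>)"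
        unfolding below_def by (auto simp: not_le)
      \<comment> \<open>Rounding each factor up to a power of 2 loses at most one exponent per
        coordinate, whence \<open>m + n\<close> in the hypothesis.\<close>
      define k where "k = (\<lambda>i. LEAST k::nat. \<bar>L i t \<omega>\<bar> \<le> 2 ^ Suc k)"
      have k1: "\<bar>L i t \<omega>\<bar> \<le> 2 ^ Suc (k i)" for i
      proof -
        obtain q where "\<bar>L i t \<omega>\<bar> < 2 ^ q" using real_arch_pow[of 2 "\<bar>L i t \<omega>\<bar>"] by auto
        also have "(2::real) ^ q \<le> 2 ^ Suc q" by simp
        finally have "\<bar>L i t \<omega>\<bar> \<le> 2 ^ Suc q" by simp
        then show ?thesis unfolding k_def by (rule LeastI)
      qed
      have k2: "2 ^ k i < \<bar>L i t \<omega>\<bar>" if k0: "k i \<noteq> 0" for i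
      proof -
        obtain q where q: "k i = Suc q" using k0 by (cases "k i") auto
        have "\<not> \<bar>L i t \<omega>\<bar> \<le> 2 ^ Suc q" using not_less_Least[of q "\<lambda>k. \<bar>L i t \<omega>\<bar> \<le> 2 ^ Suc k"] q unfolding k_def by simp
        then show ?thesis using q by simp
      qed
      have "(2::real) ^ (m + n) < (\<Prod>i=1..n. L i t \<omega>)" using m t by linarith
      also have "\<dots> \<le> (\<Prod>i=1..n. \<bar>L i t \<omega>\<bar>)" unfolding abs_prod[symmetric] by (rule abs_ge_self)
      also have "\<dots> \<le> (\<Prod>i=1..n. 2 ^ Suc (k i))" by (intro prod_mono) (use k1 in auto)
      also have "\<dots> = 2 ^ (sum k {1..n} + n)"
        by (simp add: power_sum[symmetric] prod.distrib power_add)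
      finally have "m + n < sum k {1..n} + n" by (subst (asm) power_strict_increasing_iff) auto
      then have "m \<le> sum k {1..n}" by simp
      from exists_smaller_with_sum[OF finite_atLeastAtMost this]
      obtain f where f0: "\<forall>i\<in>{1..n}. f i \<le> k i" "sum f {1..n} = m" by blast
      note f = f0(1)[rule_format] f0(2)
      define g where "g = restrict f {1..n}"
      have "sum g {1..n} = m" unfolding g_def using f(2) by simp
      moreover have "f i \<le> m" if "i \<in> {1..n}" for i using member_le_sum[of i "{1..n}" f] that f(2) by simp
      ultimately have "g \<in> compositions n m" unfolding compositions_def g_def by auto
      moreover have "traj (L i) \<omega> \<in> A (g i)" if i: "i \<in> {1..n}" for i
      proof (cases "f i = 0")
        case True
        then show ?thesis using i measurable_space[OF levy.traj_measurable[OF levy_L[OF i]] \<omega>] by (simp add: g_def A_def)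
      next
        case False
        then have "k i \<noteq> 0" using f(1)[OF i] by simp
        then have "2 ^ k i < \<bar>L i t \<omega>\<bar>" by (rule k2)
        moreover have "(2::real) ^ f i \<le> 2 ^ k i" using f(1)[OF i] by simp
        ultimately have "2 ^ f i < \<bar>L i t \<omega>\<bar>" by linarith
        then have "traj (L i) \<omega> \<in> B (f i)" unfolding Beq[OF i \<omega>] using t(1) by blast
        then show ?thesis using i False by (simp add: g_def A_def)
      qed
      ultimately show "\<omega> \<in> (\<Union>f\<in>compositions n m. {\<omega>\<in>space M. \<forall>i\<in>{1..n}. traj (L i) \<omega> \<in> A (f i)})" using \<omega> by blast
    qed
    have "{\<omega>\<in>space M. \<forall>i\<in>{1..n}. traj (L i) \<omega> \<in> A (f i)} \<in> events" for f
      by (intro sets.sets_Collect_finite_All measurable_Collect_in[OF _ A] levy.traj_measurable levy_L) auto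
    then show "(\<Union>f\<in>compositions n m. {\<omega>\<in>space M. \<forall>i\<in>{1..n}. traj (L i) \<omega> \<in> A (f i)}) \<in> events"
      using finite_compositions by (intro sets.finite_UN) auto
  qed
  also have "\<dots> \<le> (\<Sum>f\<in>compositions n m. \<P>(\<omega> in M. \<forall>i\<in>{1..n}. traj (L i) \<omega> \<in> A (f i)))"
  proof (rule finite_measure_subadditive_finite[OF finite_compositions])
    show "(\<lambda>f. {\<omega>\<in>space M. \<forall>i\<in>{1..n}. traj (L i) \<omega> \<in> A (f i)}) ` compositions n m \<subseteq> events"
      by (intro image_subsetI sets.sets_Collect_finite_All measurable_Collect_in[OF _ A] levy.traj_measurable levy_L) auto
  qed
  also have "\<dots> \<le> (\<Sum>f\<in>compositions n m. K ^ n * 2 powr - (\<alpha> * real m))"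
  proof (rule sum_mono)
    fix f assume f: "f \<in> compositions n m"
    have "\<P>(\<omega> in M. \<forall>i\<in>{1..n}. traj (L i) \<omega> \<in> A (f i)) = (\<Prod>i=1..n. \<P>(\<omega> in M. traj (L i) \<omega> \<in> A (f i)))"
      by (rule prob_joint) (rule A)
    also have "\<dots> \<le> (\<Prod>i=1..n. K * 2 powr - (\<alpha> * real (f i)))" by (intro prod_mono) (use pA in auto)
    also have "\<dots> = K ^ n * 2 powr (\<Sum>i=1..n. - (\<alpha> * real (f i)))" by (simp add: prod.distrib powr_sum)
    also have "(\<Sum>i=1..n. - (\<alpha> * real (f i))) = - (\<alpha> * real m)"
      using f unfolding compositions_def by (auto simp: sum_negf sum_distrib_left[symmetric] of_nat_sum[symmetric] simp del: of_nat_sum)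
    finally show "\<P>(\<omega> in M. \<forall>i\<in>{1..n}. traj (L i) \<omega> \<in> A (f i)) \<le> K ^ n * 2 powr - (\<alpha> * real m)" .
  qed
  also have "\<dots> = real (card (compositions n m)) * (K ^ n * 2 powr - (\<alpha> * real m))" by simp
  also have "\<dots> \<le> real ((m + 1) ^ (n - 1)) * (K ^ n * 2 powr - (\<alpha> * real m))"
    using K card_compositions[OF n, of m] by (intro mult_right_mono of_nat_mono) auto
  finally show ?thesis by (simp add: K_def mult.assoc)
qed

end

text \<open>The level \<open>x / 2\<close> absorbs the difference between reaching \<open>x\<close>
  and strictly exceeding the level in the complement of \<open>below\<close>.\<close>

lemma large_deviations_upper:
  assumes \<alpha>: "0 < \<alpha>" and b: "0 < b" and n: "1 \<le> n"
  obtains C x0 where "0 < C" "1 < x0" "\<And>(M :: 'a measure) L x. iid_stable M L n \<alpha> b \<Longrightarrow> x0 \<le> x \<Longrightarrow>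
    1 - measure M (iid_stable.below M L n (x / 2) 1) \<le> C * (ln x ^ (n - 1) / x powr \<alpha>)"
proof -
  define K where "K = max 1 (16 * b)"
  define C where "C = (1 / ln 2) ^ (n - 1) * K ^ n * 2 powr (\<alpha> * (real n + 2))"
  have K: "1 \<le> K" unfolding K_def by simp
  have C: "0 < C" unfolding C_def using K by simp
  show thesis
  proof (rule that[OF C, of "2 ^ (n + 1)"])
    show "1 < (2::real) ^ (n + 1)" by (rule one_less_power) auto
    fix M :: "'a measure" and L x assume iid: "iid_stable M L n \<alpha> b" and x: "2 ^ (n + 1) \<le> (x::real)"
    interpret iid_stable M L n \<alpha> b by fact
    have x1: "1 < x" using x one_less_power[of "2::real" "n + 1"] by simp
    define N where "N = nat \<lfloor>log 2 x\<rfloor>"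
    have "log 2 (2 ^ (n + 1)) \<le> log 2 x" using x x1 by (subst log_le_cancel_iff) auto
    then have l1: "real (n + 1) \<le> log 2 x" by (simp only: log_pow_cancel)
    then have N1: "n + 1 \<le> N" unfolding N_def by (simp add: le_nat_iff le_floor_iff)
    have Nl: "real N \<le> log 2 x" "log 2 x \<le> real N + 1"
      unfolding N_def using l1 by (auto simp: of_nat_floor) 
    \<comment> \<open>Of the exponent of \<open>x\<close>, \<open>n\<close> units pay for rounding
      the factors and 1 for halving \<open>x\<close>.\<close>
    define m where "m = N - (n + 1)"
    have mN: "m + n + 1 = N" unfolding m_def using N1 by simp
    have "2 * 2 ^ (m + n) = (2::real) ^ N" unfolding mN[symmetric] by simp
    also have "\<dots> = 2 powr real N" by (simp add: powr_realpow)
    also have "\<dots> \<le> 2 powr log 2 x" using Nl by simp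
    also have "\<dots> = x" using x1 by simp
    finally have "2 ^ (m + n) \<le> x / 2" by simp
    then have "1 - prob (below (x / 2) 1) \<le> real ((m + 1) ^ (n - 1)) * K ^ n * 2 powr - (\<alpha> * real m)"
      unfolding K_def by (rule exceed_bound)
    also have "\<dots> \<le> (ln x / ln 2) ^ (n - 1) * K ^ n * (2 powr (\<alpha> * (real n + 2)) * x powr - \<alpha>)"
    proof (intro mult_mono)
      have "real (m + 1) \<le> ln x / ln 2" using Nl mN by (simp add: log_def)
      then show "real ((m + 1) ^ (n - 1)) \<le> (ln x / ln 2) ^ (n - 1)"
        unfolding of_nat_power by (intro power_mono) auto
      have "real m \<ge> log 2 x - (real n + 2)" using Nl mN by simp
      then have "\<alpha> * (log 2 x - (real n + 2)) \<le> \<alpha> * real m" using \<alpha> by (intro mult_left_mono) auto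
      then have "2 powr - (\<alpha> * real m) \<le> 2 powr (\<alpha> * (real n + 2) + log 2 x * - \<alpha>)"
        by (intro powr_mono) (auto simp: algebra_simps)
      also have "\<dots> = 2 powr (\<alpha> * (real n + 2)) * (2 powr log 2 x) powr - \<alpha>"
        by (simp only: powr_add powr_powr)
      also have "2 powr log 2 x = x" using x1 by simp
      finally show "2 powr - (\<alpha> * real m) \<le> 2 powr (\<alpha> * (real n + 2)) * x powr - \<alpha>" .
    qed (use K x1 in auto)
    also have "\<dots> = C * (ln x ^ (n - 1) / x powr \<alpha>)"
      unfolding C_def by (simp add: power_divide powr_minus field_simps)
    finally show "1 - prob (below (x / 2) 1) \<le> C * (ln x ^ (n - 1) / x powr \<alpha>)" .
  qed
qed

text \<open>Only time 1 is used. The first \<open>n - 1\<close> coordinates lie in slabs with free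
  exponents up to \<open>q\<close>, and the last exceeds the level that completes the product.
  Different exponents give disjoint events, each of probability at least d^n
  (A^N)^(-\<alpha>).\<close>

lemma large_deviations_lower:
  assumes \<alpha>: "0 < \<alpha>" "\<alpha> < 2" and b: "0 < b" and n: "1 \<le> n"
  obtains c x0 where "0 < c" "1 < x0" "\<And>(M :: 'a measure) L x. iid_stable M L n \<alpha> b \<Longrightarrow> x0 \<le> x \<Longrightarrow>
    c * (ln x ^ (n - 1) / x powr \<alpha>) \<le> \<P>(\<omega> in M. x \<le> (\<Prod>i=1..n. L i 1 \<omega>))"
proof -
  obtain k0 x1 where k0: "0 < k0" "0 < x1"
    "\<And>\<nu> x. stable_law \<alpha> b \<nu> \<Longrightarrow> x1 \<le> x \<Longrightarrow> k0 * x powr - \<alpha> \<le> measure \<nu> {y. x < \<bar>y\<bar>}"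
    by (rule stable_law_tail_lower[OF \<alpha> b]) blast
  \<comment> \<open>Beyond \<open>x1\<close> the lower tail bound holds; the last entry makes the
    tail above A^(k+1) at most half of the lower bound for the tail above A^k, so a slab keeps the
    other half.\<close>
  define A where "A = max x1 (max 2 ((16 * b / k0) powr (1 / \<alpha>)))"
  have A: "x1 \<le> A" "2 \<le> A" "(16 * b / k0) powr (1 / \<alpha>) \<le> A" unfolding A_def by auto
  \<comment> \<open>One factor 1/2 comes from passing to one side, the other from passing from a
    tail to a slab.\<close>
  define d where "d = k0 / 4"
  have d: "0 < d" unfolding d_def using k0 by simp
  have bA: "4 * b * A powr - \<alpha> \<le> d"
  proof -
    have "16 * b / k0 = ((16 * b / k0) powr (1 / \<alpha>)) powr \<alpha>" using \<alpha> b k0 by (simp add: powr_powr)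
    also have "\<dots> \<le> A powr \<alpha>" using A \<alpha> by (intro powr_mono2) auto
    finally have "16 * b / k0 \<le> A powr \<alpha>" .
    moreover have "0 < A powr \<alpha>" using A by simp
    ultimately show ?thesis unfolding d_def powr_minus using k0 by (simp add: field_simps)
  qed
  \<comment> \<open>The first factor comes from \<open>ln x / ln A \<le> 2 * n * q\<close>, the last
    from rounding the exponent of \<open>x\<close> up to \<open>N\<close>.\<close>
  define c where "c = (1 / (2 * real n * ln A)) ^ (n - 1) * d ^ n * A powr - \<alpha>"
  have lnA: "0 < ln A" using A by simp
  have c: "0 < c" unfolding c_def using d lnA n A by simp
  show thesis
  proof (rule that[OF c, of "A ^ n"])
    show "1 < A ^ n" using A n by (intro one_less_power) auto
    fix M :: "'a measure" and L x assume iid: "iid_stable M L n \<alpha> b" and x: "A ^ n \<le> x"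
    interpret iid_stable M L n \<alpha> b by fact
    have "1 < A ^ n" using A n by (intro one_less_power) auto
    then have x1': "1 < x" using x by simp
    have tail: "2 * d * (A ^ k) powr - \<alpha> \<le> \<P>(\<omega> in M. A ^ k < L i 1 \<omega>)" (is ?t1)
      and slab: "d * (A ^ k) powr - \<alpha> \<le> \<P>(\<omega> in M. L i 1 \<omega> \<in> {A ^ k<..A ^ Suc k})" (is ?t2)
      if i: "i \<in> {1..n}" and k: "1 \<le> k" for i k
    proof -
      interpret X: stable_levy M "L i" \<alpha> b by (rule stable[OF i])
      have Lm[measurable]: "L i 1 \<in> borel_measurable M" by simp
      have "A ^ 1 \<le> A ^ k" using A k by (intro power_increasing) auto
      then have Ak: "x1 \<le> A ^ k" "0 < A ^ k" using A by auto
      have "k0 * (A ^ k) powr - \<alpha> \<le> 2 * \<P>(\<omega> in M. A ^ k < L i 1 \<omega>)"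
        using k0(3)[OF X.stable_law_X[of 1, simplified] Ak(1)] X.prob_X[of 1 "{y. A ^ k < \<bar>y\<bar>}"] X.prob_pos_half[of 1 "A ^ k"] Ak by simp
      then show t1: ?t1 unfolding d_def by simp
      have "\<P>(\<omega> in M. A ^ Suc k < L i 1 \<omega>) \<le> 4 * b * (A ^ Suc k) powr - \<alpha>"
        using X.X_tail_upper[of 1 "A ^ Suc k"] X.prob_pos_half[of 1 "A ^ Suc k"] A by simp
      also have "(A ^ Suc k) powr - \<alpha> = A powr - \<alpha> * (A ^ k) powr - \<alpha>" using A by (simp add: powr_mult)
      also have "4 * b * (A powr - \<alpha> * (A ^ k) powr - \<alpha>) = (4 * b * A powr - \<alpha>) * (A ^ k) powr - \<alpha>" by simp
      also have "\<dots> \<le> d * (A ^ k) powr - \<alpha>" by (intro mult_right_mono bA) simp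
      finally have t2: "\<P>(\<omega> in M. A ^ Suc k < L i 1 \<omega>) \<le> d * (A ^ k) powr - \<alpha>" .
      have "\<P>(\<omega> in M. A ^ k < L i 1 \<omega>) \<le> prob ({\<omega>\<in>space M. L i 1 \<omega> \<in> {A ^ k<..A ^ Suc k}} \<union> {\<omega>\<in>space M. A ^ Suc k < L i 1 \<omega>})"
        by (intro finite_measure_mono) auto
      also have "\<dots> \<le> \<P>(\<omega> in M. L i 1 \<omega> \<in> {A ^ k<..A ^ Suc k}) + \<P>(\<omega> in M. A ^ Suc k < L i 1 \<omega>)"
        by (intro measure_Un_le) auto
      finally show ?t2 using t1 t2 by linarith
    qed
    define N where "N = nat \<lceil>log A x\<rceil>"
    have "log A (A ^ n) \<le> log A x" using x A x1' by (subst log_le_cancel_iff) auto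
    then have ln1: "real n \<le> log A x" using A by (simp add: log_nat_power)
    have N: "log A x \<le> real N" "real N \<le> log A x + 1"
      unfolding N_def using ln1 n by (auto intro: order_trans[OF _ real_nat_ceiling_ge])
    have nN: "n \<le> N" using N(1) ln1 by linarith
    \<comment> \<open>With each of the \<open>n - 1\<close> free exponents at most N / n, the last
      one remains at least \<open>q\<close>, hence positive.\<close>
    define q where "q = N div n"
    have q: "n * q \<le> N" "N < n * (q + 1)" "1 \<le> q"
    proof -
      show "n * q \<le> N" unfolding q_def by simp
      show "N < n * (q + 1)" unfolding q_def using n by (simp add: dividend_less_times_div)
      show "1 \<le> q" unfolding q_def using nN n by (simp add: Suc_le_eq div_greater_zero_iff)
    qed
    define F where "F = {1..n-1} \<rightarrow>\<^sub>E {1..q}"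
    have finF: "finite F" unfolding F_def by (intro finite_PiE) auto
    define I where "I = (\<lambda>f i. if i < n then {A ^ f i<..A ^ Suc (f i)} else {A ^ (N - sum f {1..n-1})<..})"
    have Ib: "I f i \<in> sets borel" for f i unfolding I_def by simp
    define E where "E = (\<lambda>f. {\<omega>\<in>space M. \<forall>i\<in>{1..n}. L i 1 \<omega> \<in> I f i})"
    have Em: "E f \<in> events" for f
      unfolding E_def by (intro sets.sets_Collect_finite_All measurable_Collect_in[OF _ Ib] meas_L) auto
    have sumf: "sum f {1..n-1} + q \<le> N" if f: "f \<in> F" for f
    proof -
      have "sum f {1..n-1} \<le> (\<Sum>i\<in>{1..n-1}. q)" using f unfolding F_def by (intro sum_mono) auto
      then have "sum f {1..n-1} \<le> (n - 1) * q" by simp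
      moreover have "(n - 1) * q + q = n * q" using n by (cases n) auto
      ultimately show ?thesis using q by linarith
    qed
    have s: "{1..n} = insert n {1..n-1}" "n \<notin> {1..n-1}" using n by auto
    define k where "k = (\<lambda>f i. if i < n then f i else N - sum f {1..n-1})"
    have sk: "sum (k f) {1..n} = N" if f: "f \<in> F" for f
    proof -
      have "sum (k f) {1..n} = k f n + sum (k f) {1..n-1}" using s by simp
      also have "sum (k f) {1..n-1} = sum f {1..n-1}" unfolding k_def by (intro sum.cong) auto
      finally show ?thesis using sumf[OF f] by (simp add: k_def)
    qed
    have pE: "d ^ n * (A ^ N) powr - \<alpha> \<le> prob (E f)" if f: "f \<in> F" for f
    proof -
      have pi: "d * (A ^ k f i) powr - \<alpha> \<le> \<P>(\<omega> in M. traj (L i) \<omega> \<in> {p\<in>space paths. p 1 \<in> I f i})" if i: "i \<in> {1..n}" for i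
      proof -
        have "traj (L i) \<omega> \<in> {p\<in>space paths. p 1 \<in> I f i} \<longleftrightarrow> L i 1 \<omega> \<in> I f i" if "\<omega> \<in> space M" for \<omega>
          using measurable_space[OF levy.traj_measurable[OF levy_L[OF i]] that] by (simp add: traj_def)
        then have eq: "\<P>(\<omega> in M. traj (L i) \<omega> \<in> {p\<in>space paths. p 1 \<in> I f i}) = \<P>(\<omega> in M. L i 1 \<omega> \<in> I f i)"
          by (intro arg_cong[where f = prob] Collect_cong conj_cong refl)
        show ?thesis
        proof (cases "i < n")
          case True
          then have "1 \<le> f i" using f i unfolding F_def by auto
          then show ?thesis unfolding eq using slab[OF i, of "f i"] True by (simp add: I_def k_def)
        next
          case False
          have "1 \<le> N - sum f {1..n-1}" using sumf[OF f] q by simp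
          from tail[OF i this] have "2 * (d * (A ^ k f i) powr - \<alpha>) \<le> \<P>(\<omega> in M. L i 1 \<omega> \<in> I f i)"
            using False by (simp add: I_def k_def)
          moreover have "0 \<le> d * (A ^ k f i) powr - \<alpha>" using d by simp
          ultimately show ?thesis unfolding eq by linarith
        qed
      qed
      have "(\<Prod>i=1..n. (A ^ k f i) powr - \<alpha>) = (\<Prod>i=1..n. A ^ k f i) powr - \<alpha>"
        using A by (simp add: prod_powr_distrib)
      also have "(\<Prod>i=1..n. A ^ k f i) = A ^ N" by (simp only: power_sum[symmetric] sk[OF f])
      finally have "d ^ n * (A ^ N) powr - \<alpha> = (\<Prod>i=1..n. d * (A ^ k f i) powr - \<alpha>)" by (simp add: prod.distrib)
      also have "\<dots> \<le> (\<Prod>i=1..n. \<P>(\<omega> in M. traj (L i) \<omega> \<in> {p\<in>space paths. p 1 \<in> I f i}))"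
        using d by (intro prod_mono) (use pi in auto)
      also have "\<dots> = \<P>(\<omega> in M. \<forall>i\<in>{1..n}. traj (L i) \<omega> \<in> {p\<in>space paths. p 1 \<in> I f i})"
      proof (rule prob_joint[symmetric])
        fix i show "{p\<in>space paths. p 1 \<in> I f i} \<in> sets paths"
          by (intro measurable_Collect_in[OF _ Ib] measurable_component_singleton) simp
      qed
      also have "\<dots> \<le> prob (E f)" by (rule finite_measure_mono[OF _ Em]) (auto simp: E_def traj_def)
      finally show ?thesis .
    qed
    have disj: "disjoint_family_on E F"
      unfolding disjoint_family_on_def
    proof (intro ballI impI)
      fix f g assume f: "f \<in> F" and g: "g \<in> F" and fg: "f \<noteq> g"
      have "\<exists>i\<in>{1..n-1}. f i \<noteq> g i"
      proof (rule ccontr)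
        assume "\<not> ?thesis"
        then have "f = g" using f g unfolding F_def by (intro PiE_ext[of f "{1..n-1}" "\<lambda>_. {1..q}" g]) auto
        then show False using fg by simp
      qed
      then obtain i where i: "i \<in> {1..n-1}" "f i \<noteq> g i" by blast
      have lt: False if v: "v \<in> {A ^ a<..A ^ Suc a}" "v \<in> {A ^ c<..A ^ Suc c}" and ac: "a < c" for v :: real and a c :: nat
      proof -
        have "A ^ Suc a \<le> A ^ c" using A ac by (intro power_increasing) auto
        then show False using v by auto
      qed
      show "E f \<inter> E g = {}"
      proof (rule ccontr)
        assume "E f \<inter> E g \<noteq> {}"
        then obtain \<omega> where \<omega>: "\<omega> \<in> E f" "\<omega> \<in> E g" by blast
        have "i \<in> {1..n}" "i < n" using i by auto
        then have "L i 1 \<omega> \<in> {A ^ f i<..A ^ Suc (f i)}" "L i 1 \<omega> \<in> {A ^ g i<..A ^ Suc (g i)}"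
          using \<omega> unfolding E_def I_def by force+
        then show False using lt[of "L i 1 \<omega>" "f i" "g i"] lt[of "L i 1 \<omega>" "g i" "f i"] i(2) by linarith
      qed
    qed
    have "c * (ln x ^ (n - 1) / x powr \<alpha>) \<le> real q ^ (n - 1) * (d ^ n * (A ^ N) powr - \<alpha>)"
    proof -
      have lx: "0 \<le> ln x" using x1' by simp
      have "real N < real n * (real q + 1)" using q(2) by (metis of_nat_1 of_nat_add of_nat_less_iff of_nat_mult)
      also have "\<dots> \<le> real n * (2 * real q)" using q(3) by (intro mult_left_mono) auto
      finally have "log A x \<le> 2 * real n * real q" using N(1) by simp
      then have "ln x / (2 * real n * ln A) \<le> real q" unfolding log_def using lnA n by (simp add: field_simps)
      then have 1: "(ln x / (2 * real n * ln A)) ^ (n - 1) \<le> real q ^ (n - 1)"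
        using lx lnA by (intro power_mono) auto
      have "A powr - \<alpha> * x powr - \<alpha> = (A powr (log A x + 1)) powr - \<alpha>"
        using A x1' by (simp add: powr_add powr_mult)
      also have "\<dots> \<le> (A powr real N) powr - \<alpha>"
        using A N(2) \<alpha> by (intro powr_mono2') auto
      finally have 2: "A powr - \<alpha> * x powr - \<alpha> \<le> (A ^ N) powr - \<alpha>" using A by (simp add: powr_realpow)
      have "c * (ln x ^ (n - 1) / x powr \<alpha>) = (ln x / (2 * real n * ln A)) ^ (n - 1) * (d ^ n * (A powr - \<alpha> * x powr - \<alpha>))"
        unfolding c_def by (simp add: power_divide powr_minus field_simps)
      also have "\<dots> \<le> real q ^ (n - 1) * (d ^ n * (A ^ N) powr - \<alpha>)"
        using 1 2 d lx lnA by (intro mult_mono mult_left_mono) auto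
      finally show ?thesis .
    qed
    also have "\<dots> = (\<Sum>f\<in>F. d ^ n * (A ^ N) powr - \<alpha>)" by (simp add: F_def card_PiE)
    also have "\<dots> \<le> (\<Sum>f\<in>F. prob (E f))" by (intro sum_mono pE)
    also have "\<dots> = prob (\<Union>f\<in>F. E f)" using Em finF disj by (intro finite_measure_finite_Union[symmetric]) auto
    also have "\<dots> \<le> \<P>(\<omega> in M. x \<le> (\<Prod>i=1..n. L i 1 \<omega>))"
    proof (rule finite_measure_mono)
      show "(\<Union>f\<in>F. E f) \<subseteq> {\<omega>\<in>space M. x \<le> (\<Prod>i=1..n. L i 1 \<omega>)}"
      proof
        fix \<omega> assume "\<omega> \<in> (\<Union>f\<in>F. E f)"
        then obtain f where f: "f \<in> F" "\<omega> \<in> E f" by blast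
        have Lk: "A ^ k f i \<le> L i 1 \<omega>" if "i \<in> {1..n}" for i
        proof -
          have "L i 1 \<omega> \<in> I f i" using f(2) that unfolding E_def by blast
          then show ?thesis unfolding I_def k_def by (cases "i < n") auto
        qed
        have "x = A powr log A x" using A x1' by simp
        also have "\<dots> \<le> A powr real N" using A N(1) by simp
        also have "\<dots> = A ^ N" using A by (simp add: powr_realpow)
        also have "\<dots> = (\<Prod>i=1..n. A ^ k f i)" by (simp only: power_sum[symmetric] sk[OF f(1)])
        also have "\<dots> \<le> (\<Prod>i=1..n. L i 1 \<omega>)" using A by (intro prod_mono) (use Lk in auto)
        finally show "\<omega> \<in> {\<omega>\<in>space M. x \<le> (\<Prod>i=1..n. L i 1 \<omega>)}" using f(2) by (simp add: E_def)
      qed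
      show "{\<omega>\<in>space M. x \<le> (\<Prod>i=1..n. L i 1 \<omega>)} \<in> events"
        by (intro borel_measurable_le borel_measurable_prod borel_measurable_const meas_L) auto
    qed
    finally show "c * (ln x ^ (n - 1) / x powr \<alpha>) \<le> \<P>(\<omega> in M. x \<le> (\<Prod>i=1..n. L i 1 \<omega>))" .
  qed
qed

section \<open>The supremum of the product, and reduction to processes that start at 0\<close>

lemma sup_prod_bdd:
  assumes "\<And>i. i \<in> {1..n} \<Longrightarrow> cadlag (\<lambda>t. L i t \<omega>)"
  shows "bdd_above ((\<lambda>u. \<Prod>i=1..n. L i u \<omega>) ` {0..1})"
proof -
  have "\<forall>i\<in>{1..n}. \<exists>B. \<forall>t\<in>{0..1}. \<bar>L i t \<omega>\<bar> \<le> B" using cadlag_bounded[OF assms, of _ 1] by simp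
  then obtain B where B: "\<And>i t. i \<in> {1..n} \<Longrightarrow> t \<in> {0..1} \<Longrightarrow> \<bar>L i t \<omega>\<bar> \<le> B i" by metis
  show ?thesis
  proof (rule bdd_aboveI2)
    fix u :: real assume u: "u \<in> {0..1}"
    have "(\<Prod>i=1..n. L i u \<omega>) \<le> (\<Prod>i=1..n. \<bar>L i u \<omega>\<bar>)" unfolding abs_prod[symmetric] by (rule abs_ge_self)
    also have "\<dots> \<le> (\<Prod>i=1..n. B i)" using B u by (intro prod_mono) auto
    finally show "(\<Prod>i=1..n. L i u \<omega>) \<le> (\<Prod>i=1..n. B i)" .
  qed
qed

lemma sup_prod_le_iff:
  assumes "\<And>i. i \<in> {1..n} \<Longrightarrow> cadlag (\<lambda>t. L i t \<omega>)"
  shows "sup_prod n L \<omega> \<le> y \<longleftrightarrow> (\<forall>u\<in>{0..1}. (\<Prod>i=1..n. L i u \<omega>) \<le> y)"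
  unfolding sup_prod_def by (rule cSUP_le_iff[OF _ sup_prod_bdd[of n L \<omega>, OF assms]]) auto

lemma sup_prod_measurable:
  assumes cad: "\<And>i \<omega>. i \<in> {1..n} \<Longrightarrow> \<omega> \<in> space M \<Longrightarrow> cadlag (\<lambda>t. L i t \<omega>)"
    and meas: "\<And>i t. i \<in> {1..n} \<Longrightarrow> 0 \<le> t \<Longrightarrow> L i t \<in> borel_measurable M"
  shows "sup_prod n L \<in> borel_measurable M"
  unfolding borel_measurable_iff_le
proof
  fix y
  have "sup_prod n L \<omega> \<le> y \<longleftrightarrow> (\<forall>l. \<forall>k\<in>{..2 ^ l}. (\<Prod>i=1..n. L i (real (k::nat) * (1 / 2 ^ l)) \<omega>) \<le> y)" if \<omega>: "\<omega> \<in> space M" for \<omega>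
  proof -
    have "((\<lambda>t. \<Prod>i=1..n. L i t \<omega>) \<longlongrightarrow> (\<Prod>i=1..n. L i t \<omega>)) (at_right t)" if "0 \<le> t" for t
      by (intro tendsto_prod cadlag_right cad \<omega> that)
    then show ?thesis
      using dyadic_le_iff[of 0 1 "\<lambda>t. \<Prod>i=1..n. L i t \<omega>" y] sup_prod_le_iff[of n L \<omega> y, OF cad[OF _ \<omega>]] by (simp add: Ball_def)
  qed
  then have "{\<omega>\<in>space M. sup_prod n L \<omega> \<le> y} = {\<omega>\<in>space M. \<forall>l. \<forall>k\<in>{..2 ^ l}. (\<Prod>i=1..n. L i (real (k::nat) * (1 / 2 ^ l)) \<omega>) \<le> y}"
    by (intro Collect_cong conj_cong refl)
  also have "\<dots> \<in> sets M"
    by (intro sets.sets_Collect_countable_All sets.sets_Collect_finite_All borel_measurable_le borel_measurable_prod borel_measurable_const meas) auto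
  finally show "{\<omega>\<in>space M. sup_prod n L \<omega> \<le> y} \<in> sets M" .
qed

text \<open>The initial value vanishes almost surely, so subtracting it changes no law; increments
  are unchanged.\<close>

lemma started_stable:
  assumes M: "prob_space M" and X: "symmetric_stable_levy M \<alpha> b X" and ab: "0 < \<alpha>" "\<alpha> < 2" "0 < b"
  shows "stable_levy M (\<lambda>t \<omega>. X t \<omega> - X 0 \<omega>) \<alpha> b"
proof -
  interpret prob_space M by fact
  have lp: "levy_process M X" using X by (simp add: symmetric_stable_levy_def)
  have m: "X t \<in> borel_measurable M" if "0 \<le> t" for t using lp that by (simp add: levy_process_def)
  have z: "AE \<omega> in M. X 0 \<omega> = 0" using lp by (simp add: levy_process_def)
  have cad: "cadlag (\<lambda>t. X t \<omega>)" if "\<omega> \<in> space M" for \<omega> using lp that by (simp add: levy_process_def)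
  have law: "distr M borel (\<lambda>\<omega>. X t \<omega> - X 0 \<omega>) = distr M borel (X t)" if "0 \<le> t" for t
    using m[OF that] m[of 0] z by (intro distr_cong_AE) auto
  have cad': "cadlag (\<lambda>t. X t \<omega> - X 0 \<omega>)" if \<omega>: "\<omega> \<in> space M" for \<omega>
    unfolding cadlag_def
  proof (intro conjI allI impI)
    fix t :: real assume "0 \<le> t"
    then show "((\<lambda>t. X t \<omega> - X 0 \<omega>) \<longlongrightarrow> X t \<omega> - X 0 \<omega>) (at_right t)"
      by (intro tendsto_diff tendsto_const cadlag_right cad \<omega>)
  next
    fix t :: real assume "0 < t"
    then obtain l where "((\<lambda>t. X t \<omega>) \<longlongrightarrow> l) (at_left t)" using cadlag_left[OF cad[OF \<omega>]] by blast
    then have "((\<lambda>t. X t \<omega> - X 0 \<omega>) \<longlongrightarrow> l - X 0 \<omega>) (at_left t)" by (intro tendsto_diff tendsto_const)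
    then show "\<exists>l. ((\<lambda>t. X t \<omega> - X 0 \<omega>) \<longlongrightarrow> l) (at_left t)" ..
  qed
  have inc: "distr M borel (\<lambda>\<omega>. X (s + h) \<omega> - X s \<omega>) = distr M borel (X h)" if "0 \<le> s" "0 \<le> h" for s h
    using lp that by (simp add: levy_process_def)
  have ind: "indep_vars (\<lambda>_. borel) (\<lambda>j \<omega>. X (t (Suc j)) \<omega> - X (t j) \<omega>) {..<k}" if "0 \<le> t 0" "mono_on {..k} t" for k and t :: "nat \<Rightarrow> real"
    using lp that by (simp add: levy_process_def)
  show ?thesis
  proof
    show "levy_process M (\<lambda>t \<omega>. X t \<omega> - X 0 \<omega>)"
      unfolding levy_process_def using m cad' inc ind law by simp
    fix t \<theta> :: real assume t: "0 \<le> t"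
    show "char (distr M borel (\<lambda>\<omega>. X t \<omega> - X 0 \<omega>)) \<theta> = complex_of_real (exp (- (b * t * \<bar>\<theta>\<bar> powr \<alpha>)))"
      unfolding law[OF t] using X t by (simp add: symmetric_stable_levy_def)
  qed (use ab in auto)
qed

lemma started_iid:
  assumes M: "prob_space M" and L: "iid_symmetric_stable_levy M \<alpha> b n L" and ab: "0 < \<alpha>" "\<alpha> < 2" "0 < b" and n: "1 \<le> n"
  shows "iid_stable M (\<lambda>i t \<omega>. L i t \<omega> - L i 0 \<omega>) n \<alpha> b"
proof -
  interpret prob_space M by fact
  have "indep_vars (\<lambda>_. paths) (\<lambda>i. traj (L i)) {1..n}"
    using L unfolding iid_symmetric_stable_levy_def traj_def by simp
  then have "indep_vars (\<lambda>_. paths) (\<lambda>i \<omega>. \<lambda>t\<in>{0..}. traj (L i) \<omega> t - traj (L i) \<omega> 0) {1..n}"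
    by (rule indep_vars_compose2) (intro measurable_restrict borel_measurable_diff measurable_component_singleton, auto)
  moreover have "(\<lambda>\<omega>. \<lambda>t\<in>{0..}. traj (L i) \<omega> t - traj (L i) \<omega> 0) = traj (\<lambda>t \<omega>. L i t \<omega> - L i 0 \<omega>)" for i
    by (auto simp: traj_def fun_eq_iff)
  ultimately have "indep_vars (\<lambda>_. paths) (\<lambda>i. traj (\<lambda>t \<omega>. L i t \<omega> - L i 0 \<omega>)) {1..n}" by simp
  then show ?thesis
    using L n started_stable[OF M _ ab] by (intro iid_stable.intro iid_stable_axioms.intro M) (auto simp: iid_symmetric_stable_levy_def)
qed

context iid_stable
begin

lemma sup_prod_le: "{\<omega>\<in>space M. sup_prod n L \<omega> \<le> y} = below y 1"
  unfolding below_def using sup_prod_le_iff[of n L] cadlag_L by auto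

lemma sup_prod_meas: "sup_prod n L \<in> borel_measurable M"
  by (rule sup_prod_measurable) (use cadlag_L meas_L in auto)

lemma prob_sup_prod_ge_upper:
  assumes x: "0 < x"
  shows "\<P>(\<omega> in M. x \<le> sup_prod n L \<omega>) \<le> 1 - prob (below (x / 2) 1)"
proof -
  have "\<P>(\<omega> in M. x \<le> sup_prod n L \<omega>) \<le> prob (space M - below (x / 2) 1)"
    unfolding sup_prod_le[symmetric] using x sup_prod_meas
    by (intro finite_measure_mono sets.Diff sets.top borel_measurable_le borel_measurable_const) auto
  then show ?thesis using below_sets[of 1 "x / 2"] by (simp add: prob_compl)
qed

lemma prob_sup_prod_ge_lower: "\<P>(\<omega> in M. x \<le> (\<Prod>i=1..n. L i 1 \<omega>)) \<le> \<P>(\<omega> in M. x \<le> sup_prod n L \<omega>)"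
proof (rule finite_measure_mono)
  show "{\<omega>\<in>space M. x \<le> (\<Prod>i=1..n. L i 1 \<omega>)} \<subseteq> {\<omega>\<in>space M. x \<le> sup_prod n L \<omega>}"
  proof (intro subsetI CollectI conjI)
    fix \<omega> assume \<omega>: "\<omega> \<in> {\<omega>\<in>space M. x \<le> (\<Prod>i=1..n. L i 1 \<omega>)}"
    then show sp: "\<omega> \<in> space M" by simp
    have "(\<Prod>i=1..n. L i 1 \<omega>) \<le> sup_prod n L \<omega>"
      unfolding sup_prod_def by (rule cSUP_upper[OF _ sup_prod_bdd]) (use cadlag_L sp in auto)
    then show "x \<le> sup_prod n L \<omega>" using \<omega> by simp
  qed
qed (intro borel_measurable_le borel_measurable_const sup_prod_meas)

end

theorem theorem2:
  fixes n :: nat and \<alpha> b :: real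
  assumes "n \<ge> 1" and "0 < \<alpha>" and "\<alpha> < 2" and "0 < b"
  shows "\<exists>\<kappa>\<^sub>1 \<kappa>\<^sub>2 x\<^sub>0 \<epsilon>\<^sub>0 :: real.
    0 < \<kappa>\<^sub>1 \<and> \<kappa>\<^sub>1 \<le> \<kappa>\<^sub>2 \<and> 1 < x\<^sub>0 \<and> 0 < \<epsilon>\<^sub>0 \<and> \<epsilon>\<^sub>0 < 1 \<and>
    (\<forall>(M :: 'a measure) L. prob_space M \<longrightarrow> iid_symmetric_stable_levy M \<alpha> b n L \<longrightarrow>
      (\<forall>x\<ge>x\<^sub>0.
        \<kappa>\<^sub>1 * (ln x ^ (n - 1) / x powr \<alpha>) \<le> measure M {\<omega> \<in> space M. sup_prod n L \<omega> \<ge> x} \<and>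
        measure M {\<omega> \<in> space M. sup_prod n L \<omega> \<ge> x} \<le> \<kappa>\<^sub>2 * (ln x ^ (n - 1) / x powr \<alpha>)) \<and>
      (\<forall>\<epsilon>\<in>{0<..<\<epsilon>\<^sub>0}.
        \<kappa>\<^sub>1 * \<epsilon> powr (\<alpha> / 2) \<le> measure M {\<omega> \<in> space M. sup_prod n L \<omega> \<le> \<epsilon>} \<and>
        measure M {\<omega> \<in> space M. sup_prod n L \<omega> \<le> \<epsilon>} \<le> \<kappa>\<^sub>2 * \<epsilon> powr (\<alpha> / 2) * \<bar>ln \<epsilon>\<bar>))"
proof -
  note n = assms(1) and \<alpha> = assms(2,3) and b = assms(4)
  obtain C1 x1 where C1: "0 < C1" "1 < x1" and up1: "\<And>(M :: 'a measure) L x. iid_stable M L n \<alpha> b \<Longrightarrow> x1 \<le> x \<Longrightarrow>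
    1 - measure M (iid_stable.below M L n (x / 2) 1) \<le> C1 * (ln x ^ (n - 1) / x powr \<alpha>)"
    by (rule large_deviations_upper[OF \<alpha>(1) b n]) blast
  obtain c1 x2 where c1: "0 < c1" "1 < x2" and low1: "\<And>(M :: 'a measure) L x. iid_stable M L n \<alpha> b \<Longrightarrow> x2 \<le> x \<Longrightarrow>
    c1 * (ln x ^ (n - 1) / x powr \<alpha>) \<le> \<P>(\<omega> in M. x \<le> (\<Prod>i=1..n. L i 1 \<omega>))"
    by (rule large_deviations_lower[OF \<alpha> b n]) blast
  obtain C2 where C2: "0 < C2" and up2: "\<And>(M :: 'a measure) L \<epsilon>. iid_stable M L n \<alpha> b \<Longrightarrow> 0 < \<epsilon> \<Longrightarrow>
    measure M (iid_stable.below M L n \<epsilon> 1) \<le> C2 * \<epsilon> powr (\<alpha> / 2)"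
    by (rule persistence_upper[OF \<alpha>(1) b n]) blast
  obtain c2 where c2: "0 < c2" and low2: "\<And>(M :: 'a measure) L \<epsilon>. iid_stable M L n \<alpha> b \<Longrightarrow> 0 < \<epsilon> \<Longrightarrow> \<epsilon> < 1 \<Longrightarrow>
    c2 * \<epsilon> powr (\<alpha> / 2) \<le> measure M (iid_stable.below M L n \<epsilon> 1)"
    by (rule persistence_lower[OF \<alpha> b n]) blast
  define k1 where "k1 = min c1 c2"
  \<comment> \<open>Including \<open>k1\<close> secures the order of the two constants.\<close>
  define k2 where "k2 = max k1 (max C1 C2)"
  define x0 where "x0 = max x1 x2"
  have main: "(\<forall>x\<ge>x0. k1 * (ln x ^ (n - 1) / x powr \<alpha>) \<le> measure M {\<omega> \<in> space M. sup_prod n L \<omega> \<ge> x} \<and>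
        measure M {\<omega> \<in> space M. sup_prod n L \<omega> \<ge> x} \<le> k2 * (ln x ^ (n - 1) / x powr \<alpha>)) \<and>
      (\<forall>\<epsilon>\<in>{0<..<exp (- 1)}. k1 * \<epsilon> powr (\<alpha> / 2) \<le> measure M {\<omega> \<in> space M. sup_prod n L \<omega> \<le> \<epsilon>} \<and>
        measure M {\<omega> \<in> space M. sup_prod n L \<omega> \<le> \<epsilon>} \<le> k2 * \<epsilon> powr (\<alpha> / 2) * \<bar>ln \<epsilon>\<bar>)"
    if M: "prob_space M" and L: "iid_symmetric_stable_levy M \<alpha> b n L" for M :: "'a measure" and L
  proof -
    \<comment> \<open>The supremum for \<open>L'\<close> agrees almost surely with that for
      \<open>L\<close>, so both probabilities may be computed with \<open>L'\<close>.\<close>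
    define L' where "L' = (\<lambda>i t \<omega>. L i t \<omega> - L i 0 \<omega>)"
    have iid: "iid_stable M L' n \<alpha> b" unfolding L'_def by (rule started_iid[OF M L \<alpha> b n])
    interpret iid_stable M L' n \<alpha> b by (rule iid)
    have lp: "levy_process M (L i)" if "i \<in> {1..n}" for i
      using L that by (simp add: iid_symmetric_stable_levy_def symmetric_stable_levy_def)
    have Lm: "sup_prod n L \<in> borel_measurable M"
      by (rule sup_prod_measurable) (use lp in \<open>auto simp: levy_process_def\<close>)
    have "AE \<omega> in M. \<forall>i\<in>{1..n}. L i 0 \<omega> = 0"
      using lp by (intro AE_finite_allI) (auto simp: levy_process_def)
    then have ae: "AE \<omega> in M. sup_prod n L \<omega> = sup_prod n L' \<omega>"
      by eventually_elim (simp add: sup_prod_def L'_def)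
    have ge: "\<P>(\<omega> in M. x \<le> sup_prod n L \<omega>) = \<P>(\<omega> in M. x \<le> sup_prod n L' \<omega>)" for x
      using ae Lm sup_prod_meas by (intro measure_eq_AE) auto
    have le: "\<P>(\<omega> in M. sup_prod n L \<omega> \<le> \<epsilon>) = prob (below \<epsilon> 1)" for \<epsilon>
      unfolding sup_prod_le[symmetric] using ae Lm sup_prod_meas by (intro measure_eq_AE) auto
    show ?thesis
    proof (intro conjI allI impI ballI)
      fix x assume x: "x0 \<le> x"
      then have x': "x1 \<le> x" "x2 \<le> x" "1 < x" using C1 unfolding x0_def by auto
      then have r: "0 \<le> ln x ^ (n - 1) / x powr \<alpha>" by simp
      have "k1 * (ln x ^ (n - 1) / x powr \<alpha>) \<le> c1 * (ln x ^ (n - 1) / x powr \<alpha>)"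
        unfolding k1_def by (rule mult_right_mono[OF _ r]) simp
      also have "\<dots> \<le> \<P>(\<omega> in M. x \<le> (\<Prod>i=1..n. L' i 1 \<omega>))" by (rule low1[OF iid x'(2)])
      also have "\<dots> \<le> \<P>(\<omega> in M. x \<le> sup_prod n L \<omega>)" unfolding ge by (rule prob_sup_prod_ge_lower)
      finally show "k1 * (ln x ^ (n - 1) / x powr \<alpha>) \<le> \<P>(\<omega> in M. x \<le> sup_prod n L \<omega>)" .
      have "\<P>(\<omega> in M. x \<le> sup_prod n L \<omega>) \<le> 1 - prob (below (x / 2) 1)"
        unfolding ge using x' by (intro prob_sup_prod_ge_upper) simp
      also have "\<dots> \<le> C1 * (ln x ^ (n - 1) / x powr \<alpha>)" by (rule up1[OF iid x'(1)])
      also have "\<dots> \<le> k2 * (ln x ^ (n - 1) / x powr \<alpha>)"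
        unfolding k2_def by (rule mult_right_mono[OF _ r]) simp
      finally show "\<P>(\<omega> in M. x \<le> sup_prod n L \<omega>) \<le> k2 * (ln x ^ (n - 1) / x powr \<alpha>)" .
    next
      fix \<epsilon> :: real assume "\<epsilon> \<in> {0<..<exp (- 1)}"
      then have \<epsilon>: "0 < \<epsilon>" "\<epsilon> < exp (- 1)" by auto
      have "exp (- 1) < (1::real)" by simp
      then have \<epsilon>1: "\<epsilon> < 1" using \<epsilon> by linarith
      have "k1 * \<epsilon> powr (\<alpha> / 2) \<le> c2 * \<epsilon> powr (\<alpha> / 2)" unfolding k1_def by (intro mult_right_mono) auto
      also have "\<dots> \<le> \<P>(\<omega> in M. sup_prod n L \<omega> \<le> \<epsilon>)" unfolding le by (rule low2[OF iid \<epsilon>(1) \<epsilon>1])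
      finally show "k1 * \<epsilon> powr (\<alpha> / 2) \<le> \<P>(\<omega> in M. sup_prod n L \<omega> \<le> \<epsilon>)" .
      \<comment> \<open>Below exp(-1) the logarithm is at least 1 in modulus, so the bound without
        it implies the stated one.\<close>
      have "ln \<epsilon> < ln (exp (- 1))" using \<epsilon> by (subst ln_less_cancel_iff) auto
      then have l: "1 \<le> \<bar>ln \<epsilon>\<bar>" by simp
      have "\<P>(\<omega> in M. sup_prod n L \<omega> \<le> \<epsilon>) \<le> C2 * \<epsilon> powr (\<alpha> / 2)" unfolding le by (rule up2[OF iid \<epsilon>(1)])
      also have "\<dots> \<le> k2 * \<epsilon> powr (\<alpha> / 2)" unfolding k2_def by (intro mult_right_mono) auto
      also have "\<dots> = k2 * \<epsilon> powr (\<alpha> / 2) * 1" by simp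
      also have "\<dots> \<le> k2 * \<epsilon> powr (\<alpha> / 2) * \<bar>ln \<epsilon>\<bar>"
        using C1(1) by (intro mult_left_mono l mult_nonneg_nonneg) (auto simp: k2_def le_max_iff_disj)
      finally show "\<P>(\<omega> in M. sup_prod n L \<omega> \<le> \<epsilon>) \<le> k2 * \<epsilon> powr (\<alpha> / 2) * \<bar>ln \<epsilon>\<bar>" .
    qed
  qed
  show ?thesis
  proof (intro exI conjI)
    show "0 < k1" "k1 \<le> k2" "1 < x0" unfolding k1_def k2_def x0_def using c1 c2 C1 by auto
    show "0 < exp (- 1 :: real)" "exp (- 1) < (1 :: real)" by auto
    show "\<forall>(M :: 'a measure) L. prob_space M \<longrightarrow> iid_symmetric_stable_levy M \<alpha> b n L \<longrightarrow>
      (\<forall>x\<ge>x0. k1 * (ln x ^ (n - 1) / x powr \<alpha>) \<le> measure M {\<omega> \<in> space M. sup_prod n L \<omega> \<ge> x} \<and>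
        measure M {\<omega> \<in> space M. sup_prod n L \<omega> \<ge> x} \<le> k2 * (ln x ^ (n - 1) / x powr \<alpha>)) \<and>
      (\<forall>\<epsilon>\<in>{0<..<exp (- 1)}. k1 * \<epsilon> powr (\<alpha> / 2) \<le> measure M {\<omega> \<in> space M. sup_prod n L \<omega> \<le> \<epsilon>} \<and>
        measure M {\<omega> \<in> space M. sup_prod n L \<omega> \<le> \<epsilon>} \<le> k2 * \<epsilon> powr (\<alpha> / 2) * \<bar>ln \<epsilon>\<bar>)"
      using main by blast
  qed
qed

end
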